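(* Let $M\in\mathbb{R}$, $M\ge2$, and $a\in L^\infty(0,1)$. Let $\widehat\nu_i$ be the generalized radial singular eigenvalues, considered as long as $\widehat\nu_i<\big(\frac{M-2}{2}\big)^2$. Then each generalized radial singular eigenvalue $\widehat\nu_i$ is simple and any $i$-th eigenfunction (i.e. any eigenfunction related to $\widehat\nu_i$) has exactly $i$ nodal domains in $(0,1)$. In particular, if $N\ge2$ is an integer, $B$ is the unit ball of $\mathbb{R}^N$ and $a\in L^\infty(B)$ is radial, each radial singular eigenvalue $\widehat\Lambda_i^{\mathrm{rad}}<\big(\frac{N-2}{2}\big)^2$ is simple and any $i$-th eigenfunction $\psi_i^{\mathrm{rad}}$ has exactly $i$ nodal domains.
   Context: $L^2_M$ is the set of measurable $v:(0,1)\to\mathbb{R}$ with $\int_0^1r^{M-1}v^2dr<\infty$; $H^1_M$ is the set of $v\in L^2_M$ having a first order weak derivative $v'\in L^2_M$ (taken continuous on $(0,1]$); $H^1_{0,M}=\{v\in H^1_M:v(1)=0\}$; $\mathcal L_M$ is the set of measurable $v$ on $(0,1)$ with $\int_0^1r^{M-3}v^2dr<\infty$, with scalar product $\int_0^1r^{M-3}\eta\varphi\,dr$; $\mathcal H_{0,M}=H^1_{0,M}\cap\mathcal L_M$. $\widehat\nu_i=\inf\int_0^1r^{M-1}(|w'|^2-aw^2)dr\big/\int_0^1r^{M-3}w^2dr$ over $w\in\mathcal H_{0,M}\setminus\{0\}$ orthogonal in $\mathcal L_M$ to eigenfunctions $\psi_1,\dots,\psi_{i-1}$ attaining $\widehat\nu_1,\dots,\widehat\nu_{i-1}$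 (attained whenever it is $<(\frac{M-2}{2})^2$; the iteration proceeds as long as $\widehat\nu_{i-1}<(\frac{M-2}{2})^2$). An eigenfunction related to $\widehat\nu_i$ is a nonzero $\psi\in\mathcal H_{0,M}$ with $\int_0^1r^{M-1}(\psi'\varphi'-a\psi\varphi)dr=\widehat\nu_i\int_0^1r^{M-3}\psi\varphi\,dr$ for all $\varphi\in\mathcal H_{0,M}$. Simple means that the eigenspace is one-dimensional. Nodal domains of $\psi$ are the connected components of $\{r\in(0,1):\psi(r)\ne0\}$. $\widehat\Lambda_i^{\mathrm{rad}}$ and $\psi_i^{\mathrm{rad}}$ are defined by the same iterated minimization for the quotient $\int_B(|\nabla w|^2-aw^2)dx\big/\int_B|x|^{-2}w^2dx$ over radial $w\in H^1_0(B)\setminus\{0\}$ with $\int_B|x|^{-2}w^2dx<\infty$, orthogonality being with respect to $\int_B|x|^{-2}\eta\varphi\,dx$; they coincide with $\widehat\nu_i$, $\psi_i$ for $M=N$ (viewing radial functions as functions of $r=|x|\in(0,1)$). *)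

theory Defs
  imports "HOL-Analysis.Analysis"
begin

section \<open>Test functions and weak gradients\<close>

definition partial_deriv :: "'a::euclidean_space \<Rightarrow> ('a \<Rightarrow> real) \<Rightarrow> 'a \<Rightarrow> real" where
  "partial_deriv b f = (\<lambda>x. frechet_derivative f (at x) b)"

text \<open>\<open>C\<^sup>\<infinity>\<close>: the iterated partial derivatives of all orders exist and are differentiable everywhere.\<close>

definition smooth :: "('a::euclidean_space \<Rightarrow> real) \<Rightarrow> bool" where
  "smooth f \<longleftrightarrow> (\<forall>bs. set bs \<subseteq> Basis \<longrightarrow> foldr partial_deriv bs f differentiable_on UNIV)"

definition test_functions :: "'a::euclidean_space set \<Rightarrow> ('a \<Rightarrow> real) set" where
  "test_functions \<Omega> =
     {\<phi>. smooth \<phi> \<and> (\<exists>K. compact K \<and> K \<subseteq> \<Omega> \<and> (\<forall>x. x \<notin> K \<longrightarrow> \<phi> x = 0))}"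

definition locally_integrable :: "'a::euclidean_space set \<Rightarrow> ('a \<Rightarrow> real) \<Rightarrow> bool" where
  "locally_integrable \<Omega> u \<longleftrightarrow> (\<forall>K. compact K \<and> K \<subseteq> \<Omega> \<longrightarrow> integrable (lebesgue_on K) u)"

text \<open>For \<open>'a = real\<close> we have \<open>Basis = {1}\<close>, and a weak gradient is a weak derivative.\<close>

definition weak_gradient :: "'a::euclidean_space set \<Rightarrow> ('a \<Rightarrow> real) \<Rightarrow> ('a \<Rightarrow> 'a) \<Rightarrow> bool" where
  "weak_gradient \<Omega> u G \<longleftrightarrow> locally_integrable \<Omega> u \<and>
     (\<forall>b\<in>Basis. locally_integrable \<Omega> (\<lambda>x. G x \<bullet> b) \<and>
        (\<forall>\<phi>\<in>test_functions \<Omega>.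
           (LINT x|lebesgue_on \<Omega>. u x * partial_deriv b \<phi> x)
             = - (LINT x|lebesgue_on \<Omega>. (G x \<bullet> b) * \<phi> x)))"

text \<open>Weak gradients on an open set are unique up to null sets, so the choice below does not
  affect any of the integrals in which it is used.\<close>

definition wgrad :: "'a::euclidean_space set \<Rightarrow> ('a \<Rightarrow> real) \<Rightarrow> 'a \<Rightarrow> 'a" where
  "wgrad \<Omega> u = (SOME G. weak_gradient \<Omega> u G)"

definition Linfty :: "'a::euclidean_space set \<Rightarrow> ('a \<Rightarrow> real) set" where
  "Linfty \<Omega> = {a \<in> borel_measurable (lebesgue_on \<Omega>). \<exists>C. AE x in lebesgue_on \<Omega>. \<bar>a x\<bar> \<le> C}"


section \<open>Iterated minimization of a quotient\<close>

text \<open>\<open>W\<close> is the set of nonzero elements of the function space, \<open>q\<close> and \<open>ip\<close> are the bilinear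
  forms of the numerator and of the denominator, and \<open>\<psi> 1, \<psi> 2, \<dots>\<close> are the successive minimizers.\<close>

definition competitors ::
  "'f set \<Rightarrow> ('f \<Rightarrow> 'f \<Rightarrow> real) \<Rightarrow> (nat \<Rightarrow> 'f) \<Rightarrow> nat \<Rightarrow> 'f set" where
  "competitors W ip \<psi> i = {w \<in> W. \<forall>j\<in>{1..<i}. ip w (\<psi> j) = 0}"

definition min_level ::
  "'f set \<Rightarrow> ('f \<Rightarrow> 'f \<Rightarrow> real) \<Rightarrow> ('f \<Rightarrow> 'f \<Rightarrow> real) \<Rightarrow> (nat \<Rightarrow> 'f) \<Rightarrow> nat \<Rightarrow> real" where
  "min_level W q ip \<psi> i = (INF w\<in>competitors W ip \<psi> i. q w w / ip w w)"

definition minimizers_below ::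
  "'f set \<Rightarrow> ('f \<Rightarrow> 'f \<Rightarrow> real) \<Rightarrow> ('f \<Rightarrow> 'f \<Rightarrow> real) \<Rightarrow> real \<Rightarrow> (nat \<Rightarrow> 'f) \<Rightarrow> nat \<Rightarrow> bool" where
  "minimizers_below W q ip c \<psi> i \<longleftrightarrow>
     (\<forall>j\<in>{1..<i}. min_level W q ip \<psi> j < c \<and> \<psi> j \<in> competitors W ip \<psi> j \<and>
        q (\<psi> j) (\<psi> j) / ip (\<psi> j) (\<psi> j) = min_level W q ip \<psi> j)"

definition eigenspace ::
  "'f set \<Rightarrow> ('f \<Rightarrow> 'f \<Rightarrow> real) \<Rightarrow> ('f \<Rightarrow> 'f \<Rightarrow> real) \<Rightarrow> real \<Rightarrow> 'f set" where
  "eigenspace H q ip \<mu> = {u \<in> H. \<forall>\<phi>\<in>H. q u \<phi> = \<mu> * ip u \<phi>}"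

text \<open>Functions are considered up to equality almost everywhere on \<open>\<Omega>\<close>.\<close>

definition nonzero_on :: "'a::euclidean_space set \<Rightarrow> ('a \<Rightarrow> real) set \<Rightarrow> ('a \<Rightarrow> real) set" where
  "nonzero_on \<Omega> H = {u \<in> H. \<not> (AE x in lebesgue_on \<Omega>. u x = 0)}"

definition one_dimensional_on :: "'a::euclidean_space set \<Rightarrow> ('a \<Rightarrow> real) set \<Rightarrow> bool" where
  "one_dimensional_on \<Omega> E \<longleftrightarrow>
     (\<exists>\<psi>\<in>nonzero_on \<Omega> E. \<forall>u\<in>E. \<exists>c. AE x in lebesgue_on \<Omega>. u x = c * \<psi> x)"


section \<open>Generalized radial problem on the unit interval\<close>

definition L2_M :: "real \<Rightarrow> (real \<Rightarrow> real) set" where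
  "L2_M M = {v \<in> borel_measurable (lebesgue_on {0<..<1}).
     integrable (lebesgue_on {0<..<1}) (\<lambda>r. r powr (M - 1) * (v r)\<^sup>2)}"

definition H1_M :: "real \<Rightarrow> (real \<Rightarrow> real) set" where
  "H1_M M = {v \<in> L2_M M. continuous_on {0<..1} v \<and> (\<exists>g\<in>L2_M M. weak_gradient {0<..<1} v g)}"

definition H1_0M :: "real \<Rightarrow> (real \<Rightarrow> real) set" where
  "H1_0M M = {v \<in> H1_M M. v 1 = 0}"

definition calL_M :: "real \<Rightarrow> (real \<Rightarrow> real) set" where
  "calL_M M = {v \<in> borel_measurable (lebesgue_on {0<..<1}).
     integrable (lebesgue_on {0<..<1}) (\<lambda>r. r powr (M - 3) * (v r)\<^sup>2)}"

definition calH_0M :: "real \<Rightarrow> (real \<Rightarrow> real) set" where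
  "calH_0M M = H1_0M M \<inter> calL_M M"

definition ip_M :: "real \<Rightarrow> (real \<Rightarrow> real) \<Rightarrow> (real \<Rightarrow> real) \<Rightarrow> real" where
  "ip_M M \<eta> \<phi> = (LINT r|lebesgue_on {0<..<1}. r powr (M - 3) * \<eta> r * \<phi> r)"

definition form_M :: "real \<Rightarrow> (real \<Rightarrow> real) \<Rightarrow> (real \<Rightarrow> real) \<Rightarrow> (real \<Rightarrow> real) \<Rightarrow> real" where
  "form_M M a u \<phi> = (LINT r|lebesgue_on {0<..<1}.
     r powr (M - 1) * (wgrad {0<..<1} u r * wgrad {0<..<1} \<phi> r - a r * u r * \<phi> r))"

text \<open>The admissible quotients are bounded below by \<open>-\<parallel>a\<parallel>\<^sub>\<infinity>\<close>, so the real-valued infimum is genuine.\<close>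

definition nu_hat :: "real \<Rightarrow> (real \<Rightarrow> real) \<Rightarrow> (nat \<Rightarrow> real \<Rightarrow> real) \<Rightarrow> nat \<Rightarrow> real" where
  "nu_hat M a = min_level (nonzero_on {0<..<1} (calH_0M M)) (form_M M a) (ip_M M)"

definition radial_sequence_M :: "real \<Rightarrow> (real \<Rightarrow> real) \<Rightarrow> (nat \<Rightarrow> real \<Rightarrow> real) \<Rightarrow> nat \<Rightarrow> bool" where
  "radial_sequence_M M a =
     minimizers_below (nonzero_on {0<..<1} (calH_0M M)) (form_M M a) (ip_M M) (((M - 2) / 2)\<^sup>2)"

definition eigenspace_M :: "real \<Rightarrow> (real \<Rightarrow> real) \<Rightarrow> real \<Rightarrow> (real \<Rightarrow> real) set" where
  "eigenspace_M M a = eigenspace (calH_0M M) (form_M M a) (ip_M M)"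


section \<open>Radial singular problem on the unit ball\<close>

definition H1 :: "'a::euclidean_space set \<Rightarrow> ('a \<Rightarrow> real) set" where
  "H1 \<Omega> = {u \<in> borel_measurable (lebesgue_on \<Omega>).
     integrable (lebesgue_on \<Omega>) (\<lambda>x. (u x)\<^sup>2) \<and>
     (\<exists>G\<in>borel_measurable (lebesgue_on \<Omega>).
        weak_gradient \<Omega> u G \<and> integrable (lebesgue_on \<Omega>) (\<lambda>x. (norm (G x))\<^sup>2))}"

definition H1_norm :: "'a::euclidean_space set \<Rightarrow> ('a \<Rightarrow> real) \<Rightarrow> real" where
  "H1_norm \<Omega> u = sqrt (LINT x|lebesgue_on \<Omega>. (u x)\<^sup>2 + (norm (wgrad \<Omega> u x))\<^sup>2)"

definition H1_0 :: "'a::euclidean_space set \<Rightarrow> ('a \<Rightarrow> real) set" where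
  "H1_0 \<Omega> = {u \<in> H1 \<Omega>. \<exists>\<phi>. (\<forall>n. \<phi> n \<in> test_functions \<Omega>) \<and>
     (\<lambda>n::nat. H1_norm \<Omega> (\<lambda>x. u x - \<phi> n x)) \<longlonglongrightarrow> 0}"

definition radial_on :: "'a::euclidean_space set \<Rightarrow> ('a \<Rightarrow> real) \<Rightarrow> bool" where
  "radial_on \<Omega> u \<longleftrightarrow> (\<exists>g. AE x in lebesgue_on \<Omega>. u x = g (norm x))"

definition calH_rad :: "('a::euclidean_space \<Rightarrow> real) set" where
  "calH_rad = {u \<in> H1_0 (ball 0 1). radial_on (ball 0 1) u \<and>
     integrable (lebesgue_on (ball 0 1)) (\<lambda>x. (u x)\<^sup>2 / (norm x)\<^sup>2)}"

definition ip_rad :: "('a::euclidean_space \<Rightarrow> real) \<Rightarrow> ('a \<Rightarrow> real) \<Rightarrow> real" where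
  "ip_rad \<eta> \<phi> = (LINT x|lebesgue_on (ball 0 1). \<eta> x * \<phi> x / (norm x)\<^sup>2)"

definition form_rad ::
  "('a::euclidean_space \<Rightarrow> real) \<Rightarrow> ('a \<Rightarrow> real) \<Rightarrow> ('a \<Rightarrow> real) \<Rightarrow> real" where
  "form_rad a u \<phi> = (LINT x|lebesgue_on (ball 0 1).
     wgrad (ball 0 1) u x \<bullet> wgrad (ball 0 1) \<phi> x - a x * u x * \<phi> x)"

definition Lambda_rad ::
  "('a::euclidean_space \<Rightarrow> real) \<Rightarrow> (nat \<Rightarrow> 'a \<Rightarrow> real) \<Rightarrow> nat \<Rightarrow> real" where
  "Lambda_rad a = min_level (nonzero_on (ball 0 1) calH_rad) (form_rad a) ip_rad"

definition radial_sequence ::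
  "('a::euclidean_space \<Rightarrow> real) \<Rightarrow> (nat \<Rightarrow> 'a \<Rightarrow> real) \<Rightarrow> nat \<Rightarrow> bool" where
  "radial_sequence a = minimizers_below (nonzero_on (ball 0 1) calH_rad) (form_rad a) ip_rad
     (((real DIM('a) - 2) / 2)\<^sup>2)"

definition eigenspace_rad :: "('a::euclidean_space \<Rightarrow> real) \<Rightarrow> real \<Rightarrow> ('a \<Rightarrow> real) set" where
  "eigenspace_rad a = eigenspace calH_rad (form_rad a) ip_rad"


section \<open>Nodal domains\<close>

definition nodal_domains :: "'a::topological_space set \<Rightarrow> ('a \<Rightarrow> real) \<Rightarrow> 'a set set" where
  "nodal_domains S u = components {x \<in> S. u x \<noteq> 0}"

text \<open>The nodal domains of a radial function are those of its continuous profile \<open>g\<close> (unique on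
  \<open>(0,1)\<close>). We count them both on \<open>(0,1)\<close> and in the punctured ball; the origin is left out since
  \<open>g\<close> need not extend continuously to \<open>0\<close>.\<close>

definition has_radial_nodal_domains :: "('a::euclidean_space \<Rightarrow> real) \<Rightarrow> nat \<Rightarrow> bool" where
  "has_radial_nodal_domains u n \<longleftrightarrow>
     (\<exists>g. continuous_on {0<..<1} g \<and> (AE x in lebesgue_on (ball 0 1). u x = g (norm x)) \<and>
        card (nodal_domains {0<..<1} g) = n \<and>
        card (nodal_domains (ball 0 1 - {0}) (\<lambda>x::'a. g (norm x))) = n)"

end

theory Submission
  imports Defs "HOL-Complex_Analysis.Great_Picard"
begin

text \<open>Every element of \<open>\<H>\<^sub>0\<^sub>,\<^sub>M\<close> is absolutely continuous on \<open>(0,1]\<close>, and below the Hardy constant the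
  infima are attained. With \<open>P = r\<^bsup>M-1\<^esup> \<psi>'\<close> an eigenfunction becomes a solution of a first order linear
  system on \<open>(0,1]\<close>, determined by \<open>P(1)\<close> because \<open>\<psi>(1) = 0\<close>; this gives simplicity, and in particular the
  eigenvalues increase strictly. Courant's argument bounds the number of interior zeros of an \<open>i\<close>-th
  eigenfunction by \<open>i - 1\<close>. Sturm's comparison places a zero of the next eigenfunction in each nodal
  interval of the present one, including the interval that ends at the singular point \<open>0\<close>, so by
  induction there are at least \<open>i - 1\<close> zeros.

  In the ball, polar coordinates identify radial functions with their profiles. A profile lifts to
  \<open>H\<^sup>1\<^sub>0(B)\<close> because it is a limit of test functions supported in \<open>(0,1)\<close>; conversely the
  restriction of a radial function to almost every ray is its profile.\<close>

section \<open>Smooth functions\<close>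

text \<open>The obstacle is the endpoint 0: no boundary value is prescribed there, the weights
  degenerate, and \<open>a\<close> is only bounded and measurable, so no pointwise asymptotics are
  at hand. What is known near 0 comes from two integrals, of r^(M-1) v'^2 and of r^(M-3) v^2. They
  make W/r integrable for the Wronskian W of two eigenfunctions; a W that stays away from 0 near the
  origin would put a multiple of 1/r into L^1. This replaces a boundary condition at 0 in Sturm's
  comparison. The divergence of the integral of 1/r also yields radii d with d^(M-2) v(d)^2 small,
  at which v can be cut off; hence the density of test functions supported away from 0, whose radial
  lifts avoid the point where the norm is not differentiable. Attainment is needed even for the i-th
  level itself, since the given \<open>\<psi>\<close> consists of minimizers only below i: it shows
  that the i-th eigenspace is nontrivial and that consecutive levels differ. As \<open>a\<close> is
  merely measurable, u'' exists only almost everywhere, so integral equations for u and r^(M-1) u'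
  replace the second order equation.\<close>

lemma smooth_coinduct:
  assumes "f \<in> S"
    and diff: "\<And>g. g \<in> S \<Longrightarrow> g differentiable_on UNIV"
    and partial: "\<And>g b. g \<in> S \<Longrightarrow> b \<in> Basis \<Longrightarrow> partial_deriv b g \<in> S"
  shows "smooth f"
proof -
  have "foldr partial_deriv bs f \<in> S" if "set bs \<subseteq> Basis" for bs
    using that by (induction bs) (auto intro: assms)
  then show ?thesis
    unfolding smooth_def using diff by blast
qed

lemma smooth_partial_deriv:
  assumes "smooth f" "b \<in> Basis"
  shows "smooth (partial_deriv b f)"
  unfolding smooth_def
proof (intro allI impI)
  fix bs :: "'a list" assume "set bs \<subseteq> Basis"
  \<comment> \<open>\<open>foldr\<close> applies the last entry first, so a further derivative of
    \<open>partial_deriv b f\<close> is a derivative of \<open>f\<close> along the list with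
    \<open>b\<close> appended at the end.\<close>
  with assms have "foldr partial_deriv (bs @ [b]) f differentiable_on UNIV"
    unfolding smooth_def by (metis Un_subset_iff empty_set empty_subsetI insert_subset list.simps(15) set_append)
  then show "foldr partial_deriv bs (partial_deriv b f) differentiable_on UNIV"
    by simp
qed

lemma smooth_differentiable:
  assumes "smooth f" shows "f differentiable_on UNIV"
proof -
  have "foldr partial_deriv [] f differentiable_on UNIV"
    using assms unfolding smooth_def by (metis empty_set empty_subsetI)
  then show ?thesis by simp
qed

lemma smooth_differentiable_at: "smooth f \<Longrightarrow> f differentiable (at x)"
  using smooth_differentiable by (auto simp: differentiable_on_def)

lemma smooth_continuous: "smooth f \<Longrightarrow> continuous_on S f"
  using differentiable_imp_continuous_on[OF smooth_differentiable] continuous_on_subset by blast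

lemma partial_deriv_eq:
  assumes "\<And>x. (f has_derivative f' x) (at x)"
  shows "partial_deriv b f = (\<lambda>x. f' x b)"
  unfolding partial_deriv_def using frechet_derivative_at[OF assms] by metis

text \<open>Derivatives of a product leave a set of generators but, by the Leibniz rule, not the
  algebra it generates. Smoothness proofs then need only one derivative of each generator; the
  iterated derivatives come for free.\<close>

inductive_set fun_algebra :: "('a \<Rightarrow> real) set \<Rightarrow> ('a \<Rightarrow> real) set" for A where
  gen: "f \<in> A \<Longrightarrow> f \<in> fun_algebra A"
| const: "(\<lambda>x. c) \<in> fun_algebra A"
| add: "f \<in> fun_algebra A \<Longrightarrow> g \<in> fun_algebra A \<Longrightarrow> (\<lambda>x. f x + g x) \<in> fun_algebra A"
| mult: "f \<in> fun_algebra A \<Longrightarrow> g \<in> fun_algebra A \<Longrightarrow> (\<lambda>x. f x * g x) \<in> fun_algebra A"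

text \<open>The conjunction proved by induction makes the whole algebra stable under partial
  derivatives, so it can serve as the invariant set of \<open>smooth_coinduct\<close>.\<close>

lemma smooth_fun_algebra:
  fixes A :: "('a::euclidean_space \<Rightarrow> real) set"
  assumes "f \<in> fun_algebra A"
    and diff: "\<And>g. g \<in> A \<Longrightarrow> g differentiable_on UNIV"
    and partial: "\<And>g b. g \<in> A \<Longrightarrow> b \<in> Basis \<Longrightarrow> partial_deriv b g \<in> fun_algebra A"
  shows "smooth f"
proof -
  have *: "g differentiable_on UNIV \<and> (\<forall>b\<in>Basis. partial_deriv b g \<in> fun_algebra A)"
    if "g \<in> fun_algebra A" for g
    using that
  proof induction
    case (gen f)
    then show ?case using diff partial by blast
  next
    case (const c)
    have "partial_deriv b (\<lambda>x. c) = (\<lambda>x::'a. 0)" for b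
      by (rule partial_deriv_eq) auto
    then show ?case by (auto intro: fun_algebra.const)
  next
    case (add f g)
    have d: "(f has_derivative frechet_derivative f (at x)) (at x)"
      "(g has_derivative frechet_derivative g (at x)) (at x)" for x
      using add by (auto simp: differentiable_on_def frechet_derivative_works)
    have "partial_deriv b (\<lambda>x. f x + g x) = (\<lambda>x. partial_deriv b f x + partial_deriv b g x)" for b
      unfolding partial_deriv_def[of _ f] partial_deriv_def[of _ g]
      by (rule partial_deriv_eq) (intro derivative_intros d)
    then show ?case using add by (auto intro: fun_algebra.add)
  next
    case (mult f g)
    have d: "(f has_derivative frechet_derivative f (at x)) (at x)"
      "(g has_derivative frechet_derivative g (at x)) (at x)" for x
      using mult by (auto simp: differentiable_on_def frechet_derivative_works)
    have "partial_deriv b (\<lambda>x. f x * g x) = (\<lambda>x. f x * partial_deriv b g x + partial_deriv b f x * g x)" for b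
      unfolding partial_deriv_def[of _ f] partial_deriv_def[of _ g]
      by (rule partial_deriv_eq) (intro derivative_intros d)
    then show ?case using mult by (auto intro!: fun_algebra.add fun_algebra.mult)
  qed
  show ?thesis
    by (rule smooth_coinduct[OF assms(1)]) (use * in auto)
qed

lemma smooth_fun_algebra_smooth:
  fixes f :: "'a::euclidean_space \<Rightarrow> real"
  assumes "f \<in> fun_algebra {g. smooth g}" shows "smooth f"
  by (rule smooth_fun_algebra[OF assms])
    (auto intro: smooth_differentiable smooth_partial_deriv fun_algebra.gen)

lemma smooth_const [simp]: "smooth (\<lambda>x::'a::euclidean_space. c)"
  by (intro smooth_fun_algebra_smooth fun_algebra.intros)

lemma smooth_add: "smooth f \<Longrightarrow> smooth g \<Longrightarrow> smooth (\<lambda>x. f x + g x)"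
  by (intro smooth_fun_algebra_smooth fun_algebra.add fun_algebra.gen) auto

lemma smooth_mult: "smooth f \<Longrightarrow> smooth g \<Longrightarrow> smooth (\<lambda>x. f x * g x)"
  by (intro smooth_fun_algebra_smooth fun_algebra.mult fun_algebra.gen) auto

lemma smooth_cmult: "smooth f \<Longrightarrow> smooth (\<lambda>x. c * f x)"
  by (intro smooth_mult) auto

lemma smooth_diff: "smooth f \<Longrightarrow> smooth g \<Longrightarrow> smooth (\<lambda>x. f x - g x)"
  using smooth_add[of f "\<lambda>x. (-1) * g x"] smooth_cmult[of g "-1"] by simp

lemma smooth_prod:
  "finite I \<Longrightarrow> (\<And>i. i \<in> I \<Longrightarrow> smooth (f i)) \<Longrightarrow> smooth (\<lambda>x. \<Prod>i\<in>I. f i x)"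
  by (induction I rule: finite_induct) (auto intro!: smooth_mult)

lemma partial_deriv_real:
  fixes f :: "real \<Rightarrow> real"
  assumes "\<And>x. (f has_real_derivative f' x) (at x)"
  shows "partial_deriv b f = (\<lambda>x. f' x * b)"
  by (rule partial_deriv_eq) (use assms in \<open>auto simp: has_field_derivative_def\<close>)

lemma smooth_real_DERIV:
  fixes f :: "real \<Rightarrow> real"
  assumes "smooth f"
  shows "(f has_real_derivative partial_deriv 1 f x) (at x)"
proof -
  have "(f has_derivative frechet_derivative f (at x)) (at x)"
    using assms by (simp add: frechet_derivative_works[symmetric] smooth_differentiable_at)
  moreover from this have "frechet_derivative f (at x) = (\<lambda>h. partial_deriv 1 f x * h)"
    by (metis (no_types, lifting) UNIV_I frechet_derivative_at has_derivative_bounded_linear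
      linear_simps(5) mult.commute mult.right_neutral partial_deriv_def real_scaleR_def ext)
  ultimately show ?thesis by (simp add: has_field_derivative_def)
qed

lemma smooth_affine_inner:
  fixes h :: "real \<Rightarrow> real" and e :: "'a::euclidean_space"
  assumes "smooth h"
  shows "smooth (\<lambda>x. h (c * (x \<bullet> e) + d))"
proof (rule smooth_fun_algebra)
  \<comment> \<open>The profile has to range over all smooth functions, because each derivative
    replaces it by its own derivative times a constant.\<close>
  let ?A = "{(\<lambda>x. h (c * (x \<bullet> e) + d)) | h. smooth h}"
  show "(\<lambda>x. h (c * (x \<bullet> e) + d)) \<in> fun_algebra ?A"
    using assms by (auto intro: fun_algebra.gen)
  fix g assume "g \<in> ?A"
  then obtain k where k: "smooth k" and g: "g = (\<lambda>x. k (c * (x \<bullet> e) + d))" by auto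
  have d: "(g has_derivative (\<lambda>b. partial_deriv 1 k (c * (x \<bullet> e) + d) * (c * (b \<bullet> e)))) (at x)" for x
    unfolding g
    by (rule has_derivative_compose[OF _ smooth_real_DERIV[OF k, unfolded has_field_derivative_def]])
      (auto intro!: derivative_eq_intros)
  show "g differentiable_on UNIV"
    using d unfolding differentiable_on_def differentiable_def by blast
  fix b :: 'a assume "b \<in> Basis"
  have "partial_deriv b g = (\<lambda>x. partial_deriv 1 k (c * (x \<bullet> e) + d) * (c * (b \<bullet> e)))"
    by (rule partial_deriv_eq[OF d])
  also have "\<dots> \<in> fun_algebra ?A"
    using smooth_partial_deriv[OF k, of 1]
    by (intro fun_algebra.mult[OF fun_algebra.gen fun_algebra.const]) auto
  finally show "partial_deriv b g \<in> fun_algebra ?A" .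
qed

subsection \<open>Bump functions\<close>

text \<open>The powers of 1/x close the family under differentiation up to linear combinations;
  exp(-1/x) alone does not contain its derivatives.\<close>

definition flat :: "nat \<Rightarrow> real \<Rightarrow> real" where
  "flat j x = (if x > 0 then (1 / x) ^ j * exp (- 1 / x) else 0)"

lemma flat_tendsto_0: "((\<lambda>h. flat j h) \<longlongrightarrow> 0) (at 0)"
proof -
  have "((\<lambda>x. x ^ j / exp x) \<longlongrightarrow> (0::real)) at_top"
    by (rule tendsto_power_div_exp_0)
  \<comment> \<open>The substitution x -> 1/x turns the decay of x^j / exp x at infinity into
    flatness at 0 from the right.\<close>
  then have "((\<lambda>x. (inverse x) ^ j / exp (inverse x)) \<longlongrightarrow> (0::real)) (at_right 0)"
    by (rule filterlim_compose[OF _ filterlim_inverse_at_top_right])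
  then have "((\<lambda>h. flat j h) \<longlongrightarrow> 0) (at_right 0)"
  proof (rule Lim_transform_eventually)
    show "\<forall>\<^sub>F x in at_right 0. inverse x ^ j / exp (inverse x) = flat j x"
      unfolding eventually_at_right_field
      by (rule exI[of _ 1]) (auto simp: flat_def field_simps exp_minus)
  qed
  moreover have "((\<lambda>h. flat j h) \<longlongrightarrow> 0) (at_left 0)"
    by (rule tendsto_eventually) (auto simp: eventually_at_left_field flat_def intro!: exI[of _ "-1"])
  ultimately show ?thesis by (simp add: filterlim_split_at)
qed

lemma flat_DERIV: "(flat j has_real_derivative flat (j + 2) x - real j * flat (j + 1) x) (at x)"
proof -
  consider "x > 0" | "x < 0" | "x = 0" by linarith
  then show ?thesis
  proof cases
    case 1
    have "((\<lambda>x. (1 / x) ^ j * exp (- 1 / x)) has_real_derivative flat (j + 2) x - real j * flat (j + 1) x) (at x)"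
      using 1 by (auto intro!: derivative_eq_intros simp: flat_def field_simps power2_eq_square)
         (cases j; simp add: field_simps)
    then show ?thesis
      by (rule has_field_derivative_transform_within[where d=x])
        (use 1 in \<open>auto simp: flat_def dist_real_def\<close>)
  next
    case 2
    have "((\<lambda>x. 0) has_real_derivative 0) (at x)" by simp
    then have "(flat j has_real_derivative 0) (at x)"
      by (rule has_field_derivative_transform_within[where d="-x"]) (use 2 in \<open>auto simp: flat_def dist_real_def\<close>)
    then show ?thesis using 2 by (simp add: flat_def)
  next
    case 3
    \<comment> \<open>The difference quotient of \<open>flat j\<close> at 0 is
      \<open>flat (j + 1)\<close>, so its limit is again an instance of flatness.\<close>
    have "((\<lambda>h. (flat j (0 + h) - flat j 0) / h) \<longlongrightarrow> 0) (at 0)"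
      by (rule Lim_transform_eventually[OF flat_tendsto_0[of "j + 1"]])
        (auto simp: flat_def)
    then have "(flat j has_real_derivative 0) (at 0)"
      by (simp add: DERIV_def)
    then show ?thesis using 3 by (simp add: flat_def)
  qed
qed

lemma smooth_flat: "smooth (flat j)"
proof (rule smooth_fun_algebra)
  show "flat j \<in> fun_algebra (range flat)" by (intro fun_algebra.gen) auto
  fix g assume "g \<in> range flat"
  then obtain k where g: "g = flat k" by auto
  show "g differentiable_on UNIV"
    using flat_DERIV[of k] unfolding g differentiable_on_def by (auto simp: real_differentiable_def)
  fix b :: real
  have "partial_deriv b g = (\<lambda>x. (flat (k + 2) x + (- real k) * flat (k + 1) x) * b)"
    unfolding g by (rule partial_deriv_real) (use flat_DERIV[of k] in simp)
  also have "\<dots> \<in> fun_algebra (range flat)"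
    by (intro fun_algebra.intros) auto
  finally show "partial_deriv b g \<in> fun_algebra (range flat)" .
qed

lemma flat_nonneg: "flat j x \<ge> 0" by (simp add: flat_def)
lemma flat0_pos_iff: "flat 0 x > 0 \<longleftrightarrow> x > 0" by (simp add: flat_def)
lemma flat0_le_1: "flat 0 x \<le> 1" by (simp add: flat_def)

text \<open>The factor \<open>Suc n\<close> steepens the edges while the box stays fixed, so one
  family provides both a test function positive exactly on the box and an approximation of the
  indicator of the box.\<close>

definition box_bump :: "'a::euclidean_space \<Rightarrow> 'a \<Rightarrow> nat \<Rightarrow> 'a \<Rightarrow> real" where
  "box_bump a b n x = (\<Prod>e\<in>Basis. flat 0 (real (Suc n) * (x \<bullet> e - a \<bullet> e)) * flat 0 (real (Suc n) * (b \<bullet> e - x \<bullet> e)))"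

lemma smooth_box_bump: "smooth (box_bump a b n)"
proof -
  have 1: "smooth (\<lambda>x. flat 0 (real (Suc n) * (x \<bullet> e) + (- real (Suc n) * (a \<bullet> e))))" for e
    by (rule smooth_affine_inner[OF smooth_flat])
  have 2: "smooth (\<lambda>x. flat 0 ((- real (Suc n)) * (x \<bullet> e) + real (Suc n) * (b \<bullet> e)))" for e
    by (rule smooth_affine_inner[OF smooth_flat])
  have "smooth (\<lambda>x. \<Prod>e\<in>Basis. flat 0 (real (Suc n) * (x \<bullet> e) + (- real (Suc n) * (a \<bullet> e))) *
     flat 0 ((- real (Suc n)) * (x \<bullet> e) + real (Suc n) * (b \<bullet> e)))"
    by (intro smooth_prod smooth_mult 1 2) auto
  moreover have "(\<lambda>x. \<Prod>e\<in>Basis. flat 0 (real (Suc n) * (x \<bullet> e) + (- real (Suc n) * (a \<bullet> e))) *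
     flat 0 ((- real (Suc n)) * (x \<bullet> e) + real (Suc n) * (b \<bullet> e))) = box_bump a b n"
    unfolding box_bump_def by (intro ext prod.cong refl) (simp add: algebra_simps)
  ultimately show ?thesis by simp
qed

lemma box_bump_outside: "x \<notin> box a b \<Longrightarrow> box_bump a b n x = 0"
  unfolding box_bump_def
  by (subst prod_zero_iff) (auto simp: mem_box flat_def zero_less_mult_iff simp flip: not_less)

lemma box_bump_nonneg: "box_bump a b n x \<ge> 0"
  unfolding box_bump_def by (intro prod_nonneg mult_nonneg_nonneg flat_nonneg)

lemma box_bump_le_1: "box_bump a b n x \<le> 1"
  unfolding box_bump_def
  by (intro prod_le_1) (auto simp: flat_nonneg flat0_le_1 intro!: mult_le_one)

lemma box_bump_pos: "x \<in> box a b \<Longrightarrow> box_bump a b n x > 0"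
  unfolding box_bump_def
  by (intro prod_pos mult_pos_pos) (auto simp: mem_box flat0_pos_iff simp del: of_nat_Suc)

lemma box_bump_tendsto:
  "(\<lambda>n. box_bump a b n x) \<longlonglongrightarrow> (indicator (box a b) x :: real)"
proof (cases "x \<in> box a b")
  case True
  have lim: "(\<lambda>n. flat 0 (real (Suc n) * t)) \<longlonglongrightarrow> 1" if "t > 0" for t
  proof -
    have "filterlim (\<lambda>n. real (Suc n) * t) at_top sequentially"
      using that filterlim_tendsto_pos_mult_at_top[OF tendsto_const[of t] that
          filterlim_compose[OF filterlim_real_sequentially filterlim_Suc]]
      by (simp add: mult.commute)
    then have "(\<lambda>n. inverse (real (Suc n) * t)) \<longlonglongrightarrow> 0"
      by (rule filterlim_compose[OF tendsto_inverse_0_at_top[OF filterlim_ident]])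
    then have "(\<lambda>n. exp (- inverse (real (Suc n) * t))) \<longlonglongrightarrow> exp (- 0)"
      by (intro tendsto_intros)
    then show ?thesis
      using that by (simp add: flat_def divide_inverse)
  qed
  have "(\<lambda>n. box_bump a b n x) \<longlonglongrightarrow> (\<Prod>e\<in>(Basis::'a set). 1 * 1)"
    unfolding box_bump_def
    by (intro tendsto_prod tendsto_mult lim) (use True in \<open>auto simp: mem_box\<close>)
  then show ?thesis using True by simp
qed (simp add: box_bump_outside)

lemma box_bump_test_function:
  assumes "cbox a b \<subseteq> \<Omega>" shows "box_bump a b n \<in> test_functions \<Omega>"
  unfolding test_functions_def
  using smooth_box_bump[of a b n] assms box_subset_cbox[of a b] by (auto intro!: exI[of _ "cbox a b"] box_bump_outside)

section \<open>Weak derivatives\<close>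

lemma AE_lebesgue_on_iff:
  fixes S :: "'a::euclidean_space set"
  assumes "S \<in> sets lebesgue"
  shows "(AE x in lebesgue_on S. P x) \<longleftrightarrow> negligible {x \<in> S. \<not> P x}"
proof -
  have "(AE x in lebesgue_on S. P x) \<longleftrightarrow> (AE x in lebesgue. x \<in> S \<longrightarrow> P x)"
    using assms by (intro AE_restrict_space_iff) auto
  also have "\<dots> \<longleftrightarrow> {x \<in> S. \<not> P x} \<in> null_sets lebesgue"
    by (subst completion.AE_iff_null_sets) (auto simp: Collect_conj_eq[symmetric] completion.complete2
      intro: arg_cong[where f="\<lambda>A. A \<in> null_sets lebesgue"])
  finally show ?thesis by (simp add: negligible_iff_null_sets)
qed

lemma LINT_lebesgue_on_support:
  fixes f :: "'a::euclidean_space \<Rightarrow> real"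
  assumes "K \<subseteq> \<Omega>" "K \<in> sets lebesgue" "\<Omega> \<in> sets lebesgue" "\<And>x. x \<in> \<Omega> - K \<Longrightarrow> f x = 0"
  shows "(LINT x|lebesgue_on \<Omega>. f x) = (LINT x|lebesgue_on K. f x)"
    and "integrable (lebesgue_on \<Omega>) f \<longleftrightarrow> integrable (lebesgue_on K) f"
proof -
  have eq: "(\<lambda>x. indicator \<Omega> x *\<^sub>R f x) = (\<lambda>x. indicator K x *\<^sub>R f x)"
    using assms by (auto simp: indicator_def fun_eq_iff)
  show "(LINT x|lebesgue_on \<Omega>. f x) = (LINT x|lebesgue_on K. f x)"
    using assms eq by (simp add: integral_restrict_space)
  show "integrable (lebesgue_on \<Omega>) f \<longleftrightarrow> integrable (lebesgue_on K) f"
    using assms eq by (simp add: integrable_restrict_space)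
qed

text \<open>Integration against the bumps gives zero for every n, and they converge boundedly to the
  indicator of the open box; the faces of the box are a null set.\<close>

lemma integral_cbox_zero_of_test:
  fixes f :: "'a::euclidean_space \<Rightarrow> real"
  assumes "open \<Omega>" and int: "locally_integrable \<Omega> f"
    and zero: "\<And>\<phi>. \<phi> \<in> test_functions \<Omega> \<Longrightarrow> (LINT x|lebesgue_on \<Omega>. f x * \<phi> x) = 0"
    and sub: "cbox a b \<subseteq> \<Omega>"
  shows "integral (cbox a b) f = 0"
proof -
  let ?K = "cbox a b"
  have intK: "integrable (lebesgue_on ?K) f"
    using int sub by (auto simp: locally_integrable_def)
  have z: "(LINT x|lebesgue_on ?K. f x * box_bump a b n x) = 0" for n
  proof -
    have "(LINT x|lebesgue_on \<Omega>. f x * box_bump a b n x) = (LINT x|lebesgue_on ?K. f x * box_bump a b n x)"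
      using sub \<open>open \<Omega>\<close> box_subset_cbox[of a b]
      by (intro LINT_lebesgue_on_support) (auto intro!: box_bump_outside)
    then show ?thesis using zero[OF box_bump_test_function[OF sub]] by simp
  qed
  have "(\<lambda>n. LINT x|lebesgue_on ?K. f x * box_bump a b n x) \<longlonglongrightarrow> (LINT x|lebesgue_on ?K. f x * indicator (box a b) x)"
  proof (rule integral_dominated_convergence[where w = "\<lambda>x. \<bar>f x\<bar>"])
    have bm: "box_bump a b n \<in> borel_measurable (lebesgue_on ?K)" for n
      by (intro continuous_imp_measurable_on_sets_lebesgue smooth_continuous smooth_box_bump) auto
    show "(\<lambda>x. f x * box_bump a b n x) \<in> borel_measurable (lebesgue_on ?K)" for n
      using intK bm by (intro borel_measurable_times) auto
    show "(\<lambda>x. f x * indicator (box a b) x) \<in> borel_measurable (lebesgue_on ?K)"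
      using intK by (intro borel_measurable_times borel_measurable_indicator)
        (auto simp: sets_restrict_space_iff box_subset_cbox Int_absorb2)
    show "integrable (lebesgue_on ?K) (\<lambda>x. \<bar>f x\<bar>)" using intK by simp
    show "AE x in lebesgue_on ?K. (\<lambda>n. f x * box_bump a b n x) \<longlonglongrightarrow> f x * indicator (box a b) x"
      by (intro AE_I2 tendsto_intros box_bump_tendsto)
    show "AE x in lebesgue_on ?K. norm (f x * box_bump a b n x) \<le> \<bar>f x\<bar>" for n
      by (intro AE_I2) (simp add: abs_mult box_bump_nonneg mult_left_le box_bump_le_1)
  qed
  then have "(LINT x|lebesgue_on ?K. f x * indicator (box a b) x) = 0"
    unfolding z by (simp add: LIMSEQ_const_iff)
  also have "(LINT x|lebesgue_on ?K. f x * indicator (box a b) x) = (LINT x|lebesgue_on ?K. f x)"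
  proof (rule integral_cong_AE)
    show "(\<lambda>x. f x * indicator (box a b) x) \<in> borel_measurable (lebesgue_on ?K)"
      using intK by (intro borel_measurable_times borel_measurable_indicator)
        (auto simp: sets_restrict_space_iff box_subset_cbox Int_absorb2)
    show "f \<in> borel_measurable (lebesgue_on ?K)" using intK by auto
    have "{x \<in> ?K. f x * indicator (box a b) x \<noteq> f x} \<subseteq> ?K - box a b"
      by (auto simp: indicator_def)
    from negligible_subset[OF negligible_frontier_interval this]
    show "AE x in lebesgue_on ?K. f x * indicator (box a b) x = f x"
      by (subst AE_lebesgue_on_iff) auto
  qed
  also have "\<dots> = integral ?K f"
    using intK by (intro lebesgue_integral_eq_integral) auto
  finally show ?thesis .
qed

text \<open>The fundamental lemma of the calculus of variations. All integrals over boxes inside the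
  open set vanish, and by Lebesgue differentiation \<open>f x\<close> is, for almost every x, the
  limit of averages over cubes with corner x.\<close>

theorem AE_zero_of_test:
  fixes f :: "'a::euclidean_space \<Rightarrow> real"
  assumes "open \<Omega>" and int: "locally_integrable \<Omega> f"
    and zero: "\<And>\<phi>. \<phi> \<in> test_functions \<Omega> \<Longrightarrow> (LINT x|lebesgue_on \<Omega>. f x * \<phi> x) = 0"
  shows "AE x in lebesgue_on \<Omega>. f x = 0"
proof -
  have negl: "negligible {x \<in> cbox a b. f x \<noteq> 0}" if sub: "cbox a b \<subseteq> \<Omega>" for a b
  proof -
    \<comment> \<open>Extension by zero gives integrability on all boxes, as the differentiation
      theorem demands.\<close>
    define F where "F = (\<lambda>x. if x \<in> cbox a b then f x else 0)"
    have "integrable (lebesgue_on (cbox a b)) f"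
      using int sub by (auto simp: locally_integrable_def)
    then have "f integrable_on cbox a b"
      by (metis integrable_on_lebesgue_on lmeasurable_cbox fmeasurableD)
    then have "F integrable_on UNIV"
      unfolding F_def by (simp add: integrable_restrict_UNIV)
    then have "F integrable_on cbox c d" for c d
      by (rule integrable_on_subcbox) auto
    then obtain N where N: "negligible N"
      and lim: "\<And>x e. \<lbrakk>x \<notin> N; 0 < e\<rbrakk> \<Longrightarrow>
               \<exists>d>0. \<forall>h. 0 < h \<and> h < d \<longrightarrow>
                         norm(integral (cbox x (x + h *\<^sub>R One)) F /\<^sub>R h ^ DIM('a) - F x) < e"
      by (rule integrable_ccontinuous_explicit) blast+
    have "f x = 0" if x: "x \<in> box a b" "x \<notin> N" for x
    proof (rule ccontr)
      assume "f x \<noteq> 0"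
      then obtain d where d: "d > 0" and
        dl: "\<And>h. 0 < h \<and> h < d \<Longrightarrow> norm(integral (cbox x (x + h *\<^sub>R One)) F /\<^sub>R h ^ DIM('a) - F x) < \<bar>f x\<bar>"
        using lim[of x "\<bar>f x\<bar>"] x by auto
      obtain r where r: "r > 0" "ball x r \<subseteq> box a b"
        using x open_box open_contains_ball by blast
      \<comment> \<open>The points of the cube of side h with corner x have l1-distance at most h
        times the dimension from x; this choice keeps the cube inside \<open>ball x r\<close> and h
        below the threshold \<open>d\<close>.\<close>
      define h where "h = min (d / 2) (r / (2 * DIM('a)))"
      have h: "0 < h" "h < d" using d r by (auto simp: h_def min_def)
      have hr: "h * DIM('a) \<le> r / 2"
      proof -
        have "h \<le> r / (2 * DIM('a))" by (simp add: h_def)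
        then show ?thesis by (simp add: field_simps)
      qed
      have "cbox x (x + h *\<^sub>R One) \<subseteq> ball x r"
      proof
        fix y assume y: "y \<in> cbox x (x + h *\<^sub>R One)"
        have "\<bar>(y - x) \<bullet> e\<bar> \<le> h" if "e \<in> Basis" for e
          using y that by (auto simp: mem_box inner_diff_left inner_add_left)
        then have "norm (y - x) \<le> (\<Sum>e\<in>(Basis::'a set). h)"
          by (intro order_trans[OF norm_le_l1] sum_mono) auto
        then show "y \<in> ball x r"
          using hr r by (simp add: dist_norm norm_minus_commute mult.commute)
      qed
      then have sub2: "cbox x (x + h *\<^sub>R One) \<subseteq> cbox a b"
        using r box_subset_cbox[of a b] by blast
      have "integral (cbox x (x + h *\<^sub>R One)) F = integral (cbox x (x + h *\<^sub>R One)) f"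
        by (rule integral_cong) (use sub2 in \<open>auto simp: F_def\<close>)
      also have "\<dots> = 0"
        by (rule integral_cbox_zero_of_test[OF assms]) (use sub sub2 in auto)
      finally show False
        using dl[of h] h x box_subset_cbox[of a b] by (auto simp: F_def split: if_splits)
    qed
    then have "{x \<in> cbox a b. f x \<noteq> 0} \<subseteq> N \<union> (cbox a b - box a b)" by auto
    then show ?thesis
      using N negligible_subset negligible_frontier_interval negligible_Un by metis
  qed
  \<comment> \<open>Countably many boxes exhaust the open set, so the exceptional null sets add up
    to a null set.\<close>
  obtain \<D> where D: "countable \<D>" "\<D> \<subseteq> Pow \<Omega>" "\<And>X. X \<in> \<D> \<Longrightarrow> \<exists>a b. X = cbox a b" "\<Union>\<D> = \<Omega>"
    using open_countable_Union_open_cbox[OF \<open>open \<Omega>\<close>] by metis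
  have "negligible (\<Union>X\<in>\<D>. {x \<in> X. f x \<noteq> 0})"
    using D negl by (intro negligible_countable_Union) (auto, force)
  moreover have "(\<Union>X\<in>\<D>. {x \<in> X. f x \<noteq> 0}) = {x \<in> \<Omega>. f x \<noteq> 0}"
    using D(4) by auto
  ultimately show ?thesis
    using \<open>open \<Omega>\<close> by (subst AE_lebesgue_on_iff) auto
qed

lemma locally_integrable_diff:
  "locally_integrable \<Omega> f \<Longrightarrow> locally_integrable \<Omega> g \<Longrightarrow> locally_integrable \<Omega> (\<lambda>x. f x - g x)"
  by (auto simp: locally_integrable_def)

lemma integrable_times_test:
  fixes f :: "'a::euclidean_space \<Rightarrow> real"
  assumes "open \<Omega>" "locally_integrable \<Omega> f" "compact K" "K \<subseteq> \<Omega>" "\<And>x. x \<notin> K \<Longrightarrow> \<phi> x = 0" "continuous_on UNIV \<phi>"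
  shows "integrable (lebesgue_on \<Omega>) (\<lambda>x. f x * \<phi> x)"
proof -
  have [simp]: "K \<in> sets lebesgue" using \<open>compact K\<close> by (simp add: compact_imp_closed lebesgue_closedin borel_closed)
  have "compact (\<phi> ` K)"
    using assms compact_continuous_image continuous_on_subset by blast
  then obtain B where B: "\<And>x. x \<in> K \<Longrightarrow> \<bar>\<phi> x\<bar> \<le> B"
    using compact_imp_bounded bounded_iff by (metis imageI real_norm_def)
  have "integrable (lebesgue_on K) (\<lambda>x. f x * \<phi> x)"
  proof (rule Bochner_Integration.integrable_bound)
    show "integrable (lebesgue_on K) (\<lambda>x. B * f x)"
      using assms by (auto simp: locally_integrable_def)
    have "\<phi> \<in> borel_measurable (lebesgue_on K)"
      using assms(6) by (intro continuous_imp_measurable_on_sets_lebesgue) (auto intro: continuous_on_subset)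
    then show "(\<lambda>x. f x * \<phi> x) \<in> borel_measurable (lebesgue_on K)"
      using assms by (auto simp: locally_integrable_def)
    show "AE x in lebesgue_on K. norm (f x * \<phi> x) \<le> norm (B * f x)"
      using B by (intro AE_I2) (auto simp: abs_mult mult.commute space_restrict_space
        intro!: mult_right_mono order_trans[OF B])
  qed
  then show ?thesis
    using assms by (subst LINT_lebesgue_on_support(2)[of K]) auto
qed

lemma test_functionE:
  assumes "\<phi> \<in> test_functions \<Omega>"
  obtains K where "smooth \<phi>" "compact K" "K \<subseteq> \<Omega>" "\<And>x. x \<notin> K \<Longrightarrow> \<phi> x = 0"
  using assms by (auto simp: test_functions_def)

lemma integrable_times_test_function:
  assumes "open \<Omega>" "locally_integrable \<Omega> f" "\<phi> \<in> test_functions \<Omega>"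
  shows "integrable (lebesgue_on \<Omega>) (\<lambda>x. f x * \<phi> x)"
  using assms by (elim test_functionE) (auto intro!: integrable_times_test smooth_continuous)

lemma weak_gradient_unique:
  assumes "open \<Omega>" "weak_gradient \<Omega> u G" "weak_gradient \<Omega> u G'"
  shows "AE x in lebesgue_on \<Omega>. G x = G' x"
proof -
  have "AE x in lebesgue_on \<Omega>. G x \<bullet> b - G' x \<bullet> b = 0" if "b \<in> Basis" for b
  proof (rule AE_zero_of_test[OF \<open>open \<Omega>\<close>])
    have li: "locally_integrable \<Omega> (\<lambda>x. G x \<bullet> b)" "locally_integrable \<Omega> (\<lambda>x. G' x \<bullet> b)"
      using assms that by (auto simp: weak_gradient_def)
    then show "locally_integrable \<Omega> (\<lambda>x. G x \<bullet> b - G' x \<bullet> b)"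
      by (rule locally_integrable_diff)
    fix \<phi> assume "\<phi> \<in> test_functions \<Omega>"
    then show "(LINT x|lebesgue_on \<Omega>. (G x \<bullet> b - G' x \<bullet> b) * \<phi> x) = 0"
      using assms that li
      by (simp add: left_diff_distrib integrable_times_test_function weak_gradient_def)
  qed
  then have "AE x in lebesgue_on \<Omega>. \<forall>b\<in>Basis. G x \<bullet> b - G' x \<bullet> b = 0"
    by (intro AE_finite_allI) auto
  then show ?thesis
    by eventually_elim (auto intro: euclidean_eqI)
qed

lemma weak_gradient_wgrad: "weak_gradient \<Omega> u G \<Longrightarrow> weak_gradient \<Omega> u (wgrad \<Omega> u)"
  unfolding wgrad_def by (rule someI[of "weak_gradient \<Omega> u"])

lemma wgrad_AE_eq:
  "open \<Omega> \<Longrightarrow> weak_gradient \<Omega> u G \<Longrightarrow> AE x in lebesgue_on \<Omega>. wgrad \<Omega> u x = G x"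
  using weak_gradient_unique weak_gradient_wgrad by blast

section \<open>Absolutely continuous functions\<close>

text \<open>Over a fine partition the increments of \<open>K\<close> sum to at most \<open>c\<close> times the oscillation of \<open>C\<close>
  times its total increment.\<close>

lemma const_of_quadratic_increment:
  fixes K C :: "real \<Rightarrow> real"
  assumes "a \<le> b" and cont: "continuous_on {a..b} C"
    and mono: "\<And>x y. a \<le> x \<Longrightarrow> x \<le> y \<Longrightarrow> y \<le> b \<Longrightarrow> C x \<le> C y"
    and quad: "\<And>x y. a \<le> x \<Longrightarrow> x \<le> y \<Longrightarrow> y \<le> b \<Longrightarrow> \<bar>K y - K x\<bar> \<le> c * (C y - C x)^2"
    and "c \<ge> 0"
  shows "K b = K a"
proof -
  have main: "\<bar>K b - K a\<bar> \<le> c * (C b - C a) * e" if "e > 0" for e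
  proof -
    have "uniformly_continuous_on {a..b} C"
      using cont by (intro compact_uniformly_continuous) auto
    then obtain d where d: "d > 0" "\<And>x y. x \<in> {a..b} \<Longrightarrow> y \<in> {a..b} \<Longrightarrow> dist y x < d \<Longrightarrow> dist (C y) (C x) < e"
      using \<open>e > 0\<close> unfolding uniformly_continuous_on_def by metis
    obtain n :: nat where n: "real n > (b - a) / d" using reals_Archimedean2 by blast
    then have "real n > 0" using d \<open>a \<le> b\<close> by (meson divide_nonneg_pos le_less_trans diff_ge_0_iff_ge)
    define x where "x i = a + real i * ((b - a) / n)" for i :: nat
    have xi: "x i \<in> {a..b}" if "i \<le> n" for i
    proof -
      have "real i * ((b - a) / n) \<le> real n * ((b - a) / n)"
        using that \<open>a \<le> b\<close> by (intro mult_right_mono) auto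
      then show ?thesis using \<open>a \<le> b\<close> \<open>real n > 0\<close> by (auto simp: x_def)
    qed
    have step: "x (Suc i) - x i = (b - a) / n" for i
    proof -
      have "a + real (Suc i) * w - (a + real i * w) = w" for w by (simp add: algebra_simps)
      then show ?thesis unfolding x_def .
    qed
    have "(b - a) / n < d" using n d \<open>real n > 0\<close> by (simp add: field_simps)
    have "\<bar>K (x i) - K (x 0)\<bar> \<le> c * (C (x i) - C (x 0)) * e" if "i \<le> n" for i
      using that
    proof (induction i)
      case (Suc i)
      have le: "x i \<le> x (Suc i)" using step[of i] \<open>a \<le> b\<close> by (smt (verit) divide_nonneg_nonneg of_nat_0_le_iff)
      have ab: "x i \<in> {a..b}" "x (Suc i) \<in> {a..b}" using Suc xi by auto
      have "dist (C (x (Suc i))) (C (x i)) < e"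
        using step[of i] \<open>(b - a) / n < d\<close> \<open>a \<le> b\<close> by (intro d ab) (simp add: dist_real_def)
      then have Ce: "C (x (Suc i)) - C (x i) \<le> e" "C (x (Suc i)) - C (x i) \<ge> 0"
        using mono[of "x i" "x (Suc i)"] le ab by (auto simp: dist_real_def)
      have "\<bar>K (x (Suc i)) - K (x i)\<bar> \<le> c * (C (x (Suc i)) - C (x i))^2"
        using quad le ab by auto
      also have "\<dots> \<le> c * ((C (x (Suc i)) - C (x i)) * e)"
        unfolding power2_eq_square using Ce \<open>c \<ge> 0\<close> by (intro mult_left_mono) auto
      finally have "\<bar>K (x (Suc i)) - K (x i)\<bar> \<le> c * ((C (x (Suc i)) - C (x i)) * e)" .
      moreover have "\<bar>K (x i) - K (x 0)\<bar> \<le> c * (C (x i) - C (x 0)) * e" using Suc by simp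
      ultimately have "\<bar>K (x (Suc i)) - K (x 0)\<bar> \<le> c * ((C (x (Suc i)) - C (x i)) * e) + c * (C (x i) - C (x 0)) * e"
        by linarith
      then show ?case by (simp add: algebra_simps)
    qed (simp add: x_def)
    from this[of n] show ?thesis using \<open>real n > 0\<close> by (simp add: x_def)
  qed
  have "\<bar>K b - K a\<bar> \<le> 0"
  proof (rule field_le_epsilon)
    fix e :: real assume "e > 0"
    have nn: "c * (C b - C a) \<ge> 0" using mono[of a b] assms by auto
    \<comment> \<open>The summand 1 in the denominator keeps the choice meaningful when the total
      increment of \<open>C\<close> vanishes.\<close>
    have "\<bar>K b - K a\<bar> \<le> c * (C b - C a) * (e / (c * (C b - C a) + 1))"
      using nn \<open>e > 0\<close> by (intro main) (auto intro!: divide_pos_pos)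
    also have "\<dots> \<le> e" using nn \<open>e > 0\<close> by (simp add: field_simps)
    finally show "\<bar>K b - K a\<bar> \<le> 0 + e" by simp
  qed
  then show ?thesis by simp
qed

lemma absolutely_integrable_mult_continuous:
  fixes f G :: "real \<Rightarrow> real"
  assumes "f absolutely_integrable_on {a..b}" "continuous_on {a..b} G"
  shows "(\<lambda>x. f x * G x) absolutely_integrable_on {a..b}"
proof -
  have "G \<in> borel_measurable (lebesgue_on {a..b})"
    using assms(2) by (intro continuous_imp_measurable_on_sets_lebesgue) auto
  moreover have "bounded (G ` {a..b})"
    using assms(2) by (intro compact_imp_bounded compact_continuous_image) auto
  ultimately have "(\<lambda>x. G x * f x) absolutely_integrable_on {a..b}"
    using assms(1) by (intro absolutely_integrable_bounded_measurable_product_real) auto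
  then show ?thesis by (simp add: mult.commute)
qed

lemma hk_abs_bound:
  fixes f :: "real \<Rightarrow> real"
  assumes "f integrable_on S" "g integrable_on S" "\<And>x. x \<in> S \<Longrightarrow> \<bar>f x\<bar> \<le> g x"
  shows "\<bar>integral S f\<bar> \<le> integral S g"
  using Henstock_Kurzweil_Integration.integral_norm_bound_integral[of f S g] assms by simp

text \<open>Integration by parts when the derivatives are merely integrable. The defect
  \<open>K\<close> between both sides changes over an interval by a quantity quadratic in the
  increment of \<open>C\<close>, the integral of |f| + |g|, hence it is constant.\<close>

lemma integral_product_rule:
  fixes f g :: "real \<Rightarrow> real"
  assumes "a \<le> b" and f: "f absolutely_integrable_on {a..b}" and g: "g absolutely_integrable_on {a..b}"
    and F: "\<And>x. x \<in> {a..b} \<Longrightarrow> F x = F a + integral {a..x} f"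
    and G: "\<And>x. x \<in> {a..b} \<Longrightarrow> G x = G a + integral {a..x} g"
  shows "integral {a..b} (\<lambda>x. f x * G x + g x * F x) = F b * G b - F a * G a"
proof -
  have fi: "f integrable_on {a..b}" and gi: "g integrable_on {a..b}"
    using f g set_lebesgue_integral_eq_integral(1) by blast+
  have "continuous_on {a..b} (\<lambda>x. F a + integral {a..x} f)" "continuous_on {a..b} (\<lambda>x. G a + integral {a..x} g)"
    by (intro continuous_intros indefinite_integral_continuous_1 fi gi)+
  then have cF: "continuous_on {a..b} F" and cG: "continuous_on {a..b} G"
    using F G by (metis (no_types, lifting) continuous_on_cong)+
  define h where "h = (\<lambda>x. \<bar>f x\<bar> + \<bar>g x\<bar>)"
  have hi: "h integrable_on {a..b}"
    unfolding h_def using f g by (intro integrable_add) (auto simp: absolutely_integrable_on_def)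
  define C where "C x = integral {a..x} h" for x
  define p where "p = (\<lambda>x. f x * G x + g x * F x)"
  have fG: "(\<lambda>x. f x * G x) absolutely_integrable_on {a..b}" and gF: "(\<lambda>x. g x * F x) absolutely_integrable_on {a..b}"
    using f g cF cG absolutely_integrable_mult_continuous by blast+
  then have pi: "p integrable_on {a..b}"
    unfolding p_def using set_lebesgue_integral_eq_integral(1) by (intro integrable_add) blast+
  define K where "K x = integral {a..x} p - F x * G x" for x
  have sub: "u integrable_on {x..y}" if "u integrable_on {a..b}" "a \<le> x" "y \<le> b" for u :: "real \<Rightarrow> real" and x y
    using that integrable_on_subinterval by (metis atLeastatMost_subset_iff)
  have diffI: "integral {a..y} u - integral {a..x} u = integral {x..y} u"
    if "u integrable_on {a..b}" "a \<le> x" "x \<le> y" "y \<le> b" for u :: "real \<Rightarrow> real" and x y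
    using Henstock_Kurzweil_Integration.integral_combine[of a x y u] that sub[of u a y] by simp
  have "K b = K a"
  proof (rule const_of_quadratic_increment[OF \<open>a \<le> b\<close>, where C=C and c=3])
    show "continuous_on {a..b} C"
      unfolding C_def by (rule indefinite_integral_continuous_1[OF hi])
    show "C x \<le> C y" if "a \<le> x" "x \<le> y" "y \<le> b" for x y
    proof -
      have "integral {x..y} h \<ge> 0"
        by (intro Henstock_Kurzweil_Integration.integral_nonneg sub[OF hi]) (use that in \<open>auto simp: h_def\<close>)
      then show ?thesis using diffI[OF hi, of x y] that by (simp add: C_def)
    qed
    show "\<bar>K y - K x\<bar> \<le> 3 * (C y - C x)^2" if xy: "a \<le> x" "x \<le> y" "y \<le> b" for x y
    proof -
      let ?D = "C y - C x"
      have Ceq: "?D = integral {x..y} h" using diffI[OF hi] xy by (simp add: C_def)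
      have Fb: "\<bar>F t - F x\<bar> \<le> ?D" and Gb: "\<bar>G t - G x\<bar> \<le> ?D" if t: "t \<in> {x..y}" for t
      proof -
        have hle: "integral {x..t} h \<le> ?D"
          unfolding Ceq using t xy by (intro integral_subset_le sub[OF hi]) (auto simp: h_def)
        have "\<bar>integral {x..t} f\<bar> \<le> integral {x..t} h"
          using t xy by (intro hk_abs_bound sub[OF hi] sub[OF fi]) (auto simp: h_def)
        moreover have "\<bar>integral {x..t} g\<bar> \<le> integral {x..t} h"
          using t xy by (intro hk_abs_bound sub[OF hi] sub[OF gi]) (auto simp: h_def)
        moreover have "F t - F x = integral {x..t} f" "G t - G x = integral {x..t} g"
          using F[of t] F[of x] G[of t] G[of x] diffI[OF fi, of x t] diffI[OF gi, of x t] t xy by auto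
        ultimately show "\<bar>F t - F x\<bar> \<le> ?D" "\<bar>G t - G x\<bar> \<le> ?D" using hle by auto
      qed
      \<comment> \<open>Freezing \<open>F\<close> and \<open>G\<close> at the left end x: the
        increment of \<open>K\<close> is the integral of \<open>q\<close> minus the product of the
        increments of \<open>F\<close> and \<open>G\<close>. Each of the two is at most the square
        of \<open>?D\<close>.\<close>
      define q where "q = (\<lambda>t. f t * (G t - G x) + g t * (F t - F x))"
      have pq: "q = (\<lambda>t. p t - (G x * f t + F x * g t))" by (auto simp: q_def p_def algebra_simps)
      have lin: "(\<lambda>t. G x * f t + F x * g t) integrable_on {x..y}"
        by (intro integrable_add integrable_on_mult_right sub[OF fi] sub[OF gi]) (use xy in auto)
      have qi: "q integrable_on {x..y}"
        unfolding pq using xy by (intro integrable_diff lin sub[OF pi]) auto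
      have "\<bar>integral {x..y} q\<bar> \<le> integral {x..y} (\<lambda>t. ?D * h t)"
      proof (rule hk_abs_bound[OF qi])
        show "(\<lambda>t. ?D * h t) integrable_on {x..y}" using xy by (intro integrable_on_mult_right sub[OF hi]) auto
        fix t assume t: "t \<in> {x..y}"
        have "\<bar>q t\<bar> \<le> \<bar>f t\<bar> * \<bar>G t - G x\<bar> + \<bar>g t\<bar> * \<bar>F t - F x\<bar>"
          unfolding q_def by (metis abs_mult abs_triangle_ineq)
        also have "\<dots> \<le> \<bar>f t\<bar> * ?D + \<bar>g t\<bar> * ?D"
          by (intro add_mono mult_left_mono Fb[OF t] Gb[OF t]) auto
        finally show "\<bar>q t\<bar> \<le> ?D * h t" by (simp add: h_def algebra_simps)
      qed
      then have 1: "\<bar>integral {x..y} q\<bar> \<le> ?D\<^sup>2"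
        using Ceq by (simp add: power2_eq_square)
      have Fd: "integral {x..y} f = F y - F x" and Gd: "integral {x..y} g = G y - G x"
        using F[of y] F[of x] G[of y] G[of x] diffI[OF fi, of x y] diffI[OF gi, of x y] xy by auto
      have "integral {x..y} q = integral {x..y} p - (G x * (F y - F x) + F x * (G y - G x))"
      proof -
        have "integral {x..y} (\<lambda>t. G x * f t + F x * g t) = integral {x..y} (\<lambda>t. G x * f t) + integral {x..y} (\<lambda>t. F x * g t)"
          using xy by (intro Henstock_Kurzweil_Integration.integral_add integrable_on_mult_right sub[OF fi] sub[OF gi]) auto
        also have "\<dots> = G x * (F y - F x) + F x * (G y - G x)"
          by (simp add: Fd Gd)
        finally show ?thesis
          unfolding pq using xy by (subst Henstock_Kurzweil_Integration.integral_diff) (auto intro: lin sub[OF pi])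
      qed
      moreover have "K y - K x = integral {x..y} p - (F y * G y - F x * G x)"
        using diffI[OF pi, of x y] xy by (simp add: K_def)
      ultimately have "K y - K x = integral {x..y} q - (F y - F x) * (G y - G x)"
        by (simp add: algebra_simps)
      moreover have "\<bar>(F y - F x) * (G y - G x)\<bar> \<le> ?D\<^sup>2"
        unfolding abs_mult power2_eq_square using Fb[of y] Gb[of y] xy by (intro mult_mono) auto
      ultimately show ?thesis using 1 by (smt (verit) zero_le_power2)
    qed
  qed auto
  then show ?thesis by (simp add: K_def p_def)
qed

text \<open>Anchored at 1, where the boundary value is prescribed; nothing is asked of
  \<open>g\<close> at 0, where it may fail to be integrable. On (0,1] this is local absolute
  continuity of \<open>v\<close> with almost everywhere derivative \<open>g\<close>.\<close>

definition acd :: "(real \<Rightarrow> real) \<Rightarrow> (real \<Rightarrow> real) \<Rightarrow> bool" where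
  "acd v g \<longleftrightarrow> (\<forall>x. 0 < x \<longrightarrow> x \<le> 1 \<longrightarrow> g absolutely_integrable_on {x..1} \<and> integral {x..1} g = v 1 - v x)"

lemma acd_abs_integrable: "acd v g \<Longrightarrow> 0 < x \<Longrightarrow> y \<le> 1 \<Longrightarrow> g absolutely_integrable_on {x..y}"
  using absolutely_integrable_on_subinterval[where f=g and S="{x..1}" and a=x and b=y]
  by (cases "x \<le> 1") (auto simp: acd_def)

lemma acd_integrable: "acd v g \<Longrightarrow> 0 < x \<Longrightarrow> y \<le> 1 \<Longrightarrow> g integrable_on {x..y}"
  using acd_abs_integrable set_lebesgue_integral_eq_integral(1) by blast

lemma acd_integral:
  assumes "acd v g" "0 < x" "x \<le> y" "y \<le> 1"
  shows "integral {x..y} g = v y - v x"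
  using Henstock_Kurzweil_Integration.integral_combine[of x y 1 g] assms acd_integrable[OF assms(1), of x 1]
  by (auto simp: acd_def)

lemma acd_continuous:
  assumes "acd v g" shows "continuous_on {0<..1} v"
proof -
  have "continuous (at x within {0<..1}) v" if x: "x \<in> {0<..1}" for x
  proof -
    have "continuous_on {x/2..1} (\<lambda>t. v (x/2) + integral {x/2..t} g)"
      using x by (intro continuous_intros indefinite_integral_continuous_1 acd_integrable[OF assms]) auto
    then have "continuous_on {x/2..1} v"
      by (rule continuous_on_eq) (use x acd_integral[OF assms, of "x/2"] in auto)
    then have "continuous (at x within {x/2..1}) v"
      using x by (simp add: continuous_on_eq_continuous_within)
    moreover have "at x within {x/2..1} = at x within {0<..1}"
      by (rule at_within_nhd[where S="{x/2<..}"]) (use x in auto)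
    ultimately show ?thesis by simp
  qed
  then show ?thesis
    by (simp add: continuous_on_eq_continuous_within)
qed

lemma acd_mult:
  assumes "acd v g" "acd w h"
  shows "acd (\<lambda>x. v x * w x) (\<lambda>x. g x * w x + h x * v x)"
  unfolding acd_def
proof (intro allI impI conjI)
  fix x :: real assume x: "0 < x" "x \<le> 1"
  have c: "continuous_on {x..1} v" "continuous_on {x..1} w"
    by (rule continuous_on_subset[OF acd_continuous[OF assms(1)]] continuous_on_subset[OF acd_continuous[OF assms(2)]],
        use x in auto)+
  show "(\<lambda>x. g x * w x + h x * v x) absolutely_integrable_on {x..1}"
    by (rule set_integral_add(1); rule absolutely_integrable_mult_continuous)
      (use acd_abs_integrable[OF assms(1) x(1)] acd_abs_integrable[OF assms(2) x(1)] c in simp_all)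
  show "integral {x..1} (\<lambda>x. g x * w x + h x * v x) = v 1 * w 1 - v x * w x"
  proof (rule integral_product_rule)
    show "g absolutely_integrable_on {x..1}" "h absolutely_integrable_on {x..1}"
      using acd_abs_integrable[OF assms(1) x(1)] acd_abs_integrable[OF assms(2) x(1)] by simp_all
    show "v t = v x + integral {x..t} g" "w t = w x + integral {x..t} h" if "t \<in> {x..1}" for t
      using acd_integral[OF assms(1), of x t] acd_integral[OF assms(2), of x t] x that by auto
  qed (use x in auto)
qed

lemma acd_C1:
  assumes "\<And>x. 0 < x \<Longrightarrow> x \<le> 1 \<Longrightarrow> (v has_real_derivative g x) (at x within {0<..1})"
    and "continuous_on {0<..1} g"
  shows "acd v g"
  unfolding acd_def
proof (intro allI impI conjI)
  fix x :: real assume x: "0 < x" "x \<le> 1"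
  have sub: "{x..1} \<subseteq> {0<..1}" using x by auto
  show "g absolutely_integrable_on {x..1}"
    using assms(2) sub by (intro absolutely_integrable_continuous_real) (rule continuous_on_subset)
  have "(g has_integral (v 1 - v x)) {x..1}"
    using x by (intro fundamental_theorem_of_calculus)
      (use x in \<open>auto simp flip: has_real_derivative_iff_has_vector_derivative intro: DERIV_subset[OF assms(1) sub]\<close>)
  then show "integral {x..1} g = v 1 - v x" by (rule integral_unique)
qed

lemma acd_add:
  assumes "acd v g" "acd w h" shows "acd (\<lambda>x. v x + w x) (\<lambda>x. g x + h x)"
  unfolding acd_def
proof (intro allI impI conjI)
  fix x :: real assume x: "0 < x" "x \<le> 1"
  show "(\<lambda>x. g x + h x) absolutely_integrable_on {x..1}"
    by (rule set_integral_add(1)) (use acd_abs_integrable[OF assms(1) x(1)] acd_abs_integrable[OF assms(2) x(1)] in simp_all)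
  show "integral {x..1} (\<lambda>x. g x + h x) = v 1 + w 1 - (v x + w x)"
    using acd_integral[OF assms(1), of x 1] acd_integral[OF assms(2), of x 1]
      acd_integrable[OF assms(1), of x 1] acd_integrable[OF assms(2), of x 1] x
    by (subst Henstock_Kurzweil_Integration.integral_add) auto
qed

lemma acd_cmult:
  assumes "acd v g" shows "acd (\<lambda>x. c * v x) (\<lambda>x. c * g x)"
  unfolding acd_def
proof (intro allI impI conjI)
  fix x :: real assume x: "0 < x" "x \<le> 1"
  show "(\<lambda>x. c * g x) absolutely_integrable_on {x..1}"
    using acd_abs_integrable[OF assms x(1), of 1] by simp
  show "integral {x..1} (\<lambda>x. c * g x) = c * v 1 - c * v x"
    using assms x acd_integral[of v g x 1] by (simp add: right_diff_distrib)
qed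

lemma acd_diff: "acd v g \<Longrightarrow> acd w h \<Longrightarrow> acd (\<lambda>x. v x - w x) (\<lambda>x. g x - h x)"
  using acd_add[of v g "\<lambda>x. -1 * w x" "\<lambda>x. -1 * h x"] acd_cmult[of w h "-1"] by simp

lemma acd_cong_AE:
  assumes "acd v g" "AE x in lebesgue_on {0<..<1}. g x = h x"
  shows "acd v h"
  unfolding acd_def
proof (intro allI impI conjI)
  fix x :: real assume x: "0 < x" "x \<le> 1"
  have N: "negligible ({x \<in> {0<..<1}. g x \<noteq> h x} \<union> {1})"
    using assms(2) by (simp add: AE_lebesgue_on_iff)
  have *: "h t = g t" if "t \<in> {x..1} - ({x \<in> {0<..<1}. g x \<noteq> h x} \<union> {1})" for t
    using that x by auto
  show "h absolutely_integrable_on {x..1}"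
    by (rule absolutely_integrable_spike[OF acd_abs_integrable[OF assms(1)] N *]) (use x in auto)
  have "integral {x..1} g = integral {x..1} h"
    by (rule integral_spike[OF N]) (rule *)
  then show "integral {x..1} h = v 1 - v x"
    using acd_integral[OF assms(1), of x 1] x by simp
qed

section \<open>Weak derivatives on the unit interval\<close>

abbreviation leb01 :: "real measure" where "leb01 \<equiv> lebesgue_on {0<..<1}"

lemma abs_integrable_iff:
  fixes f :: "'a::euclidean_space \<Rightarrow> real"
  shows "S \<in> sets lebesgue \<Longrightarrow> f absolutely_integrable_on S \<longleftrightarrow> integrable (lebesgue_on S) f"
  by (simp add: set_integrable_def integrable_restrict_space)

lemma borel_measurable_lebesgue_on_AE:
  fixes f :: "'a::euclidean_space \<Rightarrow> 'b::euclidean_space"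
  assumes "f \<in> borel_measurable (lebesgue_on S)" "S \<in> sets lebesgue" "AE x in lebesgue_on S. f x = h x"
  shows "h \<in> borel_measurable (lebesgue_on S)"
proof -
  have "h measurable_on S"
    by (rule measurable_on_spike[of f S "{x \<in> S. f x \<noteq> h x}"])
      (use assms in \<open>auto simp: measurable_on_iff_borel_measurable AE_lebesgue_on_iff\<close>)
  then show ?thesis using assms by (simp add: measurable_on_iff_borel_measurable)
qed

lemma weak_gradient_real:
  fixes u g :: "real \<Rightarrow> real"
  shows "weak_gradient \<Omega> u g \<longleftrightarrow> locally_integrable \<Omega> u \<and> locally_integrable \<Omega> g \<and>
    (\<forall>\<phi>\<in>test_functions \<Omega>. (LINT x|lebesgue_on \<Omega>. u x * partial_deriv 1 \<phi> x) = - (LINT x|lebesgue_on \<Omega>. g x * \<phi> x))"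
  by (simp add: weak_gradient_def)

lemma compact_subset_01:
  assumes "compact K" "K \<subseteq> {0<..<1::real}"
  obtains \<alpha> \<beta> where "0 < \<alpha>" "\<alpha> < \<beta>" "\<beta> < 1" "K \<subseteq> {\<alpha><..<\<beta>}"
proof (cases "K = {}")
  case True
  then show ?thesis using that[of "1/3" "1/2"] by auto
next
  case False
  obtain l where l: "l \<in> K" "\<And>x. x \<in> K \<Longrightarrow> l \<le> x" using compact_attains_inf[OF assms(1) False] by blast
  obtain u where u: "u \<in> K" "\<And>x. x \<in> K \<Longrightarrow> x \<le> u" using compact_attains_sup[OF assms(1) False] by blast
  have "0 < l" "l \<le> u" "u < 1" using l u assms(2) by auto
  moreover have "x \<in> {l/2<..<(u+1)/2}" if "x \<in> K" for x using l(2)[OF that] u(2)[OF that] \<open>0 < l\<close> \<open>u < 1\<close> by auto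
  then have "K \<subseteq> {l/2<..<(u+1)/2}" by blast
  ultimately show ?thesis by (intro that[of "l/2" "(u+1)/2"]) auto
qed

lemma test_function_01E:
  fixes \<phi> :: "real \<Rightarrow> real"
  assumes "\<phi> \<in> test_functions {0<..<1}"
  obtains \<alpha> \<beta> where "smooth \<phi>" "0 < \<alpha>" "\<alpha> < \<beta>" "\<beta> < 1" "\<And>x. x \<notin> {\<alpha><..<\<beta>} \<Longrightarrow> \<phi> x = 0"
    "\<And>x. x \<notin> {\<alpha><..<\<beta>} \<Longrightarrow> partial_deriv 1 \<phi> x = 0"
proof -
  obtain K where K: "smooth \<phi>" "compact K" "K \<subseteq> {0<..<1}" "\<And>x. x \<notin> K \<Longrightarrow> \<phi> x = 0"
    using assms by (rule test_functionE) blast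
  obtain \<alpha> \<beta> where ab: "0 < \<alpha>" "\<alpha> < \<beta>" "\<beta> < 1" "K \<subseteq> {\<alpha><..<\<beta>}"
    using compact_subset_01[OF K(2,3)] by blast
  have "partial_deriv 1 \<phi> x = 0" if "x \<notin> {\<alpha><..<\<beta>}" for x
  proof -
    have "open (- K)" "x \<in> - K" using K(2) ab that by (auto simp: compact_imp_closed open_Compl)
    have "(\<phi> has_real_derivative 0) (at x)"
      by (rule has_field_derivative_transform_within_open[OF DERIV_const \<open>open (-K)\<close> \<open>x \<in> -K\<close>]) (use K(4) in auto)
    then show ?thesis using smooth_real_DERIV[OF K(1)] DERIV_unique by blast
  qed
  moreover have "\<phi> x = 0" if "x \<notin> {\<alpha><..<\<beta>}" for x using K(4) ab(4) that by blast
  ultimately show ?thesis by (intro that[OF K(1) ab(1-3)])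
qed

lemma locally_integrable_01:
  assumes "\<And>a b. 0 < a \<Longrightarrow> b < 1 \<Longrightarrow> f absolutely_integrable_on {a..b::real}"
  shows "locally_integrable {0<..<1} (f :: real \<Rightarrow> real)"
  unfolding locally_integrable_def
proof (intro allI impI, elim conjE)
  fix K :: "real set" assume K: "compact K" "K \<subseteq> {0<..<1}"
  obtain \<alpha> \<beta> where ab: "0 < \<alpha>" "\<alpha> < \<beta>" "\<beta> < 1" "K \<subseteq> {\<alpha><..<\<beta>}"
    using compact_subset_01[OF K] by blast
  have KS: "K \<in> sets lebesgue" using K(1) by (simp add: compact_imp_closed borel_closed)
  have "f absolutely_integrable_on {\<alpha>..\<beta>}" using assms ab by auto
  then have "f absolutely_integrable_on K"
    by (rule set_integrable_subset) (use KS ab in auto)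
  then show "integrable (lebesgue_on K) f" using KS by (simp add: abs_integrable_iff)
qed

lemma acd_locally_integrable: "acd v g \<Longrightarrow> locally_integrable {0<..<1} g"
  by (rule locally_integrable_01) (simp add: acd_abs_integrable)

lemma continuous_on_locally_integrable:
  fixes v :: "real \<Rightarrow> real"
  assumes "continuous_on {0<..<1} v" shows "locally_integrable {0<..<1} v"
  by (rule locally_integrable_01, rule absolutely_integrable_continuous_real,
      rule continuous_on_subset[OF assms]) auto

lemma smooth_partial_deriv_real: "smooth (f :: real \<Rightarrow> real) \<Longrightarrow> smooth (partial_deriv 1 f)"
  by (rule smooth_partial_deriv) auto

lemma smooth_acd: "smooth \<phi> \<Longrightarrow> acd \<phi> (partial_deriv 1 \<phi>)"
  by (rule acd_C1) (auto intro: has_field_derivative_at_within smooth_real_DERIV smooth_continuous smooth_partial_deriv_real)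

text \<open>The product with a test function is again \<open>acd\<close> and vanishes at both ends
  of an interval carrying the support, so the integral of its derivative is zero.\<close>

theorem acd_weak_gradient:
  assumes "acd v g" shows "weak_gradient {0<..<1} v g"
  unfolding weak_gradient_real
proof (intro conjI ballI)
  have cv: "continuous_on {0<..<1} v"
    using acd_continuous[OF assms] by (rule continuous_on_subset) auto
  show liv: "locally_integrable {0<..<1} v"
    by (rule continuous_on_locally_integrable[OF cv])
  show lig: "locally_integrable {0<..<1} g" by (rule acd_locally_integrable[OF assms])
  fix \<phi> :: "real \<Rightarrow> real" assume "\<phi> \<in> test_functions {0<..<1}"
  then obtain \<alpha> \<beta> where sm: "smooth \<phi>" and ab: "0 < \<alpha>" "\<alpha> < \<beta>" "\<beta> < 1"
    and z: "\<And>x. x \<notin> {\<alpha><..<\<beta>} \<Longrightarrow> \<phi> x = 0" "\<And>x. x \<notin> {\<alpha><..<\<beta>} \<Longrightarrow> partial_deriv 1 \<phi> x = 0"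
    by (rule test_function_01E) blast
  let ?d = "partial_deriv 1 \<phi>"
  have 1: "(LINT x|leb01. v x * ?d x) = (LINT x|lebesgue_on {\<alpha>..\<beta>}. v x * ?d x)"
    using ab z by (intro LINT_lebesgue_on_support) auto
  have 2: "(LINT x|leb01. g x * \<phi> x) = (LINT x|lebesgue_on {\<alpha>..\<beta>}. g x * \<phi> x)"
    using ab z by (intro LINT_lebesgue_on_support) auto
  have ai: "(\<lambda>x. g x * \<phi> x) absolutely_integrable_on {\<alpha>..\<beta>}"
    using ab by (intro absolutely_integrable_mult_continuous acd_abs_integrable[OF assms] smooth_continuous sm) auto
  have ai2: "(\<lambda>x. v x * ?d x) absolutely_integrable_on {\<alpha>..\<beta>}"
    using ab by (intro absolutely_integrable_continuous_real continuous_intros smooth_continuous smooth_partial_deriv sm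
      continuous_on_subset[OF cv]) auto
  have "integral {\<alpha>..\<beta>} (\<lambda>x. g x * \<phi> x + ?d x * v x) = v \<beta> * \<phi> \<beta> - v \<alpha> * \<phi> \<alpha>"
    using acd_integral[OF acd_mult[OF assms smooth_acd[OF sm]], of \<alpha> \<beta>] ab by auto
  then have "integral {\<alpha>..\<beta>} (\<lambda>x. g x * \<phi> x + v x * ?d x) = 0"
    using z by (simp add: mult.commute)
  moreover have "integral {\<alpha>..\<beta>} (\<lambda>x. g x * \<phi> x + v x * ?d x) = integral {\<alpha>..\<beta>} (\<lambda>x. g x * \<phi> x) + integral {\<alpha>..\<beta>} (\<lambda>x. v x * ?d x)"
    using set_lebesgue_integral_eq_integral(1)[OF ai] set_lebesgue_integral_eq_integral(1)[OF ai2]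
    by (rule Henstock_Kurzweil_Integration.integral_add)
  ultimately show "(LINT x|leb01. v x * ?d x) = - (LINT x|leb01. g x * \<phi> x)"
    unfolding 1 2 using ai ai2 by (simp add: abs_integrable_iff lebesgue_integral_eq_integral)
qed

section \<open>Functions with vanishing weak derivative\<close>

lemma smooth_antiderivative:
  fixes k :: "real \<Rightarrow> real"
  assumes "smooth k"
  obtains F where "smooth F" "\<And>x. (F has_real_derivative k x) (at x)"
proof -
  have "\<exists>F. \<forall>x::real. -\<infinity> < ereal x \<longrightarrow> ereal x < \<infinity> \<longrightarrow> (F has_vector_derivative k x) (at x)"
    using smooth_continuous[OF assms, of UNIV]
    by (intro einterval_antiderivative) (auto simp: continuous_on_eq_continuous_at)
  then obtain F where F: "\<And>x. (F has_real_derivative k x) (at x)"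
    by (auto simp: has_real_derivative_iff_has_vector_derivative)
  have pd: "partial_deriv b F = (\<lambda>x. k x * b)" for b
    by (rule partial_deriv_real[OF F])
  have "smooth F"
  \<comment> \<open>One derivative of \<open>F\<close> lands among the smooth functions, so
    adjoining the single generator \<open>F\<close> is enough.\<close>
  proof (rule smooth_fun_algebra[of _ "insert F {g. smooth g}"])
    show "F \<in> fun_algebra (insert F {g. smooth g})" by (intro fun_algebra.gen) auto
    fix g assume g: "g \<in> insert F {g. smooth g}"
    then show "g differentiable_on UNIV"
      using F smooth_differentiable[of g] by (cases "g = F") (auto simp: differentiable_on_def real_differentiable_def)
    fix b :: real assume b: "b \<in> Basis"
    show "partial_deriv b g \<in> fun_algebra (insert F {g. smooth g})"
      using g b smooth_partial_deriv[of g b] smooth_mult[OF assms smooth_const[of b]]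
      by (cases "g = F") (auto simp: pd intro!: fun_algebra.gen)
  qed
  with F show ?thesis using that by blast
qed

text \<open>Zero mean is what makes the antiderivative take the same value on both sides of the
  support of \<open>k\<close>, so that subtracting this value leaves compact support.\<close>

lemma mean_zero_antiderivative:
  fixes k :: "real \<Rightarrow> real"
  assumes k: "k \<in> test_functions {0<..<1}" and 0: "(LINT x|leb01. k x) = 0"
  obtains \<phi> where "\<phi> \<in> test_functions {0<..<1}" "partial_deriv 1 \<phi> = k"
proof -
  obtain \<alpha> \<beta> where sm: "smooth k" and ab: "0 < \<alpha>" "\<alpha> < \<beta>" "\<beta> < 1"
    and z: "\<And>x. x \<notin> {\<alpha><..<\<beta>} \<Longrightarrow> k x = 0"
    using k by (rule test_function_01E) blast
  obtain F where F: "smooth F" "\<And>x. (F has_real_derivative k x) (at x)"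
    using smooth_antiderivative[OF sm] by blast
  have ki: "integrable (lebesgue_on {\<alpha>..\<beta>}) k"
    using absolutely_integrable_continuous_real[OF smooth_continuous[OF sm], of \<alpha> \<beta>] by (simp add: abs_integrable_iff)
  have "(LINT x|leb01. k x) = (LINT x|lebesgue_on {\<alpha>..\<beta>}. k x)"
    using ab z by (intro LINT_lebesgue_on_support) auto
  also have "\<dots> = integral {\<alpha>..\<beta>} k" by (rule lebesgue_integral_eq_integral[OF ki]) auto
  also have "\<dots> = F \<beta> - F \<alpha>"
    using ab F(2) by (intro integral_unique fundamental_theorem_of_calculus)
      (auto simp flip: has_real_derivative_iff_has_vector_derivative intro: has_field_derivative_at_within)
  finally have Fab: "F \<beta> = F \<alpha>" using 0 by simp
  define \<phi> where "\<phi> x = F x - F \<alpha>" for x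
  have zl: "\<phi> x = 0" if "x \<le> \<alpha>" for x
  proof (cases "x = \<alpha>")
    case False
    then obtain t where "x < t" "t < \<alpha>" "F \<alpha> - F x = (\<alpha> - x) * k t"
      using MVT2[of x \<alpha> F k] F(2) \<open>x \<le> \<alpha>\<close> by auto
    then show ?thesis using z[of t] by (simp add: \<phi>_def)
  qed (simp add: \<phi>_def)
  have zr: "\<phi> x = 0" if "\<beta> \<le> x" for x
  proof (cases "x = \<beta>")
    case False
    then obtain t where "\<beta> < t" "t < x" "F x - F \<beta> = (x - \<beta>) * k t"
      using MVT2[of \<beta> x F k] F(2) \<open>\<beta> \<le> x\<close> by auto
    then show ?thesis using z[of t] Fab by (simp add: \<phi>_def)
  qed (simp add: \<phi>_def Fab)
  have "smooth \<phi>" unfolding \<phi>_def by (intro smooth_diff F) auto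
  moreover have "\<phi> x = 0" if "x \<notin> {\<alpha>..\<beta>}" for x
    using that zl[of x] zr[of x] by auto
  moreover have "compact {\<alpha>..\<beta>}" "{\<alpha>..\<beta>} \<subseteq> {0<..<1}" using ab by auto
  ultimately have "\<phi> \<in> test_functions {0<..<1}" unfolding test_functions_def by blast
  moreover have "partial_deriv 1 \<phi> = (\<lambda>x. k x * 1)"
    unfolding \<phi>_def by (rule partial_deriv_real) (auto intro!: derivative_eq_intros F)
  ultimately show ?thesis using that by simp
qed

lemma test_functions_diff_cmult:
  assumes "\<psi> \<in> test_functions \<Omega>" "\<eta> \<in> test_functions \<Omega>"
  shows "(\<lambda>x. \<psi> x - m * \<eta> x) \<in> test_functions \<Omega>"
proof -
  obtain K L where "smooth \<psi>" "compact K" "K \<subseteq> \<Omega>" "\<And>x. x \<notin> K \<Longrightarrow> \<psi> x = 0"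
     "smooth \<eta>" "compact L" "L \<subseteq> \<Omega>" "\<And>x. x \<notin> L \<Longrightarrow> \<eta> x = 0"
    using assms by (elim test_functionE) blast
  then show ?thesis
    unfolding test_functions_def
    by (intro CollectI conjI smooth_diff smooth_cmult exI[of _ "K \<union> L"]) (auto simp: compact_Un)
qed

lemma integral_box_bump_pos: "0 < (LINT x|leb01. box_bump (1/4) (3/4::real) 0 x)"
proof -
  have T: "box_bump (1/4) (3/4::real) 0 \<in> test_functions {0<..<1}" by (rule box_bump_test_function) auto
  have i: "integrable leb01 (box_bump (1/4) (3/4::real) 0)"
    using integrable_times_test_function[OF _ continuous_on_locally_integrable[of "\<lambda>_. 1"] T] by simp
  have "(LINT x|leb01. box_bump (1/4) (3/4::real) 0 x) \<noteq> 0"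
  proof
    assume "(LINT x|leb01. box_bump (1/4) (3/4::real) 0 x) = 0"
    then have "AE x in leb01. box_bump (1/4) (3/4::real) 0 x = 0"
      using integral_nonneg_eq_0_iff_AE[OF i] by (simp add: box_bump_nonneg)
    then have "negligible {x \<in> {0<..<1}. box_bump (1/4) (3/4::real) 0 x \<noteq> 0}" by (simp add: AE_lebesgue_on_iff)
    then have "negligible {1/4<..<3/4::real}"
      by (rule negligible_subset) (use box_bump_pos[of _ "1/4::real" "3/4" 0] in force)
    then have "negligible (box (1/4) (3/4::real))" by simp
    then show False by (simp only: negligible_interval(2) box_eq_empty) auto
  qed
  moreover have "0 \<le> (LINT x|leb01. box_bump (1/4) (3/4::real) 0 x)"
    by (intro integral_nonneg_AE AE_I2 box_bump_nonneg)
  ultimately show ?thesis by simp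
qed

text \<open>The du Bois-Reymond lemma. Every test function minus a multiple of one fixed bump has
  mean zero and so is a derivative, on which \<open>w\<close> vanishes; thus \<open>w\<close> minus
  a suitable constant annihilates all test functions.\<close>

lemma AE_const_of_weak_derivative_zero:
  assumes li: "locally_integrable {0<..<1} (w :: real \<Rightarrow> real)"
    and zero: "\<And>\<phi>. \<phi> \<in> test_functions {0<..<1} \<Longrightarrow> (LINT x|leb01. w x * partial_deriv 1 \<phi> x) = 0"
  obtains c where "AE x in leb01. w x = c"
proof -
  define \<eta> where "\<eta> = box_bump (1/4) (3/4::real) 0"
  have \<eta>: "\<eta> \<in> test_functions {0<..<1}" unfolding \<eta>_def by (rule box_bump_test_function) auto
  have li1: "locally_integrable {0<..<1} (\<lambda>x::real. c::real)" for c
    by (rule continuous_on_locally_integrable) auto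
  have tint: "integrable leb01 \<phi>" if "\<phi> \<in> test_functions {0<..<1}" for \<phi>
    using integrable_times_test_function[OF _ li1[of 1] that] by simp
  define I where "I = (LINT x|leb01. \<eta> x)"
  have "I \<noteq> 0" unfolding I_def \<eta>_def using integral_box_bump_pos by (rule less_imp_neq[symmetric])
  \<comment> \<open>Testing the desired identity \<open>w = c\<close> against the bump forces this
    value.\<close>
  define c where "c = (LINT x|leb01. w x * \<eta> x) / I"
  have "AE x in leb01. w x - c = 0"
  proof (rule AE_zero_of_test)
    show "locally_integrable {0<..<1} (\<lambda>x. w x - c)" by (intro locally_integrable_diff li li1)
    fix \<psi> :: "real \<Rightarrow> real" assume \<psi>: "\<psi> \<in> test_functions {0<..<1}"
    define m where "m = (LINT x|leb01. \<psi> x) / I"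
    define k where "k x = \<psi> x - m * \<eta> x" for x
    have "k \<in> test_functions {0<..<1}" unfolding k_def[abs_def] by (rule test_functions_diff_cmult[OF \<psi> \<eta>])
    moreover have "(LINT x|leb01. k x) = 0"
      using tint[OF \<psi>] tint[OF \<eta>] \<open>I \<noteq> 0\<close> by (simp add: k_def m_def I_def)
    ultimately obtain \<phi> where "\<phi> \<in> test_functions {0<..<1}" "partial_deriv 1 \<phi> = k"
      by (rule mean_zero_antiderivative)
    then have "(LINT x|leb01. w x * k x) = 0" using zero by metis
    moreover have iw: "integrable leb01 (\<lambda>x. w x * \<psi> x)" "integrable leb01 (\<lambda>x. w x * \<eta> x)"
      by (intro integrable_times_test_function li \<psi> \<eta> open_greaterThanLessThan)+
    then have "(LINT x|leb01. w x * k x) = (LINT x|leb01. w x * \<psi> x) - m * (LINT x|leb01. w x * \<eta> x)"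
    proof -
      have "(\<lambda>x. w x * k x) = (\<lambda>x. w x * \<psi> x - m * (w x * \<eta> x))" by (auto simp: k_def algebra_simps)
      then show ?thesis using iw by simp
    qed
    ultimately have "(LINT x|leb01. w x * \<psi> x) = c * (LINT x|leb01. \<psi> x)"
      using \<open>I \<noteq> 0\<close> by (simp add: m_def c_def)
    then show "(LINT x|leb01. (w x - c) * \<psi> x) = 0"
      using iw tint[OF \<psi>] by (simp add: left_diff_distrib)
  qed (use li in auto)
  then have "AE x in leb01. w x = c" by eventually_elim simp
  then show ?thesis using that by blast
qed

text \<open>The primitive of \<open>g\<close> taken from 1 has the same weak derivative as
  \<open>u\<close>, so their difference is constant almost everywhere. This turns weak derivatives
  into absolute continuity.\<close>

theorem weak_gradient_acd:
  assumes wg: "weak_gradient {0<..<1} u g"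
    and gi: "\<And>x. 0 < x \<Longrightarrow> x \<le> 1 \<Longrightarrow> g absolutely_integrable_on {x..1}"
  obtains c where "acd (\<lambda>x. c - integral {x..1} g) g" "AE x in leb01. u x = c - integral {x..1} g"
proof -
  have acd0: "acd (\<lambda>x. c - integral {x..1} g) g" for c
    using gi by (auto simp: acd_def)
  let ?v = "\<lambda>x. 0 - integral {x..1} g"
  have wv: "weak_gradient {0<..<1} ?v g" by (rule acd_weak_gradient[OF acd0])
  obtain c where "AE x in leb01. u x - ?v x = c"
  proof (rule AE_const_of_weak_derivative_zero[of "\<lambda>x. u x - ?v x"])
    have li: "locally_integrable {0<..<1} u" "locally_integrable {0<..<1} ?v"
      using wg wv unfolding weak_gradient_def by blast+
    then show "locally_integrable {0<..<1} (\<lambda>x. u x - ?v x)" by (rule locally_integrable_diff)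
    fix \<phi> :: "real \<Rightarrow> real" assume \<phi>: "\<phi> \<in> test_functions {0<..<1}"
    obtain K where K: "smooth \<phi>" "compact K" "K \<subseteq> {0<..<1}" "\<And>x. x \<notin> K \<Longrightarrow> \<phi> x = 0"
      using \<phi> by (rule test_functionE) blast
    obtain \<alpha> \<beta> where ab: "0 < \<alpha>" "\<alpha> < \<beta>" "\<beta> < 1"  "\<And>x. x \<notin> {\<alpha><..<\<beta>} \<Longrightarrow> partial_deriv 1 \<phi> x = 0"
      using \<phi> by (rule test_function_01E) blast
    have ii: "integrable leb01 (\<lambda>x. f x * partial_deriv 1 \<phi> x)" if "locally_integrable {0<..<1} f" for f
      by (rule integrable_times_test[OF _ that, of "{\<alpha>..\<beta>}"]) (use ab in \<open>auto intro!: smooth_continuous smooth_partial_deriv_real K\<close>)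
    then show "(LINT x|leb01. (u x - ?v x) * partial_deriv 1 \<phi> x) = 0"
      using wg wv \<phi> ii[OF li(1)] ii[OF li(2)] unfolding weak_gradient_real left_diff_distrib
      by (subst Bochner_Integration.integral_diff) auto
  qed blast
  then have "AE x in leb01. u x = c - integral {x..1} g" by eventually_elim simp
  with acd0[of c] show ?thesis using that by blast
qed

section \<open>The weighted Sobolev space\<close>

lemma borel_measurable_powr_01 [measurable]: "(\<lambda>r. r powr s) \<in> borel_measurable leb01"
  by (intro measurable_restrict_space1 measurable_completion) measurable

lemma L2_M_cong_AE:
  assumes "g \<in> L2_M M" "AE x in leb01. g x = h x" shows "h \<in> L2_M M"
proof -
  have h: "h \<in> borel_measurable leb01"
    by (rule borel_measurable_lebesgue_on_AE[of g]) (use assms in \<open>auto simp: L2_M_def\<close>)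
  have "integrable leb01 (\<lambda>r. r powr (M - 1) * (h r)^2)"
  proof (rule integrable_cong_AE_imp)
    show "integrable leb01 (\<lambda>r. r powr (M - 1) * (g r)^2)" using assms by (simp add: L2_M_def)
    show "AE r in leb01. r powr (M - 1) * (g r)^2 = r powr (M - 1) * (h r)^2"
      using assms(2) by eventually_elim simp
    show "(\<lambda>r. r powr (M - 1) * (h r)^2) \<in> borel_measurable leb01"
      using h by measurable
  qed
  with h show ?thesis by (simp add: L2_M_def)
qed

lemma powr_lower:
  fixes x t s :: real
  assumes "0 < x" "x \<le> t" "t \<le> 1" shows "min (x powr s) 1 \<le> t powr s"
proof (cases "s \<ge> 0")
  case True
  then have "x powr s \<le> t powr s" using assms by (intro powr_mono2) auto
  then show ?thesis by simp
next
  case False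
  then have "1 powr s \<le> t powr s" using assms by (intro powr_mono2') auto
  then show ?thesis by simp
qed

lemma integrable_const_01: "integrable leb01 (\<lambda>r. c::real)"
proof -
  have "(\<lambda>r. c) absolutely_integrable_on {0..1::real}" by (intro absolutely_integrable_continuous_real continuous_on_const)
  then have "(\<lambda>r. c) absolutely_integrable_on {0<..<1::real}" by (simp only: absolutely_integrable_on_Icc_iff_Ioo)
  then show ?thesis by (subst (asm) abs_integrable_iff) auto
qed

lemma abs_le_1_plus_square: "\<bar>x\<bar> \<le> 1 + x\<^sup>2" for x :: real
  using zero_le_power2[of "\<bar>x\<bar> - 1"] by (simp add: power2_eq_square algebra_simps)

text \<open>On [x,1] the weight has a positive lower bound m, whatever the sign of the exponent, and
  |g| <= 1 + g^2 passes from square integrability to integrability on a bounded interval.\<close>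

lemma L2_M_abs_integrable:
  assumes "g \<in> L2_M M" "0 < x" "x \<le> 1"
  shows "g absolutely_integrable_on {x..1}"
proof -
  define m where "m = min (x powr (M - 1)) 1"
  have m: "m > 0" using assms by (simp add: m_def)
  have gm: "g \<in> borel_measurable leb01" and gi: "integrable leb01 (\<lambda>r. r powr (M - 1) * (g r)^2)"
    using assms by (auto simp: L2_M_def)
  define iv where "iv = (indicator {x<..<1::real} :: real \<Rightarrow> real)"
  have "integrable leb01 (\<lambda>r. iv r * g r)"
  proof (rule Bochner_Integration.integrable_bound)
    have "integrable leb01 (\<lambda>r. 1::real)" by (rule integrable_const_01)
    then show "integrable leb01 (\<lambda>r. 1 + (1 / m) * (r powr (M - 1) * (g r)^2))"
      using gi by (intro Bochner_Integration.integrable_add integrable_mult_right) auto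
    show "(\<lambda>r. iv r * g r) \<in> borel_measurable leb01"
      unfolding iv_def using gm assms by (intro borel_measurable_times borel_measurable_indicator) (auto simp: sets_restrict_space_iff Int_absorb2)
    show "AE r in leb01. norm (iv r * g r) \<le> norm (1 + (1 / m) * (r powr (M - 1) * (g r)^2))"
    proof (rule AE_I2)
      fix r :: real
      show "norm (iv r * g r) \<le> norm (1 + (1 / m) * (r powr (M - 1) * (g r)^2))"
      proof (cases "r \<in> {x<..<1}")
        case True
        then have "m \<le> r powr (M - 1)" unfolding m_def using assms by (intro powr_lower) auto
        then have "m * (g r)^2 \<le> r powr (M - 1) * (g r)^2" by (intro mult_right_mono) auto
        then have 1: "(g r)^2 \<le> (1 / m) * (r powr (M - 1) * (g r)^2)" using m by (simp add: pos_le_divide_eq mult.commute)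
        have "norm (iv r * g r) = \<bar>g r\<bar>" using True by (simp add: iv_def)
        also have "\<dots> \<le> 1 + (1 / m) * (r powr (M - 1) * (g r)^2)"
          using 1 abs_le_1_plus_square[of "g r"] by linarith
        also have "\<dots> \<le> norm (1 + (1 / m) * (r powr (M - 1) * (g r)^2))"
          unfolding real_norm_def by (rule abs_ge_self)
        finally show ?thesis .
      qed (simp add: iv_def)
    qed
  qed
  also have "(\<lambda>r. iv r * g r) = (\<lambda>r. if r \<in> {x<..<1} then g r else 0)" by (auto simp: iv_def)
  finally have "integrable leb01 (\<lambda>r. if r \<in> {x<..<1} then g r else 0)" .
  then have "integrable (lebesgue_on {x<..<1}) (\<lambda>r. if r \<in> {x<..<1} then g r else 0)"
    by (rule iffD1[OF LINT_lebesgue_on_support(2), rotated -1]) (use assms in auto)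
  then have "integrable (lebesgue_on {x<..<1}) g"
    by (rule iffD1[OF Bochner_Integration.integrable_cong[OF refl], rotated]) simp
  then have "g absolutely_integrable_on {x<..<1}" by (rule iffD2[OF abs_integrable_iff, rotated]) simp
  then show ?thesis by (simp only: absolutely_integrable_on_Icc_iff_Ioo)
qed

lemma continuous_AE_eq_01:
  fixes f g :: "real \<Rightarrow> real"
  assumes f: "continuous_on {0<..<1} f" and g: "continuous_on {0<..<1} g" and AE: "AE x in leb01. f x = g x"
    and x: "x \<in> {0<..<1}"
  shows "f x = g x"
proof -
  have "open ({0<..<1} \<inter> (\<lambda>x. f x - g x) -` (- {0}))"
    by (intro continuous_open_preimage continuous_intros f g)
  moreover have "negligible ({0<..<1} \<inter> (\<lambda>x. f x - g x) -` (- {0}))"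
  proof -
    have "negligible {x \<in> {0<..<1}. f x \<noteq> g x}" using AE by (simp add: AE_lebesgue_on_iff)
    then show ?thesis by (rule negligible_subset) auto
  qed
  ultimately have "{0<..<1} \<inter> (\<lambda>x. f x - g x) -` (- {0}) = {}"
    using open_not_negligible by blast
  then show ?thesis using x by auto
qed

text \<open>Almost everywhere statements on (0,1) do not see the point 1. The value there is
  recovered as a limit along 1 - 1/(n+2), which is how the boundary condition survives the change of
  representative.\<close>

lemma continuous_AE_eq_01':
  fixes f g :: "real \<Rightarrow> real"
  assumes f: "continuous_on {0<..1} f" and g: "continuous_on {0<..1} g" and AE: "AE x in leb01. f x = g x"
    and x: "x \<in> {0<..1}"
  shows "f x = g x"
proof (cases "x < 1")
  case True
  show ?thesis
    by (rule continuous_AE_eq_01[OF continuous_on_subset[OF f] continuous_on_subset[OF g] AE]) (use x True in auto)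
next
  case False
  then have [simp]: "x = 1" using x by auto
  have s: "(\<lambda>n. 1 - 1 / real (Suc (Suc n))) \<longlonglongrightarrow> 1"
    using tendsto_diff[OF tendsto_const[of 1] LIMSEQ_Suc[OF LIMSEQ_inverse_real_of_nat]] by (simp add: divide_inverse)
  have i: "1 - 1 / real (Suc (Suc n)) \<in> {0<..<1}" for n by auto
  have *: "(\<lambda>n. h (1 - 1 / real (Suc (Suc n)))) \<longlonglongrightarrow> h 1" if "continuous_on {0<..1} h" for h :: "real \<Rightarrow> real"
    by (rule continuous_on_tendsto_compose[OF that s]) (use i in \<open>auto intro!: always_eventually\<close>)
  have "f (1 - 1 / real (Suc (Suc n))) = g (1 - 1 / real (Suc (Suc n)))" for n
    by (rule continuous_AE_eq_01[OF continuous_on_subset[OF f] continuous_on_subset[OF g] AE i]) auto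
  then show ?thesis using *[OF f] *[OF g] LIMSEQ_unique by simp
qed

lemma acd_cong: "(\<And>x. x \<in> {0<..1} \<Longrightarrow> v x = w x) \<Longrightarrow> acd v g \<longleftrightarrow> acd w g"
  by (auto simp: acd_def)

text \<open>Both the given function and the primitive of its weak derivative are continuous on
  (0,1], so they agree there at every point. The arbitrary choice \<open>wgrad\<close> may serve as
  the derivative because \<open>acd\<close> ignores null sets.\<close>

theorem calH_0M_acd:
  assumes "v \<in> calH_0M M"
  shows "acd v (wgrad {0<..<1} v)" "wgrad {0<..<1} v \<in> L2_M M" "v 1 = 0" "v \<in> calL_M M"
proof -
  obtain g where g: "g \<in> L2_M M" "weak_gradient {0<..<1} v g" and cv: "continuous_on {0<..1} v"
    using assms by (auto simp: calH_0M_def H1_0M_def H1_M_def)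
  obtain c where c: "acd (\<lambda>x. c - integral {x..1} g) g" "AE x in leb01. v x = c - integral {x..1} g"
    using weak_gradient_acd[OF g(2) L2_M_abs_integrable[OF g(1)]] by blast
  have "v x = c - integral {x..1} g" if "x \<in> {0<..1}" for x
    by (rule continuous_AE_eq_01'[OF cv acd_continuous[OF c(1)] c(2) that])
  then have "acd v g" using acd_cong[of v "\<lambda>x. c - integral {x..1} g"] c(1) by blast
  moreover have AE: "AE x in leb01. wgrad {0<..<1} v x = g x"
    using wgrad_AE_eq[OF _ g(2)] by simp
  then have AE': "AE x in leb01. g x = wgrad {0<..<1} v x" by (simp add: eq_commute)
  ultimately show "acd v (wgrad {0<..<1} v)" by (rule acd_cong_AE)
  show "wgrad {0<..<1} v \<in> L2_M M" by (rule L2_M_cong_AE[OF g(1) AE'])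
  show "v 1 = 0" "v \<in> calL_M M" using assms by (auto simp: calH_0M_def H1_0M_def)
qed

text \<open>Membership of \<open>v\<close> in \<open>L2_M M\<close> comes from
  \<open>calL_M M\<close>, as r^(M-1) is at most r^(M-3) on (0,1). The second conclusion identifies
  the chosen \<open>wgrad\<close> with the derivative at hand.\<close>

theorem calH_0M_I:
  assumes acd: "acd v g" and "v 1 = 0" and g: "g \<in> L2_M M" and vL: "v \<in> calL_M M"
  shows "v \<in> calH_0M M" "AE x in leb01. wgrad {0<..<1} v x = g x"
proof -
  have wg: "weak_gradient {0<..<1} v g" by (rule acd_weak_gradient[OF acd])
  then show "AE x in leb01. wgrad {0<..<1} v x = g x" by (intro wgrad_AE_eq) auto
  have vm: "v \<in> borel_measurable leb01" and vi: "integrable leb01 (\<lambda>r. r powr (M - 3) * (v r)^2)"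
    using vL by (auto simp: calL_M_def)
  have "integrable leb01 (\<lambda>r. r powr (M - 1) * (v r)^2)"
  proof (rule Bochner_Integration.integrable_bound[OF vi])
    show "(\<lambda>r. r powr (M - 1) * (v r)^2) \<in> borel_measurable leb01"
      using vm by measurable
    show "AE r in leb01. norm (r powr (M - 1) * (v r)^2) \<le> norm (r powr (M - 3) * (v r)^2)"
      by (intro AE_I2) (auto simp: space_restrict_space intro!: mult_right_mono powr_mono')
  qed
  then have "v \<in> L2_M M" using vm by (simp add: L2_M_def)
  then show "v \<in> calH_0M M"
    using acd_continuous[OF acd] wg g assms by (auto simp: calH_0M_def H1_0M_def H1_M_def)
qed

section \<open>Square integrable functions\<close>

text \<open>Besides the Cauchy-Schwarz inequalities it yields the Euler-Lagrange equation of a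
  minimizer: for a = 0 the linear coefficient must vanish.\<close>

lemma quadratic_nonneg_imp:
  fixes a b c :: real
  assumes "\<And>t. 0 \<le> a + 2 * b * t + c * t\<^sup>2" "0 \<le> c"
  shows "b\<^sup>2 \<le> a * c"
proof (cases "c = 0")
  case True
  have "b = 0"
  proof (rule ccontr)
    assume "b \<noteq> 0"
    then show False using assms(1)[of "- (a + 1) / (2 * b)"] True by simp
  qed
  then show ?thesis using True by simp
next
  case False
  then have "c > 0" using assms by simp
  have "0 \<le> a + 2 * b * (- b / c) + c * (- b / c)^2" by (rule assms)
  also have "\<dots> = a - b\<^sup>2 / c" using \<open>c > 0\<close> by (simp add: field_simps power2_eq_square)
  finally show ?thesis using \<open>c > 0\<close> by (simp add: field_simps)
qed

lemma integrable_weighted_mult: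
  fixes p u w :: "'a \<Rightarrow> real"
  assumes [measurable]: "p \<in> borel_measurable M" "u \<in> borel_measurable M" "w \<in> borel_measurable M"
    and nn: "\<And>x. x \<in> space M \<Longrightarrow> 0 \<le> p x"
    and i: "integrable M (\<lambda>x. p x * (u x)^2)" "integrable M (\<lambda>x. p x * (w x)^2)"
  shows "integrable M (\<lambda>x. p x * u x * w x)"
proof (rule Bochner_Integration.integrable_bound)
  show "integrable M (\<lambda>x. p x * (u x)^2 + p x * (w x)^2)" using i by simp
  show "AE x in M. norm (p x * u x * w x) \<le> norm (p x * (u x)^2 + p x * (w x)^2)"
  proof (rule AE_I2)
    fix x assume x: "x \<in> space M"
    have "2 * \<bar>u x * w x\<bar> \<le> (u x)^2 + (w x)^2"
      using zero_le_power2[of "\<bar>u x\<bar> - \<bar>w x\<bar>"] by (simp add: power2_diff abs_mult)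
    then have "\<bar>u x * w x\<bar> \<le> (u x)^2 + (w x)^2" using abs_ge_zero[of "u x * w x"] by linarith
    then have "p x * \<bar>u x * w x\<bar> \<le> p x * ((u x)^2 + (w x)^2)" using nn[OF x] by (intro mult_left_mono)
    moreover have "norm (p x * u x * w x) = p x * \<bar>u x * w x\<bar>" using nn[OF x] by (simp add: abs_mult)
    moreover have "0 \<le> p x * ((u x)^2 + (w x)^2)" using nn[OF x] by simp
    ultimately show "norm (p x * u x * w x) \<le> norm (p x * (u x)^2 + p x * (w x)^2)"
      by (simp add: distrib_left)
  qed
qed simp

lemma weighted_square_expand:
  fixes p u w :: "'a \<Rightarrow> real"
  assumes [measurable]: "p \<in> borel_measurable M" "u \<in> borel_measurable M" "w \<in> borel_measurable M"
    and nn: "\<And>x. x \<in> space M \<Longrightarrow> 0 \<le> p x"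
    and i: "integrable M (\<lambda>x. p x * (u x)^2)" "integrable M (\<lambda>x. p x * (w x)^2)"
  shows "integrable M (\<lambda>x. p x * (u x + t * w x)^2)"
    and "(LINT x|M. p x * (u x + t * w x)^2) =
      (LINT x|M. p x * (u x)^2) + 2 * (LINT x|M. p x * u x * w x) * t + (LINT x|M. p x * (w x)^2) * t\<^sup>2"
proof -
  have eq: "(\<lambda>x. p x * (u x + t * w x)^2) = (\<lambda>x. p x * (u x)^2 + (2 * t) * (p x * u x * w x) + t\<^sup>2 * (p x * (w x)^2))"
    by (auto simp: power2_sum algebra_simps power_mult_distrib)
  have m: "integrable M (\<lambda>x. p x * u x * w x)" by (intro integrable_weighted_mult assms)
  show "integrable M (\<lambda>x. p x * (u x + t * w x)^2)"
    unfolding eq using i m by simp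
  show "(LINT x|M. p x * (u x + t * w x)^2) =
      (LINT x|M. p x * (u x)^2) + 2 * (LINT x|M. p x * u x * w x) * t + (LINT x|M. p x * (w x)^2) * t\<^sup>2"
    unfolding eq using i m by simp
qed

lemma weighted_Cauchy_Schwarz:
  fixes p u w :: "'a \<Rightarrow> real"
  assumes "p \<in> borel_measurable M" "u \<in> borel_measurable M" "w \<in> borel_measurable M"
    and nn: "\<And>x. x \<in> space M \<Longrightarrow> 0 \<le> p x"
    and i: "integrable M (\<lambda>x. p x * (u x)^2)" "integrable M (\<lambda>x. p x * (w x)^2)"
  shows "(LINT x|M. p x * u x * w x)^2 \<le> (LINT x|M. p x * (u x)^2) * (LINT x|M. p x * (w x)^2)"
proof (rule quadratic_nonneg_imp)
  fix t
  have "0 \<le> (LINT x|M. p x * (u x + t * w x)^2)"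
    using nn by (intro integral_nonneg_AE AE_I2) auto
  then show "0 \<le> (LINT x|M. p x * (u x)^2) + 2 * (LINT x|M. p x * u x * w x) * t + (LINT x|M. p x * (w x)^2) * t\<^sup>2"
    using weighted_square_expand(2)[OF assms] by simp
  show "0 \<le> (LINT x|M. p x * (w x)^2)"
    using nn by (intro integral_nonneg_AE AE_I2) auto
qed

text \<open>Fatou's lemma in the form needed for lower semicontinuity: integrability of the limit is
  a conclusion, and only an eventual bound on the integrals is used.\<close>

lemma integral_le_of_AE_tendsto:
  fixes f :: "'a \<Rightarrow> real"
  assumes [measurable]: "\<And>n::nat. F n \<in> borel_measurable M" "f \<in> borel_measurable M"
    and lim: "AE x in M. (\<lambda>n. F n x) \<longlonglongrightarrow> f x"
    and nn: "\<And>n x. x \<in> space M \<Longrightarrow> 0 \<le> F n x"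
    and int: "\<And>n. integrable M (F n)" and ev: "\<forall>\<^sub>F n in sequentially. (LINT x|M. F n x) \<le> c"
  shows "integrable M f" "(LINT x|M. f x) \<le> c"
proof -
  have f0: "AE x in M. 0 \<le> f x"
    using lim AE_space by eventually_elim (rule LIMSEQ_le_const, assumption, use nn in blast)
  obtain N where N: "\<And>n. n \<ge> N \<Longrightarrow> (LINT x|M. F n x) \<le> c" using ev by (auto simp: eventually_sequentially)
  have "0 \<le> (LINT x|M. F N x)" by (intro integral_nonneg_AE AE_I2 nn)
  then have c0: "0 \<le> c" using N[of N] by simp
  have "(\<integral>\<^sup>+x. ennreal (f x) \<partial>M) = (\<integral>\<^sup>+x. liminf (\<lambda>n. ennreal (F n x)) \<partial>M)"
    by (rule nn_integral_cong_AE) (use lim in \<open>eventually_elim, auto intro!: lim_imp_Liminf[symmetric] tendsto_ennrealI\<close>)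
  also have "\<dots> \<le> liminf (\<lambda>n. \<integral>\<^sup>+x. ennreal (F n x) \<partial>M)"
    by (rule nn_integral_liminf) measurable
  also have "\<dots> = liminf (\<lambda>n. ennreal (LINT x|M. F n x))"
    by (intro arg_cong[where f=liminf] ext nn_integral_eq_integral int AE_I2 nn)
  also have "\<dots> \<le> liminf (\<lambda>n::nat. ennreal c)"
    by (rule Liminf_mono) (use ev in \<open>eventually_elim, auto intro: ennreal_leI\<close>)
  also have "\<dots> = ennreal c" by (simp add: Liminf_const)
  finally have le: "(\<integral>\<^sup>+x. ennreal (f x) \<partial>M) \<le> ennreal c" .
  then show int_f: "integrable M f"
    using f0 by (intro integrableI_nonneg) (auto simp: le_less_trans)
  have "ennreal (LINT x|M. f x) \<le> ennreal c"
    using le nn_integral_eq_integral[OF int_f f0] by simp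
  then show "(LINT x|M. f x) \<le> c" using c0 by (simp add: ennreal_le_iff)
qed

text \<open>Riesz-Fischer for a weight of finite mass. The finite mass bounds weighted L1 norms of
  increments through their L2 norms, so a fast subsequence converges almost everywhere; Fatou then
  gives convergence in L2.\<close>

lemma weighted_L2_complete:
  fixes g :: "nat \<Rightarrow> 'a \<Rightarrow> real" and p :: "'a \<Rightarrow> real"
  assumes [measurable]: "p \<in> borel_measurable M" "\<And>n. g n \<in> borel_measurable M"
    and pos: "\<And>x. x \<in> space M \<Longrightarrow> 0 < p x" and pint: "integrable M p"
    and gi: "\<And>n. integrable M (\<lambda>x. p x * (g n x)^2)"
    and cauchy: "\<And>e. e > 0 \<Longrightarrow> \<exists>N. \<forall>n\<ge>N. \<forall>k\<ge>N. (LINT x|M. p x * (g n x - g k x)^2) < e"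
  obtains h where "h \<in> borel_measurable M" "integrable M (\<lambda>x. p x * (h x)^2)"
    "\<And>n. integrable M (\<lambda>x. p x * (g n x - h x)^2)" "(\<lambda>n. LINT x|M. p x * (g n x - h x)^2) \<longlonglongrightarrow> 0"
proof -
  have nn: "0 \<le> p x" if "x \<in> space M" for x using pos[OF that] by simp
  have di: "integrable M (\<lambda>x. p x * (g n x - g k x)^2)" for n k
    using weighted_square_expand(1)[of p M "g n" "g k" "-1"] nn gi by simp
  \<comment> \<open>Squared distances below (1/4)^j survive multiplication by 2^j in the estimate of
    the increments and can still be summed.\<close>
  have "\<exists>N. \<forall>n\<ge>N. \<forall>k\<ge>N. (LINT x|M. p x * (g n x - g k x)^2) < (1/4)^j" for j :: nat
    by (rule cauchy) simp
  then obtain N where N: "\<And>j n k. n \<ge> N j \<Longrightarrow> k \<ge> N j \<Longrightarrow> (LINT x|M. p x * (g n x - g k x)^2) < (1/4)^j"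
    by metis
  define s where "s = rec_nat (N 0) (\<lambda>j m. max (Suc m) (N (Suc j)))"
  have s_Suc: "s (Suc j) = max (Suc (s j)) (N (Suc j))" for j by (simp add: s_def)
  have sN: "s j \<ge> N j" for j by (cases j) (auto simp: s_Suc s_def)
  have sm: "strict_mono s" by (rule strict_monoI_Suc) (simp add: s_Suc)
  define d where "d j x = g (s (Suc j)) x - g (s j) x" for j x
  have [measurable]: "d j \<in> borel_measurable M" for j unfolding d_def by measurable
  define P where "P = (LINT x|M. p x)"
  have P0: "P \<ge> 0" unfolding P_def using nn by (intro integral_nonneg_AE AE_I2)
  have dj: "integrable M (\<lambda>x. p x * \<bar>d j x\<bar>)" "(LINT x|M. p x * \<bar>d j x\<bar>) \<le> (1 + P) * (1/2)^j" for j
  proof -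
    \<comment> \<open>From (2^j |d| - 1)^2 >= 0: |d| is split into its square with factor 2^j and a
      constant (1/2)^j, both summable in j after integration.\<close>
    define B where "B x = 2^j * (p x * (d j x)^2) + (1/2)^j * p x" for x
    have Bi: "integrable M B" unfolding B_def d_def using di pint by simp
    have le: "p x * \<bar>d j x\<bar> \<le> B x" if "x \<in> space M" for x
    proof -
      have "0 \<le> (2^j * \<bar>d j x\<bar> - 1)^2" by simp
      also have "\<dots> = 2^j * (2^j * (d j x)^2 - 2 * \<bar>d j x\<bar> + (1/2)^j)"
        by (simp add: power2_diff power_mult_distrib algebra_simps power2_eq_square power_one_over)
      finally have "2^j * 0 \<le> 2^j * (2^j * (d j x)^2 - 2 * \<bar>d j x\<bar> + (1/2)^j)" by simp
      then have "2 * \<bar>d j x\<bar> \<le> 2^j * (d j x)^2 + (1/2)^j"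
        by (subst (asm) mult_le_cancel_left_pos) auto
      then have "\<bar>d j x\<bar> \<le> 2^j * (d j x)^2 + (1/2)^j" using abs_ge_zero[of "d j x"] by linarith
      then have "p x * \<bar>d j x\<bar> \<le> p x * (2^j * (d j x)^2 + (1/2)^j)" using nn[OF that] by (rule mult_left_mono)
      then show ?thesis by (simp add: B_def algebra_simps)
    qed
    show i: "integrable M (\<lambda>x. p x * \<bar>d j x\<bar>)"
    proof (rule Bochner_Integration.integrable_bound[OF Bi])
      show "AE x in M. norm (p x * \<bar>d j x\<bar>) \<le> norm (B x)"
        using le nn by (intro AE_I2) (force intro!: order_trans[OF le abs_ge_self])
    qed simp
    have "(LINT x|M. p x * \<bar>d j x\<bar>) \<le> (LINT x|M. B x)"
      using i Bi le by (intro integral_mono) auto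
    also have "\<dots> = 2^j * (LINT x|M. p x * (d j x)^2) + (1/2)^j * P"
      unfolding B_def P_def using di pint by (simp add: d_def)
    also have "\<dots> \<le> 2^j * (1/4)^j + (1/2)^j * P"
    proof (intro add_right_mono mult_left_mono)
      have Nj: "N j \<le> s (Suc j)" using sN[of j] s_Suc[of j] by simp
      show "(LINT x|M. p x * (d j x)^2) \<le> (1/4)^j" unfolding d_def by (rule less_imp_le[OF N[OF Nj sN[of j]]])
    qed simp
    also have "2^j * (1/4)^j = ((2 * (1/4))^j :: real)" by (rule power_mult_distrib[symmetric])
    also have "2 * (1/4) = (1/2 :: real)" by simp
    finally show "(LINT x|M. p x * \<bar>d j x\<bar>) \<le> (1 + P) * (1/2)^j" by (simp add: algebra_simps)
  qed
  have "(\<integral>\<^sup>+x. (\<Sum>j. ennreal (p x * \<bar>d j x\<bar>)) \<partial>M) = (\<Sum>j. \<integral>\<^sup>+x. ennreal (p x * \<bar>d j x\<bar>) \<partial>M)"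
    by (rule nn_integral_suminf) measurable
  also have "\<dots> = (\<Sum>j. ennreal (LINT x|M. p x * \<bar>d j x\<bar>))"
    by (intro arg_cong[where f=suminf] ext nn_integral_eq_integral dj AE_I2) (use nn in auto)
  also have "\<dots> \<le> (\<Sum>j. ennreal ((1 + P) * (1/2)^j))"
    by (intro suminf_le ennreal_leI dj) auto
  also have "\<dots> = ennreal (\<Sum>j. (1 + P) * (1/2)^j)"
    using P0 by (intro suminf_ennreal2) (auto intro!: summable_mult summable_geometric)
  finally have fin: "(\<integral>\<^sup>+x. (\<Sum>j. ennreal (p x * \<bar>d j x\<bar>)) \<partial>M) \<noteq> \<infinity>"
    by (auto simp: top_unique)
  have "AE x in M. (\<Sum>j. ennreal (p x * \<bar>d j x\<bar>)) \<noteq> \<infinity>"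
    by (rule nn_integral_PInf_AE[OF _ fin]) measurable
  then have conv: "AE x in M. convergent (\<lambda>j. g (s j) x)"
    using AE_space
  proof eventually_elim
    case (elim x)
    have "summable (\<lambda>j. p x * \<bar>d j x\<bar>)"
      using elim nn by (intro summable_suminf_not_top) (auto simp: infinity_ennreal_def)
    then have "summable (\<lambda>j. (1 / p x) * (p x * \<bar>d j x\<bar>))" by (rule summable_mult)
    then have "summable (\<lambda>j. \<bar>d j x\<bar>)" using pos[of x] elim by simp
    then have "summable (\<lambda>j. d j x)" by (rule summable_rabs_cancel)
    then have "convergent (\<lambda>n. \<Sum>j<n. d j x)" by (simp add: summable_iff_convergent)
    moreover have "(\<Sum>j<n. d j x) = g (s n) x - g (s 0) x" for n
      unfolding d_def by (rule sum_lessThan_telescope)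
    ultimately have "convergent (\<lambda>n. (g (s n) x - g (s 0) x) + g (s 0) x)"
      by (intro convergent_add convergent_const) simp
    then show ?case by simp
  qed
  define h where "h x = lim (\<lambda>j. g (s j) x)" for x
  have hm[measurable]: "h \<in> borel_measurable M" unfolding h_def by measurable
  have lim: "AE x in M. (\<lambda>j. g (s j) x) \<longlonglongrightarrow> h x"
    using conv by eventually_elim (simp add: h_def convergent_LIMSEQ_iff)
  \<comment> \<open>Fatou along the fast subsequence with \<open>g n\<close> fixed. It serves twice,
    with c = 1 for integrability and with c = e/2 for convergence.\<close>
  have key: "integrable M (\<lambda>x. p x * (g n x - h x)^2) \<and> (LINT x|M. p x * (g n x - h x)^2) \<le> c"
    if c: "\<forall>\<^sub>F j in sequentially. (LINT x|M. p x * (g n x - g (s j) x)^2) \<le> c" for n c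
  proof -
    have "AE x in M. (\<lambda>j. p x * (g n x - g (s j) x)^2) \<longlonglongrightarrow> p x * (g n x - h x)^2"
      using lim by eventually_elim (intro tendsto_intros)
    from integral_le_of_AE_tendsto[OF _ _ this _ di c] show ?thesis using nn by simp
  qed
  have ki: "integrable M (\<lambda>x. p x * (g n x - h x)^2)" for n
  proof -
    obtain N1 where N1: "\<And>n k. n \<ge> N1 \<Longrightarrow> k \<ge> N1 \<Longrightarrow> (LINT x|M. p x * (g n x - g k x)^2) < 1"
      using cauchy[of 1] by auto
    have "integrable M (\<lambda>x. p x * (g N1 x - h x)^2)"
    proof (rule conjunct1[OF key])
      show "\<forall>\<^sub>F j in sequentially. (LINT x|M. p x * (g N1 x - g (s j) x)^2) \<le> 1"
        unfolding eventually_sequentially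
        by (intro exI[of _ N1] allI impI less_imp_le[OF N1] order_trans[OF _ seq_suble[OF sm]]) auto
    qed
    from weighted_square_expand(1)[OF _ _ _ nn di[of n N1] this, of 1]
    show ?thesis by simp
  qed
  show ?thesis
  proof (rule that[OF hm])
    show "integrable M (\<lambda>x. p x * (g n x - h x)^2)" for n by (rule ki)
    show "integrable M (\<lambda>x. p x * (h x)^2)"
      using weighted_square_expand(1)[OF _ _ _ nn gi[of 0] ki[of 0], of "-1"] by simp
    show "(\<lambda>n. LINT x|M. p x * (g n x - h x)^2) \<longlonglongrightarrow> 0"
    proof (rule LIMSEQ_I)
      fix e :: real assume "e > 0"
      then obtain N1 where N1: "\<And>n k. n \<ge> N1 \<Longrightarrow> k \<ge> N1 \<Longrightarrow> (LINT x|M. p x * (g n x - g k x)^2) < e/2"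
        using cauchy[of "e/2"] by auto
      have "(LINT x|M. p x * (g n x - h x)^2) \<le> e/2" if "n \<ge> N1" for n
      proof (rule conjunct2[OF key])
        show "\<forall>\<^sub>F j in sequentially. (LINT x|M. p x * (g n x - g (s j) x)^2) \<le> e/2"
          unfolding eventually_sequentially
          by (intro exI[of _ N1] allI impI less_imp_le[OF N1] order_trans[OF _ seq_suble[OF sm]] that) auto
      qed
      then have le: "(LINT x|M. p x * (g n x - h x)^2) < e" if "n \<ge> N1" for n
        using that \<open>e > 0\<close> by fastforce
      have "0 \<le> (LINT x|M. p x * (g n x - h x)^2)" for n
        using nn by (intro integral_nonneg_AE AE_I2) auto
      then show "\<exists>no. \<forall>n\<ge>no. norm ((LINT x|M. p x * (g n x - h x)^2) - 0) < e"
        using le by (intro exI[of _ N1]) auto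
    qed
  qed
qed

section \<open>Symmetric bilinear forms on a space of functions\<close>

text \<open>Bilinearity is asked on \<open>H\<close> only: the integrals defining the forms are
  additive just where the integrands are integrable, and \<open>wgrad\<close> is meaningful only for
  weakly differentiable functions. Elements are functions, so no quotient by null sets is
  formed.\<close>

locale sym_form =
  fixes H :: "('a \<Rightarrow> real) set" and b :: "('a \<Rightarrow> real) \<Rightarrow> ('a \<Rightarrow> real) \<Rightarrow> real"
  assumes add_mem: "u \<in> H \<Longrightarrow> v \<in> H \<Longrightarrow> (\<lambda>x. u x + v x) \<in> H"
    and scale_mem: "u \<in> H \<Longrightarrow> (\<lambda>x. c * u x) \<in> H"
    and add_left: "u \<in> H \<Longrightarrow> v \<in> H \<Longrightarrow> w \<in> H \<Longrightarrow> b (\<lambda>x. u x + v x) w = b u w + b v w"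
    and scale_left: "u \<in> H \<Longrightarrow> w \<in> H \<Longrightarrow> b (\<lambda>x. c * u x) w = c * b u w"
    and sym: "u \<in> H \<Longrightarrow> v \<in> H \<Longrightarrow> b u v = b v u"
begin

lemma add_right: "u \<in> H \<Longrightarrow> v \<in> H \<Longrightarrow> w \<in> H \<Longrightarrow> b w (\<lambda>x. u x + v x) = b w u + b w v"
  using sym[of w "\<lambda>x. u x + v x"] sym[of w u] sym[of w v] add_left[of u v w] add_mem[of u v] by simp

lemma scale_right: "u \<in> H \<Longrightarrow> w \<in> H \<Longrightarrow> b w (\<lambda>x. c * u x) = c * b w u"
  using sym[of w "\<lambda>x. c * u x"] sym[of w u] scale_left[of u w] scale_mem[of u] by simp

lemma diff_mem: "u \<in> H \<Longrightarrow> v \<in> H \<Longrightarrow> (\<lambda>x. u x - v x) \<in> H"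
  using add_mem[of u "\<lambda>x. -1 * v x"] scale_mem[of v "-1"] by simp

lemma diff_left: "u \<in> H \<Longrightarrow> v \<in> H \<Longrightarrow> w \<in> H \<Longrightarrow> b (\<lambda>x. u x - v x) w = b u w - b v w"
  using add_left[of u "\<lambda>x. -1 * v x" w] scale_mem[of v "-1"] scale_left[of v w "-1"] by simp

lemma lin_mem: "u \<in> H \<Longrightarrow> v \<in> H \<Longrightarrow> (\<lambda>x. u x + t * v x) \<in> H"
  by (intro add_mem scale_mem)

lemma lin_left: "u \<in> H \<Longrightarrow> v \<in> H \<Longrightarrow> w \<in> H \<Longrightarrow> b (\<lambda>x. u x + t * v x) w = b u w + t * b v w"
  by (simp add: add_left scale_left scale_mem)

lemma lin_square:
  "u \<in> H \<Longrightarrow> v \<in> H \<Longrightarrow> b (\<lambda>x. u x + t * v x) (\<lambda>x. u x + t * v x) = b u u + 2 * b u v * t + b v v * t\<^sup>2"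
  using sym[of v u] by (simp add: add_left scale_left add_right scale_right scale_mem add_mem power2_eq_square algebra_simps)

lemma sum_mem: "finite I \<Longrightarrow> I \<noteq> {} \<Longrightarrow> (\<And>i. i \<in> I \<Longrightarrow> f i \<in> H) \<Longrightarrow> (\<lambda>x. \<Sum>i\<in>I. d i * f i x) \<in> H"
proof (induction I rule: finite_ne_induct)
  case (insert i I)
  have "(\<lambda>x. \<Sum>i\<in>I. d i * f i x) \<in> H" "f i \<in> H" using insert by auto
  then show ?case using insert add_mem[OF scale_mem[of "f i" "d i"]] by simp
qed (simp add: scale_mem)

lemma sum_left:
  "finite I \<Longrightarrow> I \<noteq> {} \<Longrightarrow> (\<And>i. i \<in> I \<Longrightarrow> f i \<in> H) \<Longrightarrow> w \<in> H \<Longrightarrow> b (\<lambda>x. \<Sum>i\<in>I. d i * f i x) w = (\<Sum>i\<in>I. d i * b (f i) w)"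
proof (induction I rule: finite_ne_induct)
  case (insert i I)
  have "(\<lambda>x. \<Sum>i\<in>I. d i * f i x) \<in> H" using insert by (intro sum_mem) auto
  then show ?case using insert by (simp add: add_left scale_left scale_mem)
qed (simp add: scale_left)

lemma linear_combination: "sym_form H (\<lambda>u v. c * b u v)"
  by unfold_locales (auto simp: add_mem scale_mem add_left scale_left sym algebra_simps)

lemma Cauchy_Schwarz:
  assumes "\<And>w. w \<in> H \<Longrightarrow> 0 \<le> b w w" "u \<in> H" "v \<in> H"
  shows "(b u v)^2 \<le> b u u * b v v"
proof (rule quadratic_nonneg_imp)
  fix t
  show "0 \<le> b u u + 2 * b u v * t + b v v * t\<^sup>2"
    using assms(1)[OF lin_mem[OF assms(2,3), of t]] lin_square[OF assms(2,3)] by simp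
qed (use assms in simp)

text \<open>A semidefinite form is continuous for its own seminorm: the pairing by Cauchy-Schwarz,
  the square by expanding around the limit.\<close>

lemma tendsto_form:
  assumes nn: "\<And>w. w \<in> H \<Longrightarrow> 0 \<le> b w w" and w: "\<And>n::nat. w n \<in> H" "u \<in> H"
    and lim: "(\<lambda>n. b (\<lambda>x. w n x - u x) (\<lambda>x. w n x - u x)) \<longlonglongrightarrow> 0"
  shows "v \<in> H \<Longrightarrow> (\<lambda>n. b (w n) v) \<longlonglongrightarrow> b u v" "(\<lambda>n. b (w n) (w n)) \<longlonglongrightarrow> b u u"
proof -
  have d: "(\<lambda>x. w n x - u x) \<in> H" for n by (intro diff_mem w)
  have 1: "(\<lambda>n. b (\<lambda>x. w n x - u x) v) \<longlonglongrightarrow> 0" if v: "v \<in> H" for v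
  proof -
    have "(\<lambda>n. sqrt (b (\<lambda>x. w n x - u x) (\<lambda>x. w n x - u x) * b v v)) \<longlonglongrightarrow> sqrt (0 * b v v)"
      by (intro tendsto_intros lim)
    then have "(\<lambda>n. sqrt (b (\<lambda>x. w n x - u x) (\<lambda>x. w n x - u x) * b v v)) \<longlonglongrightarrow> 0" by simp
    then show ?thesis
    proof (rule Lim_null_comparison[rotated])
      show "\<forall>\<^sub>F n in sequentially. norm (b (\<lambda>x. w n x - u x) v) \<le> sqrt (b (\<lambda>x. w n x - u x) (\<lambda>x. w n x - u x) * b v v)"
        using Cauchy_Schwarz[OF nn d v] by (intro always_eventually allI) (metis real_norm_def real_sqrt_abs real_sqrt_le_mono)
    qed
  qed
  have 2: "(\<lambda>n. b (w n) v) \<longlonglongrightarrow> b u v" if v: "v \<in> H" for v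
    using tendsto_add[OF 1[OF v] tendsto_const[of "b u v"]] by (simp add: diff_left w v)
  then show "v \<in> H \<Longrightarrow> (\<lambda>n. b (w n) v) \<longlonglongrightarrow> b u v" .
  have "b (w n) (w n) = b (\<lambda>x. w n x - u x) (\<lambda>x. w n x - u x) + 2 * b (w n) u - b u u" for n
    using lin_square[of "w n" u "-1"] w by simp
  moreover have "(\<lambda>n. b (\<lambda>x. w n x - u x) (\<lambda>x. w n x - u x) + 2 * b (w n) u - b u u) \<longlonglongrightarrow> 0 + 2 * b u u - b u u"
    by (intro tendsto_intros lim 2 w)
  ultimately show "(\<lambda>n. b (w n) (w n)) \<longlonglongrightarrow> b u u" by simp
qed

end

lemma sym_form_add: "sym_form H b \<Longrightarrow> sym_form H c \<Longrightarrow> sym_form H (\<lambda>u v. b u v + c u v)"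
  unfolding sym_form_def by (simp add: algebra_simps)

section \<open>The forms of the radial problem\<close>

abbreviation wd :: "(real \<Rightarrow> real) \<Rightarrow> real \<Rightarrow> real" where "wd v \<equiv> wgrad {0<..<1} v"

definition energy :: "real \<Rightarrow> (real \<Rightarrow> real) \<Rightarrow> (real \<Rightarrow> real) \<Rightarrow> real" where
  "energy M u w = (LINT r|leb01. r powr (M - 1) * wd u r * wd w r)"

abbreviation energy_sq :: "real \<Rightarrow> (real \<Rightarrow> real) \<Rightarrow> real" where "energy_sq M u \<equiv> energy M u u"

abbreviation ip_sq :: "real \<Rightarrow> (real \<Rightarrow> real) \<Rightarrow> real" where "ip_sq M u \<equiv> ip_M M u u"

definition potential :: "real \<Rightarrow> (real \<Rightarrow> real) \<Rightarrow> (real \<Rightarrow> real) \<Rightarrow> (real \<Rightarrow> real) \<Rightarrow> real" where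
  "potential M a u w = (LINT r|leb01. r powr (M - 1) * a r * u r * w r)"

text \<open>The exponents M-1 and M-3 differ by a shift of M by 2, so one L2 theory covers both
  norms.\<close>

lemma calL_M_eq: "calL_M M = L2_M (M - 2)"
proof -
  have "M - 2 - 1 = M - 3" by simp
  then show ?thesis unfolding calL_M_def L2_M_def by simp
qed

lemma L2_M_D: "u \<in> L2_M M \<Longrightarrow> u \<in> borel_measurable leb01" "u \<in> L2_M M \<Longrightarrow> integrable leb01 (\<lambda>r. r powr (M - 1) * (u r)^2)"
  by (auto simp: L2_M_def)

lemma L2_M_mult_integrable:
  "u \<in> L2_M M \<Longrightarrow> w \<in> L2_M M \<Longrightarrow> integrable leb01 (\<lambda>r. r powr (M - 1) * u r * w r)"
  by (intro integrable_weighted_mult L2_M_D borel_measurable_powr_01) auto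

lemma L2_M_lin:
  assumes "u \<in> L2_M M" "w \<in> L2_M M" shows "(\<lambda>r. u r + t * w r) \<in> L2_M M"
proof -
  have "integrable leb01 (\<lambda>r. r powr (M - 1) * (u r + t * w r)^2)"
    by (rule weighted_square_expand(1)[OF borel_measurable_powr_01 L2_M_D(1)[OF assms(1)] L2_M_D(1)[OF assms(2)] _ L2_M_D(2)[OF assms(1)] L2_M_D(2)[OF assms(2)]]) auto
  then show ?thesis using L2_M_D(1)[OF assms(1)] L2_M_D(1)[OF assms(2)] by (simp add: L2_M_def)
qed

lemma L2_M_zero: "(\<lambda>r. 0) \<in> L2_M M" by (simp add: L2_M_def)

lemma L2_M_add: "u \<in> L2_M M \<Longrightarrow> w \<in> L2_M M \<Longrightarrow> (\<lambda>r. u r + w r) \<in> L2_M M"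
  using L2_M_lin[of u M w 1] by simp

lemma L2_M_mono:
  assumes "u \<in> L2_M M" "M \<le> M'" shows "u \<in> L2_M M'"
proof -
  have "integrable leb01 (\<lambda>r. r powr (M' - 1) * (u r)^2)"
  proof (rule Bochner_Integration.integrable_bound[OF L2_M_D(2)[OF assms(1)]])
    show "(\<lambda>r. r powr (M' - 1) * (u r)^2) \<in> borel_measurable leb01"
      using L2_M_D(1)[OF assms(1)] by measurable
    show "AE r in leb01. norm (r powr (M' - 1) * (u r)^2) \<le> norm (r powr (M - 1) * (u r)^2)"
      using assms(2) by (intro AE_I2) (auto simp: space_restrict_space intro!: mult_right_mono powr_mono')
  qed
  then show ?thesis using L2_M_D(1)[OF assms(1)] by (simp add: L2_M_def)
qed

lemma calH_0M_lin:
  assumes u: "u \<in> calH_0M M" and v: "v \<in> calH_0M M"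
  shows "(\<lambda>r. u r + t * v r) \<in> calH_0M M" "AE r in leb01. wd (\<lambda>r. u r + t * v r) r = wd u r + t * wd v r"
proof -
  have 1: "acd (\<lambda>r. u r + t * v r) (\<lambda>r. wd u r + t * wd v r)"
    by (intro acd_add acd_cmult calH_0M_acd(1)[OF u] calH_0M_acd(1)[OF v])
  have 2: "u 1 + t * v 1 = 0" using calH_0M_acd(3)[OF u] calH_0M_acd(3)[OF v] by simp
  have 3: "(\<lambda>r. wd u r + t * wd v r) \<in> L2_M M" by (intro L2_M_lin calH_0M_acd(2)[OF u] calH_0M_acd(2)[OF v])
  have 4: "(\<lambda>r. u r + t * v r) \<in> calL_M M"
    unfolding calL_M_eq by (intro L2_M_lin calH_0M_acd(4)[OF u, unfolded calL_M_eq] calH_0M_acd(4)[OF v, unfolded calL_M_eq])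
  show "(\<lambda>r. u r + t * v r) \<in> calH_0M M" "AE r in leb01. wd (\<lambda>r. u r + t * v r) r = wd u r + t * wd v r"
    by (rule calH_0M_I[OF 1 2 3 4])+
qed

lemma calH_0M_zero: "(\<lambda>r. 0) \<in> calH_0M M" "AE r in leb01. wd (\<lambda>r. 0) r = 0"
proof -
  have "acd (\<lambda>r. 0) (\<lambda>r. 0)" by (rule acd_C1) auto
  from calH_0M_I[OF this refl L2_M_zero] L2_M_zero
  show "(\<lambda>r. 0) \<in> calH_0M M" "AE r in leb01. wd (\<lambda>r. 0) r = 0" unfolding calL_M_eq by blast+
qed

lemma calH_0M_add:
  assumes u: "u \<in> calH_0M M" and v: "v \<in> calH_0M M"
  shows "(\<lambda>r. u r + v r) \<in> calH_0M M" "AE r in leb01. wd (\<lambda>r. u r + v r) r = wd u r + wd v r"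
  using calH_0M_lin[OF assms, of 1] by simp_all

lemma calH_0M_scale:
  assumes u: "u \<in> calH_0M M"
  shows "(\<lambda>r. c * u r) \<in> calH_0M M" "AE r in leb01. wd (\<lambda>r. c * u r) r = c * wd u r"
proof -
  have *: "(\<lambda>r. c * u r) \<in> calH_0M M \<and> (AE r in leb01. wd (\<lambda>r. c * u r) r = wd (\<lambda>r. 0) r + c * wd u r)"
    using calH_0M_lin[OF calH_0M_zero(1) u, of c] by simp
  then show "(\<lambda>r. c * u r) \<in> calH_0M M" by blast
  from * have "AE r in leb01. wd (\<lambda>r. c * u r) r = wd (\<lambda>r. 0) r + c * wd u r" by blast
  with calH_0M_zero(2) show "AE r in leb01. wd (\<lambda>r. c * u r) r = c * wd u r" by eventually_elim simp
qed

lemma calH_0M_integrable: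
  assumes u: "u \<in> calH_0M M" and w: "w \<in> calH_0M M"
  shows "integrable leb01 (\<lambda>r. r powr (M - 1) * wd u r * wd w r)"
    "integrable leb01 (\<lambda>r. r powr (M - 3) * u r * w r)"
    "integrable leb01 (\<lambda>r. r powr (M - 1) * u r * w r)"
    "a \<in> Linfty {0<..<1} \<Longrightarrow> integrable leb01 (\<lambda>r. r powr (M - 1) * a r * u r * w r)"
proof -
  show "integrable leb01 (\<lambda>r. r powr (M - 1) * wd u r * wd w r)"
    by (intro L2_M_mult_integrable calH_0M_acd assms)
  have L: "u \<in> L2_M (M - 2)" "w \<in> L2_M (M - 2)" using calH_0M_acd(4)[OF u] calH_0M_acd(4)[OF w] by (simp_all add: calL_M_eq)
  then show "integrable leb01 (\<lambda>r. r powr (M - 3) * u r * w r)"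
    using L2_M_mult_integrable[OF L] by (simp add: algebra_simps)
  have L': "u \<in> L2_M M" "w \<in> L2_M M" using L2_M_mono[OF L(1)] L2_M_mono[OF L(2)] by simp_all
  then show i: "integrable leb01 (\<lambda>r. r powr (M - 1) * u r * w r)" by (rule L2_M_mult_integrable)
  assume a: "a \<in> Linfty {0<..<1}"
  then obtain C where am: "a \<in> borel_measurable leb01" and C: "AE r in leb01. \<bar>a r\<bar> \<le> C" by (auto simp: Linfty_def)
  show "integrable leb01 (\<lambda>r. r powr (M - 1) * a r * u r * w r)"
  proof (rule Bochner_Integration.integrable_bound)
    show "integrable leb01 (\<lambda>r. C * (r powr (M - 1) * u r * w r))" using i by simp
    show "(\<lambda>r. r powr (M - 1) * a r * u r * w r) \<in> borel_measurable leb01"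
      using am L2_M_D(1)[OF L'(1)] L2_M_D(1)[OF L'(2)] by measurable
    show "AE r in leb01. norm (r powr (M - 1) * a r * u r * w r) \<le> norm (C * (r powr (M - 1) * u r * w r))"
      using C
    proof eventually_elim
      case (elim r)
      have "norm (r powr (M - 1) * a r * u r * w r) = \<bar>a r\<bar> * \<bar>r powr (M - 1) * u r * w r\<bar>"
        by (simp add: abs_mult)
      also have "\<dots> \<le> \<bar>C\<bar> * \<bar>r powr (M - 1) * u r * w r\<bar>"
        using elim by (intro mult_right_mono) auto
      finally show ?case by (simp add: abs_mult)
    qed
  qed
qed

lemma calH_0M_measurable:
  assumes "u \<in> calH_0M M" shows "u \<in> borel_measurable leb01" "wd u \<in> borel_measurable leb01"
  using calH_0M_acd[OF assms] by (auto simp: calL_M_def L2_M_def)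

lemma sym_form_ip: "sym_form (calH_0M M) (ip_M M)"
proof
  fix u v w :: "real \<Rightarrow> real" and c :: real assume H: "u \<in> calH_0M M" "v \<in> calH_0M M"
  show "(\<lambda>x. u x + v x) \<in> calH_0M M" "(\<lambda>x. c * u x) \<in> calH_0M M"
    using H calH_0M_add calH_0M_scale by blast+
  show "ip_M M u v = ip_M M v u" unfolding ip_M_def by (simp add: mult.commute mult.left_commute)
  show "ip_M M (\<lambda>x. c * u x) v = c * ip_M M u v" if "v \<in> calH_0M M" for v
    unfolding ip_M_def by (subst integral_mult_right_zero[symmetric]) (simp add: algebra_simps)
  assume w: "w \<in> calH_0M M"
  show "ip_M M (\<lambda>x. u x + v x) w = ip_M M u w + ip_M M v w"
    unfolding ip_M_def distrib_left distrib_right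
    using calH_0M_integrable(2)[OF H(1) w] calH_0M_integrable(2)[OF H(2) w] by simp
qed

lemma sym_form_energy: "sym_form (calH_0M M) (energy M)"
proof
  fix u v w :: "real \<Rightarrow> real" and c :: real assume H: "u \<in> calH_0M M" "v \<in> calH_0M M"
  show "energy M u v = energy M v u" unfolding energy_def by (simp add: mult.commute mult.left_commute)
  show "energy M (\<lambda>x. c * u x) v = c * energy M u v"
  proof -
    have "energy M (\<lambda>x. c * u x) v = (LINT r|leb01. c * (r powr (M - 1) * wd u r * wd v r))"
      unfolding energy_def
      by (rule integral_cong_AE) (use calH_0M_measurable[OF H(1)] calH_0M_measurable[OF H(2)]
        calH_0M_measurable[OF calH_0M_scale(1)[OF H(1), of c]] calH_0M_scale(2)[OF H(1), of c] in \<open>auto elim!: eventually_mono\<close>)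
    then show ?thesis unfolding energy_def by simp
  qed
  assume w: "w \<in> calH_0M M"
  have "energy M (\<lambda>x. u x + v x) w = (LINT r|leb01. r powr (M - 1) * wd u r * wd w r + r powr (M - 1) * wd v r * wd w r)"
    unfolding energy_def
    by (rule integral_cong_AE) (use calH_0M_measurable[OF H(1)] calH_0M_measurable[OF H(2)] calH_0M_measurable[OF w]
        calH_0M_measurable[OF calH_0M_add(1)[OF H]] calH_0M_add(2)[OF H] in \<open>auto elim!: eventually_mono simp: algebra_simps\<close>)
  then show "energy M (\<lambda>x. u x + v x) w = energy M u w + energy M v w"
    unfolding energy_def
    using calH_0M_integrable(1)[OF H(1) w] calH_0M_integrable(1)[OF H(2) w] by simp
qed (use calH_0M_add calH_0M_scale in blast)+

lemma sym_form_potential: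
  assumes a: "a \<in> Linfty {0<..<1}" shows "sym_form (calH_0M M) (potential M a)"
proof
  fix u v w :: "real \<Rightarrow> real" and c :: real assume H: "u \<in> calH_0M M" "v \<in> calH_0M M"
  show "potential M a u v = potential M a v u" unfolding potential_def by (simp add: mult.commute mult.left_commute)
  show "potential M a (\<lambda>x. c * u x) v = c * potential M a u v"
    unfolding potential_def by (subst integral_mult_right_zero[symmetric]) (simp add: algebra_simps)
  assume w: "w \<in> calH_0M M"
  show "potential M a (\<lambda>x. u x + v x) w = potential M a u w + potential M a v w"
    unfolding potential_def distrib_left distrib_right
    using calH_0M_integrable(4)[OF H(1) w a] calH_0M_integrable(4)[OF H(2) w a] by simp
qed (use calH_0M_add calH_0M_scale in blast)+

lemma form_M_eq:
  assumes a: "a \<in> Linfty {0<..<1}" and u: "u \<in> calH_0M M" and w: "w \<in> calH_0M M"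
  shows "form_M M a u w = energy M u w - potential M a u w"
proof -
  have "form_M M a u w = (LINT r|leb01. r powr (M - 1) * wd u r * wd w r - r powr (M - 1) * a r * u r * w r)"
    unfolding form_M_def by (simp add: algebra_simps)
  then show ?thesis
    unfolding energy_def potential_def
    using calH_0M_integrable(1)[OF u w] calH_0M_integrable(4)[OF u w a] by simp
qed

lemma sym_form_form_M:
  assumes a: "a \<in> Linfty {0<..<1}" shows "sym_form (calH_0M M) (form_M M a)"
proof -
  interpret P: sym_form "calH_0M M" "potential M a" by (rule sym_form_potential[OF a])
  interpret N: sym_form "calH_0M M" "\<lambda>u v. energy M u v + (-1) * potential M a u v"
    by (intro sym_form_add sym_form_energy P.linear_combination)
  show ?thesis
  proof
    fix u v w :: "real \<Rightarrow> real" and c :: real assume H: "u \<in> calH_0M M" "v \<in> calH_0M M"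
    show "form_M M a u v = form_M M a v u"
      using N.sym[OF H] by (simp add: form_M_eq[OF a] H)
    show "form_M M a (\<lambda>x. c * u x) v = c * form_M M a u v"
      using N.scale_left[OF H, of c] by (simp add: form_M_eq[OF a] H N.scale_mem algebra_simps)
    assume w: "w \<in> calH_0M M"
    show "form_M M a (\<lambda>x. u x + v x) w = form_M M a u w + form_M M a v w"
      using N.add_left[OF H w] by (simp add: form_M_eq[OF a] H w N.add_mem algebra_simps)
  qed (rule N.add_mem N.scale_mem, assumption+)+
qed

lemma energy_nonneg: "0 \<le> energy M u u"
  unfolding energy_def by (intro integral_nonneg_AE AE_I2) (simp add: mult.assoc)

lemma ip_M_nonneg: "0 \<le> ip_M M u u"
  unfolding ip_M_def by (intro integral_nonneg_AE AE_I2) (simp add: mult.assoc)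

lemma ip_M_square: "ip_M M u u = (LINT r|leb01. r powr (M - 3) * (u r)^2)"
  unfolding ip_M_def by (simp add: power2_eq_square mult.assoc)

lemma energy_square: "energy M u u = (LINT r|leb01. r powr (M - 1) * (wd u r)^2)"
  unfolding energy_def by (simp add: power2_eq_square mult.assoc)

lemma ip_M_pos:
  assumes "u \<in> nonzero_on {0<..<1} (calH_0M M)" shows "0 < ip_M M u u"
proof -
  have u: "u \<in> calH_0M M" "\<not> (AE x in leb01. u x = 0)" using assms by (auto simp: nonzero_on_def)
  have "ip_M M u u \<noteq> 0"
  proof
    assume "ip_M M u u = 0"
    then have "AE r in leb01. r powr (M - 3) * u r * u r = 0"
      using integral_nonneg_eq_0_iff_AE[OF calH_0M_integrable(2)[OF u(1) u(1)]] by (simp add: ip_M_def mult.assoc)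
    then have "AE r in leb01. u r = 0" using AE_space by eventually_elim (auto simp: space_restrict_space)
    with u show False by simp
  qed
  with ip_M_nonneg[of M u] show ?thesis by simp
qed

lemma calH_0M_eqI:
  assumes u: "u \<in> calH_0M M" and v: "v \<in> calH_0M M" and AE: "AE x in leb01. u x = v x" and x: "x \<in> {0<..1}"
  shows "u x = v x"
  by (rule continuous_AE_eq_01'[OF acd_continuous[OF calH_0M_acd(1)[OF u]] acd_continuous[OF calH_0M_acd(1)[OF v]] AE x])

lemma calH_0M_cong:
  assumes u: "u \<in> calH_0M M" and v: "v \<in> calH_0M M" and AE: "AE x in leb01. u x = v x"
  shows "AE x in leb01. wd u x = wd v x"
proof -
  have "acd u (wd v)"
    using acd_cong[of u v] calH_0M_eqI[OF assms] calH_0M_acd(1)[OF v] by blast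
  from calH_0M_I(2)[OF this calH_0M_acd(3)[OF u] calH_0M_acd(2)[OF v] calH_0M_acd(4)[OF u]] show ?thesis .
qed

lemma form_M_cong:
  assumes u: "u \<in> calH_0M M" and v: "v \<in> calH_0M M" and AE: "AE x in leb01. u x = v x" and w: "w \<in> calH_0M M"
    and a: "a \<in> Linfty {0<..<1}"
  shows "form_M M a u w = form_M M a v w" "ip_M M u w = ip_M M v w"
proof -
  note [measurable] = calH_0M_measurable[OF u] calH_0M_measurable[OF v] calH_0M_measurable[OF w]
  have [measurable]: "a \<in> borel_measurable leb01" using a by (simp add: Linfty_def)
  show "form_M M a u w = form_M M a v w"
    unfolding form_M_def
  proof (rule integral_cong_AE)
    show "AE r in leb01. r powr (M - 1) * (wd u r * wd w r - a r * u r * w r) = r powr (M - 1) * (wd v r * wd w r - a r * v r * w r)"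
      using AE calH_0M_cong[OF u v AE] by eventually_elim simp
  qed measurable
  show "ip_M M u w = ip_M M v w"
    unfolding ip_M_def
  proof (rule integral_cong_AE)
    show "AE r in leb01. r powr (M - 3) * u r * w r = r powr (M - 3) * v r * w r"
      using AE by eventually_elim simp
  qed measurable
qed

lemma form_M_null:
  assumes u: "u \<in> calH_0M M" "u \<notin> nonzero_on {0<..<1} (calH_0M M)" and w: "w \<in> calH_0M M" and a: "a \<in> Linfty {0<..<1}"
  shows "form_M M a u w = 0" "ip_M M u w = 0"
proof -
  have AE: "AE x in leb01. u x = 0" using u by (auto simp: nonzero_on_def)
  interpret F: sym_form "calH_0M M" "form_M M a" by (rule sym_form_form_M[OF a])
  interpret I: sym_form "calH_0M M" "ip_M M" by (rule sym_form_ip)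
  show "form_M M a u w = 0" "ip_M M u w = 0"
    using form_M_cong[OF u(1) calH_0M_zero(1) AE w a] F.scale_left[OF u(1) w, of 0] I.scale_left[OF u(1) w, of 0] by simp_all
qed

lemma Linfty_bound:
  assumes "a \<in> Linfty {0<..<1}"
  obtains C where "C \<ge> 0" "AE r in leb01. \<bar>a r\<bar> \<le> C"
proof -
  obtain C where "AE r in leb01. \<bar>a r\<bar> \<le> C" using assms by (auto simp: Linfty_def)
  then have "AE r in leb01. \<bar>a r\<bar> \<le> max C 0" by eventually_elim simp
  then show ?thesis using that[of "max C 0"] by simp
qed

text \<open>The first bound keeps the weight r^(M-1), for which sequences of bounded energy are
  precompact; the second trades it for the larger norm of \<open>ip_M\<close>.\<close>

lemma potential_bound:
  assumes a: "a \<in> Linfty {0<..<1}" and C: "AE r in leb01. \<bar>a r\<bar> \<le> C" "C \<ge> 0" and u: "u \<in> calH_0M M"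
  shows "\<bar>potential M a u u\<bar> \<le> C * (LINT r|leb01. r powr (M - 1) * (u r)^2)"
    "\<bar>potential M a u u\<bar> \<le> C * ip_M M u u"
proof -
  have iu: "integrable leb01 (\<lambda>r. r powr (M - 1) * (u r)^2)"
    using calH_0M_integrable(3)[OF u u] by (simp add: power2_eq_square mult.assoc)
  have iu3: "integrable leb01 (\<lambda>r. r powr (M - 3) * (u r)^2)"
    using calH_0M_integrable(2)[OF u u] by (simp add: power2_eq_square mult.assoc)
  have "\<bar>potential M a u u\<bar> \<le> (LINT r|leb01. \<bar>r powr (M - 1) * a r * u r * u r\<bar>)"
    unfolding potential_def by (rule integral_abs_bound)
  also have "\<dots> \<le> (LINT r|leb01. C * (r powr (M - 1) * (u r)^2))"
  proof (rule integral_mono_AE)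
    show "integrable leb01 (\<lambda>r. \<bar>r powr (M - 1) * a r * u r * u r\<bar>)" using calH_0M_integrable(4)[OF u u a] by simp
    show "AE r in leb01. \<bar>r powr (M - 1) * a r * u r * u r\<bar> \<le> C * (r powr (M - 1) * (u r)^2)"
      using C(1)
    proof eventually_elim
      case (elim r)
      have "\<bar>r powr (M - 1) * a r * u r * u r\<bar> = \<bar>a r\<bar> * (r powr (M - 1) * (u r)^2)"
        by (simp add: abs_mult power2_eq_square)
      also have "\<dots> \<le> C * (r powr (M - 1) * (u r)^2)" using elim by (intro mult_right_mono) auto
      finally show ?case .
    qed
  qed (use iu in simp)
  finally show 1: "\<bar>potential M a u u\<bar> \<le> C * (LINT r|leb01. r powr (M - 1) * (u r)^2)" by simp
  have "(LINT r|leb01. r powr (M - 1) * (u r)^2) \<le> (LINT r|leb01. r powr (M - 3) * (u r)^2)"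
    using iu iu3 by (intro integral_mono) (auto simp: space_restrict_space intro!: mult_right_mono powr_mono')
  then show "\<bar>potential M a u u\<bar> \<le> C * ip_M M u u"
    using 1 C(2) unfolding ip_M_square by (meson mult_left_mono order_trans)
qed

section \<open>Hardy inequality and compactness\<close>

lemma LINT_interval:
  assumes "0 \<le> x" "x \<le> y" "y \<le> 1" and g: "g absolutely_integrable_on {x..y}"
  shows "integrable leb01 (\<lambda>r. indicator {x<..<y} r * g r)"
    "(LINT r|leb01. indicator {x<..<y} r * g r) = integral {x..y} (g :: real \<Rightarrow> real)"
proof -
  have sub: "{x<..<y} \<subseteq> {0<..<1}" using assms by auto
  have "g absolutely_integrable_on {x<..<y}" using g by (simp only: absolutely_integrable_on_Icc_iff_Ioo)
  then have gi: "integrable (lebesgue_on {x<..<y}) g" by (rule iffD1[OF abs_integrable_iff, rotated]) simp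
  have cong: "integrable (lebesgue_on {x<..<y}) (\<lambda>r. indicator {x<..<y} r * g r) = integrable (lebesgue_on {x<..<y}) g"
    by (rule Bochner_Integration.integrable_cong[OF refl]) simp
  have s1: "integrable leb01 (\<lambda>r. indicator {x<..<y} r * g r) = integrable (lebesgue_on {x<..<y}) (\<lambda>r. indicator {x<..<y} r * g r)"
    by (rule LINT_lebesgue_on_support(2)) (use sub in auto)
  show "integrable leb01 (\<lambda>r. indicator {x<..<y} r * g r)" unfolding s1 cong by (rule gi)
  have "(LINT r|leb01. indicator {x<..<y} r * g r) = (LINT r|lebesgue_on {x<..<y}. indicator {x<..<y} r * g r)"
    by (rule LINT_lebesgue_on_support(1)) (use sub in auto)
  also have "\<dots> = (LINT r|lebesgue_on {x<..<y}. g r)"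
    by (rule Bochner_Integration.integral_cong[OF refl]) simp
  also have "\<dots> = integral {x<..<y} g" by (rule lebesgue_integral_eq_integral[OF gi]) simp
  also have "\<dots> = integral {x..y} g" by (rule integral_open_interval_real[symmetric])
  finally show "(LINT r|leb01. indicator {x<..<y} r * g r) = integral {x..y} g" .
qed

lemma integrable_01_abs: "integrable leb01 f \<Longrightarrow> f absolutely_integrable_on {0..1::real}" for f :: "real \<Rightarrow> real"
  by (simp only: absolutely_integrable_on_Icc_iff_Ioo abs_integrable_iff) (simp add: abs_integrable_iff)

text \<open>Integration by parts reaches only down to d > 0; this is the passage d -> 0, by
  continuity of the indefinite integral.\<close>

lemma LINT_nonneg_of_tails:
  fixes f :: "real \<Rightarrow> real"
  assumes f: "integrable leb01 f" and tail: "\<And>d. 0 < d \<Longrightarrow> d < 1 \<Longrightarrow> 0 \<le> integral {d..1} f"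
  shows "0 \<le> (LINT r|leb01. f r)"
proof -
  have ai: "f absolutely_integrable_on {0..1}" by (rule integrable_01_abs[OF f])
  then have fi: "f integrable_on {0..1}" using set_lebesgue_integral_eq_integral(1) by blast
  have "(LINT r|leb01. f r) = integral {0<..<1} f" using f by (intro lebesgue_integral_eq_integral) auto
  then have L: "(LINT r|leb01. f r) = integral {0..1} f" by (simp add: integral_open_interval_real)
  have "continuous_on {0..1} (\<lambda>x. integral {x..1} f)" by (rule indefinite_integral_continuous_1'[OF fi])
  then have lim: "((\<lambda>x. integral {x..1} f) \<longlongrightarrow> integral {0..1} f) (at_right 0)"
    using continuous_on_Icc_at_rightD by fastforce
  have "0 \<le> integral {0..1} f"
  proof (rule tendsto_lowerbound[OF lim])
    show "\<forall>\<^sub>F x in at_right 0. 0 \<le> integral {x..1} f"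
      unfolding eventually_at_right_field by (intro exI[of _ 1]) (auto intro: tail)
  qed simp
  then show ?thesis by (simp add: L)
qed

lemma acd_powr: "acd (\<lambda>r. r powr s) (\<lambda>r. s * r powr (s - 1))"
proof (rule acd_C1)
  fix x :: real assume "0 < x"
  then show "((\<lambda>r. r powr s) has_real_derivative s * x powr (s - 1)) (at x within {0<..1})"
    by (rule has_field_derivative_at_within[OF has_real_derivative_powr])
qed (auto intro!: continuous_intros)

text \<open>With m = (M-2)/2 the square r^(M-3) (r u' + m u)^2 is the integrand plus m times the
  derivative of r^(M-2) u^2. Over [d,1] that derivative contributes -d^(M-2) u(d)^2, a boundary term
  of favourable sign, so nothing has to be known about u at 0.\<close>

theorem Hardy:
  assumes M: "2 \<le> M" and u: "u \<in> calH_0M M"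
  shows "((M - 2) / 2)^2 * ip_M M u u \<le> energy M u u"
proof -
  define m where "m = (M - 2) / 2"
  have m: "m \<ge> 0" "M - 2 = 2 * m" using M by (auto simp: m_def)
  define g where "g = wd u"
  define f where "f r = r powr (M - 1) * g r * g r - m\<^sup>2 * (r powr (M - 3) * u r * u r)" for r
  note a = calH_0M_acd[OF u, folded g_def]
  note i1 = calH_0M_integrable(1)[OF u u, folded g_def] and i2 = calH_0M_integrable(2)[OF u u]
  have fi: "integrable leb01 f" unfolding f_def using i1 i2 by simp
  have "0 \<le> (LINT r|leb01. f r)"
  proof (rule LINT_nonneg_of_tails[OF fi])
    fix d :: real assume d: "0 < d" "d < 1"
    define k where "k = (\<lambda>r. (M - 2) * r powr (M - 2 - 1) * (u r * u r) + (g r * u r + g r * u r) * r powr (M - 2))"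
    have acdk: "acd (\<lambda>r. r powr (M - 2) * (u r * u r)) k"
      unfolding k_def by (intro acd_mult acd_powr a(1))
    have Ik: "integral {d..1} k = - (d powr (M - 2) * (u d * u d))"
      using acd_integral[OF acdk, of d 1] d a(3) by simp
    have ki: "k integrable_on {d..1}" using acd_integrable[OF acdk d(1)] by simp
    have fid: "f integrable_on {d..1}"
      using integrable_01_abs[OF fi] d set_lebesgue_integral_eq_integral(1)
        absolutely_integrable_on_subinterval[where f=f and S="{0..1}" and a=d and b=1] by auto
    have "0 \<le> f r + m * k r" if r: "r \<in> {d..1}" for r
    proof -
      have r0: "r > 0" using r d by auto
      have p1: "r powr (M - 1) = r powr (M - 3) * r\<^sup>2" "r powr (M - 2) = r powr (M - 3) * r"
        using powr_add[of r "M - 3" 2] powr_add[of r "M - 3" 1] r0 by simp_all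
      have e: "M - 2 - 1 = M - 3" by simp
      have "f r + m * k r = r powr (M - 3) * (r * g r + m * u r)^2"
        unfolding f_def k_def p1 e unfolding m(2) by (simp add: power2_eq_square algebra_simps)
      then show ?thesis by simp
    qed
    then have "0 \<le> integral {d..1} (\<lambda>r. f r + m * k r)"
      by (intro Henstock_Kurzweil_Integration.integral_nonneg integrable_add fid integrable_on_mult_right ki) auto
    also have "\<dots> = integral {d..1} f + m * integral {d..1} k"
      using fid ki by (subst Henstock_Kurzweil_Integration.integral_add) (auto intro: integrable_on_mult_right)
    finally have "m * (d powr (M - 2) * (u d * u d)) \<le> integral {d..1} f" using Ik by simp
    moreover have "0 \<le> m * (d powr (M - 2) * (u d * u d))" using m by simp
    ultimately show "0 \<le> integral {d..1} f" by linarith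
  qed
  also have "(LINT r|leb01. f r) = energy M u u - m\<^sup>2 * ip_M M u u"
    unfolding f_def energy_def ip_M_def g_def[symmetric] using i1 i2 by simp
  finally show ?thesis by (simp add: m_def)
qed

text \<open>Cauchy-Schwarz against r^(1-M) on (x,y), the function for which the weight cancels and
  the left side becomes the increment of \<open>v\<close>. For M >= 1 this power is largest at the
  left end x.\<close>

lemma acd_Hoelder:
  assumes M: "1 \<le> M" and acd: "acd v g" and g: "g \<in> L2_M M" and xy: "0 < x" "x \<le> y" "y \<le> 1"
  shows "(v y - v x)^2 \<le> (LINT r|leb01. r powr (M - 1) * (g r)^2) * (x powr (1 - M) * (y - x))"
proof -
  define w where "w r = r powr (1 - M) * indicator {x<..<y} r" for r
  define h where "h r = r powr (1 - M)" for r :: real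
  have hc: "continuous_on {x..y} h" unfolding h_def using xy by (intro continuous_intros) auto
  have hai: "h absolutely_integrable_on {x..y}" by (rule absolutely_integrable_continuous_real[OF hc])
  have i: "{x<..<y} \<in> sets leb01" using xy by (auto simp: sets_restrict_space_iff)
  have wm: "w \<in> borel_measurable leb01"
    unfolding w_def by (intro borel_measurable_times borel_measurable_powr_01 borel_measurable_indicator i)
  have one: "r powr (M - 1) * r powr (1 - M) = 1" if "r > 0" for r :: real
    using that by (simp flip: powr_add)
  have sp: "r > 0" if "r \<in> space leb01" for r using that by (simp add: space_restrict_space)
  have w2: "r powr (M - 1) * (w r)^2 = indicator {x<..<y} r * h r" if "r \<in> space leb01" for r
    using one[OF sp[OF that]] by (auto simp: w_def h_def power2_eq_square indicator_def)
  have gw: "r powr (M - 1) * g r * w r = indicator {x<..<y} r * g r" if "r \<in> space leb01" for r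
    using one[OF sp[OF that]] by (auto simp: w_def indicator_def algebra_simps)
  have wi: "integrable leb01 (\<lambda>r. r powr (M - 1) * (w r)^2)"
    by (rule iffD2[OF Bochner_Integration.integrable_cong[OF refl w2]], assumption, rule LINT_interval(1)[OF _ xy(2,3) hai])
      (use xy in auto)
  have "(LINT r|leb01. r powr (M - 1) * g r * w r)^2 \<le> (LINT r|leb01. r powr (M - 1) * (g r)^2) * (LINT r|leb01. r powr (M - 1) * (w r)^2)"
    by (rule weighted_Cauchy_Schwarz[OF borel_measurable_powr_01 L2_M_D(1)[OF g] wm _ L2_M_D(2)[OF g] wi]) auto
  also have "(LINT r|leb01. r powr (M - 1) * g r * w r) = (LINT r|leb01. indicator {x<..<y} r * g r)"
    by (rule Bochner_Integration.integral_cong[OF refl gw])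
  also have "\<dots> = integral {x..y} g"
    using LINT_interval(2)[OF _ xy(2,3) acd_abs_integrable[OF acd xy(1,3)]] xy by simp
  also have "\<dots> = v y - v x" by (rule acd_integral[OF acd xy])
  also have "(LINT r|leb01. r powr (M - 1) * (w r)^2) = (LINT r|leb01. indicator {x<..<y} r * h r)"
    by (rule Bochner_Integration.integral_cong[OF refl w2])
  also have "\<dots> = integral {x..y} h" using LINT_interval(2)[OF _ xy(2,3) hai] xy by simp
  also have "(LINT r|leb01. r powr (M - 1) * (g r)^2) * integral {x..y} h \<le> (LINT r|leb01. r powr (M - 1) * (g r)^2) * (x powr (1 - M) * (y - x))"
  proof (rule mult_left_mono)
    have "integral {x..y} h \<le> integral {x..y} (\<lambda>_. x powr (1 - M))"
      using hai xy M unfolding h_def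
      by (intro integral_le) (auto intro!: powr_mono2' set_lebesgue_integral_eq_integral(1))
    then show "integral {x..y} h \<le> x powr (1 - M) * (y - x)" using xy by (simp add: mult.commute)
    show "0 \<le> (LINT r|leb01. r powr (M - 1) * (g r)^2)" by (intro integral_nonneg_AE AE_I2) auto
  qed
  finally show ?thesis .
qed

lemma calH_0M_Hoelder:
  assumes "1 \<le> M" "u \<in> calH_0M M" "0 < x" "x \<le> y" "y \<le> 1"
  shows "(u y - u x)^2 \<le> energy M u u * (x powr (1 - M) * (y - x))"
  using acd_Hoelder[OF assms(1) calH_0M_acd(1,2)[OF assms(2)] assms(3-5)] by (simp add: energy_square)

text \<open>The Hoelder bound up to the endpoint 1, where \<open>u\<close> vanishes, with the factor
  1 - x estimated by 1.\<close>

lemma calH_0M_pointwise: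
  assumes M: "1 \<le> M" and u: "u \<in> calH_0M M" and x: "0 < x" "x \<le> 1"
  shows "x powr (M - 1) * (u x)^2 \<le> energy M u u"
proof -
  have "(u x)^2 \<le> energy M u u * (x powr (1 - M) * (1 - x))"
    using calH_0M_Hoelder[OF M u x(1), of 1] x calH_0M_acd(3)[OF u] by simp
  also have "\<dots> \<le> energy M u u * (x powr (1 - M) * 1)"
    using x energy_nonneg[of M u] by (intro mult_left_mono) auto
  finally have "x powr (M - 1) * (u x)^2 \<le> x powr (M - 1) * (energy M u u * x powr (1 - M))"
    by (intro mult_left_mono) auto
  also have "\<dots> = energy M u u" using x by (simp add: mult.left_commute flip: powr_add)
  finally show ?thesis .
qed

text \<open>Arzela-Ascoli by hand: a diagonal subsequence converges at all rationals, and the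
  Hoelder bound, uniform in n, carries convergence over to every point of (0,1).\<close>

lemma calH_0M_compact:
  assumes M: "1 \<le> M" and w: "\<And>n::nat. w n \<in> calH_0M M" and K: "\<And>n. energy M (w n) (w n) \<le> K"
  obtains k f where "strict_mono (k :: nat \<Rightarrow> nat)" "\<And>r. r \<in> {0<..<1} \<Longrightarrow> (\<lambda>n. w (k n) r) \<longlonglongrightarrow> f r"
proof -
  have K0: "K \<ge> 0" using K[of 0] energy_nonneg[of M "w 0"] by simp
  \<comment> \<open>The diagonal argument wants one bound for all points; multiplying by r^((M-1)/2)
    turns the pointwise energy bound into the constant sqrt K.\<close>
  define \<omega> where "\<omega> r = r powr ((M - 1) / 2)" for r :: real
  have \<omega>sq: "(\<omega> r)^2 = r powr (M - 1)" if "r > 0" for r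
    using that by (simp add: \<omega>_def power2_eq_square flip: powr_add)
  have \<omega>0: "\<omega> r > 0" if "r > 0" for r using that by (simp add: \<omega>_def)
  let ?S = "\<rat> \<inter> {0<..<1::real}"
  have cS: "countable ?S" by (intro countable_Int1 countable_rat)
  have bd: "norm (\<omega> r * w n r) \<le> sqrt K" if "r \<in> ?S" for n r
  proof -
    have r: "0 < r" "r \<le> 1" using that by auto
    have "(\<omega> r * w n r)^2 \<le> K"
      using calH_0M_pointwise[OF M w r, of n] K[of n] \<omega>sq[OF r(1)] by (simp add: power_mult_distrib)
    from real_sqrt_le_mono[OF this] show ?thesis by simp
  qed
  obtain k where k: "strict_mono (k :: nat \<Rightarrow> nat)" and kc: "\<And>r. r \<in> ?S \<Longrightarrow> \<exists>l. (\<lambda>n. \<omega> r * w (k n) r) \<longlonglongrightarrow> l"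
    using function_convergent_subsequence[OF cS, of "\<lambda>n r. \<omega> r * w n r" "sqrt K"] bd by metis
  have conv_rat: "Cauchy (\<lambda>n. w (k n) r)" if r: "r \<in> ?S" for r
  proof -
    obtain l where "(\<lambda>n. \<omega> r * w (k n) r) \<longlonglongrightarrow> l" using kc[OF r] by blast
    then have "(\<lambda>n. (1 / \<omega> r) * (\<omega> r * w (k n) r)) \<longlonglongrightarrow> (1 / \<omega> r) * l" by (intro tendsto_intros)
    then show ?thesis using \<omega>0[of r] r by (intro LIMSEQ_imp_Cauchy) auto
  qed
  have conv: "convergent (\<lambda>n. w (k n) r)" if r: "r \<in> {0<..<1}" for r
  proof -
    have "Cauchy (\<lambda>n. w (k n) r)"
    proof (rule metric_CauchyI)
      fix e :: real assume e: "e > 0"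
      define L where "L = (K + 1) * r powr (1 - M)"
      have L: "L > 0" using K0 r by (simp add: L_def)
      \<comment> \<open>Within distance h of r the Hoelder bound keeps increments below e/3; the
        minimum with 1 - r keeps the rational point q inside (0,1).\<close>
      define h where "h = min (1 - r) ((e/3)^2 / L)"
      have h: "h > 0" using r L e by (simp add: h_def)
      obtain q where q: "q \<in> \<rat>" "r < q" "q < r + h" using Rats_dense_in_real[of r "r + h"] h by auto
      have q1: "q < 1" "q - r < (e/3)^2 / L" using q by (auto simp: h_def)
      have near: "\<bar>w n q - w n r\<bar> < e/3" for n
      proof -
        have "(w n q - w n r)^2 \<le> energy M (w n) (w n) * (r powr (1 - M) * (q - r))"
          using calH_0M_Hoelder[OF M w, of r q n] r q q1 by simp
        also have "\<dots> \<le> (K + 1) * (r powr (1 - M) * (q - r))"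
          using K[of n] q by (intro mult_right_mono) auto
        also have "\<dots> = L * (q - r)" by (simp add: L_def)
        also have "\<dots> < L * ((e/3)^2 / L)" using L q1 by (intro mult_strict_left_mono)
        also have "\<dots> = (e/3)^2" using L by simp
        finally have "\<bar>w n q - w n r\<bar>\<^sup>2 < (e/3)^2" by simp
        then show ?thesis by (rule power2_less_imp_less) (use e in simp)
      qed
      have "q \<in> ?S" using q q1 r by auto
      then obtain N where N: "\<And>i j. i \<ge> N \<Longrightarrow> j \<ge> N \<Longrightarrow> dist (w (k i) q) (w (k j) q) < e/3"
        using conv_rat[of q] e unfolding Cauchy_def by (metis zero_less_divide_iff zero_less_numeral)
      have "dist (w (k i) r) (w (k j) r) < e" if "i \<ge> N" "j \<ge> N" for i j
        using near[of "k i"] near[of "k j"] N[OF that] unfolding dist_real_def by linarith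
      then show "\<exists>N. \<forall>i\<ge>N. \<forall>j\<ge>N. dist (w (k i) r) (w (k j) r) < e" by blast
    qed
    then show ?thesis by (simp add: Cauchy_convergent_iff)
  qed
  show ?thesis by (rule that[OF k, of "\<lambda>r. lim (\<lambda>n. w (k n) r)"]) (use conv in \<open>simp add: convergent_LIMSEQ_iff\<close>)
qed

lemma L2_M_diff: "u \<in> L2_M M \<Longrightarrow> w \<in> L2_M M \<Longrightarrow> (\<lambda>r. u r - w r) \<in> L2_M M"
  using L2_M_lin[of u M w "-1"] by simp

lemma calH_0M_diff:
  assumes u: "u \<in> calH_0M M" and v: "v \<in> calH_0M M"
  shows "(\<lambda>r. u r - v r) \<in> calH_0M M" "AE r in leb01. wd (\<lambda>r. u r - v r) r = wd u r - wd v r"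
  using calH_0M_lin[OF assms, of "-1"] by simp_all

lemma calH_0M_L2: "u \<in> calH_0M M \<Longrightarrow> u \<in> L2_M M" "u \<in> calH_0M M \<Longrightarrow> u \<in> L2_M (M - 2)"
  using calH_0M_acd(4)[of u M] L2_M_mono[of u "M - 2" M] by (simp_all add: calL_M_eq)

text \<open>The pointwise bound carries exactly the weight r^(M-1), so a constant dominates and
  pointwise convergence becomes convergence in this norm. With the weight r^(M-3) the same bound
  would only give K / r^2.\<close>

lemma bounded_L2_Cauchy:
  assumes M: "1 \<le> M" and w: "\<And>n::nat. w n \<in> calH_0M M" and K: "\<And>n. energy M (w n) (w n) \<le> K"
    and lim: "\<And>r. r \<in> {0<..<1} \<Longrightarrow> (\<lambda>n. w n r) \<longlonglongrightarrow> f r" and e: "e > 0"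
  shows "\<exists>N. \<forall>n\<ge>N. \<forall>k\<ge>N. (LINT r|leb01. r powr (M - 1) * (w n r - w k r)^2) < e"
proof -
  have wm[measurable]: "w n \<in> borel_measurable leb01" for n by (rule calH_0M_measurable[OF w])
  have fm[measurable]: "f \<in> borel_measurable leb01"
    by (rule borel_measurable_LIMSEQ_real[OF lim wm]) (simp add: space_restrict_space)
  have bd: "r powr (M - 1) * (w n r)^2 \<le> K" if "r \<in> {0<..<1}" for n r
    using calH_0M_pointwise[OF M w, of r n] K[of n] that by auto
  have bdf: "r powr (M - 1) * (f r)^2 \<le> K" if "r \<in> {0<..<1}" for r
    by (rule LIMSEQ_le_const2[of "\<lambda>n. r powr (M - 1) * (w n r)^2"]) (use bd that in \<open>auto intro!: tendsto_intros lim\<close>)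
  have bd2: "r powr (M - 1) * (w n r - f r)^2 \<le> 4 * K" if r: "r \<in> {0<..<1}" for n r
  proof -
    have "(w n r - f r)^2 \<le> 2 * (w n r)^2 + 2 * (f r)^2"
      using zero_le_power2[of "w n r + f r"] by (simp add: power2_sum power2_diff)
    then have "r powr (M - 1) * (w n r - f r)^2 \<le> r powr (M - 1) * (2 * (w n r)^2 + 2 * (f r)^2)"
      by (intro mult_left_mono) auto
    then show ?thesis using bd[OF r, of n] bdf[OF r] by (simp add: algebra_simps)
  qed
  have di: "integrable leb01 (\<lambda>r. r powr (M - 1) * (w n r - f r)^2)" for n
    by (rule Bochner_Integration.integrable_bound[OF integrable_const_01[of "4 * K"]])
      (use bd2 in \<open>auto simp: space_restrict_space intro!: AE_I2 order_trans[OF bd2 abs_ge_self]\<close>)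
  have "(\<lambda>n. LINT r|leb01. r powr (M - 1) * (w n r - f r)^2) \<longlonglongrightarrow> (LINT r|leb01. 0)"
  proof (rule integral_dominated_convergence[where w="\<lambda>r. 4 * K"])
    show "AE r in leb01. (\<lambda>n. r powr (M - 1) * (w n r - f r)^2) \<longlonglongrightarrow> 0"
    proof (rule AE_I2)
      fix r assume "r \<in> space leb01"
      then have "(\<lambda>n. r powr (M - 1) * (w n r - f r)^2) \<longlonglongrightarrow> r powr (M - 1) * (f r - f r)^2"
        by (intro tendsto_intros lim) (simp add: space_restrict_space)
      then show "(\<lambda>n. r powr (M - 1) * (w n r - f r)^2) \<longlonglongrightarrow> 0" by simp
    qed
    show "AE r in leb01. norm (r powr (M - 1) * (w n r - f r)^2) \<le> 4 * K" for n
      using bd2 by (intro AE_I2) (simp add: space_restrict_space)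
  qed (auto simp: integrable_const_01)
  then have "(\<lambda>n. LINT r|leb01. r powr (M - 1) * (w n r - f r)^2) \<longlonglongrightarrow> 0" by simp
  from LIMSEQ_D[OF this, of "e/4"] e obtain N where "\<forall>n\<ge>N. norm ((LINT r|leb01. r powr (M - 1) * (w n r - f r)^2) - 0) < e/4"
    by auto
  then have N: "(LINT r|leb01. r powr (M - 1) * (w n r - f r)^2) < e/4" if "n \<ge> N" for n
    using that abs_ge_self[of "LINT r|leb01. r powr (M - 1) * (w n r - f r)^2"] by fastforce
  have "(LINT r|leb01. r powr (M - 1) * (w n r - w k r)^2) < e" if "n \<ge> N" "k \<ge> N" for n k
  proof -
    have "(LINT r|leb01. r powr (M - 1) * (w n r - w k r)^2) \<le> (LINT r|leb01. 2 * (r powr (M - 1) * (w n r - f r)^2) + 2 * (r powr (M - 1) * (w k r - f r)^2))"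
    proof (rule integral_mono)
      show "integrable leb01 (\<lambda>r. r powr (M - 1) * (w n r - w k r)^2)"
        by (rule L2_M_D(2)[OF L2_M_diff[OF calH_0M_L2(1)[OF w] calH_0M_L2(1)[OF w]]])
      fix r
      have "(w n r - w k r)^2 \<le> 2 * (w n r - f r)^2 + 2 * (w k r - f r)^2"
        using zero_le_power2[of "(w n r - f r) + (w k r - f r)"] by (simp add: power2_eq_square algebra_simps)
      then have "r powr (M - 1) * (w n r - w k r)^2 \<le> r powr (M - 1) * (2 * (w n r - f r)^2 + 2 * (w k r - f r)^2)"
        by (intro mult_left_mono) auto
      then show "r powr (M - 1) * (w n r - w k r)^2 \<le> 2 * (r powr (M - 1) * (w n r - f r)^2) + 2 * (r powr (M - 1) * (w k r - f r)^2)"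
        by (simp add: algebra_simps)
    qed (use di in simp)
    also have "\<dots> = 2 * (LINT r|leb01. r powr (M - 1) * (w n r - f r)^2) + 2 * (LINT r|leb01. r powr (M - 1) * (w k r - f r)^2)"
      using di by simp
    also have "\<dots> < e" using N[OF that(1)] N[OF that(2)] by linarith
    finally show ?thesis .
  qed
  then show ?thesis by blast
qed

text \<open>The derivatives have a weighted L2 limit \<open>g\<close>; integrating it from 1 gives a
  candidate with the right boundary value, and the Hoelder bound shows that it is the pointwise
  limit. Fatou then controls the norm with weight r^(M-3), a weight that is not integrable for M =
  2.\<close>

lemma calH_0M_complete:
  assumes M: "2 \<le> M" and w: "\<And>n::nat. w n \<in> calH_0M M"
    and lim: "\<And>r. r \<in> {0<..<1} \<Longrightarrow> (\<lambda>n. w n r) \<longlonglongrightarrow> f r"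
    and E: "\<And>e. e > 0 \<Longrightarrow> \<exists>N. \<forall>n\<ge>N. \<forall>k\<ge>N. energy_sq M (\<lambda>r. w n r - w k r) < e"
    and I: "\<And>e. e > 0 \<Longrightarrow> \<exists>N. \<forall>n\<ge>N. \<forall>k\<ge>N. ip_sq M (\<lambda>r. w n r - w k r) < e"
  obtains u where "u \<in> calH_0M M" "(\<lambda>n. energy_sq M (\<lambda>r. w n r - u r)) \<longlonglongrightarrow> 0"
    "(\<lambda>n. ip_sq M (\<lambda>r. w n r - u r)) \<longlonglongrightarrow> 0"
proof -
  have M1: "1 \<le> M" using M by simp
  note [measurable] = calH_0M_measurable[OF w]
  have Eeq: "energy_sq M (\<lambda>r. w n r - w k r) = (LINT r|leb01. r powr (M - 1) * (wd (w n) r - wd (w k) r)^2)" for n k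
    unfolding energy_square
  proof (rule integral_cong_AE)
    show "AE r in leb01. r powr (M - 1) * (wd (\<lambda>r. w n r - w k r) r)^2 = r powr (M - 1) * (wd (w n) r - wd (w k) r)^2"
      using calH_0M_diff(2)[OF w w, of n k] by eventually_elim simp
  qed (use calH_0M_measurable(2)[OF calH_0M_diff(1)[OF w w, of n k]] in measurable)
  have pint: "integrable leb01 (\<lambda>r. r powr (M - 1))"
    by (rule Bochner_Integration.integrable_bound[OF integrable_const_01[of 1]])
      (use M in \<open>auto simp: space_restrict_space powr_le1 intro!: AE_I2\<close>)
  obtain g where g: "g \<in> borel_measurable leb01" "integrable leb01 (\<lambda>r. r powr (M - 1) * (g r)^2)"
    "\<And>n. integrable leb01 (\<lambda>r. r powr (M - 1) * (wd (w n) r - g r)^2)"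
    "(\<lambda>n. LINT r|leb01. r powr (M - 1) * (wd (w n) r - g r)^2) \<longlonglongrightarrow> 0"
  proof (rule weighted_L2_complete[of "\<lambda>r. r powr (M - 1)" leb01 "\<lambda>n. wd (w n)"])
    show "0 < r powr (M - 1)" if "r \<in> space leb01" for r using that by (simp add: space_restrict_space)
    show "integrable leb01 (\<lambda>r. r powr (M - 1) * (wd (w n) r)^2)" for n
      by (rule L2_M_D(2)[OF calH_0M_acd(2)[OF w]])
    show "\<exists>N. \<forall>n\<ge>N. \<forall>k\<ge>N. (LINT r|leb01. r powr (M - 1) * (wd (w n) r - wd (w k) r)^2) < e" if "e > 0" for e
      using E[OF that] by (simp add: Eeq)
  qed (use pint in auto)
  then have gL: "g \<in> L2_M M" by (simp add: L2_M_def)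
  define u where "u x = - integral {x..1} g" for x
  have acdu: "acd u g" using L2_M_abs_integrable[OF gL] by (auto simp: acd_def u_def)
  have u1: "u 1 = 0" by (simp add: u_def)
  have wu: "(\<lambda>n. w n r) \<longlonglongrightarrow> u r" if r: "r \<in> {0<..<1}" for r
  proof -
    have le: "(w n r - u r)^2 \<le> (LINT r|leb01. r powr (M - 1) * (wd (w n) r - g r)^2) * (r powr (1 - M) * (1 - r))" for n
      using acd_Hoelder[OF M1 acd_diff[OF calH_0M_acd(1)[OF w] acdu] L2_M_diff[OF calH_0M_acd(2)[OF w] gL], of r 1 n] r
        calH_0M_acd(3)[OF w] u1 by (simp add: power2_commute)
    have "(\<lambda>n. (LINT r|leb01. r powr (M - 1) * (wd (w n) r - g r)^2) * (r powr (1 - M) * (1 - r))) \<longlonglongrightarrow> 0 * (r powr (1 - M) * (1 - r))"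
      by (intro tendsto_intros g)
    then have "(\<lambda>n. (LINT r|leb01. r powr (M - 1) * (wd (w n) r - g r)^2) * (r powr (1 - M) * (1 - r))) \<longlonglongrightarrow> 0"
      by simp
    then have "(\<lambda>n. (w n r - u r)^2) \<longlonglongrightarrow> 0"
      by (rule Lim_null_comparison[rotated]) (use le in simp)
    from tendsto_real_sqrt[OF this] have "(\<lambda>n. \<bar>w n r - u r\<bar>) \<longlonglongrightarrow> 0" by simp
    then have "(\<lambda>n. w n r - u r) \<longlonglongrightarrow> 0" by (rule tendsto_rabs_zero_cancel)
    then show ?thesis by (simp add: LIM_zero_iff)
  qed
  have um: "u \<in> borel_measurable leb01"
    by (rule borel_measurable_LIMSEQ_real[OF wu calH_0M_measurable(1)[OF w]]) (simp add: space_restrict_space)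
  note [measurable] = um
  have ipeq: "ip_sq M (\<lambda>r. w n r - w k r) = (LINT r|leb01. r powr (M - 3) * (w n r - w k r)^2)" for n k
    by (rule ip_M_square)
  have wi: "integrable leb01 (\<lambda>r. r powr (M - 3) * (w n r - w k r)^2)" for n k
    using L2_M_D(2)[OF L2_M_diff[OF calH_0M_L2(2)[OF w[of n]] calH_0M_L2(2)[OF w[of k]]]] by (simp add: algebra_simps)
  have Fat: "integrable leb01 (\<lambda>r. r powr (M - 3) * (w n r - u r)^2)"
     "(LINT r|leb01. r powr (M - 3) * (w n r - u r)^2) \<le> c"
    if c: "\<forall>\<^sub>F k in sequentially. ip_sq M (\<lambda>r. w n r - w k r) \<le> c" for n c
  proof -
    have "AE r in leb01. (\<lambda>k. r powr (M - 3) * (w n r - w k r)^2) \<longlonglongrightarrow> r powr (M - 3) * (w n r - u r)^2"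
      by (intro AE_I2 tendsto_intros wu) (simp add: space_restrict_space)
    from integral_le_of_AE_tendsto[OF _ _ this _ wi c[unfolded ipeq]]
    show "integrable leb01 (\<lambda>r. r powr (M - 3) * (w n r - u r)^2)"
     "(LINT r|leb01. r powr (M - 3) * (w n r - u r)^2) \<le> c" by simp_all
  qed
  obtain N1 where N1: "\<And>n k. n \<ge> N1 \<Longrightarrow> k \<ge> N1 \<Longrightarrow> ip_sq M (\<lambda>r. w n r - w k r) < 1"
    using I[of 1] by auto
  have "integrable leb01 (\<lambda>r. r powr (M - 3) * (w N1 r - u r)^2)"
    by (rule Fat(1)[of N1 1]) (auto simp: eventually_sequentially intro!: exI[of _ N1] less_imp_le[OF N1])
  then have "(\<lambda>r. w N1 r - u r) \<in> L2_M (M - 2)"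
    unfolding L2_M_def by (simp add: algebra_simps)
  from L2_M_diff[OF calH_0M_L2(2)[OF w[of N1]] this] have uL: "u \<in> calL_M M" by (simp add: calL_M_eq)
  have uH: "u \<in> calH_0M M" and uAE: "AE r in leb01. wd u r = g r"
    by (rule calH_0M_I[OF acdu u1 gL uL])+
  show ?thesis
  proof (rule that[OF uH])
    have "energy_sq M (\<lambda>r. w n r - u r) = (LINT r|leb01. r powr (M - 1) * (wd (w n) r - g r)^2)" for n
      unfolding energy_square
    proof (rule integral_cong_AE)
      show "AE r in leb01. r powr (M - 1) * (wd (\<lambda>r. w n r - u r) r)^2 = r powr (M - 1) * (wd (w n) r - g r)^2"
        using calH_0M_diff(2)[OF w uH, of n] uAE by eventually_elim simp
    qed (use calH_0M_measurable(2)[OF calH_0M_diff(1)[OF w uH, of n]] g(1) in measurable)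
    then show "(\<lambda>n. energy_sq M (\<lambda>r. w n r - u r)) \<longlonglongrightarrow> 0" using g(4) by simp
    show "(\<lambda>n. ip_sq M (\<lambda>r. w n r - u r)) \<longlonglongrightarrow> 0"
    proof (rule LIMSEQ_I)
      fix e :: real assume e: "e > 0"
      then obtain N where N: "\<And>n k. n \<ge> N \<Longrightarrow> k \<ge> N \<Longrightarrow> ip_sq M (\<lambda>r. w n r - w k r) < e/2"
        using I[of "e/2"] by auto
      have "ip_sq M (\<lambda>r. w n r - u r) \<le> e/2" if "n \<ge> N" for n
        unfolding ip_M_square
        by (rule Fat(2), unfold eventually_sequentially, intro exI[of _ N] allI impI less_imp_le[OF N] that)
      then have "ip_sq M (\<lambda>r. w n r - u r) < e" if "n \<ge> N" for n
        using that e by fastforce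
      then show "\<exists>no. \<forall>n\<ge>no. norm (ip_sq M (\<lambda>r. w n r - u r) - 0) < e"
        using ip_M_nonneg by (intro exI[of _ N]) auto
    qed
  qed
qed

section \<open>Iterated minimization\<close>

context sym_form
begin

text \<open>Unlike \<open>sum_mem\<close> this admits an empty index set, the case i = 1 in which no
  earlier minimizer exists.\<close>

lemma add_sum_mem:
  "finite I \<Longrightarrow> u \<in> H \<Longrightarrow> (\<And>i. i \<in> I \<Longrightarrow> f i \<in> H) \<Longrightarrow> (\<lambda>x. u x + (\<Sum>i\<in>I. d i * f i x)) \<in> H"
proof (induction I rule: finite_induct)
  case (insert i I)
  have "(\<lambda>x. (u x + (\<Sum>i\<in>I. d i * f i x)) + d i * f i x) \<in> H"
    by (rule lin_mem) (use insert in auto)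
  moreover have "(\<lambda>x. (u x + (\<Sum>i\<in>I. d i * f i x)) + d i * f i x) = (\<lambda>x. u x + (\<Sum>i\<in>insert i I. d i * f i x))"
    using insert by (simp add: algebra_simps)
  ultimately show ?case by simp
qed simp

lemma add_sum_left:
  "finite I \<Longrightarrow> u \<in> H \<Longrightarrow> (\<And>i. i \<in> I \<Longrightarrow> f i \<in> H) \<Longrightarrow> w \<in> H \<Longrightarrow>
    b (\<lambda>x. u x + (\<Sum>i\<in>I. d i * f i x)) w = b u w + (\<Sum>i\<in>I. d i * b (f i) w)"
proof (induction I rule: finite_induct)
  case (insert i I)
  have "b (\<lambda>x. (u x + (\<Sum>i\<in>I. d i * f i x)) + d i * f i x) w = b (\<lambda>x. u x + (\<Sum>i\<in>I. d i * f i x)) w + d i * b (f i) w"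
    using insert by (intro lin_left add_sum_mem) auto
  moreover have "(\<lambda>x. (u x + (\<Sum>i\<in>I. d i * f i x)) + d i * f i x) = (\<lambda>x. u x + (\<Sum>i\<in>insert i I. d i * f i x))"
    using insert by (simp add: algebra_simps)
  ultimately show ?case using insert by simp
qed simp

end

text \<open>\<open>null\<close> makes elements outside \<open>W\<close> invisible to both forms, so
  inequalities for quotients over \<open>W\<close> extend to all of \<open>H\<close> once multiplied
  out. \<open>bounded_below\<close> is what makes the real infimum a lower bound.\<close>

locale variational = Q: sym_form H q + I: sym_form H ip
  for H :: "('a \<Rightarrow> real) set" and q ip +
  fixes W
  assumes W_sub: "W \<subseteq> H"
    and pos: "w \<in> W \<Longrightarrow> 0 < ip w w"
    and null: "u \<in> H \<Longrightarrow> u \<notin> W \<Longrightarrow> \<phi> \<in> H \<Longrightarrow> q u \<phi> = 0 \<and> ip u \<phi> = 0"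
    and bounded_below: "\<exists>C. \<forall>w\<in>W. C * ip w w \<le> q w w"
begin

lemma bdd_quotients: "S \<subseteq> W \<Longrightarrow> bdd_below ((\<lambda>w. q w w / ip w w) ` S)"
proof -
  assume S: "S \<subseteq> W"
  obtain C where C: "\<And>w. w \<in> W \<Longrightarrow> C * ip w w \<le> q w w" using bounded_below by blast
  have "C \<le> q w w / ip w w" if "w \<in> S" for w
    using C[of w] pos[of w] S that by (auto simp: pos_le_divide_eq)
  then show ?thesis by (intro bdd_belowI[of _ C]) auto
qed

lemma competitors_sub: "competitors W ip \<psi> i \<subseteq> W" "competitors W ip \<psi> i \<subseteq> H"
  using W_sub by (auto simp: competitors_def)

lemma min_level_le:
  assumes "w \<in> H" "\<And>j. j \<in> {1..<i} \<Longrightarrow> ip w (\<psi> j) = 0"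
  shows "min_level W q ip \<psi> i * ip w w \<le> q w w"
proof (cases "w \<in> W")
  case True
  then have "w \<in> competitors W ip \<psi> i" using assms by (auto simp: competitors_def)
  then have "min_level W q ip \<psi> i \<le> q w w / ip w w"
    unfolding min_level_def by (intro cINF_lower bdd_quotients competitors_sub)
  then show ?thesis using pos[OF True] by (simp add: pos_le_divide_eq)
next
  case False
  then show ?thesis using null[of w w] assms by simp
qed

text \<open>Fewer competitors give a larger infimum. Nonemptiness matters: a real infimum over the
  empty set would carry no information.\<close>

lemma min_level_mono:
  assumes "j \<le> i" "competitors W ip \<psi> i \<noteq> {}"
  shows "min_level W q ip \<psi> j \<le> min_level W q ip \<psi> i"
  unfolding min_level_def
  by (rule cINF_superset_mono) (use assms in \<open>auto simp: competitors_def intro!: bdd_quotients\<close>)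

lemma minimizers_below_mono: "minimizers_below W q ip c \<psi> i \<Longrightarrow> j \<le> i \<Longrightarrow> minimizers_below W q ip c \<psi> j"
  by (auto simp: minimizers_below_def)

lemma minimizersD:
  assumes "minimizers_below W q ip c \<psi> i" "j \<in> {1..<i}"
  shows "\<psi> j \<in> competitors W ip \<psi> j" "\<psi> j \<in> W" "\<psi> j \<in> H" "min_level W q ip \<psi> j < c"
    "q (\<psi> j) (\<psi> j) = min_level W q ip \<psi> j * ip (\<psi> j) (\<psi> j)"
proof -
  show 1: "\<psi> j \<in> competitors W ip \<psi> j" using assms by (auto simp: minimizers_below_def)
  then show 2: "\<psi> j \<in> W" "\<psi> j \<in> H" using competitors_sub by blast+
  show "min_level W q ip \<psi> j < c" using assms by (auto simp: minimizers_below_def)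
  show "q (\<psi> j) (\<psi> j) = min_level W q ip \<psi> j * ip (\<psi> j) (\<psi> j)"
    using assms pos[OF 2(1)] by (auto simp: minimizers_below_def divide_eq_eq)
qed

lemma minimizers_orthogonal:
  assumes "minimizers_below W q ip c \<psi> i" "j \<in> {1..<i}" "k \<in> {1..<i}" "j \<noteq> k"
  shows "ip (\<psi> j) (\<psi> k) = 0"
proof -
  have *: "ip (\<psi> j) (\<psi> k) = 0" if "j \<in> {1..<i}" "k \<in> {1..<i}" "k < j" for j k
    using minimizersD(1)[OF assms(1) that(1)] that by (auto simp: competitors_def)
  show ?thesis
    using *[of j k] *[of k j] I.sym minimizersD(3)[OF assms(1)] assms(2-4) by (metis linorder_neqE_nat)
qed

text \<open>A minimizer is critical for variations orthogonal to the previous minimizers; in the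
  remaining directions, which are eigenfunctions themselves, both sides vanish.\<close>

theorem minimizer_eigenfunction:
  assumes "minimizers_below W q ip c \<psi> i" "w \<in> H" "\<And>j. j \<in> {1..<i} \<Longrightarrow> ip w (\<psi> j) = 0"
    "q w w = min_level W q ip \<psi> i * ip w w"
  shows "w \<in> eigenspace H q ip (min_level W q ip \<psi> i)"
  using assms
proof (induction i arbitrary: w rule: less_induct)
  case (less i)
  note mb = less.prems(1) and wH = less.prems(2) and orth = less.prems(3) and wq = less.prems(4)
  let ?\<nu> = "min_level W q ip \<psi> i"
  have \<psi>H: "\<psi> j \<in> H" if "j \<in> {1..<i}" for j using minimizersD(3)[OF mb that] .
  \<comment> \<open>By the induction hypothesis each earlier \<psi> j is an eigenfunction of its own
    level, so its pairing with \<open>w\<close> under \<open>q\<close> is a multiple of the one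
    under \<open>ip\<close>, which is zero.\<close>
  have eig: "q w (\<psi> j) = 0" if j: "j \<in> {1..<i}" for j
  proof -
    have "\<psi> j \<in> eigenspace H q ip (min_level W q ip \<psi> j)"
    proof (rule less.IH)
      show "minimizers_below W q ip c \<psi> j" using minimizers_below_mono[OF mb] j by simp
      show "ip (\<psi> j) (\<psi> k) = 0" if "k \<in> {1..<j}" for k
        using minimizers_orthogonal[OF mb j, of k] that j by auto
    qed (use j minimizersD[OF mb j] in auto)
    then have "q (\<psi> j) w = min_level W q ip \<psi> j * ip (\<psi> j) w" using wH by (auto simp: eigenspace_def)
    then show ?thesis using Q.sym[OF wH \<psi>H[OF j]] I.sym[OF wH \<psi>H[OF j]] orth[OF j] by simp
  qed
  have orthcase: "q w \<phi> = ?\<nu> * ip w \<phi>" if \<phi>: "\<phi> \<in> H" and o: "\<And>j. j \<in> {1..<i} \<Longrightarrow> ip \<phi> (\<psi> j) = 0" for \<phi>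
  proof -
    \<comment> \<open>The excess of w + t \<phi> over the level is a nonnegative polynomial in t
      with zero constant term, hence its linear coefficient vanishes.\<close>
    have "(q w \<phi> - ?\<nu> * ip w \<phi>)^2 \<le> 0 * (q \<phi> \<phi> - ?\<nu> * ip \<phi> \<phi>)"
    proof (rule quadratic_nonneg_imp)
      fix t
      have "?\<nu> * ip (\<lambda>x. w x + t * \<phi> x) (\<lambda>x. w x + t * \<phi> x) \<le> q (\<lambda>x. w x + t * \<phi> x) (\<lambda>x. w x + t * \<phi> x)"
        by (rule min_level_le) (use wH \<phi> o orth \<psi>H in \<open>auto simp: I.lin_left Q.lin_mem\<close>)
      then show "0 \<le> 0 + 2 * (q w \<phi> - ?\<nu> * ip w \<phi>) * t + (q \<phi> \<phi> - ?\<nu> * ip \<phi> \<phi>) * t\<^sup>2"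
        using wq unfolding I.lin_square[OF wH \<phi>] Q.lin_square[OF wH \<phi>] by (simp add: algebra_simps)
      show "0 \<le> q \<phi> \<phi> - ?\<nu> * ip \<phi> \<phi>" using min_level_le[OF \<phi>, of i \<psi>] o by simp
    qed
    then show ?thesis by simp
  qed
  show ?case
    unfolding eigenspace_def
  proof (intro CollectI conjI ballI wH)
    fix \<phi> assume \<phi>: "\<phi> \<in> H"
    \<comment> \<open>Gram-Schmidt coefficients: they remove from \<phi> its components along the
      earlier minimizers.\<close>
    define d where "d j = - (ip \<phi> (\<psi> j) / ip (\<psi> j) (\<psi> j))" for j
    define \<phi>' where "\<phi>' x = \<phi> x + (\<Sum>j\<in>{1..<i}. d j * \<psi> j x)" for x
    have \<phi>'H: "\<phi>' \<in> H" unfolding \<phi>'_def by (intro Q.add_sum_mem \<phi> \<psi>H) auto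
    have "ip \<phi>' (\<psi> k) = 0" if k: "k \<in> {1..<i}" for k
    proof -
      have "ip \<phi>' (\<psi> k) = ip \<phi> (\<psi> k) + (\<Sum>j\<in>{1..<i}. d j * ip (\<psi> j) (\<psi> k))"
        unfolding \<phi>'_def by (intro I.add_sum_left \<phi> \<psi>H k) auto
      also have "(\<Sum>j\<in>{1..<i}. d j * ip (\<psi> j) (\<psi> k)) = (\<Sum>j\<in>{1..<i}. if j = k then d k * ip (\<psi> k) (\<psi> k) else 0)"
        by (rule sum.cong) (use minimizers_orthogonal[OF mb _ k] in auto)
      also have "\<dots> = d k * ip (\<psi> k) (\<psi> k)" using k by simp
      also have "\<dots> = - ip \<phi> (\<psi> k)" using pos[OF minimizersD(2)[OF mb k]] by (simp add: d_def)
      finally show ?thesis by simp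
    qed
    then have "q w \<phi>' = ?\<nu> * ip w \<phi>'" by (rule orthcase[OF \<phi>'H])
    moreover have "q w \<phi>' = q w \<phi>"
    proof -
      have "q w \<phi>' = q \<phi>' w" by (rule Q.sym[OF wH \<phi>'H])
      also have "\<dots> = q \<phi> w + (\<Sum>j\<in>{1..<i}. d j * q (\<psi> j) w)"
        unfolding \<phi>'_def by (intro Q.add_sum_left \<phi> \<psi>H wH) auto
      also have "(\<Sum>j\<in>{1..<i}. d j * q (\<psi> j) w) = 0"
        by (rule sum.neutral) (use eig Q.sym[OF wH \<psi>H] in auto)
      finally show ?thesis using Q.sym[OF wH \<phi>] by simp
    qed
    moreover have "ip w \<phi>' = ip w \<phi>"
    proof -
      have "ip w \<phi>' = ip \<phi>' w" by (rule I.sym[OF wH \<phi>'H])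
      also have "\<dots> = ip \<phi> w + (\<Sum>j\<in>{1..<i}. d j * ip (\<psi> j) w)"
        unfolding \<phi>'_def by (intro I.add_sum_left \<phi> \<psi>H wH) auto
      also have "(\<Sum>j\<in>{1..<i}. d j * ip (\<psi> j) w) = 0"
        by (rule sum.neutral) (use orth I.sym[OF wH \<psi>H] in auto)
      finally show ?thesis using I.sym[OF wH \<phi>] by simp
    qed
    ultimately show "q w \<phi> = ?\<nu> * ip w \<phi>" by simp
  qed
qed

lemma minimizer_seq:
  assumes ne: "competitors W ip \<psi> i \<noteq> {}" and \<psi>H: "\<And>j. j \<in> {1..<i} \<Longrightarrow> \<psi> j \<in> H"
  obtains w :: "nat \<Rightarrow> 'a \<Rightarrow> real" where "\<And>n. w n \<in> H" "\<And>n j. j \<in> {1..<i} \<Longrightarrow> ip (w n) (\<psi> j) = 0"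
    "\<And>n. ip (w n) (w n) = 1" "\<And>n. q (w n) (w n) < min_level W q ip \<psi> i + 1 / real (Suc n)"
proof -
  let ?\<nu> = "min_level W q ip \<psi> i"
  have "\<exists>w. w \<in> H \<and> (\<forall>j\<in>{1..<i}. ip w (\<psi> j) = 0) \<and> ip w w = 1 \<and> q w w < ?\<nu> + 1 / real (Suc n)" for n
  proof -
    have "?\<nu> < ?\<nu> + 1 / real (Suc n)" by simp
    then obtain v where v: "v \<in> competitors W ip \<psi> i" "q v v / ip v v < ?\<nu> + 1 / real (Suc n)"
      unfolding min_level_def using cINF_less_iff[OF ne bdd_quotients[OF competitors_sub(1)]] by blast
    have vH: "v \<in> H" "v \<in> W" using v competitors_sub by blast+
    define s where "s = 1 / sqrt (ip v v)"
    have s2: "s * s = 1 / ip v v" using pos[OF vH(2)] by (simp add: s_def)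
    have "ip (\<lambda>x. s * v x) (\<lambda>x. s * v x) = (s * s) * ip v v"
      using vH by (simp add: I.scale_left I.scale_right I.scale_mem)
    then have "ip (\<lambda>x. s * v x) (\<lambda>x. s * v x) = 1" using s2 pos[OF vH(2)] by simp
    moreover have "q (\<lambda>x. s * v x) (\<lambda>x. s * v x) = (s * s) * q v v"
      using vH by (simp add: Q.scale_left Q.scale_right Q.scale_mem)
    then have "q (\<lambda>x. s * v x) (\<lambda>x. s * v x) < ?\<nu> + 1 / real (Suc n)" using s2 v(2) by simp
    moreover have "\<forall>j\<in>{1..<i}. ip (\<lambda>x. s * v x) (\<psi> j) = 0"
      using v(1) vH \<psi>H by (auto simp: I.scale_left competitors_def)
    ultimately show ?thesis using I.scale_mem[OF vH(1), of s] by blast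
  qed
  then obtain w where "\<forall>n. w n \<in> H \<and> (\<forall>j\<in>{1..<i}. ip (w n) (\<psi> j) = 0) \<and> ip (w n) (w n) = 1 \<and> q (w n) (w n) < ?\<nu> + 1 / real (Suc n)"
    by metis
  then show ?thesis using that[of w] by blast
qed

end

lemma variational_radial:
  assumes a: "a \<in> Linfty {0<..<1}"
  shows "variational (calH_0M M) (form_M M a) (ip_M M) (nonzero_on {0<..<1} (calH_0M M))"
proof -
  interpret Q: sym_form "calH_0M M" "form_M M a" by (rule sym_form_form_M[OF a])
  interpret I: sym_form "calH_0M M" "ip_M M" by (rule sym_form_ip)
  obtain C where C: "C \<ge> 0" "AE r in leb01. \<bar>a r\<bar> \<le> C" using Linfty_bound[OF a] by blast
  show ?thesis
  proof
    show "nonzero_on {0<..<1} (calH_0M M) \<subseteq> calH_0M M" by (auto simp: nonzero_on_def)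
    show "0 < ip_M M w w" if "w \<in> nonzero_on {0<..<1} (calH_0M M)" for w by (rule ip_M_pos[OF that])
    show "form_M M a u \<phi> = 0 \<and> ip_M M u \<phi> = 0"
      if "u \<in> calH_0M M" "u \<notin> nonzero_on {0<..<1} (calH_0M M)" "\<phi> \<in> calH_0M M" for u \<phi>
      using form_M_null[OF that a] by simp
    have "(- C) * ip_M M w w \<le> form_M M a w w" if "w \<in> nonzero_on {0<..<1} (calH_0M M)" for w
    proof -
      have w: "w \<in> calH_0M M" using that by (simp add: nonzero_on_def)
      show ?thesis
        using potential_bound(2)[OF a C(2,1) w] energy_nonneg[of M w] by (simp add: form_M_eq[OF a w w])
    qed
    then show "\<exists>C. \<forall>w\<in>nonzero_on {0<..<1} (calH_0M M). C * ip_M M w w \<le> form_M M a w w" by blast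
  qed
qed

text \<open>A minimizing sequence is Cauchy: by the parallelogram law the excess \<open>q - \<nu> ip\<close> of the
  differences tends to \<open>0\<close>, and below the Hardy constant it controls the norm up to the compact term
  \<open>\<integral> r\<^bsup>M-1\<^esup> w\<^sup>2\<close>.\<close>

theorem nu_hat_attained:
  assumes M: "2 \<le> M" and a: "a \<in> Linfty {0<..<1}"
    and ne: "competitors (nonzero_on {0<..<1} (calH_0M M)) (ip_M M) \<psi> i \<noteq> {}"
    and \<psi>H: "\<And>j. j \<in> {1..<i} \<Longrightarrow> \<psi> j \<in> calH_0M M"
    and lt: "nu_hat M a \<psi> i < ((M - 2) / 2)^2"
  obtains u where "u \<in> calH_0M M" "\<And>j. j \<in> {1..<i} \<Longrightarrow> ip_M M u (\<psi> j) = 0" "ip_M M u u = 1"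
    "form_M M a u u = nu_hat M a \<psi> i * ip_M M u u"
proof -
  let ?W = "nonzero_on {0<..<1} (calH_0M M)"
  interpret V: variational "calH_0M M" "form_M M a" "ip_M M" ?W by (rule variational_radial[OF a])
  interpret EE: sym_form "calH_0M M" "energy M" by (rule sym_form_energy)
  define \<nu> where "\<nu> = nu_hat M a \<psi> i"
  have \<nu>eq: "min_level ?W (form_M M a) (ip_M M) \<psi> i = \<nu>" by (simp add: \<nu>_def nu_hat_def)
  obtain C where C: "C \<ge> 0" "AE r in leb01. \<bar>a r\<bar> \<le> C" using Linfty_bound[OF a] by blast
  obtain w0 where w0: "\<And>n. w0 n \<in> calH_0M M" "\<And>n j. j \<in> {1..<i} \<Longrightarrow> ip_M M (w0 n) (\<psi> j) = 0"
    "\<And>n. ip_M M (w0 n) (w0 n) = 1" "\<And>n. form_M M a (w0 n) (w0 n) < \<nu> + 1 / real (Suc n)"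
    using V.minimizer_seq[OF ne \<psi>H] unfolding \<nu>eq by metis
  have K: "energy M (w0 n) (w0 n) \<le> \<nu> + 1 + C" for n
  proof -
    have "1 / real (Suc n) \<le> 1" by simp
    then have "form_M M a (w0 n) (w0 n) \<le> \<nu> + 1" using w0(4)[of n] by linarith
    then show ?thesis
      using w0(3)[of n] potential_bound(2)[OF a C(2,1) w0(1)[of n]] by (simp add: form_M_eq[OF a w0(1) w0(1)])
  qed
  obtain k f where k: "strict_mono (k :: nat \<Rightarrow> nat)" and f: "\<And>r. r \<in> {0<..<1} \<Longrightarrow> (\<lambda>n. w0 (k n) r) \<longlonglongrightarrow> f r"
    using calH_0M_compact[of M w0, OF _ w0(1) K] M by auto
  define w where "w n = w0 (k n)" for n
  have w: "w n \<in> calH_0M M" "ip_M M (w n) (w n) = 1" "energy M (w n) (w n) \<le> \<nu> + 1 + C"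
     "j \<in> {1..<i} \<Longrightarrow> ip_M M (w n) (\<psi> j) = 0" "form_M M a (w n) (w n) < \<nu> + 1 / real (Suc n)" for n j
  proof -
    show "w n \<in> calH_0M M" "ip_M M (w n) (w n) = 1" "energy M (w n) (w n) \<le> \<nu> + 1 + C"
     "j \<in> {1..<i} \<Longrightarrow> ip_M M (w n) (\<psi> j) = 0" unfolding w_def by (rule w0 K, assumption?)+
    have "1 / real (Suc (k n)) \<le> 1 / real (Suc n)" using seq_suble[OF k, of n] by (intro divide_left_mono) auto
    then show "form_M M a (w n) (w n) < \<nu> + 1 / real (Suc n)" using w0(4)[of "k n"] unfolding w_def by linarith
  qed
  have lim: "(\<lambda>n. w n r) \<longlonglongrightarrow> f r" if "r \<in> {0<..<1}" for r unfolding w_def by (rule f[OF that])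
  interpret P: sym_form "calH_0M M" "\<lambda>u v. form_M M a u v + (- \<nu>) * ip_M M u v"
    by (intro sym_form_add V.Q.sym_form_axioms V.I.linear_combination)
  define B where "B u v = form_M M a u v + (- \<nu>) * ip_M M u v" for u v
  have Bdiff: "B (\<lambda>r. w n r - w m r) (\<lambda>r. w n r - w m r) \<le> 2 / real (Suc n) + 2 / real (Suc m)" for n m
  proof -
    have Bn: "B (w n) (w n) \<le> 1 / real (Suc n)" for n using w(2,5)[of n] by (simp add: B_def)
    \<comment> \<open>Parallelogram identity. The sum of two members of the sequence satisfies the
      same orthogonality, so its excess is nonnegative and may be dropped.\<close>
    have "B (\<lambda>r. w n r + (-1) * w m r) (\<lambda>r. w n r + (-1) * w m r) + B (\<lambda>r. w n r + 1 * w m r) (\<lambda>r. w n r + 1 * w m r) = 2 * B (w n) (w n) + 2 * B (w m) (w m)"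
      unfolding B_def by (subst (1 2) P.lin_square[OF w(1) w(1)]) simp
    moreover have "0 \<le> B (\<lambda>r. w n r + 1 * w m r) (\<lambda>r. w n r + 1 * w m r)"
    proof -
      have "\<nu> * ip_sq M (\<lambda>r. w n r + 1 * w m r) \<le> form_M M a (\<lambda>r. w n r + 1 * w m r) (\<lambda>r. w n r + 1 * w m r)"
        unfolding \<nu>eq[symmetric]
        by (rule V.min_level_le) (use calH_0M_add(1)[OF w(1) w(1)] V.I.add_left[OF w(1) w(1) \<psi>H] w(4) in auto)
      then show ?thesis by (simp add: B_def)
    qed
    ultimately show ?thesis using Bn[of n] Bn[of m] by (simp add: divide_inverse del: of_nat_Suc)
  qed
  \<comment> \<open>The gap to the Hardy constant: Hardy's inequality bounds the energy minus \<nu>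
    times the \<open>ip\<close>-square from below by \<delta> times the
    \<open>ip\<close>-square.\<close>
  define \<delta> where "\<delta> = ((M - 2) / 2)^2 - \<nu>"
  have \<delta>: "\<delta> > 0" using lt by (simp add: \<delta>_def \<nu>_def)
  \<comment> \<open>Bounds the excess of a difference plus its potential term, the latter kept in
    the norm with weight r^(M-1), where the Cauchy property already follows from
    compactness.\<close>
  define R where "R n m = 2 / real (Suc n) + 2 / real (Suc m) + C * (LINT r|leb01. r powr (M - 1) * (w n r - w m r)^2)" for n m
  have dH: "(\<lambda>r. w n r - w m r) \<in> calH_0M M" for n m by (rule calH_0M_diff(1)[OF w(1) w(1)])
  have ctl: "\<delta> * ip_sq M (\<lambda>r. w n r - w m r) \<le> R n m"
     "energy_sq M (\<lambda>r. w n r - w m r) \<le> R n m + \<bar>\<nu>\<bar> * ip_sq M (\<lambda>r. w n r - w m r)" for n m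
  proof -
    let ?d = "\<lambda>r. w n r - w m r"
    have 1: "energy M ?d ?d - \<nu> * ip_M M ?d ?d \<le> R n m"
      using Bdiff[of n m] potential_bound(1)[OF a C(2,1) dH[of n m]]
      by (simp add: B_def R_def form_M_eq[OF a dH dH] abs_le_iff)
    then show "\<delta> * ip_M M ?d ?d \<le> R n m"
      using Hardy[OF M dH[of n m]] by (simp add: \<delta>_def left_diff_distrib)
    have "\<nu> * ip_M M ?d ?d \<le> \<bar>\<nu>\<bar> * ip_M M ?d ?d" by (intro mult_right_mono ip_M_nonneg) auto
    then show "energy M ?d ?d \<le> R n m + \<bar>\<nu>\<bar> * ip_M M ?d ?d" using 1 by linarith
  qed
  have RC: "\<exists>N. \<forall>n\<ge>N. \<forall>m\<ge>N. R n m < e" if e: "e > 0" for e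
  proof -
    have "\<exists>N. \<forall>n\<ge>N. \<forall>m\<ge>N. (LINT r|leb01. r powr (M - 1) * (w n r - w m r)^2) < e / (2 * (C + 1))"
      by (rule bounded_L2_Cauchy[OF _ w(1) w(3) lim]) (use M e C in auto)
    then obtain N1 where N1: "\<And>n m. n \<ge> N1 \<Longrightarrow> m \<ge> N1 \<Longrightarrow> (LINT r|leb01. r powr (M - 1) * (w n r - w m r)^2) < e / (2 * (C + 1))"
      by blast
    obtain N2 :: nat where N2: "8 / e < real N2" using reals_Archimedean2 by blast
    have small: "2 / real (Suc n) < e / 4" if "n \<ge> N2" for n
    proof -
      have "8 / e < real (Suc n)" using N2 that by simp
      then show ?thesis using e by (simp add: field_simps)
    qed
    have "R n m < e" if "n \<ge> max N1 N2" "m \<ge> max N1 N2" for n m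
    proof -
      have "C * (LINT r|leb01. r powr (M - 1) * (w n r - w m r)^2) \<le> C * (e / (2 * (C + 1)))"
        using N1[of n m] that C by (intro mult_left_mono) auto
      also have "\<dots> \<le> e / 2" using C e by (simp add: field_simps)
      finally show ?thesis using small[of n] small[of m] that by (simp add: R_def)
    qed
    then show ?thesis by blast
  qed
  have IC: "\<exists>N. \<forall>n\<ge>N. \<forall>m\<ge>N. ip_sq M (\<lambda>r. w n r - w m r) < e" if e: "e > 0" for e
  proof -
    obtain N where N: "\<And>n m. n \<ge> N \<Longrightarrow> m \<ge> N \<Longrightarrow> R n m < \<delta> * e" using RC[of "\<delta> * e"] \<delta> e by auto
    have "ip_sq M (\<lambda>r. w n r - w m r) < e" if "n \<ge> N" "m \<ge> N" for n m
      using le_less_trans[OF ctl(1) N[OF that]] \<delta> by simp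
    then show ?thesis by blast
  qed
  have EC: "\<exists>N. \<forall>n\<ge>N. \<forall>m\<ge>N. energy_sq M (\<lambda>r. w n r - w m r) < e" if e: "e > 0" for e
  proof -
    have e': "e / (2 * (\<bar>\<nu>\<bar> + 1)) > 0" using e by simp
    obtain N1 where N1: "\<And>n m. n \<ge> N1 \<Longrightarrow> m \<ge> N1 \<Longrightarrow> ip_sq M (\<lambda>r. w n r - w m r) < e / (2 * (\<bar>\<nu>\<bar> + 1))"
      using IC[OF e'] by blast
    obtain N2 where N2: "\<And>n m. n \<ge> N2 \<Longrightarrow> m \<ge> N2 \<Longrightarrow> R n m < e / 2" using RC[of "e / 2"] e by auto
    have "energy_sq M (\<lambda>r. w n r - w m r) < e" if "n \<ge> max N1 N2" "m \<ge> max N1 N2" for n m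
    proof -
      have "\<bar>\<nu>\<bar> * ip_sq M (\<lambda>r. w n r - w m r) \<le> \<bar>\<nu>\<bar> * (e / (2 * (\<bar>\<nu>\<bar> + 1)))"
        using N1[of n m] that by (intro mult_left_mono) auto
      also have "\<dots> \<le> e / 2" using e by (simp add: field_simps)
      finally show ?thesis using ctl(2)[of n m] N2[of n m] that by simp
    qed
    then show ?thesis by blast
  qed
  obtain u where u: "u \<in> calH_0M M" and uE: "(\<lambda>n. energy_sq M (\<lambda>r. w n r - u r)) \<longlonglongrightarrow> 0"
    and uI: "(\<lambda>n. ip_sq M (\<lambda>r. w n r - u r)) \<longlonglongrightarrow> 0"
    using calH_0M_complete[OF M w(1) lim EC IC] by blast
  have u1: "ip_M M u u = 1"
    using V.I.tendsto_form(2)[OF ip_M_nonneg w(1) u uI] by (simp add: w(2) LIMSEQ_const_iff)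
  have uo: "ip_M M u (\<psi> j) = 0" if "j \<in> {1..<i}" for j
    using V.I.tendsto_form(1)[OF ip_M_nonneg w(1) u uI \<psi>H[OF that]] by (simp add: w(4)[OF that] LIMSEQ_const_iff)
  \<comment> \<open>The form itself may be indefinite; adding C times \<open>ip_M\<close> makes it
    semidefinite, so that its values converge along the sequence.\<close>
  interpret T: sym_form "calH_0M M" "\<lambda>u v. form_M M a u v + C * ip_M M u v"
    by (intro sym_form_add V.Q.sym_form_axioms V.I.linear_combination)
  have Tnn: "0 \<le> form_M M a v v + C * ip_M M v v" if "v \<in> calH_0M M" for v
    using potential_bound(2)[OF a C(2,1) that] energy_nonneg[of M v] by (simp add: form_M_eq[OF a that that])
  have "(\<lambda>n. form_M M a (\<lambda>r. w n r - u r) (\<lambda>r. w n r - u r) + C * ip_sq M (\<lambda>r. w n r - u r)) \<longlonglongrightarrow> 0"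
  proof (rule Lim_null_comparison)
    have dH': "(\<lambda>r. w n r - u r) \<in> calH_0M M" for n by (rule calH_0M_diff(1)[OF w(1) u])
    show "\<forall>\<^sub>F n in sequentially. norm (form_M M a (\<lambda>r. w n r - u r) (\<lambda>r. w n r - u r) + C * ip_sq M (\<lambda>r. w n r - u r))
      \<le> energy_sq M (\<lambda>r. w n r - u r) + 2 * C * ip_sq M (\<lambda>r. w n r - u r)"
      using Tnn[OF dH'] potential_bound(2)[OF a C(2,1) dH']
      by (intro always_eventually allI) (simp add: form_M_eq[OF a dH' dH'] abs_le_iff)
    have "(\<lambda>n. energy_sq M (\<lambda>r. w n r - u r) + 2 * C * ip_sq M (\<lambda>r. w n r - u r)) \<longlonglongrightarrow> 0 + 2 * C * 0"
      by (intro tendsto_intros uE uI)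
    then show "(\<lambda>n. energy_sq M (\<lambda>r. w n r - u r) + 2 * C * ip_sq M (\<lambda>r. w n r - u r)) \<longlonglongrightarrow> 0" by simp
  qed
  from T.tendsto_form(2)[OF Tnn w(1) u this]
  have lim1: "(\<lambda>n. form_M M a (w n) (w n) + C) \<longlonglongrightarrow> form_M M a u u + C" by (simp add: w(2) u1)
  have "(\<lambda>n. \<nu> + 1 / real (Suc n) + C) \<longlonglongrightarrow> \<nu> + 0 + C"
    by (intro tendsto_intros LIMSEQ_Suc[OF lim_1_over_n])
  from LIMSEQ_le[OF lim1 this] have "form_M M a u u + C \<le> \<nu> + 0 + C"
    using less_imp_le[OF w(5)] by (auto intro!: exI[of _ 0])
  moreover have "\<nu> * ip_M M u u \<le> form_M M a u u"
    unfolding \<nu>eq[symmetric] by (rule V.min_level_le[OF u uo])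
  ultimately have "form_M M a u u = \<nu> * ip_M M u u" using u1 by simp
  then show ?thesis using that[OF u uo u1] by (simp add: \<nu>_def)
qed

section \<open>The ordinary differential equation\<close>

text \<open>\<open>P = r\<^bsup>M-1\<^esup> u'\<close>, so that \<open>(u, P)\<close> solves a first order system with bounded coefficients on
  each \<open>[\<delta>, 1]\<close>.\<close>

definition solution :: "real \<Rightarrow> (real \<Rightarrow> real) \<Rightarrow> real \<Rightarrow> (real \<Rightarrow> real) \<Rightarrow> (real \<Rightarrow> real) \<Rightarrow> bool" where
  "solution M a \<nu> u P \<longleftrightarrow> acd u (\<lambda>r. P r * r powr (1 - M)) \<and>
     acd P (\<lambda>r. - (a r * r powr (M - 1) + \<nu> * r powr (M - 3)) * u r)"

lemma test_function_calH:
  assumes "\<phi> \<in> test_functions {0<..<1}"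
  shows "\<phi> \<in> calH_0M M" "AE r in leb01. wd \<phi> r = partial_deriv 1 \<phi> r"
proof -
  obtain \<alpha> \<beta> where sm: "smooth \<phi>" and ab: "0 < \<alpha>" "\<alpha> < \<beta>" "\<beta> < 1"
    and z: "\<And>x. x \<notin> {\<alpha><..<\<beta>} \<Longrightarrow> \<phi> x = 0" "\<And>x. x \<notin> {\<alpha><..<\<beta>} \<Longrightarrow> partial_deriv 1 \<phi> x = 0"
    using assms by (rule test_function_01E) blast
  have L: "h \<in> L2_M M'" if "continuous_on UNIV h" "\<And>x. x \<notin> {\<alpha><..<\<beta>} \<Longrightarrow> h x = 0" for h M'
  proof -
    have hm: "h \<in> borel_measurable leb01"
      by (intro continuous_imp_measurable_on_sets_lebesgue continuous_on_subset[OF that(1)]) auto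
    have "continuous_on {\<alpha>..\<beta>} (\<lambda>r. r powr (M' - 1) * (h r)^2)"
      using ab by (intro continuous_intros continuous_on_subset[OF that(1)]) auto
    then have "integrable (lebesgue_on {\<alpha>..\<beta>}) (\<lambda>r. r powr (M' - 1) * (h r)^2)"
      by (rule iffD1[OF abs_integrable_iff absolutely_integrable_continuous_real, rotated]) simp
    then have "integrable leb01 (\<lambda>r. r powr (M' - 1) * (h r)^2)"
      by (rule iffD2[OF LINT_lebesgue_on_support(2), rotated -1]) (use ab that(2) in auto)
    with hm show ?thesis by (simp add: L2_M_def)
  qed
  have 1: "\<phi> 1 = 0" using z ab by simp
  have 2: "partial_deriv 1 \<phi> \<in> L2_M M" by (rule L[OF smooth_continuous[OF smooth_partial_deriv_real[OF sm]]]) (rule z)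
  have 3: "\<phi> \<in> calL_M M" unfolding calL_M_eq by (rule L[OF smooth_continuous[OF sm]]) (rule z)
  show "\<phi> \<in> calH_0M M" "AE r in leb01. wd \<phi> r = partial_deriv 1 \<phi> r"
    by (rule calH_0M_I[OF smooth_acd[OF sm] 1 2 3])+
qed

lemma coefficient_abs_integrable:
  assumes a: "a \<in> Linfty {0<..<1}" and x: "0 < x" "x \<le> 1" and u: "continuous_on {0<..1} u"
  shows "(\<lambda>r. (a r * r powr (M - 1) + \<nu> * r powr (M - 3)) * u r) absolutely_integrable_on {x..1}"
proof -
  obtain C where C: "C \<ge> 0" "AE r in leb01. \<bar>a r\<bar> \<le> C" using Linfty_bound[OF a] by blast
  have am: "a \<in> borel_measurable leb01" using a by (simp add: Linfty_def)
  have "integrable leb01 a"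
    by (rule Bochner_Integration.integrable_bound[OF integrable_const_01[of C] am]) (use C in auto)
  from absolutely_integrable_on_subinterval[OF integrable_01_abs[OF this], where a=x and b=1]
  have ai: "a absolutely_integrable_on {x..1}" using x by auto
  have cu: "continuous_on {x..1} u" by (rule continuous_on_subset[OF u]) (use x in auto)
  have "(\<lambda>r. a r * (r powr (M - 1) * u r)) absolutely_integrable_on {x..1}"
    by (rule absolutely_integrable_mult_continuous[OF ai]) (use x in \<open>auto intro!: continuous_intros cu\<close>)
  moreover have "(\<lambda>r. \<nu> * r powr (M - 3) * u r) absolutely_integrable_on {x..1}"
    by (rule absolutely_integrable_continuous_real) (use x in \<open>auto intro!: continuous_intros cu\<close>)
  ultimately have "(\<lambda>r. a r * (r powr (M - 1) * u r) + \<nu> * r powr (M - 3) * u r) absolutely_integrable_on {x..1}"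
    by (rule set_integral_add(1))
  then show ?thesis by (simp add: algebra_simps)
qed

text \<open>Testing with smooth compactly supported functions says that r^(M-1) u' has a weak
  derivative that is integrable on every [x,1]; \<open>P\<close> is its continuous
  representative.\<close>

theorem eigenfunction_solution:
  assumes a: "a \<in> Linfty {0<..<1}" and u: "u \<in> eigenspace_M M a \<nu>"
  obtains P where "solution M a \<nu> u P" "AE r in leb01. r powr (M - 1) * wd u r = P r"
proof -
  have uH: "u \<in> calH_0M M" and eq: "\<And>\<phi>. \<phi> \<in> calH_0M M \<Longrightarrow> form_M M a u \<phi> = \<nu> * ip_M M u \<phi>"
    using u by (auto simp: eigenspace_M_def eigenspace_def)
  note ua = calH_0M_acd[OF uH]
  define F where "F = (\<lambda>r. (a r * r powr (M - 1) + \<nu> * r powr (M - 3)) * u r)"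
  have Fi: "F absolutely_integrable_on {x..1}" if "0 < x" "x \<le> 1" for x
    unfolding F_def by (rule coefficient_abs_integrable[OF a that acd_continuous[OF ua(1)]])
  have nFi: "(\<lambda>r. - F r) absolutely_integrable_on {x..1}" if "0 < x" "x \<le> 1" for x
  proof -
    have "(\<lambda>r. (-1) * F r) absolutely_integrable_on {x..1}"
      by (rule set_integrable_mult_right) (rule Fi[OF that])
    then show ?thesis by simp
  qed
  have Fl: "locally_integrable {0<..<1} (\<lambda>r. - F r)"
  proof (rule locally_integrable_01)
    fix x b :: real assume "0 < x" "b < 1"
    then show "(\<lambda>r. - F r) absolutely_integrable_on {x..b}"
      using absolutely_integrable_on_subinterval[OF nFi[of x], where a=x and b=b] by (cases "x \<le> 1") auto
  qed
  have "weak_gradient {0<..<1} (\<lambda>r. r powr (M - 1) * wd u r) (\<lambda>r. - F r)"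
    unfolding weak_gradient_real
  proof (intro conjI ballI Fl)
    show "locally_integrable {0<..<1} (\<lambda>r. r powr (M - 1) * wd u r)"
    proof (rule locally_integrable_01)
      fix x b :: real assume x: "0 < x" "b < 1"
      have "(\<lambda>r. wd u r * r powr (M - 1)) absolutely_integrable_on {x..b}"
        by (rule absolutely_integrable_mult_continuous[OF acd_abs_integrable[OF ua(1) x(1)]]) (use x in \<open>auto intro!: continuous_intros\<close>)
      then show "(\<lambda>r. r powr (M - 1) * wd u r) absolutely_integrable_on {x..b}" by (simp add: mult.commute)
    qed
    fix \<phi> :: "real \<Rightarrow> real" assume \<phi>: "\<phi> \<in> test_functions {0<..<1}"
    note \<phi>H = test_function_calH(1)[OF \<phi>, of M] test_function_calH(2)[OF \<phi>]
    have "(LINT r|leb01. r powr (M - 1) * wd u r * partial_deriv 1 \<phi> r) = energy M u \<phi>"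
      unfolding energy_def
    proof (rule integral_cong_AE)
      show "AE r in leb01. r powr (M - 1) * wd u r * partial_deriv 1 \<phi> r = r powr (M - 1) * wd u r * wd \<phi> r"
        using \<phi>H(2) by eventually_elim simp
      have "partial_deriv 1 \<phi> \<in> borel_measurable leb01"
        by (rule borel_measurable_lebesgue_on_AE[OF calH_0M_measurable(2)[OF \<phi>H(1)] _ \<phi>H(2)]) simp
      then show "(\<lambda>r. r powr (M - 1) * wd u r * partial_deriv 1 \<phi> r) \<in> borel_measurable leb01"
        using calH_0M_measurable(2)[OF uH] by measurable
    qed (use calH_0M_measurable[OF uH] calH_0M_measurable[OF \<phi>H(1)] in measurable)
    also have "\<dots> = potential M a u \<phi> + \<nu> * ip_M M u \<phi>"
      using eq[OF \<phi>H(1)] form_M_eq[OF a uH \<phi>H(1)] by simp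
    also have "\<dots> = (LINT r|leb01. r powr (M - 1) * a r * u r * \<phi> r + \<nu> * (r powr (M - 3) * u r * \<phi> r))"
      unfolding potential_def ip_M_def
      using calH_0M_integrable(2)[OF uH \<phi>H(1)] calH_0M_integrable(4)[OF uH \<phi>H(1) a] by simp
    also have "\<dots> = (LINT r|leb01. F r * \<phi> r)"
      by (rule Bochner_Integration.integral_cong[OF refl]) (simp add: F_def algebra_simps)
    finally show "(LINT r|leb01. r powr (M - 1) * wd u r * partial_deriv 1 \<phi> r) = - (LINT r|leb01. - F r * \<phi> r)"
      by simp
  qed
  from weak_gradient_acd[OF this nFi] obtain c where
    c: "acd (\<lambda>x. c - integral {x..1} (\<lambda>r. - F r)) (\<lambda>r. - F r)"
      "AE r in leb01. r powr (M - 1) * wd u r = c - integral {r..1} (\<lambda>r. - F r)"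
    by blast
  define P where "P x = c - integral {x..1} (\<lambda>r. - F r)" for x
  have PAE: "AE r in leb01. r powr (M - 1) * wd u r = P r" using c(2) by (simp add: P_def)
  have "AE r in leb01. wd u r = P r * r powr (1 - M)"
    using PAE AE_space
  proof eventually_elim
    case (elim r)
    then have r: "r > 0" by (simp add: space_restrict_space)
    have "P r * r powr (1 - M) = wd u r * (r powr (M - 1) * r powr (1 - M))" by (simp add: elim(1)[symmetric])
    then show ?case using r by (simp flip: powr_add)
  qed
  then have "acd u (\<lambda>r. P r * r powr (1 - M))" by (rule acd_cong_AE[OF ua(1)])
  moreover have "acd P (\<lambda>r. - (a r * r powr (M - 1) + \<nu> * r powr (M - 3)) * u r)"
    using c(1) unfolding P_def[symmetric] by (simp only: F_def mult_minus_left)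
  ultimately have "solution M a \<nu> u P" by (simp add: solution_def)
  then show ?thesis using PAE that by blast
qed

section \<open>Uniqueness from Cauchy data\<close>

lemma solution_lin:
  assumes "solution M a \<nu> u P" "solution M a \<nu> w R"
  shows "solution M a \<nu> (\<lambda>r. u r + t * w r) (\<lambda>r. P r + t * R r)"
proof -
  have "acd (\<lambda>r. u r + t * w r) (\<lambda>r. P r * r powr (1 - M) + t * (R r * r powr (1 - M)))"
    using assms by (intro acd_add acd_cmult) (auto simp: solution_def)
  moreover have "acd (\<lambda>r. P r + t * R r) (\<lambda>r. - (a r * r powr (M - 1) + \<nu> * r powr (M - 3)) * u r + t * (- (a r * r powr (M - 1) + \<nu> * r powr (M - 3)) * w r))"
    using assms by (intro acd_add acd_cmult) (auto simp: solution_def)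
  ultimately show ?thesis unfolding solution_def by (simp add: algebra_simps)
qed

text \<open>The integral E of e satisfies E' <= K E, so E exp(-K y) is nonincreasing; it starts at 0
  while E is nonnegative.\<close>

lemma gronwall_zero:
  fixes e :: "real \<Rightarrow> real"
  assumes "x0 \<le> b" and cont: "continuous_on {x0..b} e" and nn: "\<And>y. y \<in> {x0..b} \<Longrightarrow> 0 \<le> e y"
    and le: "\<And>y. y \<in> {x0..b} \<Longrightarrow> e y \<le> K * integral {x0..y} e" and "y \<in> {x0..b}"
  shows "e y = 0"
proof -
  define E where "E y = integral {x0..y} e" for y
  have ei: "e integrable_on {x0..b}" by (rule integrable_continuous_real[OF cont])
  have E0: "E y \<ge> 0" if "y \<in> {x0..b}" for y
    unfolding E_def using that nn
    by (intro Henstock_Kurzweil_Integration.integral_nonneg integrable_on_subinterval[OF ei]) auto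
  have dE: "(E has_real_derivative e y) (at y within {x0..b})" if "y \<in> {x0..b}" for y
    unfolding E_def has_real_derivative_iff_has_vector_derivative
    by (rule integral_has_vector_derivative[OF cont that])
  define G where "G y = E y * exp (- K * y)" for y
  have dG: "(G has_real_derivative (e y - K * E y) * exp (- K * y)) (at y within {x0..b})" if "y \<in> {x0..b}" for y
    unfolding G_def by (rule derivative_eq_intros dE[OF that] refl)+ (simp add: algebra_simps)
  have "\<exists>z\<in>{x0..y}. G y - G x0 = ((e z - K * E z) * exp (- K * z)) * (y - x0)"
  proof (rule mvt_very_simple)
    show "x0 \<le> y" using assms(5) by simp
    show "(G has_derivative (\<lambda>h. ((e z - K * E z) * exp (- K * z)) * h)) (at z within {x0..y})" if "x0 \<le> z" "z \<le> y" for z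
      using DERIV_subset[OF dG[of z], of "{x0..y}"] that assms(5) by (auto simp: has_field_derivative_def)
  qed
  then obtain z where z: "z \<in> {x0..y}" "G y - G x0 = ((e z - K * E z) * exp (- K * z)) * (y - x0)" by blast
  have "e z - K * E z \<le> 0" using le[of z] z(1) assms(5) by (auto simp: E_def)
  then have "(e z - K * E z) * exp (- K * z) \<le> 0" by (intro mult_nonpos_nonneg) auto
  then have "((e z - K * E z) * exp (- K * z)) * (y - x0) \<le> 0"
    by (rule mult_nonpos_nonneg) (use assms(5) in auto)
  moreover have "G x0 = 0" by (simp add: G_def E_def)
  ultimately have "E y * exp (- K * y) \<le> 0" using z(2) by (simp add: G_def)
  then have "E y \<le> 0" by (simp add: mult_le_0_iff)
  then have "E y = 0" using E0[OF assms(5)] by simp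
  then show ?thesis using le[OF assms(5)] nn[OF assms(5)] by (simp add: E_def)
qed

lemma gronwall_zero_backwards:
  fixes e :: "real \<Rightarrow> real"
  assumes "b \<le> x0" and cont: "continuous_on {b..x0} e" and nn: "\<And>y. y \<in> {b..x0} \<Longrightarrow> 0 \<le> e y"
    and le: "\<And>y. y \<in> {b..x0} \<Longrightarrow> e y \<le> K * integral {y..x0} e" and "y \<in> {b..x0}"
  shows "e y = 0"
proof -
  have "e (- (- y)) = 0"
  proof (rule gronwall_zero[where ?x0.0="-x0" and b="-b" and K=K and e="\<lambda>t. e (- t)"])
    show "continuous_on {- x0..- b} (\<lambda>t. e (- t))"
      by (rule continuous_on_compose2[OF cont]) (auto intro!: continuous_intros)
    show "e (- t) \<le> K * integral {- x0..t} (\<lambda>t. e (- t))" if "t \<in> {- x0..- b}" for t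
      using le[of "- t"] that Henstock_Kurzweil_Integration.integral_reflect_real[of x0 "- t" e] by simp
  qed (use assms in auto)
  then show ?thesis by simp
qed

text \<open>The bound on \<open>a\<close> holds only almost everywhere. Clamping changes
  \<open>a\<close> on a null set, which \<open>acd\<close> does not see, and gives a bound at every
  point for estimates under the integral.\<close>

lemma solution_bounded_coefficient:
  assumes "solution M a \<nu> u P" "AE r in leb01. \<bar>a r\<bar> \<le> C"
  shows "solution M (\<lambda>r. max (- C) (min C (a r))) \<nu> u P"
proof -
  have AE: "AE r in leb01. - (a r * r powr (M - 1) + \<nu> * r powr (M - 3)) * u r = - (max (- C) (min C (a r)) * r powr (M - 1) + \<nu> * r powr (M - 3)) * u r"
    using assms(2) by eventually_elim (simp add: abs_le_iff max_def min_def)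
  then show ?thesis using acd_cong_AE[OF conjunct2[OF assms(1)[unfolded solution_def]] AE] assms(1) by (simp add: solution_def)
qed

lemma solution_continuous:
  assumes "solution M a \<nu> u P" shows "continuous_on {0<..1} u" "continuous_on {0<..1} P"
  using assms acd_continuous by (auto simp: solution_def)

text \<open>Gronwall for |u| + |P|, run to the right and to the left of \<open>x0\<close>. On [d,1]
  the coefficients are bounded although they may blow up at 0, and d > 0 is arbitrary.\<close>

theorem solution_unique:
  assumes sol: "solution M a \<nu> u P" and a: "a \<in> Linfty {0<..<1}" and x0: "0 < x0" "x0 \<le> 1" "u x0 = 0" "P x0 = 0"
    and y: "0 < y" "y \<le> 1"
  shows "u y = 0" "P y = 0"
proof -
  obtain C where C: "C \<ge> 0" "AE r in leb01. \<bar>a r\<bar> \<le> C" using Linfty_bound[OF a] by blast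
  define b where "b r = max (- C) (min C (a r))" for r
  have bC: "\<bar>b r\<bar> \<le> C" for r using C(1) by (auto simp: b_def)
  have "solution M b \<nu> u P" unfolding b_def by (rule solution_bounded_coefficient[OF sol C(2)])
  then have au: "acd u (\<lambda>r. P r * r powr (1 - M))" and aP: "acd P (\<lambda>r. - (b r * r powr (M - 1) + \<nu> * r powr (M - 3)) * u r)"
    by (auto simp: solution_def)
  define d where "d = min x0 y"
  have d: "0 < d" "d \<le> x0" "d \<le> y" "d \<le> 1" using x0 y by (auto simp: d_def)
  \<comment> \<open>One continuous majorant for the coefficients of both equations, so a single
    constant \<open>K\<close> serves.\<close>
  define k where "k r = C * r powr (M - 1) + \<bar>\<nu>\<bar> * r powr (M - 3) + r powr (1 - M)" for r
  have "continuous_on {d..1} k" unfolding k_def using d by (auto intro!: continuous_intros)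
  then have "compact (k ` {d..1})" by (rule compact_continuous_image) simp
  then obtain K where K: "\<And>r. r \<in> {d..1} \<Longrightarrow> \<bar>k r\<bar> \<le> K"
    using compact_imp_bounded bounded_iff by (metis imageI real_norm_def)
  have k1: "r powr (1 - M) \<le> K" "\<bar>b r * r powr (M - 1) + \<nu> * r powr (M - 3)\<bar> \<le> K" if "r \<in> {d..1}" for r
  proof -
    have "\<bar>b r * r powr (M - 1) + \<nu> * r powr (M - 3)\<bar> \<le> \<bar>b r\<bar> * r powr (M - 1) + \<bar>\<nu>\<bar> * r powr (M - 3)"
      by (rule order_trans[OF abs_triangle_ineq]) (simp add: abs_mult)
    also have "\<dots> \<le> C * r powr (M - 1) + \<bar>\<nu>\<bar> * r powr (M - 3)" by (intro add_right_mono mult_right_mono bC) auto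
    finally have 1: "\<bar>b r * r powr (M - 1) + \<nu> * r powr (M - 3)\<bar> \<le> C * r powr (M - 1) + \<bar>\<nu>\<bar> * r powr (M - 3)" .
    have 2: "0 \<le> C * r powr (M - 1) + \<bar>\<nu>\<bar> * r powr (M - 3)" "0 \<le> r powr (1 - M)" using C(1) by auto
    have 3: "k r \<le> K" using K[OF that] by simp
    show "r powr (1 - M) \<le> K" using 2 3 unfolding k_def by linarith
    show "\<bar>b r * r powr (M - 1) + \<nu> * r powr (M - 3)\<bar> \<le> K" using 1 2 3 unfolding k_def by linarith
  qed
  have K0: "0 \<le> K" using K[of 1] d by (auto intro: order_trans[OF abs_ge_zero])
  define e where "e r = \<bar>u r\<bar> + \<bar>P r\<bar>" for r
  have cu: "continuous_on {d..1} u" "continuous_on {d..1} P"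
    by (rule continuous_on_subset[OF acd_continuous[OF au]] continuous_on_subset[OF acd_continuous[OF aP]], use d in auto)+
  have ce: "continuous_on {s..t} e" if "d \<le> s" "t \<le> 1" for s t
    unfolding e_def by (intro continuous_intros continuous_on_subset[OF cu(1)] continuous_on_subset[OF cu(2)]) (use that in auto)
  have inc: "\<bar>u t - u s\<bar> + \<bar>P t - P s\<bar> \<le> K * integral {s..t} e" if st: "d \<le> s" "s \<le> t" "t \<le> 1" for s t
  proof -
    have cs: "continuous_on {s..t} u" "continuous_on {s..t} P"
      by (rule continuous_on_subset[OF cu(1)] continuous_on_subset[OF cu(2)], use st in auto)+
    have s0: "0 < s" using st d by simp
    have "\<bar>integral {s..t} (\<lambda>r. P r * r powr (1 - M))\<bar> \<le> integral {s..t} (\<lambda>r. K * \<bar>P r\<bar>)"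
    proof (rule hk_abs_bound[OF acd_integrable[OF au s0 st(3)]])
      show "(\<lambda>r. K * \<bar>P r\<bar>) integrable_on {s..t}" by (intro integrable_continuous_real continuous_intros cs)
      show "\<bar>P r * r powr (1 - M)\<bar> \<le> K * \<bar>P r\<bar>" if "r \<in> {s..t}" for r
        using k1(1)[of r] that st by (simp add: abs_mult mult.commute[of K] mult_left_mono)
    qed
    moreover have "\<bar>integral {s..t} (\<lambda>r. - (b r * r powr (M - 1) + \<nu> * r powr (M - 3)) * u r)\<bar> \<le> integral {s..t} (\<lambda>r. K * \<bar>u r\<bar>)"
    proof (rule hk_abs_bound[OF acd_integrable[OF aP s0 st(3)]])
      show "(\<lambda>r. K * \<bar>u r\<bar>) integrable_on {s..t}" by (intro integrable_continuous_real continuous_intros cs)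
      show "\<bar>- (b r * r powr (M - 1) + \<nu> * r powr (M - 3)) * u r\<bar> \<le> K * \<bar>u r\<bar>" if "r \<in> {s..t}" for r
        unfolding abs_mult abs_minus_cancel by (intro mult_right_mono k1(2)) (use that st in auto)
    qed
    moreover have "integral {s..t} (\<lambda>r. K * \<bar>P r\<bar>) + integral {s..t} (\<lambda>r. K * \<bar>u r\<bar>) = integral {s..t} (\<lambda>r. K * \<bar>P r\<bar> + K * \<bar>u r\<bar>)"
      by (intro Henstock_Kurzweil_Integration.integral_add[symmetric] integrable_continuous_real continuous_intros cs)
    moreover have "(\<lambda>r. K * \<bar>P r\<bar> + K * \<bar>u r\<bar>) = (\<lambda>r. K * e r)" by (auto simp: e_def algebra_simps)
    ultimately show ?thesis
      using acd_integral[OF au s0 st(2,3)] acd_integral[OF aP s0 st(2,3)] by simp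
  qed
  have "e y = 0"
  proof (cases "x0 \<le> y")
    case True
    show ?thesis
    proof (rule gronwall_zero[OF _ ce])
      show "e t \<le> K * integral {x0..t} e" if "t \<in> {x0..1}" for t
        using inc[of x0 t] that d x0 by (simp add: e_def)
    qed (use True y d x0 in \<open>auto simp: e_def\<close>)
  next
    case False
    show ?thesis
    proof (rule gronwall_zero_backwards[OF _ ce])
      show "e t \<le> K * integral {t..x0} e" if "t \<in> {d..x0}" for t
        using inc[of t x0] that d x0 by (simp add: e_def)
    qed (use False y d x0 in \<open>auto simp: e_def\<close>)
  qed
  then show "u y = 0" "P y = 0" by (simp_all add: e_def)
qed

lemma acd_DERIV:
  assumes "acd v g" and g: "continuous_on {0<..<1} g" and x: "0 < x" "x < 1"
  shows "(v has_real_derivative g x) (at x)"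
proof -
  define c d where "c = x / 2" and "d = (x + 1) / 2"
  have cd: "0 < c" "c < x" "x < d" "d < 1" using x by (auto simp: c_def d_def)
  have "continuous_on {c..d} g" by (rule continuous_on_subset[OF g]) (use cd in auto)
  then have "((\<lambda>t. v c + integral {c..t} g) has_real_derivative g x) (at x within {c..d})"
    using cd by (auto intro!: derivative_eq_intros integral_has_real_derivative)
  then have "((\<lambda>t. v c + integral {c..t} g) has_real_derivative g x) (at x)"
    using cd by (simp add: at_within_Icc_at)
  then show ?thesis
    by (rule has_field_derivative_transform_within_open[where S="{c<..<d}"])
      (use cd acd_integral[OF assms(1), of c] in auto)
qed

lemma solution_DERIV:
  assumes "solution M a \<nu> u P" "0 < x" "x < 1"
  shows "(u has_real_derivative P x * x powr (1 - M)) (at x)"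
proof (rule acd_DERIV)
  show "acd u (\<lambda>r. P r * r powr (1 - M))" using assms by (simp add: solution_def)
  show "continuous_on {0<..<1} (\<lambda>r. P r * r powr (1 - M))"
    by (intro continuous_intros continuous_on_subset[OF solution_continuous(2)[OF assms(1)]]) auto
qed (use assms in auto)

text \<open>On such an interval the derivative is zero as well, hence so is \<open>P\<close>: one
  point with vanishing Cauchy data annihilates the solution.\<close>

lemma solution_zero_interval:
  assumes sol: "solution M a \<nu> u P" and a: "a \<in> Linfty {0<..<1}" and cd: "0 \<le> c" "c < d" "d \<le> 1"
    and z: "\<And>r. c < r \<Longrightarrow> r < d \<Longrightarrow> u r = 0" and y: "0 < y" "y \<le> 1"
  shows "u y = 0"
proof -
  define x where "x = (c + d) / 2"
  have x: "c < x" "x < d" "0 < x" "x < 1" using cd by (auto simp: x_def less_max_iff_disj min_less_iff_disj)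
  have "(u has_real_derivative 0) (at x)"
    by (rule has_field_derivative_transform_within_open[OF DERIV_const, where S="{c<..<d}"]) (use x z in auto)
  then have "P x * x powr (1 - M) = 0" using solution_DERIV[OF sol x(3,4)] DERIV_unique by blast
  then have "P x = 0" using x by simp
  then show ?thesis using solution_unique(1)[OF sol a, of x y] x z y by simp
qed

lemma nonzero_solution:
  assumes u: "u \<in> nonzero_on {0<..<1} H" and z: "\<And>y. 0 < y \<Longrightarrow> y < 1 \<Longrightarrow> u y = 0" shows False
  using u z by (auto simp: nonzero_on_def AE_lebesgue_on_iff)

theorem eigenspace_one_dimensional:
  assumes a: "a \<in> Linfty {0<..<1}" and u: "u \<in> nonzero_on {0<..<1} (eigenspace_M M a \<nu>)" and w: "w \<in> eigenspace_M M a \<nu>"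
  obtains c where "\<And>r. 0 < r \<Longrightarrow> r \<le> 1 \<Longrightarrow> w r = c * u r"
proof -
  have uE: "u \<in> eigenspace_M M a \<nu>" using u by (simp add: nonzero_on_def)
  obtain P where P: "solution M a \<nu> u P" using eigenfunction_solution[OF a uE] by blast
  obtain R where R: "solution M a \<nu> w R" using eigenfunction_solution[OF a w] by blast
  have 1: "u 1 = 0" "w 1 = 0" using uE w calH_0M_acd(3) by (auto simp: eigenspace_M_def eigenspace_def)
  have "P 1 \<noteq> 0"
  proof
    assume "P 1 = 0"
    then show False using nonzero_solution[OF u] solution_unique(1)[OF P a, of 1] 1 by auto
  qed
  define c where "c = R 1 / P 1"
  have "solution M a \<nu> (\<lambda>r. w r + (- c) * u r) (\<lambda>r. R r + (- c) * P r)" by (rule solution_lin[OF R P])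
  then have "w r + (- c) * u r = 0" if "0 < r" "r \<le> 1" for r
    by (rule solution_unique(1)[where ?x0.0=1]) (use a 1 that \<open>P 1 \<noteq> 0\<close> in \<open>auto simp: c_def\<close>)
  then show ?thesis using that[of c] by simp
qed

section \<open>Sturm comparison\<close>

lemma constant_sign:
  fixes f :: "real \<Rightarrow> real"
  assumes "continuous_on {\<alpha><..<\<beta>} f" "\<And>x. x \<in> {\<alpha><..<\<beta>} \<Longrightarrow> f x \<noteq> 0"
  shows "(\<forall>x\<in>{\<alpha><..<\<beta>}. 0 < f x) \<or> (\<forall>x\<in>{\<alpha><..<\<beta>}. f x < 0)"
proof (rule ccontr)
  assume "\<not> ?thesis"
  then obtain x y where xy: "x \<in> {\<alpha><..<\<beta>}" "f x \<le> 0" "y \<in> {\<alpha><..<\<beta>}" "0 \<le> f y" by (auto simp: not_less)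
  have "connected (f ` {\<alpha><..<\<beta>})" by (rule connected_continuous_image[OF assms(1)]) simp
  then have "{f x..f y} \<subseteq> f ` {\<alpha><..<\<beta>}" using xy by (intro connected_contains_Icc) auto
  then have "0 \<in> f ` {\<alpha><..<\<beta>}" using xy by auto
  then show False using assms(2) by auto
qed

lemma solution_scale:
  assumes "solution M a \<nu> u P" shows "solution M a \<nu> (\<lambda>r. c * u r) (\<lambda>r. c * P r)"
  using acd_cmult[of u "\<lambda>r. P r * r powr (1 - M)" c] acd_cmult[of P "\<lambda>r. - (a r * r powr (M - 1) + \<nu> * r powr (M - 3)) * u r" c] assms
  unfolding solution_def by (simp add: algebra_simps)

lemma not_integrable_reciprocal:
  assumes f: "integrable leb01 f" and d: "0 < d" "d \<le> 1" and \<eta>: "0 < \<eta>" and ge: "\<And>x. 0 < x \<Longrightarrow> x < d \<Longrightarrow> \<eta> / x \<le> \<bar>f x\<bar>"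
  shows False
proof -
  define J where "J = integral {0..1} (\<lambda>x. \<bar>f x\<bar>)"
  have fi: "(\<lambda>x. \<bar>f x\<bar>) integrable_on {0..1}"
    using integrable_01_abs[of "\<lambda>x. \<bar>f x\<bar>"] f set_lebesgue_integral_eq_integral(1) by blast
  have J0: "J \<ge> 0" unfolding J_def by (rule Henstock_Kurzweil_Integration.integral_nonneg[OF fi]) simp
  \<comment> \<open>Solves \<eta> ln((d/2)/\<epsilon>) = J + 1, so that the integral of \<eta>/x
    over [\<epsilon>, d/2] exceeds the total integral J of |f|.\<close>
  define \<epsilon> where "\<epsilon> = (d / 2) * exp (- ((J + 1) / \<eta>))"
  have "exp (- ((J + 1) / \<eta>)) \<le> 1" using J0 \<eta> by simp
  then have \<epsilon>: "0 < \<epsilon>" "\<epsilon> \<le> d / 2" using d by (auto simp: \<epsilon>_def intro: mult_left_le)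
  have "((\<lambda>x. \<eta> / x) has_integral (\<eta> * ln (d/2) - \<eta> * ln \<epsilon>)) {\<epsilon>..d/2}"
  proof (rule fundamental_theorem_of_calculus[OF \<epsilon>(2)])
    fix x assume "x \<in> {\<epsilon>..d/2}"
    then show "((\<lambda>x. \<eta> * ln x) has_vector_derivative \<eta> / x) (at x within {\<epsilon>..d/2})"
      using \<epsilon> unfolding has_real_derivative_iff_has_vector_derivative[symmetric]
      by (auto intro!: derivative_eq_intros)
  qed
  moreover have "ln \<epsilon> = ln (d/2) - (J + 1) / \<eta>" unfolding \<epsilon>_def by (subst ln_mult) (use d in auto)
  then have "\<eta> * ln (d/2) - \<eta> * ln \<epsilon> = J + 1" using \<eta> by (simp add: right_diff_distrib)
  ultimately have hi: "((\<lambda>x. \<eta> / x) has_integral (J + 1)) {\<epsilon>..d/2}" by simp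
  have sub: "(\<lambda>x. \<bar>f x\<bar>) integrable_on {\<epsilon>..d/2}" by (rule integrable_on_subinterval[OF fi]) (use \<epsilon> d in auto)
  have "J + 1 \<le> integral {\<epsilon>..d/2} (\<lambda>x. \<bar>f x\<bar>)"
    by (rule has_integral_le[OF hi integrable_integral[OF sub]]) (use ge \<epsilon> d in auto)
  also have "\<dots> \<le> J" unfolding J_def by (rule integral_subset_le[OF _ sub fi]) (use \<epsilon> d in auto)
  finally show False by simp
qed

text \<open>A wrong sign of \<open>P\<close> at the endpoint would persist nearby by continuity, and
  integrating P r^(1-M) would push \<open>u\<close> to the wrong side of zero. No one-sided
  derivative at the endpoint is needed.\<close>

lemma solution_end_sign:
  assumes sol: "solution M a \<nu> u P" and ab: "0 \<le> \<alpha>" "\<alpha> < \<beta>" "\<beta> \<le> 1" and pos: "\<And>x. \<alpha> < x \<Longrightarrow> x < \<beta> \<Longrightarrow> 0 < u x"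
  shows "u \<beta> = 0 \<Longrightarrow> P \<beta> \<le> 0" "0 < \<alpha> \<Longrightarrow> u \<alpha> = 0 \<Longrightarrow> 0 \<le> P \<alpha>"
proof -
  have au: "acd u (\<lambda>r. P r * r powr (1 - M))" using sol by (simp add: solution_def)
  note cP = solution_continuous(2)[OF sol]
  show "P \<beta> \<le> 0" if "u \<beta> = 0"
  proof (rule ccontr)
    assume "\<not> P \<beta> \<le> 0"
    then have "P \<beta> > 0" by simp
    have "\<beta> \<in> {0<..1}" using ab by simp
    then obtain \<delta> where \<delta>: "\<delta> > 0" "\<And>x. x \<in> {0<..1} \<Longrightarrow> dist x \<beta> < \<delta> \<Longrightarrow> dist (P x) (P \<beta>) < P \<beta>"
      using cP \<open>P \<beta> > 0\<close> unfolding continuous_on_iff by blast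
    define x where "x = max ((\<alpha> + \<beta>) / 2) (\<beta> - \<delta> / 2)"
    have x: "\<alpha> < x" "x < \<beta>" "\<beta> - \<delta> < x" using ab \<delta>(1) by (auto simp: x_def less_max_iff_disj min_less_iff_disj)
    have "0 \<le> integral {x..\<beta>} (\<lambda>r. P r * r powr (1 - M))"
    proof (rule Henstock_Kurzweil_Integration.integral_nonneg)
      show "(\<lambda>r. P r * r powr (1 - M)) integrable_on {x..\<beta>}" by (rule acd_integrable[OF au]) (use x ab in auto)
      fix r assume "r \<in> {x..\<beta>}"
      then have "dist (P r) (P \<beta>) < P \<beta>" by (intro \<delta>(2)) (use x ab in \<open>auto simp: dist_real_def\<close>)
      then show "0 \<le> P r * r powr (1 - M)" by (simp add: dist_real_def)
    qed
    also have "\<dots> = u \<beta> - u x" by (rule acd_integral[OF au]) (use x ab in auto)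
    finally show False using pos[of x] x that by simp
  qed
  show "0 \<le> P \<alpha>" if "0 < \<alpha>" "u \<alpha> = 0"
  proof (rule ccontr)
    assume "\<not> 0 \<le> P \<alpha>"
    then have "P \<alpha> < 0" by simp
    have "\<alpha> \<in> {0<..1}" using ab that by simp
    then obtain \<delta> where \<delta>: "\<delta> > 0" "\<And>x. x \<in> {0<..1} \<Longrightarrow> dist x \<alpha> < \<delta> \<Longrightarrow> dist (P x) (P \<alpha>) < - P \<alpha>"
      using cP \<open>P \<alpha> < 0\<close> unfolding continuous_on_iff by (metis neg_0_less_iff_less)
    define x where "x = min ((\<alpha> + \<beta>) / 2) (\<alpha> + \<delta> / 2)"
    have x: "\<alpha> < x" "x < \<beta>" "x < \<alpha> + \<delta>" using ab \<delta>(1) by (auto simp: x_def less_max_iff_disj min_less_iff_disj)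
    have "0 \<le> integral {\<alpha>..x} (\<lambda>r. - (P r * r powr (1 - M)))"
    proof (rule Henstock_Kurzweil_Integration.integral_nonneg)
      show "(\<lambda>r. - (P r * r powr (1 - M))) integrable_on {\<alpha>..x}"
        by (rule integrable_neg[OF acd_integrable[OF au]]) (use x ab that in auto)
      fix r assume "r \<in> {\<alpha>..x}"
      then have "dist (P r) (P \<alpha>) < - P \<alpha>" by (intro \<delta>(2)) (use x ab that in \<open>auto simp: dist_real_def\<close>)
      then have "P r \<le> 0" by (simp add: dist_real_def)
      then show "0 \<le> - (P r * r powr (1 - M))" using mult_nonpos_nonneg[of "P r" "r powr (1 - M)"] by simp
    qed
    also have "\<dots> = - (u x - u \<alpha>)" using acd_integral[OF au, of \<alpha> x] x ab that by simp
    finally show False using pos[of x] x that by simp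
  qed
qed

text \<open>The Wronskian \<open>W = P\<^sub>1 u\<^sub>2 - P\<^sub>2 u\<^sub>1\<close> has derivative \<open>(\<nu>\<^sub>2 - \<nu>\<^sub>1) r\<^bsup>M-3\<^esup> u\<^sub>1 u\<^sub>2 > 0\<close>.\<close>

lemma sturm_positive:
  assumes s1: "solution M a \<nu>1 u1 P1" and s2: "solution M a \<nu>2 u2 P2" and \<nu>: "\<nu>1 < \<nu>2"
    and ab: "0 \<le> \<alpha>" "\<alpha> < \<beta>" "\<beta> \<le> 1"
    and p1: "\<And>x. \<alpha> < x \<Longrightarrow> x < \<beta> \<Longrightarrow> 0 < u1 x" and p2: "\<And>x. \<alpha> < x \<Longrightarrow> x < \<beta> \<Longrightarrow> 0 < u2 x"
    and zb: "u1 \<beta> = 0" and za: "\<alpha> = 0 \<or> u1 \<alpha> = 0"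
    and int: "integrable leb01 (\<lambda>r. (P1 r * u2 r - P2 r * u1 r) / r)"
  shows False
proof -
  define W where "W r = P1 r * u2 r - P2 r * u1 r" for r
  define k where "k r = (\<nu>2 - \<nu>1) * r powr (M - 3) * u1 r * u2 r" for r
  have "acd W (\<lambda>r. ((- (a r * r powr (M - 1) + \<nu>1 * r powr (M - 3)) * u1 r) * u2 r + (P2 r * r powr (1 - M)) * P1 r) -
     ((- (a r * r powr (M - 1) + \<nu>2 * r powr (M - 3)) * u2 r) * u1 r + (P1 r * r powr (1 - M)) * P2 r))"
    unfolding W_def using s1 s2 by (intro acd_diff acd_mult) (auto simp: solution_def)
  then have aW: "acd W k" unfolding k_def by (simp add: algebra_simps)
  have c: "continuous_on {0<..1} u1" "continuous_on {0<..1} u2" using solution_continuous s1 s2 by blast+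
  have ck: "continuous_on {0<..<1} k"
    unfolding k_def by (intro continuous_intros continuous_on_subset[OF c(1)] continuous_on_subset[OF c(2)]) auto
  have inc: "W x < W y" if "\<alpha> \<le> x" "0 < x" "x < y" "y \<le> \<beta>" for x y
  proof (rule DERIV_pos_imp_increasing_open[OF that(3)])
    show "\<exists>l. DERIV W t :> l \<and> 0 < l" if "x < t" "t < y" for t
    proof (intro exI conjI)
      show "DERIV W t :> k t" by (rule acd_DERIV[OF aW ck]) (use that \<open>0 < x\<close> \<open>y \<le> \<beta>\<close> ab in auto)
      show "0 < k t" unfolding k_def using p1[of t] p2[of t] \<nu> that \<open>\<alpha> \<le> x\<close> \<open>0 < x\<close> \<open>y \<le> \<beta>\<close> by simp
    qed
    show "continuous_on {x..y} W" by (rule continuous_on_subset[OF acd_continuous[OF aW]]) (use that ab in auto)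
  qed
  have nn: "0 \<le> u2 x" if "\<alpha> \<le> x" "0 < x" "x \<le> \<beta>" for x
  proof -
    have "closure {\<alpha><..<\<beta>} = {\<alpha>..\<beta>}" using ab by simp
    \<comment> \<open>When \<alpha> = 0 the closure of (\<alpha>,\<beta>) contains 0, where
      \<open>u2\<close> need not be continuous; the left end is therefore moved up to x/2.\<close>
    define T where "T = {max \<alpha> (x/2)<..<\<beta>}"
    have T: "closure T = {max \<alpha> (x/2)..\<beta>}" unfolding T_def using ab that by (intro closure_greaterThanLessThan) auto
    show ?thesis
    proof (rule continuous_ge_on_closure[of T u2])
      show "continuous_on (closure T) u2" unfolding T by (rule continuous_on_subset[OF c(2)]) (use that ab in auto)
      show "x \<in> closure T" unfolding T using that by auto
      show "0 \<le> u2 t" if "t \<in> T" for t using p2[of t] that by (auto simp: T_def)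
    qed
  qed
  \<comment> \<open>At \<beta> only P1 u2 survives, a product of a nonpositive and a nonnegative
    number.\<close>
  have Wb: "W \<beta> \<le> 0"
    using solution_end_sign(1)[OF s1 ab p1 zb] nn[of \<beta>] ab zb by (simp add: W_def mult_nonpos_nonneg)
  show False
  proof (cases "\<alpha> = 0")
    case False
    \<comment> \<open>Likewise W is nonnegative at a zero \<alpha> > 0 of \<open>u1\<close>, against
      its strict increase towards a nonpositive value.\<close>
    then have "0 \<le> W \<alpha>"
      using solution_end_sign(2)[OF s1 ab p1] nn[of \<alpha>] za ab by (simp add: W_def)
    then show False using inc[of \<alpha> \<beta>] Wb ab False by simp
  next
    case True
    \<comment> \<open>At the singular end W has no boundary value. Being increasing and negative at
      \<beta>/2, it stays below a negative constant on (0,\<beta>/2), so |W|/r cannot be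
      integrable.\<close>
    have "W (\<beta>/2) < 0" using inc[of "\<beta>/2" \<beta>] Wb ab True by simp
    show False
    proof (rule not_integrable_reciprocal[OF int, of "\<beta>/2" "- W (\<beta>/2)"])
      show "- W (\<beta>/2) / x \<le> \<bar>(P1 x * u2 x - P2 x * u1 x) / x\<bar>" if "0 < x" "x < \<beta>/2" for x
      proof -
        have "- W (\<beta>/2) \<le> \<bar>W x\<bar>" using inc[of x "\<beta>/2"] that ab True by simp
        then have "- W (\<beta>/2) / x \<le> \<bar>W x\<bar> / x" using that by (intro divide_right_mono) auto
        then show ?thesis using that by (simp add: W_def abs_divide)
      qed
    qed (use ab \<open>W (\<beta>/2) < 0\<close> in auto)
  qed
qed

theorem sturm_zero:
  assumes a: "a \<in> Linfty {0<..<1}" and u1: "u1 \<in> eigenspace_M M a \<nu>1" and u2: "u2 \<in> eigenspace_M M a \<nu>2" and \<nu>: "\<nu>1 < \<nu>2"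
    and ab: "0 \<le> \<alpha>" "\<alpha> < \<beta>" "\<beta> \<le> 1"
    and n1: "\<And>x. x \<in> {\<alpha><..<\<beta>} \<Longrightarrow> u1 x \<noteq> 0" and zb: "u1 \<beta> = 0" and za: "\<alpha> = 0 \<or> u1 \<alpha> = 0"
  shows "\<exists>x\<in>{\<alpha><..<\<beta>}. u2 x = 0"
proof (rule ccontr)
  assume "\<not> ?thesis"
  then have n2: "\<And>x. x \<in> {\<alpha><..<\<beta>} \<Longrightarrow> u2 x \<noteq> 0" by blast
  obtain P1 where P1: "solution M a \<nu>1 u1 P1" "AE r in leb01. r powr (M - 1) * wd u1 r = P1 r" using eigenfunction_solution[OF a u1] by blast
  obtain P2 where P2: "solution M a \<nu>2 u2 P2" "AE r in leb01. r powr (M - 1) * wd u2 r = P2 r" using eigenfunction_solution[OF a u2] by blast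
  have H: "u1 \<in> calH_0M M" "u2 \<in> calH_0M M" using u1 u2 by (auto simp: eigenspace_M_def eigenspace_def)
  have c: "continuous_on {\<alpha><..<\<beta>} u1" "continuous_on {\<alpha><..<\<beta>} u2"
    by (rule continuous_on_subset[OF solution_continuous(1)[OF P1(1)]] continuous_on_subset[OF solution_continuous(1)[OF P2(1)]], use ab in auto)+
  \<comment> \<open>r^(M-1) (v/r)^2 = r^(M-3) v^2: this puts v/r into the same weighted L2 space as
    v' and makes W/r a combination of products of two such functions.\<close>
  have quot: "(\<lambda>r. v r / r) \<in> L2_M M" if "v \<in> calH_0M M" for v
  proof -
    have "integrable leb01 (\<lambda>r. r powr (M - 1) * (v r / r)^2) = integrable leb01 (\<lambda>r. r powr (M - 3) * (v r)^2)"
    proof (rule Bochner_Integration.integrable_cong[OF refl])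
      fix r assume "r \<in> space leb01"
      then have r: "r > 0" by (simp add: space_restrict_space)
      have "r powr (M - 1) = r powr (M - 3) * r\<^sup>2" using powr_add[of r "M - 3" 2] r by simp
      then show "r powr (M - 1) * (v r / r)^2 = r powr (M - 3) * (v r)^2" using r by (simp add: power_divide)
    qed
    then have "integrable leb01 (\<lambda>r. r powr (M - 1) * (v r / r)^2)"
      using calH_0M_acd(4)[OF that] by (simp add: calL_M_def)
    moreover have "(\<lambda>r. v r / r) \<in> borel_measurable leb01"
      by (intro borel_measurable_divide calH_0M_measurable(1)[OF that] continuous_imp_measurable_on_sets_lebesgue continuous_on_id) auto
    ultimately show ?thesis by (simp add: L2_M_def)
  qed
  have int: "integrable leb01 (\<lambda>r. (P1 r * u2 r - P2 r * u1 r) / r)"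
  proof (rule integrable_cong_AE_imp)
    show "integrable leb01 (\<lambda>r. r powr (M - 1) * wd u1 r * (u2 r / r) - r powr (M - 1) * wd u2 r * (u1 r / r))"
      by (intro Bochner_Integration.integrable_diff L2_M_mult_integrable quot H calH_0M_acd(2))
    show "AE r in leb01. r powr (M - 1) * wd u1 r * (u2 r / r) - r powr (M - 1) * wd u2 r * (u1 r / r) = (P1 r * u2 r - P2 r * u1 r) / r"
      using P1(2) P2(2) by eventually_elim (simp add: diff_divide_distrib)
    have cc: "continuous_on {0<..<1} h" if "continuous_on {0<..1} h" for h :: "real \<Rightarrow> real"
      by (rule continuous_on_subset[OF that]) auto
    show "(\<lambda>r. (P1 r * u2 r - P2 r * u1 r) / r) \<in> borel_measurable leb01"
      by (intro continuous_imp_measurable_on_sets_lebesgue continuous_intros cc solution_continuous[OF P1(1)] solution_continuous[OF P2(1)]) auto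
  qed
  \<comment> \<open>The signs make both functions positive; rescaling by them multiplies the
    Wronskian by s1 s2 only.\<close>
  obtain s1 where s1: "s1 = 1 \<or> s1 = (-1::real)" "\<And>x. x \<in> {\<alpha><..<\<beta>} \<Longrightarrow> 0 < s1 * u1 x"
    using constant_sign[OF c(1) n1] by (metis mult_1 mult_minus1 neg_0_less_iff_less)
  obtain s2 where s2: "s2 = 1 \<or> s2 = (-1::real)" "\<And>x. x \<in> {\<alpha><..<\<beta>} \<Longrightarrow> 0 < s2 * u2 x"
    using constant_sign[OF c(2) n2] by (metis mult_1 mult_minus1 neg_0_less_iff_less)
  have "(\<lambda>r. ((s1 * P1 r) * (s2 * u2 r) - (s2 * P2 r) * (s1 * u1 r)) / r) = (\<lambda>r. (s1 * s2) * ((P1 r * u2 r - P2 r * u1 r) / r))"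
    by (auto simp: algebra_simps diff_divide_distrib)
  then have int': "integrable leb01 (\<lambda>r. ((s1 * P1 r) * (s2 * u2 r) - (s2 * P2 r) * (s1 * u1 r)) / r)"
    by (simp only:) (intro integrable_mult_right int)
  show False
    by (rule sturm_positive[OF solution_scale[OF P1(1), of s1] solution_scale[OF P2(1), of s2] \<nu> ab _ _ _ _ int'])
      (use s1 s2 zb za in auto)
qed

section \<open>Counting zeros\<close>

text \<open>One unknown more than equations; Gaussian elimination on the last equation reduces n by
  one.\<close>

lemma homogeneous_system_nontrivial:
  fixes A :: "'l \<Rightarrow> nat \<Rightarrow> real"
  assumes "finite I" "card I = Suc n"
  shows "\<exists>d. (\<exists>l\<in>I. d l \<noteq> 0) \<and> (\<forall>j<n. (\<Sum>l\<in>I. d l * A l j) = 0)"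
  using assms
proof (induction n arbitrary: I A)
  case 0
  then obtain p where "I = {p}" by (auto simp: card_1_singleton_iff)
  then show ?case by (intro exI[of _ "\<lambda>_. 1"]) auto
next
  case (Suc n)
  show ?case
  proof (cases "\<forall>l\<in>I. A l n = 0")
    case True
    obtain p where p: "p \<in> I" using Suc.prems by (metis card.empty ex_in_conv nat.distinct(1))
    have I: "finite (I - {p})" "card (I - {p}) = Suc n" using Suc.prems p by auto
    obtain d where d: "\<exists>l\<in>I - {p}. d l \<noteq> 0" "\<And>j. j < n \<Longrightarrow> (\<Sum>l\<in>I - {p}. d l * A l j) = 0"
      using Suc.IH[OF I, of A] by blast
    define d' where "d' l = (if l = p then 0 else d l)" for l
    have "(\<Sum>l\<in>I. d' l * A l j) = 0" if "j < Suc n" for j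
    proof (cases "j = n")
      case False
      have "(\<Sum>l\<in>I. d' l * A l j) = d' p * A p j + (\<Sum>l\<in>I - {p}. d' l * A l j)"
        by (rule sum.remove) (use Suc.prems p in auto)
      also have "(\<Sum>l\<in>I - {p}. d' l * A l j) = (\<Sum>l\<in>I - {p}. d l * A l j)"
        by (rule sum.cong) (auto simp: d'_def)
      finally show ?thesis using d(2)[of j] that False by (simp add: d'_def)
    qed (use True in simp)
    moreover have "\<exists>l\<in>I. d' l \<noteq> 0" using d(1) by (auto simp: d'_def)
    ultimately show ?thesis by blast
  next
    case False
    then obtain p where p: "p \<in> I" "A p n \<noteq> 0" by blast
    have I: "finite (I - {p})" "card (I - {p}) = Suc n" using Suc.prems p by auto
    \<comment> \<open>Elimination of the unknown \<open>p\<close>, the pivot of equation n, from the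
      first n equations.\<close>
    define B where "B l j = A l j - A l n / A p n * A p j" for l j
    obtain d where d: "\<exists>l\<in>I - {p}. d l \<noteq> 0" "\<And>j. j < n \<Longrightarrow> (\<Sum>l\<in>I - {p}. d l * B l j) = 0"
      using Suc.IH[OF I, of B] by blast
    define s where "s = (\<Sum>l\<in>I - {p}. d l * A l n)"
    \<comment> \<open>The coefficient of the pivot is recovered so that equation n holds.\<close>
    define d' where "d' l = (if l = p then - s / A p n else d l)" for l
    have "(\<Sum>l\<in>I. d' l * A l j) = 0" if "j < Suc n" for j
    proof -
      have 1: "(\<Sum>l\<in>I. d' l * A l j) = - s / A p n * A p j + (\<Sum>l\<in>I - {p}. d l * A l j)"
      proof -
        have "(\<Sum>l\<in>I. d' l * A l j) = d' p * A p j + (\<Sum>l\<in>I - {p}. d' l * A l j)"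
          by (rule sum.remove) (use Suc.prems p in auto)
        also have "(\<Sum>l\<in>I - {p}. d' l * A l j) = (\<Sum>l\<in>I - {p}. d l * A l j)"
          by (rule sum.cong) (auto simp: d'_def)
        finally show ?thesis by (simp add: d'_def)
      qed
      show ?thesis
      proof (cases "j = n")
        case True
        then show ?thesis using 1 p by (simp add: s_def)
      next
        case False
        then have "(\<Sum>l\<in>I - {p}. d l * B l j) = 0" using d(2) that by simp
        moreover have "(\<Sum>l\<in>I - {p}. d l * B l j) = (\<Sum>l\<in>I - {p}. d l * A l j) - s * (A p j / A p n)"
          unfolding B_def s_def sum_distrib_right sum_subtractf[symmetric]
          by (rule sum.cong) (auto simp: algebra_simps)
        ultimately show ?thesis using 1 by simp
      qed
    qed
    moreover have "\<exists>l\<in>I. d' l \<noteq> 0" using d(1) by (auto simp: d'_def)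
    ultimately show ?thesis by blast
  qed
qed

text \<open>There are i coefficients against i - 1 orthogonality conditions. The linear system is
  indexed from 0 and the minimizers from 1, hence the shift by \<open>Suc\<close>.\<close>

lemma orthogonal_combination:
  assumes I: "finite I" "card I = i" "1 \<le> i" and f: "\<And>l. l \<in> I \<Longrightarrow> f l \<in> calH_0M M" and \<psi>: "\<And>j. j \<in> {1..<i} \<Longrightarrow> \<psi> j \<in> calH_0M M"
  obtains d where "\<exists>l\<in>I. d l \<noteq> 0" "(\<lambda>r. \<Sum>l\<in>I. d l * f l r) \<in> calH_0M M"
    "\<And>j. j \<in> {1..<i} \<Longrightarrow> ip_M M (\<lambda>r. \<Sum>l\<in>I. d l * f l r) (\<psi> j) = 0"
proof -
  interpret sym_form "calH_0M M" "ip_M M" by (rule sym_form_ip)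
  have ne: "I \<noteq> {}" using I by auto
  obtain d where d: "\<exists>l\<in>I. d l \<noteq> 0" "\<And>j. j < i - 1 \<Longrightarrow> (\<Sum>l\<in>I. d l * ip_M M (f l) (\<psi> (Suc j))) = 0"
    using homogeneous_system_nontrivial[of I "i - 1" "\<lambda>l j. ip_M M (f l) (\<psi> (Suc j))"] I by auto
  have "ip_M M (\<lambda>r. \<Sum>l\<in>I. d l * f l r) (\<psi> j) = 0" if j: "j \<in> {1..<i}" for j
  proof -
    have "j - 1 < i - 1" "Suc (j - 1) = j" using j by auto
    then show ?thesis using sum_left[where d=d and f=f, OF I(1) ne f \<psi>[OF j]] d(2)[of "j - 1"] by simp
  qed
  then show ?thesis using that[OF d(1) sum_mem[OF I(1) ne f]] by blast
qed

text \<open>Bumps with disjoint supports are independent, so a nontrivial combination of i of them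
  that is orthogonal to the earlier functions is nonzero.\<close>

lemma competitors_nonempty:
  assumes "1 \<le> i" and \<psi>: "\<And>j. j \<in> {1..<i} \<Longrightarrow> \<psi> j \<in> calH_0M M"
  shows "competitors (nonzero_on {0<..<1} (calH_0M M)) (ip_M M) \<psi> i \<noteq> {}"
proof -
  define h where "h l = box_bump (1 / (real l + 3)) (1 / (real l + 2)) 0" for l
  have ord: "1 / (real l + 3) < 1 / (real l + 2)" for l by (simp add: frac_less2)
  have hT: "h l \<in> test_functions {0<..<1}" for l
  proof -
    have "0 < 1 / (real l + 3)" "1 / (real l + 2) < 1" by simp_all
    then have "{1 / (real l + 3)..1 / (real l + 2)} \<subseteq> {0<..<1}"
      by (meson atLeastAtMost_iff greaterThanLessThan_iff le_less_trans less_le_trans subsetI)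
    then show ?thesis unfolding h_def by (intro box_bump_test_function) simp
  qed
  have out: "h l r = 0" if "r \<notin> {1 / (real l + 3)<..<1 / (real l + 2)}" for l r
    unfolding h_def using that by (intro box_bump_outside) auto
  obtain d where d: "\<exists>l\<in>{..<i}. d l \<noteq> 0" and wH: "(\<lambda>r. \<Sum>l<i. d l * h l r) \<in> calH_0M M"
    and orth: "\<And>j. j \<in> {1..<i} \<Longrightarrow> ip_M M (\<lambda>r. \<Sum>l<i. d l * h l r) (\<psi> j) = 0"
    using orthogonal_combination[of "{..<i}" i h M \<psi>] assms test_function_calH(1)[OF hT] by auto
  obtain l0 where l0: "l0 < i" "d l0 \<noteq> 0" using d by auto
  \<comment> \<open>The centre of the support of a bump with nonzero coefficient; all other bumps
    vanish there.\<close>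
  define x where "x = (1 / (real l0 + 3) + 1 / (real l0 + 2)) / 2"
  have x: "1 / (real l0 + 3) < x" "x < 1 / (real l0 + 2)" using ord[of l0] by (auto simp: x_def)
  have "1 / (real l0 + 2) \<le> 1" "0 < 1 / (real l0 + 3)" by simp_all
  then have "0 < x" "x \<le> 1" using x by linarith+
  then have x01: "x \<in> {0<..1}" by simp
  have "h l x = 0" if ne: "l \<noteq> l0" for l
  proof (rule out)
    consider "l + 1 \<le> l0" | "l0 + 1 \<le> l" using ne by linarith
    then show "x \<notin> {1 / (real l + 3)<..<1 / (real l + 2)}"
    proof cases
      case 1
      then have "real l + 3 \<le> real l0 + 2" by linarith
      then have "1 / (real l0 + 2) \<le> 1 / (real l + 3)" by (intro divide_left_mono) auto
      then show ?thesis using x by auto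
    next
      case 2
      then have "real l0 + 3 \<le> real l + 2" by linarith
      then have "1 / (real l + 2) \<le> 1 / (real l0 + 3)" by (intro divide_left_mono) auto
      then show ?thesis using x by auto
    qed
  qed
  then have "(\<Sum>l<i. d l * h l x) = (\<Sum>l<i. if l = l0 then d l0 * h l0 x else 0)" by (intro sum.cong) auto
  also have "\<dots> = d l0 * h l0 x" using l0 by simp
  finally have "(\<Sum>l<i. d l * h l x) \<noteq> 0"
    using l0 box_bump_pos[of x "1 / (real l0 + 3)" "1 / (real l0 + 2)" 0] x by (simp add: h_def)
  then have "(\<lambda>r. \<Sum>l<i. d l * h l r) \<in> nonzero_on {0<..<1} (calH_0M M)"
    using calH_0M_eqI[OF wH calH_0M_zero(1) _ x01] wH by (auto simp: nonzero_on_def)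
  then show ?thesis using orth by (auto simp: competitors_def)
qed

text \<open>Nested pieces on (0,c) instead of pieces between consecutive zeros: each needs a single
  zero of \<open>u\<close> and no ordering of the zeros.\<close>

definition truncate :: "real \<Rightarrow> (real \<Rightarrow> real) \<Rightarrow> real \<Rightarrow> real" where
  "truncate c u r = (if r < c then u r else 0)"

text \<open>Since \<open>u c = 0\<close> the cut creates no jump, so the truncated derivative is
  still the derivative of the truncation.\<close>

lemma truncate_calH:
  assumes u: "u \<in> calH_0M M" and c: "0 < c" "c < 1" "u c = 0"
  shows "truncate c u \<in> calH_0M M" "AE r in leb01. wd (truncate c u) r = truncate c (wd u) r"
proof -
  note ua = calH_0M_acd[OF u]
  have L2: "truncate c v \<in> L2_M M'" if v: "v \<in> L2_M M'" for v M'
  proof -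
    have s: "{..<c} \<inter> {0<..<1} \<in> sets leb01" using c by (auto simp: sets_restrict_space_iff)
    have eq: "truncate c v r = indicator ({..<c} \<inter> {0<..<1}) r * v r" if "r \<in> space leb01" for r
      using that by (auto simp: truncate_def indicator_def space_restrict_space)
    have m: "truncate c v \<in> borel_measurable leb01"
      by (subst measurable_cong[OF eq]) (assumption, rule borel_measurable_times[OF borel_measurable_indicator[OF s] L2_M_D(1)[OF v]])
    have "integrable leb01 (\<lambda>r. r powr (M' - 1) * (truncate c v r)^2)"
    proof (rule Bochner_Integration.integrable_bound[OF L2_M_D(2)[OF v]])
      show "(\<lambda>r. r powr (M' - 1) * (truncate c v r)^2) \<in> borel_measurable leb01"
        by (intro borel_measurable_times borel_measurable_powr_01 borel_measurable_power m)
    qed (auto simp: truncate_def)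
    with m show ?thesis by (simp add: L2_M_def)
  qed
  have acd: "acd (truncate c u) (truncate c (wd u))"
    unfolding acd_def
  proof (intro allI impI conjI)
    fix x :: real assume x: "0 < x" "x \<le> 1"
    have g: "wd u absolutely_integrable_on {x..1}" using acd_abs_integrable[OF ua(1) x(1)] by simp
    have "integrable lebesgue (\<lambda>r. indicator {..<c} r *\<^sub>R (indicator {x..1} r *\<^sub>R wd u r))"
      by (rule integrable_mult_indicator[OF _ g[unfolded set_integrable_def]]) simp
    moreover have "(\<lambda>r. indicator {..<c} r *\<^sub>R (indicator {x..1} r *\<^sub>R wd u r)) = (\<lambda>r. indicator {x..1} r *\<^sub>R truncate c (wd u) r)"
      by (auto simp: truncate_def indicator_def)
    ultimately show ai: "truncate c (wd u) absolutely_integrable_on {x..1}" unfolding set_integrable_def by simp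
    have zero: "integral {max x c..1} (truncate c (wd u)) = 0"
      by (rule integral_unique, rule has_integral_is_0) (auto simp: truncate_def)
    show "integral {x..1} (truncate c (wd u)) = truncate c u 1 - truncate c u x"
    proof (cases "x < c")
      case True
      have "integral {x..1} (truncate c (wd u)) = integral {x..c} (truncate c (wd u)) + integral {c..1} (truncate c (wd u))"
        using True c set_lebesgue_integral_eq_integral(1)[OF ai]
        by (intro Henstock_Kurzweil_Integration.integral_combine[symmetric]) auto
      also have "integral {x..c} (truncate c (wd u)) = integral {x..c} (wd u)"
        by (rule integral_spike[of "{c}"]) (auto simp: truncate_def)
      also have "\<dots> = - u x" using acd_integral[OF ua(1) x(1), of c] True c by simp
      finally show ?thesis using zero True c truncate_def[of c u 1] truncate_def[of c u x] by (simp add: max_def)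
    next
      case False
      then show ?thesis using zero c truncate_def[of c u 1] truncate_def[of c u x] by (simp add: max_def)
    qed
  qed
  have 1: "truncate c u 1 = 0" using c by (simp add: truncate_def)
  have 3: "truncate c u \<in> calL_M M" using L2 ua(4) unfolding calL_M_eq by blast
  show "truncate c u \<in> calH_0M M" "AE r in leb01. wd (truncate c u) r = truncate c (wd u) r"
    by (rule calH_0M_I[OF acd 1 L2[OF ua(2)] 3])+
qed

text \<open>Where the shorter truncation is supported, the longer one coincides with
  \<open>u\<close>. A mixed term thus becomes \<open>u\<close> tested with one truncation, which the
  eigenvalue equation evaluates.\<close>

lemma truncate_form:
  assumes a: "a \<in> Linfty {0<..<1}" and u: "u \<in> calH_0M M" and c: "0 < c" "c < 1" "u c = 0" and d: "0 < d" "d < 1" "u d = 0" and cd: "c \<le> d"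
  shows "form_M M a (truncate c u) (truncate d u) = form_M M a u (truncate c u)"
    "ip_M M (truncate c u) (truncate d u) = ip_M M u (truncate c u)"
proof -
  note tc = truncate_calH[OF u c] and td = truncate_calH[OF u d]
  note [measurable] = calH_0M_measurable[OF u] calH_0M_measurable[OF tc(1)] calH_0M_measurable[OF td(1)]
  have [measurable]: "a \<in> borel_measurable leb01" using a by (simp add: Linfty_def)
  show "form_M M a (truncate c u) (truncate d u) = form_M M a u (truncate c u)"
    unfolding form_M_def
  proof (rule integral_cong_AE)
    show "AE r in leb01. r powr (M - 1) * (wd (truncate c u) r * wd (truncate d u) r - a r * truncate c u r * truncate d u r) =
       r powr (M - 1) * (wd u r * wd (truncate c u) r - a r * u r * truncate c u r)"
      using tc(2) td(2) by eventually_elim (use cd in \<open>auto simp: truncate_def\<close>)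
  qed measurable
  show "ip_M M (truncate c u) (truncate d u) = ip_M M u (truncate c u)"
    unfolding ip_M_def
    by (rule Bochner_Integration.integral_cong) (use cd in \<open>auto simp: truncate_def\<close>)
qed

text \<open>The default 0 when no point of \<open>Z\<close> lies below c is the singular endpoint,
  the left end of the first nodal interval.\<close>

definition left_end :: "real set \<Rightarrow> real \<Rightarrow> real" where
  "left_end Z c = Max (insert 0 {z \<in> Z. z < c})"

lemma left_end:
  assumes "finite Z" "Z \<subseteq> {0<..<1}" "0 < c"
  shows "0 \<le> left_end Z c" "left_end Z c < c" "left_end Z c = 0 \<or> left_end Z c \<in> Z" "\<And>z. z \<in> Z \<Longrightarrow> z < c \<Longrightarrow> z \<le> left_end Z c"
proof -
  have f: "finite (insert 0 {z \<in> Z. z < c})" using assms by simp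
  show "0 \<le> left_end Z c" unfolding left_end_def by (rule Max_ge[OF f]) simp
  have m: "left_end Z c \<in> insert 0 {z \<in> Z. z < c}" unfolding left_end_def by (rule Max_in[OF f]) simp
  then show "left_end Z c < c" "left_end Z c = 0 \<or> left_end Z c \<in> Z" using assms by auto
  show "z \<le> left_end Z c" if "z \<in> Z" "z < c" for z
    unfolding left_end_def by (rule Max_ge[OF f]) (use that in simp)
qed

definition zeros :: "(real \<Rightarrow> real) \<Rightarrow> real set" where
  "zeros u = {x \<in> {0<..<1}. u x = 0}"

text \<open>Courant: with \<open>i\<close> zeros, a combination of the truncations of \<open>u\<close> at these zeros would be
  a minimizer, hence an eigenfunction, vanishing near \<open>1\<close>.\<close>

theorem courant:
  assumes a: "a \<in> Linfty {0<..<1}" and i: "1 \<le> i" and rs: "radial_sequence_M M a \<psi> i"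
    and u: "u \<in> nonzero_on {0<..<1} (eigenspace_M M a (nu_hat M a \<psi> i))"
  shows "finite (zeros u)" "card (zeros u) < i"
proof -
  let ?\<nu> = "nu_hat M a \<psi> i" and ?W = "nonzero_on {0<..<1} (calH_0M M)"
  interpret V: variational "calH_0M M" "form_M M a" "ip_M M" ?W by (rule variational_radial[OF a])
  have mb: "minimizers_below ?W (form_M M a) (ip_M M) (((M - 2) / 2)^2) \<psi> i" using rs by (simp add: radial_sequence_M_def)
  have uE: "u \<in> eigenspace_M M a ?\<nu>" using u by (simp add: nonzero_on_def)
  then have uH: "u \<in> calH_0M M" and ueq: "\<And>\<phi>. \<phi> \<in> calH_0M M \<Longrightarrow> form_M M a u \<phi> = ?\<nu> * ip_M M u \<phi>"
    by (auto simp: eigenspace_M_def eigenspace_def)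
  obtain P where P: "solution M a ?\<nu> u P" using eigenfunction_solution[OF a uE] by blast
  have nz: "\<exists>r. c < r \<and> r < d \<and> u r \<noteq> 0" if "0 \<le> c" "c < d" "d \<le> 1" for c d
    using solution_zero_interval[OF P a that] nonzero_solution[OF u] by (metis less_imp_le)
  have no: False if C: "C \<subseteq> zeros u" "finite C" "card C = i" for C
  proof -
    have Cz: "0 < c" "c < 1" "u c = 0" if "c \<in> C" for c using that C by (auto simp: zeros_def)
    obtain d where d: "\<exists>l\<in>C. d l \<noteq> 0" and wH: "(\<lambda>r. \<Sum>c\<in>C. d c * truncate c u r) \<in> calH_0M M"
      and orth: "\<And>j. j \<in> {1..<i} \<Longrightarrow> ip_M M (\<lambda>r. \<Sum>c\<in>C. d c * truncate c u r) (\<psi> j) = 0"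
      using orthogonal_combination[OF C(2,3) i, of "\<lambda>c. truncate c u" M \<psi>] truncate_calH(1)[OF uH Cz] V.minimizersD(3)[OF mb] by auto
    define w where "w = (\<lambda>r. \<Sum>c\<in>C. d c * truncate c u r)"
    have Cne: "C \<noteq> {}" using d by auto
    have TH: "truncate c u \<in> calH_0M M" if "c \<in> C" for c by (rule truncate_calH(1)[OF uH Cz[OF that]])
    have T: "form_M M a (truncate c u) (truncate c' u) = ?\<nu> * ip_M M (truncate c u) (truncate c' u)" if "c \<in> C" "c' \<in> C" for c c'
    proof -
      have *: "form_M M a (truncate c u) (truncate c' u) = ?\<nu> * ip_M M (truncate c u) (truncate c' u)" if cc: "c \<in> C" "c' \<in> C" "c \<le> c'" for c c'
        using truncate_form[OF a uH Cz[OF cc(1)] Cz[OF cc(2)] cc(3)] ueq[OF TH[OF cc(1)]] by simp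
      show ?thesis
        using *[OF that] *[OF that(2,1)] V.Q.sym[OF TH[OF that(1)] TH[OF that(2)]] V.I.sym[OF TH[OF that(1)] TH[OF that(2)]]
        by (cases "c \<le> c'") auto
    qed
    have T2: "form_M M a w (truncate c' u) = ?\<nu> * ip_M M w (truncate c' u)" if "c' \<in> C" for c'
    proof -
      have "form_M M a w (truncate c' u) = (\<Sum>c\<in>C. d c * form_M M a (truncate c u) (truncate c' u))"
        unfolding w_def by (rule V.Q.sum_left[where f="\<lambda>c. truncate c u", OF C(2) Cne TH TH[OF that]])
      also have "\<dots> = ?\<nu> * (\<Sum>c\<in>C. d c * ip_M M (truncate c u) (truncate c' u))"
        unfolding sum_distrib_left by (rule sum.cong) (use T[OF _ that] in auto)
      also have "(\<Sum>c\<in>C. d c * ip_M M (truncate c u) (truncate c' u)) = ip_M M w (truncate c' u)"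
        unfolding w_def by (rule V.I.sum_left[where f="\<lambda>c. truncate c u", OF C(2) Cne TH TH[OF that], symmetric])
      finally show ?thesis .
    qed
    have wH': "w \<in> calH_0M M" using wH by (simp add: w_def)
    have "form_M M a w w = (\<Sum>c\<in>C. d c * form_M M a (truncate c u) w)"
      by (subst (1) w_def, rule V.Q.sum_left[where f="\<lambda>c. truncate c u", OF C(2) Cne TH wH'])
    also have "\<dots> = (\<Sum>c\<in>C. d c * (?\<nu> * ip_M M (truncate c u) w))"
      by (rule sum.cong) (use T2 V.Q.sym[OF wH' TH] V.I.sym[OF wH' TH] in auto)
    also have "\<dots> = ?\<nu> * (\<Sum>c\<in>C. d c * ip_M M (truncate c u) w)" by (simp add: sum_distrib_left algebra_simps)
    also have "(\<Sum>c\<in>C. d c * ip_M M (truncate c u) w) = ip_M M w w"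
      by (subst (2) w_def, rule V.I.sum_left[where f="\<lambda>c. truncate c u", OF C(2) Cne TH wH', symmetric])
    finally have "form_M M a w w = ?\<nu> * ip_M M w w" .
    \<comment> \<open>\<open>w\<close> attains the level among functions orthogonal to the earlier
      minimizers, hence it solves the eigenvalue equation; by simplicity it is a multiple of
      \<open>u\<close>.\<close>
    then have wE: "w \<in> eigenspace_M M a ?\<nu>"
      using V.minimizer_eigenfunction[OF mb wH'] orth unfolding eigenspace_M_def nu_hat_def w_def by blast
    obtain k where k: "\<And>r. 0 < r \<Longrightarrow> r \<le> 1 \<Longrightarrow> w r = k * u r" using eigenspace_one_dimensional[OF a u wE] by blast
    have "Max C \<in> C" using C(2) Cne by simp
    note M01 = Cz[OF this]
    \<comment> \<open>Beyond the largest chosen zero all truncations vanish while \<open>u\<close>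
      does not vanish identically, so the multiple is zero.\<close>
    obtain r1 where r1: "Max C < r1" "r1 < 1" "u r1 \<noteq> 0" using nz[of "Max C" 1] M01(1,2) by auto
    have "w r1 = 0" unfolding w_def truncate_def
    proof (rule sum.neutral, rule ballI)
      fix c assume "c \<in> C"
      then have "\<not> r1 < c" using Max_ge[OF C(2), of c] r1(1) by simp
      then show "d c * (if r1 < c then u r1 else 0) = 0" by simp
    qed
    then have k0: "k = 0" using k[of r1] r1 M01(1) by simp
    \<comment> \<open>The largest chosen zero with nonzero coefficient: between its left neighbour
      and itself only its own term survives, so \<open>w\<close> is not identically zero
      there.\<close>
    define D where "D = {c \<in> C. d c \<noteq> 0}"
    define c0 where "c0 = Max D"
    have D: "finite D" "D \<noteq> {}" using C(2) d by (auto simp: D_def)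
    have c0: "c0 \<in> C" "d c0 \<noteq> 0" using Max_in[OF D] by (auto simp: c0_def D_def)
    have C01: "C \<subseteq> {0<..<1}" using C by (auto simp: zeros_def)
    note le = left_end[OF C(2) C01 Cz(1)[OF c0(1)]]
    obtain r0 where r0: "left_end C c0 < r0" "r0 < c0" "u r0 \<noteq> 0"
      using nz[OF le(1,2)] Cz[OF c0(1)] by auto
    have "w r0 = (\<Sum>c\<in>C. if c = c0 then d c0 * u r0 else 0)"
      unfolding w_def truncate_def
    proof (rule sum.cong[OF refl])
      fix c assume c: "c \<in> C"
      consider "c < c0" | "c = c0" | "c > c0" by linarith
      then show "d c * (if r0 < c then u r0 else 0) = (if c = c0 then d c0 * u r0 else 0)"
      proof cases
        case 1
        then show ?thesis using le(4)[OF c] r0 by auto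
      next
        case 3
        then have "d c = 0" using Max_ge[OF D(1), of c] c by (force simp: c0_def D_def)
        then show ?thesis using 3 by simp
      qed (use r0 in auto)
    qed
    also have "\<dots> = d c0 * u r0" using C(2) c0 by simp
    finally show False using k[of r0] k0 r0 c0 le(1) Cz(2)[OF c0(1)] by auto
  qed
  show fin: "finite (zeros u)"
    using no infinite_arbitrarily_large[of "zeros u" i] by blast
  show "card (zeros u) < i"
  proof (rule ccontr)
    assume "\<not> card (zeros u) < i"
    then obtain C where "C \<subseteq> zeros u" "card C = i" "finite C" using obtain_subset_with_card_n[of i "zeros u"] by (metis not_less)
    then show False using no by blast
  qed
qed

text \<open>The k zeros of \<open>u1\<close> bound k + 1 nodal intervals, labelled by their right
  ends, which are the zeros together with 1. Each interval contains a zero of \<open>u2\<close>, and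
  these increase with the label, hence are distinct.\<close>

theorem sturm_count:
  assumes a: "a \<in> Linfty {0<..<1}" and u1: "u1 \<in> eigenspace_M M a \<nu>1" and u2: "u2 \<in> eigenspace_M M a \<nu>2" and \<nu>: "\<nu>1 < \<nu>2"
    and f1: "finite (zeros u1)" and f2: "finite (zeros u2)"
  shows "card (zeros u1) < card (zeros u2)"
proof -
  let ?Z = "zeros u1"
  have Z01: "?Z \<subseteq> {0<..<1}" by (auto simp: zeros_def)
  have u11: "u1 1 = 0" using u1 calH_0M_acd(3) by (auto simp: eigenspace_M_def eigenspace_def)
  have c1: "0 < c" "c \<le> 1" "u1 c = 0" if "c \<in> insert 1 ?Z" for c using that u11 by (auto simp: zeros_def)
  have "\<exists>x\<in>{left_end ?Z c<..<c}. u2 x = 0" if c: "c \<in> insert 1 ?Z" for c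
  proof (rule sturm_zero[OF a u1 u2 \<nu>])
    note le = left_end[OF f1 Z01 c1(1)[OF c]]
    show "0 \<le> left_end ?Z c" "left_end ?Z c < c" by (rule le)+
    show "c \<le> 1" "u1 c = 0" using c1[OF c] by auto
    show "left_end ?Z c = 0 \<or> u1 (left_end ?Z c) = 0" using le(3) by (auto simp: zeros_def)
    show "u1 x \<noteq> 0" if "x \<in> {left_end ?Z c<..<c}" for x
      using le(4)[of x] that le(1) c1[OF c] by (force simp: zeros_def)
  qed
  then obtain f where f: "\<And>c. c \<in> insert 1 ?Z \<Longrightarrow> f c \<in> {left_end ?Z c<..<c}" "\<And>c. c \<in> insert 1 ?Z \<Longrightarrow> u2 (f c) = 0"
    by metis
  have mono: "f c < f c'" if cc: "c \<in> insert 1 ?Z" "c' \<in> insert 1 ?Z" "c < c'" for c c'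
  proof -
    have "c \<in> ?Z" using cc c1(2)[OF cc(2)] by auto
    then have "c \<le> left_end ?Z c'" by (rule left_end(4)[OF f1 Z01 c1(1)[OF cc(2)]]) (rule cc)
    then show ?thesis using f(1)[OF cc(1)] f(1)[OF cc(2)] by auto
  qed
  have "inj_on f (insert 1 ?Z)"
    by (rule linorder_inj_onI) (use mono in \<open>auto dest: less_imp_neq\<close>)
  moreover have "f ` insert 1 ?Z \<subseteq> zeros u2"
  proof
    fix y assume "y \<in> f ` insert 1 ?Z"
    then obtain c where c: "c \<in> insert 1 ?Z" "y = f c" by blast
    then show "y \<in> zeros u2"
      using f(1)[OF c(1)] f(2)[OF c(1)] left_end(1)[OF f1 Z01 c1(1)[OF c(1)]] c1(2)[OF c(1)] by (auto simp: zeros_def)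
  qed
  ultimately have "card (insert 1 ?Z) \<le> card (zeros u2)" by (rule card_inj_on_le[OF _ _ f2])
  moreover have "1 \<notin> ?Z" by (auto simp: zeros_def)
  ultimately show ?thesis using f1 by simp
qed

text \<open>Components are labelled by their right ends; the additional label 1 accounts for the
  successor in the count.\<close>

lemma components_interval_minus_finite:
  assumes Z: "finite Z" "Z \<subseteq> {0<..<1::real}"
  shows "components ({0<..<1} - Z) = (\<lambda>c. {left_end Z c<..<c}) ` insert 1 Z"
    and "card (components ({0<..<1} - Z)) = Suc (card Z)"
proof -
  let ?S = "{0<..<1} - Z" and ?I = "\<lambda>c. {left_end Z c<..<c}"
  have c1: "0 < c" "c \<le> 1" if "c \<in> insert 1 Z" for c using that Z(2) by auto
  note le = left_end[OF Z c1(1)]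
  have sub: "?I c \<subseteq> ?S" if c: "c \<in> insert 1 Z" for c
    using le(1)[OF c] le(4)[OF c] c1[OF c] by force
  have comp: "?I c \<in> components ?S" if c: "c \<in> insert 1 Z" for c
    unfolding in_components_maximal
  proof (intro conjI allI impI sub[OF c])
    show "?I c \<noteq> {}" using le(2)[OF c] by simp
    show "connected (?I c)" by simp
    fix d assume d: "d \<noteq> {} \<and> ?I c \<subseteq> d \<and> d \<subseteq> ?S \<and> connected d"
    define m where "m = (left_end Z c + c) / 2"
    have m: "m \<in> ?I c" using le(2)[OF c] by (auto simp: m_def)
    have "y \<in> ?I c" if y: "y \<in> d" for y
    proof (rule ccontr)
      assume "y \<notin> ?I c"
      then consider "y \<le> left_end Z c" | "c \<le> y" by auto
      then show False
      proof cases
        case 1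
        have "{y..m} \<subseteq> d" using d y m by (intro connected_contains_Icc) auto
        then have "left_end Z c \<in> d" using 1 m by auto
        then have "left_end Z c \<in> ?S" using d by blast
        then show False using le(3)[OF c] by auto
      next
        case 2
        have "{m..y} \<subseteq> d" using d y m by (intro connected_contains_Icc) auto
        then have "c \<in> d" using 2 m by auto
        then have "c \<in> ?S" using d by blast
        then show False using c by auto
      qed
    qed
    then show "d = ?I c" using d by blast
  qed
  have "X \<in> ?I ` insert 1 Z" if X: "X \<in> components ?S" for X
  proof -
    obtain x where x: "x \<in> X" using in_components_nonempty[OF X] by blast
    have xS: "x \<in> ?S" using x X in_components_subset by blast
    \<comment> \<open>The first point of \<open>Z\<close> to the right of x, or 1 if there is none,
      labels the component of x.\<close>
    define c where "c = Min {c \<in> insert 1 Z. x < c}"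
    have fin: "finite {c \<in> insert 1 Z. x < c}" using Z by simp
    have "1 \<in> {c \<in> insert 1 Z. x < c}" using xS by simp
    then have c: "c \<in> insert 1 Z" "x < c" using Min_in[OF fin] unfolding c_def by blast+
    have "left_end Z c < x"
    proof (rule ccontr)
      assume n: "\<not> left_end Z c < x"
      then have lz: "left_end Z c \<in> Z" using le(3)[OF c(1)] xS by auto
      then have "x < left_end Z c" using n xS by (metis Diff_iff linorder_neqE_linordered_idom)
      then have "Min {c \<in> insert 1 Z. x < c} \<le> left_end Z c" using lz by (intro Min_le[OF fin]) auto
      then show False using le(2)[OF c(1)] unfolding c_def[symmetric] by simp
    qed
    then have "x \<in> ?I c" using c by simp
    then have "X = ?I c" using components_nonoverlap[OF X comp[OF c(1)]] x by blast
    then show ?thesis using c by blast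
  qed
  then show eq: "components ?S = ?I ` insert 1 Z" using comp by blast
  have "inj_on ?I (insert 1 Z)"
  proof (rule inj_onI)
    fix c c' assume cc: "c \<in> insert 1 Z" "c' \<in> insert 1 Z" "?I c = ?I c'"
    \<comment> \<open>A nonempty open interval determines its right end as a supremum, so the
      labelling is injective.\<close>
    have s: "Sup (?I c) = c" "Sup (?I c') = c'" using le(2)[OF cc(1)] le(2)[OF cc(2)] by simp_all
    show "c = c'" using arg_cong[OF cc(3), of Sup] unfolding s .
  qed
  then have "card (components ?S) = card (insert 1 Z)" unfolding eq by (rule card_image)
  also have "\<dots> = Suc (card Z)" using Z by (subst card_insert_disjoint) auto
  finally show "card (components ?S) = Suc (card Z)" .
qed

section \<open>The radial eigenvalues\<close>

text \<open>If two consecutive levels agreed, a minimizer of the later one would lie in the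
  eigenspace of \<psi> k and be a multiple of it, yet be orthogonal to it. Attainment at the later
  level produces that minimizer.\<close>

lemma nu_hat_strict:
  assumes M: "2 \<le> M" and a: "a \<in> Linfty {0<..<1}" and k: "1 \<le> k" and rs: "radial_sequence_M M a \<psi> (Suc k)"
    and lt: "nu_hat M a \<psi> (Suc k) < ((M - 2) / 2)^2"
  shows "nu_hat M a \<psi> k < nu_hat M a \<psi> (Suc k)" "\<psi> k \<in> nonzero_on {0<..<1} (eigenspace_M M a (nu_hat M a \<psi> k))"
proof -
  let ?W = "nonzero_on {0<..<1} (calH_0M M)"
  interpret V: variational "calH_0M M" "form_M M a" "ip_M M" ?W by (rule variational_radial[OF a])
  have mb: "minimizers_below ?W (form_M M a) (ip_M M) (((M - 2) / 2)^2) \<psi> (Suc k)" using rs by (simp add: radial_sequence_M_def)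
  have kk: "k \<in> {1..<Suc k}" using k by simp
  note D = V.minimizersD[OF mb]
  have \<psi>H: "\<psi> j \<in> calH_0M M" if "j \<in> {1..<Suc k}" for j using D(3)[OF that] .
  have \<psi>E: "\<psi> k \<in> eigenspace_M M a (nu_hat M a \<psi> k)"
    unfolding eigenspace_M_def nu_hat_def
    by (rule V.minimizer_eigenfunction[OF V.minimizers_below_mono[OF mb] D(3)[OF kk] V.minimizers_orthogonal[OF mb] D(5)[OF kk]]) auto
  then show \<psi>n: "\<psi> k \<in> nonzero_on {0<..<1} (eigenspace_M M a (nu_hat M a \<psi> k))"
    using D(2)[OF kk] by (auto simp: nonzero_on_def)
  have ne: "competitors ?W (ip_M M) \<psi> (Suc k) \<noteq> {}" by (rule competitors_nonempty[OF _ \<psi>H]) auto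
  have le: "nu_hat M a \<psi> k \<le> nu_hat M a \<psi> (Suc k)"
    unfolding nu_hat_def by (rule V.min_level_mono[OF _ ne]) simp
  have "nu_hat M a \<psi> k \<noteq> nu_hat M a \<psi> (Suc k)"
  proof
    assume eq: "nu_hat M a \<psi> k = nu_hat M a \<psi> (Suc k)"
    obtain u where u: "u \<in> calH_0M M" "\<And>j. j \<in> {1..<Suc k} \<Longrightarrow> ip_M M u (\<psi> j) = 0" "ip_M M u u = 1"
      "form_M M a u u = nu_hat M a \<psi> (Suc k) * ip_M M u u"
      by (rule nu_hat_attained[OF M a ne \<psi>H lt]) blast+
    have "u \<in> eigenspace_M M a (nu_hat M a \<psi> (Suc k))"
      unfolding eigenspace_M_def nu_hat_def
      by (rule V.minimizer_eigenfunction[OF mb u(1,2) u(4)[unfolded nu_hat_def]])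
    then have uE: "u \<in> eigenspace_M M a (nu_hat M a \<psi> k)" using eq by simp
    obtain c where c: "\<And>r. 0 < r \<Longrightarrow> r \<le> 1 \<Longrightarrow> u r = c * \<psi> k r" by (rule eigenspace_one_dimensional[OF a \<psi>n uE]) blast
    have AE: "AE r in leb01. u r = c * \<psi> k r" using c by (intro AE_I2) (simp add: space_restrict_space)
    have cH: "(\<lambda>r. c * \<psi> k r) \<in> calH_0M M" by (rule calH_0M_scale(1)[OF \<psi>H[OF kk]])
    have e: "ip_M M u w = c * ip_M M (\<psi> k) w" if "w \<in> calH_0M M" for w
      using form_M_cong(2)[OF u(1) cH AE that a] V.I.scale_left[OF \<psi>H[OF kk] that] by simp
    have "c * ip_M M (\<psi> k) (\<psi> k) = 0" using e[OF \<psi>H[OF kk]] u(2)[OF kk] by simp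
    then have "c = 0" using V.pos[OF D(2)[OF kk]] by simp
    then show False using e[OF u(1)] u(3) by simp
  qed
  with le show "nu_hat M a \<psi> k < nu_hat M a \<psi> (Suc k)" by simp
qed

lemma zeros_eigenfunction:
  assumes M: "2 \<le> M" and a: "a \<in> Linfty {0<..<1}"
  shows "1 \<le> i \<Longrightarrow> radial_sequence_M M a \<psi> i \<Longrightarrow> nu_hat M a \<psi> i < ((M - 2) / 2)^2 \<Longrightarrow>
    u \<in> nonzero_on {0<..<1} (eigenspace_M M a (nu_hat M a \<psi> i)) \<Longrightarrow> finite (zeros u) \<and> Suc (card (zeros u)) = i"
proof (induction i arbitrary: u)
  case (Suc k)
  note cou = courant[OF a Suc.prems(1,2,4)]
  show ?case
  proof (cases "k = 0")
    case False
    then have k: "1 \<le> k" by simp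
    note st = nu_hat_strict[OF M a k Suc.prems(2,3)]
    have "radial_sequence_M M a \<psi> k" using Suc.prems(2) by (auto simp: radial_sequence_M_def minimizers_below_def)
    then have IH: "finite (zeros (\<psi> k))" "Suc (card (zeros (\<psi> k))) = k"
      using Suc.IH[OF k _ _ st(2)] st(1) Suc.prems(3) by auto
    \<comment> \<open>\<psi> k has k - 1 zeros, so \<open>u\<close> has at least k, and Courant's
      bound allows at most k.\<close>
    have "card (zeros (\<psi> k)) < card (zeros u)"
      by (rule sturm_count[OF a _ _ st(1) IH(1) cou(1)]) (use st(2) Suc.prems(4) in \<open>auto simp: nonzero_on_def\<close>)
    then show ?thesis using cou IH(2) by simp
  qed (use cou in simp)
qed simp

text \<open>\<open>one_dimensional_on\<close> also asserts a nonzero element. The sequence supplies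
  none at index i, so a minimizer \<open>w\<close> of level i is constructed.\<close>

theorem radial_eigenvalues:
  assumes M: "2 \<le> M" and a: "a \<in> Linfty {0<..<1}" and i: "1 \<le> i" and rs: "radial_sequence_M M a \<psi> i"
    and lt: "nu_hat M a \<psi> i < ((M - 2) / 2)^2"
  shows "one_dimensional_on {0<..<1} (eigenspace_M M a (nu_hat M a \<psi> i))"
    and "u \<in> nonzero_on {0<..<1} (eigenspace_M M a (nu_hat M a \<psi> i)) \<Longrightarrow> card (nodal_domains {0<..<1} u) = i"
proof -
  let ?W = "nonzero_on {0<..<1} (calH_0M M)"
  interpret V: variational "calH_0M M" "form_M M a" "ip_M M" ?W by (rule variational_radial[OF a])
  have mb: "minimizers_below ?W (form_M M a) (ip_M M) (((M - 2) / 2)^2) \<psi> i" using rs by (simp add: radial_sequence_M_def)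
  have \<psi>H: "\<psi> j \<in> calH_0M M" if "j \<in> {1..<i}" for j using V.minimizersD(3)[OF mb that] .
  have ne: "competitors ?W (ip_M M) \<psi> i \<noteq> {}" by (rule competitors_nonempty[OF i \<psi>H])
  obtain w where w: "w \<in> calH_0M M" "\<And>j. j \<in> {1..<i} \<Longrightarrow> ip_M M w (\<psi> j) = 0" "ip_M M w w = 1"
    "form_M M a w w = nu_hat M a \<psi> i * ip_M M w w"
    by (rule nu_hat_attained[OF M a ne \<psi>H lt]) blast+
  have wE: "w \<in> eigenspace_M M a (nu_hat M a \<psi> i)"
    unfolding eigenspace_M_def nu_hat_def
    by (rule V.minimizer_eigenfunction[OF mb w(1,2) w(4)[unfolded nu_hat_def]])
  have wn: "w \<in> nonzero_on {0<..<1} (eigenspace_M M a (nu_hat M a \<psi> i))"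
  proof -
    have "w \<in> ?W" using V.null[OF w(1) _ w(1)] w(3) by fastforce
    then show ?thesis using wE by (auto simp: nonzero_on_def)
  qed
  show "one_dimensional_on {0<..<1} (eigenspace_M M a (nu_hat M a \<psi> i))"
    unfolding one_dimensional_on_def
  proof (intro bexI[OF _ wn] ballI)
    fix v assume "v \<in> eigenspace_M M a (nu_hat M a \<psi> i)"
    from eigenspace_one_dimensional[OF a wn this] obtain c where c: "\<And>r. 0 < r \<Longrightarrow> r \<le> 1 \<Longrightarrow> v r = c * w r" by blast
    then have "AE r in leb01. v r = c * w r" by (intro AE_I2) (simp add: space_restrict_space)
    then show "\<exists>c. AE r in leb01. v r = c * w r" by blast
  qed
  assume u: "u \<in> nonzero_on {0<..<1} (eigenspace_M M a (nu_hat M a \<psi> i))"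
  from zeros_eigenfunction[OF M a i rs lt u] have z: "finite (zeros u)" "Suc (card (zeros u)) = i" by auto
  have eq: "{x \<in> {0<..<1}. u x \<noteq> 0} = {0<..<1} - zeros u" by (auto simp: zeros_def)
  have "zeros u \<subseteq> {0<..<1}" by (auto simp: zeros_def)
  then show "card (nodal_domains {0<..<1} u) = i"
    unfolding nodal_domains_def eq using components_interval_minus_finite(2)[OF z(1)] z(2) by simp
qed

section \<open>Integration by parts in Euclidean space\<close>

definition grad :: "('a::euclidean_space \<Rightarrow> real) \<Rightarrow> 'a \<Rightarrow> 'a" where
  "grad \<phi> x = (\<Sum>b\<in>Basis. partial_deriv b \<phi> x *\<^sub>R b)"

lemma grad_inner: "b \<in> Basis \<Longrightarrow> grad \<phi> x \<bullet> b = partial_deriv b \<phi> x"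
  unfolding grad_def by (simp add: inner_sum_left inner_Basis if_distrib cong: if_cong)

lemma smooth_DERIV_line:
  assumes "smooth F"
  shows "((\<lambda>s. F (x + s *\<^sub>R e)) has_real_derivative grad F (x + s *\<^sub>R e) \<bullet> e) (at s)"
proof -
  let ?D = "frechet_derivative F (at (x + s *\<^sub>R e))"
  have d: "(F has_derivative ?D) (at (x + s *\<^sub>R e))"
    using smooth_differentiable_at[OF assms] by (simp add: frechet_derivative_works[symmetric])
  interpret D: bounded_linear ?D using has_derivative_bounded_linear[OF d] .
  have De: "?D e = grad F (x + s *\<^sub>R e) \<bullet> e"
  proof -
    have "?D e = ?D (\<Sum>b\<in>Basis. (e \<bullet> b) *\<^sub>R b)" by (simp add: euclidean_representation)
    also have "\<dots> = (\<Sum>b\<in>Basis. (e \<bullet> b) * ?D b)" by (simp add: D.sum D.scale)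
    also have "\<dots> = grad F (x + s *\<^sub>R e) \<bullet> e"
      unfolding grad_def inner_sum_left partial_deriv_def
      by (intro sum.cong refl) (simp add: inner_commute mult.commute)
    finally show ?thesis .
  qed
  have "((\<lambda>s. x + s *\<^sub>R e) has_derivative (\<lambda>h. h *\<^sub>R e)) (at s)" by (auto intro!: derivative_eq_intros)
  from has_derivative_compose[OF this d]
  have "((\<lambda>s. F (x + s *\<^sub>R e)) has_derivative (\<lambda>h. ?D (h *\<^sub>R e))) (at s)" .
  moreover have "(\<lambda>h. ?D (h *\<^sub>R e)) = (*) (grad F (x + s *\<^sub>R e) \<bullet> e)"
    by (rule ext) (simp add: D.scale De mult.commute)
  ultimately show ?thesis unfolding has_field_derivative_def by simp
qed

lemma partial_deriv_zero_on_open: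
  assumes "open S" "\<And>x. x \<in> S \<Longrightarrow> F x = 0" "x \<in> S"
  shows "partial_deriv b F x = 0"
proof -
  have "(F has_derivative (\<lambda>_. 0)) (at x)"
    by (rule has_derivative_transform_within_open[OF has_derivative_const[of 0]]) (use assms in auto)
  from fun_cong[OF frechet_derivative_at[OF this], of b] show ?thesis unfolding partial_deriv_def by simp
qed

lemma partial_deriv_zero_outside:
  assumes "compact K" "\<And>x. x \<notin> K \<Longrightarrow> F x = 0" "x \<notin> K"
  shows "partial_deriv b F x = 0"
  by (rule partial_deriv_zero_on_open[of "- K"]) (use assms in \<open>auto simp: compact_imp_closed open_Compl\<close>)

text \<open>Difference quotients have integral zero by translation invariance. They converge to the
  partial derivative and, by the mean value theorem, are dominated by a constant on an enlarged
  ball.\<close>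

lemma integral_partial_deriv_zero:
  fixes F :: "'a::euclidean_space \<Rightarrow> real"
  assumes F: "smooth F" and K: "compact K" "\<And>x. x \<notin> K \<Longrightarrow> F x = 0" and b: "b \<in> Basis"
  shows "(LINT x|lborel. partial_deriv b F x) = 0"
proof -
  let ?d = "partial_deriv b F"
  have cd: "continuous_on UNIV ?d" by (intro smooth_continuous smooth_partial_deriv F b)
  have cF: "continuous_on UNIV F" by (intro smooth_continuous F)
  have [measurable]: "?d \<in> borel_measurable borel" "F \<in> borel_measurable borel"
    using cd cF by (auto intro: borel_measurable_continuous_onI)
  have "compact (?d ` K)" by (rule compact_continuous_image[OF continuous_on_subset[OF cd] K(1)]) simp
  then obtain C0 where C0: "\<And>x. x \<in> K \<Longrightarrow> \<bar>?d x\<bar> \<le> C0"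
    using compact_imp_bounded bounded_iff by (metis imageI real_norm_def)
  define C where "C = max C0 0"
  have C: "\<bar>?d x\<bar> \<le> C" for x
    using C0[of x] partial_deriv_zero_outside[OF K, where x=x and b=b] by (cases "x \<in> K") (auto simp: C_def)
  obtain R where R: "\<And>x. x \<in> K \<Longrightarrow> norm x \<le> R" using compact_imp_bounded[OF K(1)] by (auto simp: bounded_iff)
  define q where "q n x = real (Suc n) * (F (x + (1 / real (Suc n)) *\<^sub>R b) - F x)" for n x
  have qm[measurable]: "q n \<in> borel_measurable borel" for n unfolding q_def by measurable
  have line: "((\<lambda>s. F (x + s *\<^sub>R b)) has_real_derivative ?d (x + s *\<^sub>R b)) (at s)" for x s
    using smooth_DERIV_line[OF F, where x=x and e=b and s=s] by (simp add: grad_inner[OF b])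
  have qb: "\<bar>q n x\<bar> \<le> C" for n x
  proof -
    obtain z where "F (x + (1 / real (Suc n)) *\<^sub>R b) - F (x + 0 *\<^sub>R b) = (1 / real (Suc n) - 0) * ?d (x + z *\<^sub>R b)"
      using MVT2[of 0 "1 / real (Suc n)" "\<lambda>s. F (x + s *\<^sub>R b)" "\<lambda>s. ?d (x + s *\<^sub>R b)"] line by auto
    then have "q n x = ?d (x + z *\<^sub>R b)" by (simp add: q_def field_simps)
    then show ?thesis using C by simp
  qed
  \<comment> \<open>Steps have length at most 1, so outside the radius R + 1 both arguments avoid
    \<open>K\<close>.\<close>
  have q0: "q n x = 0" if "x \<notin> cball 0 (R + 1)" for n x
  proof -
    have nx: "norm x > R + 1" using that by simp
    have c1: "norm ((1 / real (Suc n)) *\<^sub>R b) \<le> 1" using b by simp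
    have "norm x \<le> norm (x + c) + norm c" for c :: 'a using norm_triangle_ineq4[of "x + c" c] by simp
    from this[of "(1 / real (Suc n)) *\<^sub>R b"] have "norm (x + (1 / real (Suc n)) *\<^sub>R b) > R"
      using nx c1 by linarith
    then have "x \<notin> K" "x + (1 / real (Suc n)) *\<^sub>R b \<notin> K" using R nx by force+
    then show ?thesis by (simp add: q_def K(2))
  qed
  have Fi: "integrable lborel F"
  proof -
    have "integrable lborel (\<lambda>x. indicator K x *\<^sub>R F x)"
      by (rule borel_integrable_compact[OF K(1)]) (rule continuous_on_subset[OF cF], simp)
    moreover have "(\<lambda>x. indicator K x *\<^sub>R F x) = F" using K(2) by (fastforce simp: indicator_def)
    ultimately show ?thesis by simp
  qed
  have trans: "integrable lborel (\<lambda>x. F (x + c)) \<and> (LINT x|lborel. F (x + c)) = (LINT x|lborel. F x)" for c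
  proof -
    have "integrable (distr lborel borel ((+) c)) F" using Fi by (simp add: lborel_distr_plus)
    then have "integrable lborel (\<lambda>x. F (c + x))" by (subst (asm) integrable_distr_eq) auto
    moreover have "(LINT x|lborel. F (c + x)) = (LINT x|distr lborel borel ((+) c). F x)"
      by (rule integral_distr[symmetric]) auto
    ultimately show ?thesis by (simp add: lborel_distr_plus add.commute)
  qed
  have "(LINT x|lborel. q n x) = 0" for n
    unfolding q_def using trans[of "(1 / real (Suc n)) *\<^sub>R b"] Fi by simp
  moreover have "(\<lambda>n. LINT x|lborel. q n x) \<longlonglongrightarrow> (LINT x|lborel. ?d x)"
  proof (rule integral_dominated_convergence[where w="\<lambda>x. C * indicator (cball 0 (R + 1)) x"])
    have "emeasure lborel (cball (0::'a) (R + 1)) < \<infinity>" by (rule emeasure_bounded_finite) simp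
    then show "integrable lborel (\<lambda>x. C * indicator (cball (0::'a) (R + 1)) x)"
      by (intro integrable_mult_right integrable_real_indicator) auto
    show "AE x in lborel. (\<lambda>n. q n x) \<longlonglongrightarrow> ?d x"
    proof (rule AE_I2)
      fix x
      have "((\<lambda>h. (F (x + (0 + h) *\<^sub>R b) - F (x + 0 *\<^sub>R b)) / h) \<longlongrightarrow> ?d (x + 0 *\<^sub>R b)) (at 0)"
        using line[of x 0] unfolding DERIV_def .
      then have "((\<lambda>h. (F (x + h *\<^sub>R b) - F x) / h) \<longlongrightarrow> ?d x) (at 0)" by simp
      moreover have "filterlim (\<lambda>n. 1 / real (Suc n)) (at 0) sequentially"
        unfolding filterlim_at using LIMSEQ_Suc[OF lim_1_over_n] by auto
      ultimately have "(\<lambda>n. (F (x + (1 / real (Suc n)) *\<^sub>R b) - F x) / (1 / real (Suc n))) \<longlonglongrightarrow> ?d x"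
        by (rule filterlim_compose)
      then show "(\<lambda>n. q n x) \<longlonglongrightarrow> ?d x" by (simp add: q_def mult.commute)
    qed
    show "AE x in lborel. norm (q n x) \<le> C * indicator (cball 0 (R + 1)) x" for n
      using qb q0 by (intro AE_I2) (auto simp: indicator_def)
  qed measurable
  ultimately show ?thesis by (simp add: LIMSEQ_const_iff)
qed

lemma continuous_locally_integrable:
  fixes f :: "'a::euclidean_space \<Rightarrow> real"
  assumes "continuous_on UNIV f" shows "locally_integrable \<Omega> f"
  unfolding locally_integrable_def
proof (intro allI impI, elim conjE)
  fix K :: "'a set" assume K: "compact K" "K \<subseteq> \<Omega>"
  have "integrable lborel (\<lambda>x. indicator K x *\<^sub>R f x)"
    by (rule borel_integrable_compact[OF K(1)]) (rule continuous_on_subset[OF assms], simp)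
  then have "integrable lebesgue (\<lambda>x. indicator K x *\<^sub>R f x)"
    by (simp add: integrable_completion borel_measurable_integrable)
  moreover have "K \<in> sets lebesgue" using K(1) by (simp add: compact_imp_closed borel_closed)
  ultimately show "integrable (lebesgue_on K) f" by (simp add: integrable_restrict_space)
qed

lemma partial_deriv_mult:
  assumes f: "smooth f" and g: "smooth g"
  shows "partial_deriv b (\<lambda>x. f x * g x) = (\<lambda>x. f x * partial_deriv b g x + partial_deriv b f x * g x)"
proof -
  have d: "(f has_derivative frechet_derivative f (at x)) (at x)"
    "(g has_derivative frechet_derivative g (at x)) (at x)" for x
    using smooth_differentiable_at[OF f] smooth_differentiable_at[OF g] by (auto simp: frechet_derivative_works)
  show ?thesis
    unfolding partial_deriv_def[of _ f] partial_deriv_def[of _ g]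
    by (rule partial_deriv_eq) (intro derivative_intros d)
qed

text \<open>The product with a test function is smooth with compact support in \<Omega>, so its
  partial derivative integrates to zero; the product rule splits this into the two sides of the
  identity.\<close>

lemma smooth_weak_gradient:
  fixes \<phi> :: "'a::euclidean_space \<Rightarrow> real"
  assumes \<phi>: "smooth \<phi>" and "open \<Omega>"
  shows "weak_gradient \<Omega> \<phi> (grad \<phi>)"
  unfolding weak_gradient_def
proof (intro conjI ballI)
  show "locally_integrable \<Omega> \<phi>" by (intro continuous_locally_integrable smooth_continuous \<phi>)
  fix b :: 'a assume b: "b \<in> Basis"
  show li: "locally_integrable \<Omega> (\<lambda>x. grad \<phi> x \<bullet> b)"
    unfolding grad_inner[OF b] by (intro continuous_locally_integrable smooth_continuous smooth_partial_deriv \<phi> b)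
  fix \<psi> assume \<psi>: "\<psi> \<in> test_functions \<Omega>"
  obtain K where K: "smooth \<psi>" "compact K" "K \<subseteq> \<Omega>" "\<And>x. x \<notin> K \<Longrightarrow> \<psi> x = 0" using \<psi> by (rule test_functionE) blast
  have KL: "K \<in> sets lebesgue" using K(2) by (simp add: compact_imp_closed borel_closed)
  have \<Omega>L: "\<Omega> \<in> sets lebesgue" using \<open>open \<Omega>\<close> by simp
  note dz = partial_deriv_zero_outside[OF K(2,4)]
  have 1: "integrable (lebesgue_on \<Omega>) (\<lambda>x. \<phi> x * partial_deriv b \<psi> x)"
    by (rule integrable_times_test[OF \<open>open \<Omega>\<close> continuous_locally_integrable K(2,3) dz])
      (auto intro: smooth_continuous \<phi> smooth_partial_deriv K b)
  have 2: "integrable (lebesgue_on \<Omega>) (\<lambda>x. partial_deriv b \<phi> x * \<psi> x)"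
    by (rule integrable_times_test[OF \<open>open \<Omega>\<close> continuous_locally_integrable K(2,3,4)])
      (auto intro: smooth_continuous \<phi> smooth_partial_deriv K b)
  have "(LINT x|lebesgue_on \<Omega>. \<phi> x * partial_deriv b \<psi> x + partial_deriv b \<phi> x * \<psi> x) = (LINT x|lebesgue_on \<Omega>. partial_deriv b (\<lambda>x. \<phi> x * \<psi> x) x)"
    by (simp add: partial_deriv_mult[OF \<phi> K(1)])
  also have "\<dots> = (LINT x|lebesgue. indicator \<Omega> x *\<^sub>R partial_deriv b (\<lambda>x. \<phi> x * \<psi> x) x)"
    using \<Omega>L by (simp add: integral_restrict_space)
  also have "(\<lambda>x. indicator \<Omega> x *\<^sub>R partial_deriv b (\<lambda>x. \<phi> x * \<psi> x) x) = partial_deriv b (\<lambda>x. \<phi> x * \<psi> x)"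
  proof
    fix x show "indicator \<Omega> x *\<^sub>R partial_deriv b (\<lambda>x. \<phi> x * \<psi> x) x = partial_deriv b (\<lambda>x. \<phi> x * \<psi> x) x"
      using partial_deriv_zero_outside[OF K(2), where F="\<lambda>x. \<phi> x * \<psi> x" and x=x and b=b] K(3,4) by (cases "x \<in> \<Omega>") auto
  qed
  also have "(LINT x|lebesgue. partial_deriv b (\<lambda>x. \<phi> x * \<psi> x) x) = (LINT x|lborel. partial_deriv b (\<lambda>x. \<phi> x * \<psi> x) x)"
    by (intro integral_completion) (use borel_measurable_continuous_onI[OF smooth_continuous[OF smooth_partial_deriv[OF smooth_mult[OF \<phi> K(1)] b]]] in simp)
  also have "\<dots> = 0"
    by (rule integral_partial_deriv_zero[OF smooth_mult[OF \<phi> K(1)] K(2) _ b]) (simp add: K(4))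
  finally show "(LINT x|lebesgue_on \<Omega>. \<phi> x * partial_deriv b \<psi> x) = - (LINT x|lebesgue_on \<Omega>. grad \<phi> x \<bullet> b * \<psi> x)"
    using 1 2 by (simp add: grad_inner[OF b])
qed

section \<open>Polar coordinates for radial functions\<close>

text \<open>The area of the unit sphere, as the derivative at radius 1 of the volume of balls; no
  surface measure is introduced.\<close>

definition sphere_area :: "'a::euclidean_space itself \<Rightarrow> real" where
  "sphere_area _ = DIM('a) * measure lborel (ball (0::'a) 1)"

lemma sphere_area_pos: "0 < sphere_area TYPE('a::euclidean_space)"
  unfolding sphere_area_def using content_ball_pos[of 1 "0::'a"] by simp

text \<open>Polar coordinates for radial functions need only volumes of shells. Both measures give
  the half-line beyond x the volume between radius x and 1, one from the volume of balls, the other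
  by integrating a power of r.\<close>

lemma distr_norm_ball:
  "distr (density lborel (indicator (ball (0::'a::euclidean_space) 1))) borel norm =
   density lborel (\<lambda>r. ennreal (sphere_area TYPE('a) * r ^ (DIM('a) - 1)) * indicator {0<..<1} r)" (is "?L = ?R")
proof (rule measure_eqI_lessThan)
  let ?B = "ball (0::'a) 1" and ?V = "measure lborel (ball (0::'a) 1)" and ?N = "DIM('a)"
  have N: "?N \<ge> 1" by simp
  show "sets ?L = sets borel" "sets ?R = sets borel" by simp_all
  have ns[simp]: "norm -` {x<..} \<in> sets (borel :: 'a measure)" for x
    using measurable_sets[of norm "borel :: 'a measure" borel "{x<..}"] by simp
  have im[simp]: "(indicator ?B :: 'a \<Rightarrow> ennreal) \<in> borel_measurable borel" by (rule borel_measurable_indicator) simp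
  have finB: "emeasure lborel ?B < \<infinity>" by (rule emeasure_lborel_ball_finite)
  have mL: "emeasure ?L {x<..} = emeasure lborel (?B - cball 0 x)" for x
  proof -
    have "emeasure ?L {x<..} = emeasure (density lborel (indicator ?B)) (norm -` {x<..})" by (subst emeasure_distr) auto
    also have "\<dots> = (\<integral>\<^sup>+y. indicator ?B y * indicator (norm -` {x<..}) y \<partial>lborel)" by (subst emeasure_density) auto
    also have "\<dots> = (\<integral>\<^sup>+y. indicator (?B - cball 0 x) y \<partial>lborel)" by (rule nn_integral_cong) (auto simp: indicator_def)
    also have "\<dots> = emeasure lborel (?B - cball 0 x)" by (rule nn_integral_indicator) auto
    finally show ?thesis .
  qed
  show "emeasure ?L {x<..} < \<infinity>" for x
    unfolding mL by (rule le_less_trans[OF emeasure_mono finB]) auto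
  have VL: "emeasure ?L {x<..} = ennreal (?V * (1 - (max x 0) ^ ?N))" if "x < 1" for x
  proof (cases "x \<le> 0")
    case True
    \<comment> \<open>For x < 0 the removed ball is empty, for x = 0 it is a single point.\<close>
    have "?B - cball 0 x = ?B \<or> ?B - cball 0 x = ?B - {0}" using True by (cases "x = 0") auto
    moreover have "emeasure lborel (?B - {0}) = emeasure lborel ?B" by (rule emeasure_Diff_null_set) auto
    ultimately have "emeasure ?L {x<..} = emeasure lborel ?B" unfolding mL by (elim disjE) (simp_all only:)
    then show ?thesis using True N finB by (simp add: emeasure_eq_ennreal_measure max_def power_0_left)
  next
    case False
    have sub: "cball 0 x \<subseteq> ?B" using that by auto
    have "emeasure lborel (?B - cball 0 x) = emeasure lborel ?B - emeasure lborel (cball (0::'a) x)"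
      by (rule emeasure_Diff) (use sub finB le_less_trans[OF emeasure_mono[OF sub] finB] in auto)
    also have "\<dots> = ennreal ?V - ennreal (measure lborel (cball (0::'a) x))"
      using finB le_less_trans[OF emeasure_mono[OF sub] finB] by (simp add: emeasure_eq_ennreal_measure)
    also have "measure lborel (cball (0::'a) x) = x ^ ?N * ?V"
      using content_cball[of x "0::'a"] content_ball[of 1 "0::'a"] False by simp
    also have "ennreal ?V - ennreal (x ^ ?N * ?V) = ennreal (?V - x ^ ?N * ?V)" using False by (intro ennreal_minus) simp
    finally show ?thesis unfolding mL using False by (simp add: max_def algebra_simps)
  qed
  have VR: "emeasure ?R {x<..} = ennreal (?V * (1 - (max x 0) ^ ?N))" if "x < 1" for x
  proof -
    let ?f = "\<lambda>r. sphere_area TYPE('a) * r ^ (?N - 1)"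
    have "emeasure ?R {x<..} = (\<integral>\<^sup>+r. ennreal (?f r) * indicator {0<..<1} r * indicator {x<..} r \<partial>lborel)"
      by (subst emeasure_density) auto
    also have "\<dots> = (\<integral>\<^sup>+r. ennreal (?f r) * indicator {max x 0..1} r \<partial>lborel)"
    proof (rule nn_integral_cong_AE)
      have "AE r in lborel. r \<noteq> max x 0" "AE r in lborel. r \<noteq> (1::real)" by (rule AE_lborel_singleton)+
      then show "AE r in lborel. ennreal (?f r) * indicator {0<..<1} r * indicator {x<..} r = ennreal (?f r) * indicator {max x 0..1} r"
        by eventually_elim (auto simp: indicator_def max_def)
    qed
    also have "\<dots> = ennreal (?V * 1 ^ ?N - ?V * (max x 0) ^ ?N)"
    proof (rule nn_integral_FTC_Icc)
      show "((\<lambda>r. ?V * r ^ ?N) has_real_derivative ?f r) (at r)" for r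
        unfolding sphere_area_def by (auto intro!: derivative_eq_intros)
      show "0 \<le> ?f r" if "r \<in> {max x 0..1}" for r using that sphere_area_pos[where 'a='a] by simp
    qed (use that in auto)
    finally show ?thesis by (simp add: right_diff_distrib)
  qed
  show "emeasure ?L {x<..} = emeasure ?R {x<..}" for x
  proof (cases "x < 1")
    case False
    have e: "?B - cball 0 x = {}" using False by auto
    have L0: "emeasure ?L {x<..} = 0" unfolding mL e by simp
    have "emeasure ?R {x<..} = (\<integral>\<^sup>+r. ennreal (sphere_area TYPE('a) * r ^ (?N - 1)) * indicator {0<..<1} r * indicator {x<..} r \<partial>lborel)"
      by (subst emeasure_density) auto
    also have "\<dots> = (\<integral>\<^sup>+r. 0 \<partial>(lborel :: real measure))"
      by (rule nn_integral_cong) (use False in \<open>auto simp: indicator_def\<close>)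
    finally have "emeasure ?R {x<..} = 0" by simp
    with e show ?thesis by (simp only: L0)
  qed (simp only: VL VR)
qed

lemma emeasure_radial_preimage:
  assumes A: "A \<in> sets borel"
  shows "emeasure lborel (ball (0::'a::euclidean_space) 1 \<inter> norm -` A) =
    (\<integral>\<^sup>+r. ennreal (sphere_area TYPE('a) * r ^ (DIM('a) - 1)) * indicator {0<..<1} r * indicator A r \<partial>lborel)"
proof -
  let ?B = "ball (0::'a) 1"
  have ns: "norm -` A \<in> sets (borel :: 'a measure)" using measurable_sets[of norm "borel :: 'a measure" borel A] A by simp
  have im: "(indicator ?B :: 'a \<Rightarrow> ennreal) \<in> borel_measurable borel" by (rule borel_measurable_indicator) simp
  have "emeasure lborel (?B \<inter> norm -` A) = (\<integral>\<^sup>+y. indicator (?B \<inter> norm -` A) y \<partial>lborel)"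
    by (rule nn_integral_indicator[symmetric]) (use ns in simp)
  also have "\<dots> = (\<integral>\<^sup>+y. indicator ?B y * indicator (norm -` A) y \<partial>lborel)"
    by (rule nn_integral_cong) (auto simp: indicator_def)
  also have "\<dots> = emeasure (density lborel (indicator ?B)) (norm -` A)" using ns im by (subst emeasure_density) auto
  also have "\<dots> = emeasure (distr (density lborel (indicator ?B)) borel norm) A" using A by (subst emeasure_distr) auto
  also have "\<dots> = (\<integral>\<^sup>+r. ennreal (sphere_area TYPE('a) * r ^ (DIM('a) - 1)) * indicator {0<..<1} r * indicator A r \<partial>lborel)"
    unfolding distr_norm_ball using A by (subst emeasure_density) auto
  finally show ?thesis .
qed

lemma negligible_radial_preimage:
  assumes "negligible A"
  shows "negligible {x \<in> ball (0::'a::euclidean_space) 1. norm x \<in> A}"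
proof -
  obtain A' where A': "A' \<in> null_sets lborel" "A \<subseteq> A'"
    using assms by (auto simp: negligible_iff_null_sets null_sets_completion_iff2)
  have Ab: "A' \<in> sets borel" using A' by auto
  have AE: "AE r in lborel. r \<notin> A'" using AE_not_in[OF A'(1)] .
  have "emeasure lborel (ball (0::'a) 1 \<inter> norm -` A') = (\<integral>\<^sup>+r. 0 \<partial>(lborel :: real measure))"
    unfolding emeasure_radial_preimage[OF Ab] by (rule nn_integral_cong_AE) (use AE in \<open>eventually_elim, simp\<close>)
  then have "ball (0::'a) 1 \<inter> norm -` A' \<in> null_sets lborel"
    using measurable_sets[of norm "borel :: 'a measure" borel A'] Ab by (intro null_setsI) auto
  then have "negligible (ball (0::'a) 1 \<inter> norm -` A')"
    by (auto simp: negligible_iff_null_sets null_sets_completion_iff2)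
  then show ?thesis by (rule negligible_subset) (use A' in auto)
qed

text \<open>The density of the radial measure is positive on all of (0,1), so a set of radii whose
  preimage is null is itself null.\<close>

lemma negligible_of_radial_preimage:
  assumes A: "A \<in> sets borel" "A \<subseteq> {0<..<1}" and n: "negligible {x \<in> ball (0::'a::euclidean_space) 1. norm x \<in> A}"
  shows "negligible A"
proof -
  let ?f = "\<lambda>r. ennreal (sphere_area TYPE('a) * r ^ (DIM('a) - 1)) * indicator {0<..<1} r * indicator A r"
  have eq: "{x \<in> ball (0::'a) 1. norm x \<in> A} = ball 0 1 \<inter> norm -` A" by auto
  have s: "ball (0::'a) 1 \<inter> norm -` A \<in> sets borel" using measurable_sets[of norm "borel :: 'a measure" borel A] A by auto
  have "ball (0::'a) 1 \<inter> norm -` A \<in> null_sets lebesgue" using n unfolding eq by (simp add: negligible_iff_null_sets)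
  then have "emeasure lborel (ball (0::'a) 1 \<inter> norm -` A) = 0" using s by (auto simp: null_sets_def emeasure_completion)
  then have "(\<integral>\<^sup>+r. ?f r \<partial>lborel) = 0" unfolding emeasure_radial_preimage[OF A(1)] .
  moreover have "?f \<in> borel_measurable lborel" using A by measurable
  ultimately have "AE r in lborel. ?f r = 0" by (subst (asm) nn_integral_0_iff_AE) auto
  then have "AE r in lborel. r \<notin> A"
  proof eventually_elim
    case (elim r)
    show ?case
    proof
      assume r: "r \<in> A"
      then have "0 < r" "r < 1" using A by auto
      then have "?f r = ennreal (sphere_area TYPE('a) * r ^ (DIM('a) - 1))" using r by simp
      moreover have "0 < sphere_area TYPE('a) * r ^ (DIM('a) - 1)" using sphere_area_pos[where 'a='a] \<open>0 < r\<close> by simp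
      ultimately show False using elim by (simp add: ennreal_eq_0_iff)
    qed
  qed
  then have "A \<in> null_sets lborel" using A by (simp add: AE_iff_null_sets)
  then show ?thesis by (auto simp: negligible_iff_null_sets null_sets_completion_iff2)
qed

lemma polar_borel:
  fixes f :: "real \<Rightarrow> real"
  assumes f[measurable]: "f \<in> borel_measurable borel"
  shows "integrable (lebesgue_on (ball (0::'a::euclidean_space) 1)) (\<lambda>x. f (norm x)) \<longleftrightarrow>
      integrable leb01 (\<lambda>r. r powr (real DIM('a) - 1) * f r)" (is ?I)
    and "(LINT x|lebesgue_on (ball (0::'a) 1). f (norm x)) =
      sphere_area TYPE('a) * (LINT r|leb01. r powr (real DIM('a) - 1) * f r)" (is ?L)
proof -
  let ?B = "ball (0::'a) 1" and ?\<omega> = "sphere_area TYPE('a)" and ?n = "DIM('a) - 1"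
  have fn[measurable]: "(\<lambda>x::'a. f (norm x)) \<in> borel_measurable borel" by measurable
  have BL: "?B \<in> sets lebesgue" by simp
  have dens: "density lborel (indicator ?B) = density lborel (\<lambda>x. ennreal (indicator ?B x))" by (simp add: ennreal_indicator)
  have D: "distr (density lborel (\<lambda>x. ennreal (indicator ?B x))) borel norm = density lborel (\<lambda>r. ennreal (?\<omega> * r ^ ?n * indicator {0<..<1} r))"
  proof -
    have "(\<lambda>r. ennreal (?\<omega> * r ^ ?n) * indicator {0<..<1} r) = (\<lambda>r. ennreal (?\<omega> * r ^ ?n * indicator {0<..<1} r))"
      by (auto simp: indicator_def)
    then show ?thesis using distr_norm_ball[where 'a='a] unfolding dens by simp
  qed
  have wnn: "AE r in lborel. 0 \<le> ?\<omega> * r ^ ?n * indicator {0<..<1} r"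
    using sphere_area_pos[where 'a='a] by (intro AE_I2) (auto simp: indicator_def)
  have bI: "(indicator ?B :: 'a \<Rightarrow> real) \<in> borel_measurable lborel" by (intro borel_measurable_indicator) simp
  have cong: "indicator {0<..<1} r *\<^sub>R (?\<omega> * (r powr (real DIM('a) - 1) * f r)) = (?\<omega> * r ^ ?n * indicator {0<..<1} r) *\<^sub>R f r" for r
  proof (cases "r \<in> {0<..<1}")
    case True
    have e: "real DIM('a) - 1 = real ?n" by (simp add: of_nat_diff)
    have "r powr real ?n = r ^ ?n" using True by (intro powr_realpow) auto
    then have "r powr (real DIM('a) - 1) = r ^ ?n" unfolding e .
    then show ?thesis using True by simp
  qed simp
  have lm: "(\<lambda>x. indicator ?B x *\<^sub>R f (norm x)) \<in> borel_measurable lborel"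
    using fn by (intro borel_measurable_scaleR bI) simp
  have "integrable (lebesgue_on ?B) (\<lambda>x. f (norm x)) \<longleftrightarrow> integrable lebesgue (\<lambda>x. indicator ?B x *\<^sub>R f (norm x))"
    using BL by (simp add: integrable_restrict_space)
  also have "\<dots> \<longleftrightarrow> integrable lborel (\<lambda>x. indicator ?B x *\<^sub>R f (norm x))" by (rule integrable_completion[OF lm])
  also have "\<dots> \<longleftrightarrow> integrable (density lborel (\<lambda>x. ennreal (indicator ?B x))) (\<lambda>x. f (norm x))"
    by (rule integrable_density[symmetric]) (use bI in auto)
  also have "\<dots> \<longleftrightarrow> integrable (distr (density lborel (\<lambda>x. ennreal (indicator ?B x))) borel norm) f"
    by (rule integrable_distr_eq[symmetric]) auto
  also have "\<dots> \<longleftrightarrow> integrable lborel (\<lambda>r. (?\<omega> * r ^ ?n * indicator {0<..<1} r) *\<^sub>R f r)"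
    unfolding D by (rule integrable_density) (use wnn in auto)
  also have "\<dots> \<longleftrightarrow> integrable lebesgue (\<lambda>r. (?\<omega> * r ^ ?n * indicator {0<..<1} r) *\<^sub>R f r)"
    by (rule integrable_completion[symmetric]) measurable
  also have "\<dots> \<longleftrightarrow> integrable leb01 (\<lambda>r. ?\<omega> * (r powr (real DIM('a) - 1) * f r))"
    unfolding cong[symmetric] by (subst integrable_restrict_space) auto
  also have "\<dots> \<longleftrightarrow> integrable leb01 (\<lambda>r. r powr (real DIM('a) - 1) * f r)"
    using sphere_area_pos[where 'a='a] by simp
  finally show ?I .
  have "(LINT x|lebesgue_on ?B. f (norm x)) = (LINT x|lebesgue. indicator ?B x *\<^sub>R f (norm x))"
    using BL by (simp add: integral_restrict_space)
  also have "\<dots> = (LINT x|lborel. indicator ?B x *\<^sub>R f (norm x))" by (rule integral_completion[OF lm])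
  also have "\<dots> = (LINT x|density lborel (\<lambda>x. ennreal (indicator ?B x)). f (norm x))"
    by (rule integral_density[symmetric]) (use bI in auto)
  also have "\<dots> = (LINT r|distr (density lborel (\<lambda>x. ennreal (indicator ?B x))) borel norm. f r)"
    by (rule integral_distr[symmetric]) auto
  also have "\<dots> = (LINT r|lborel. (?\<omega> * r ^ ?n * indicator {0<..<1} r) *\<^sub>R f r)"
    unfolding D by (rule integral_density) (use wnn in auto)
  also have "\<dots> = (LINT r|lebesgue. (?\<omega> * r ^ ?n * indicator {0<..<1} r) *\<^sub>R f r)"
    by (rule integral_completion[symmetric]) measurable
  also have "\<dots> = (LINT r|leb01. ?\<omega> * (r powr (real DIM('a) - 1) * f r))"
    unfolding cong[symmetric] by (subst integral_restrict_space) auto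
  finally show ?L by simp
qed

section \<open>From Borel to Lebesgue measurable profiles\<close>

lemma AE_lborel_lebesgue_on:
  fixes S :: "'a::euclidean_space set"
  assumes "AE x in lborel. x \<in> S \<longrightarrow> P x" "S \<in> sets lebesgue" shows "AE x in lebesgue_on S. P x"
  using AE_completion[OF assms(1)] assms(2) by (subst AE_restrict_space_iff) auto

lemma borel_representative:
  fixes f :: "'a::euclidean_space \<Rightarrow> real"
  assumes "f \<in> borel_measurable (lebesgue_on S)" "S \<in> sets lebesgue"
  obtains f' where "f' \<in> borel_measurable borel" "AE x in lebesgue_on S. f x = f' x"
proof -
  have "(\<lambda>x. if x \<in> S then f x else 0) \<in> borel_measurable lebesgue" by (rule borel_measurable_if_I[OF assms])
  then obtain f' where f': "f' \<in> borel_measurable lborel" "AE x in lborel. (if x \<in> S then f x else 0) = f' x"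
    using completion_ex_borel_measurable_real by blast
  from f'(2) have "AE x in lborel. x \<in> S \<longrightarrow> f x = f' x" by eventually_elim auto
  then have "AE x in lebesgue_on S. f x = f' x" by (rule AE_lborel_lebesgue_on[OF _ assms(2)])
  then show ?thesis using f' that by auto
qed

text \<open>Null sets of radii pull back to null sets. The origin is excluded because its norm lies
  outside (0,1), where nothing is known of \<open>P\<close>.\<close>

lemma AE_radial:
  assumes "AE r in leb01. P r"
  shows "AE x in lebesgue_on (ball (0::'a::euclidean_space) 1). x \<noteq> 0 \<longrightarrow> P (norm x)"
proof -
  have "negligible {r \<in> {0<..<1}. \<not> P r}" using assms by (simp add: AE_lebesgue_on_iff)
  from negligible_radial_preimage[OF this, where 'a='a] show ?thesis
    by (subst AE_lebesgue_on_iff) (auto elim!: negligible_subset)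
qed

lemma AE_ball_nonzero: "AE x in lebesgue_on (ball (0::'a::euclidean_space) 1). x \<noteq> 0"
proof -
  have "negligible {x \<in> ball (0::'a) 1. \<not> x \<noteq> 0}" by (rule negligible_subset[of "{0}"]) auto
  then show ?thesis by (subst AE_lebesgue_on_iff) auto
qed

text \<open>Composition of a Lebesgue measurable function with the norm stays measurable because
  null sets of radii pull back to null sets; the formula is transported from a Borel
  representative.\<close>

theorem polar:
  fixes f :: "real \<Rightarrow> real"
  assumes f: "f \<in> borel_measurable leb01"
  shows "(\<lambda>x. f (norm x)) \<in> borel_measurable (lebesgue_on (ball (0::'a::euclidean_space) 1))"
    and "integrable (lebesgue_on (ball (0::'a) 1)) (\<lambda>x. f (norm x)) \<longleftrightarrow>
      integrable leb01 (\<lambda>r. r powr (real DIM('a) - 1) * f r)"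
    and "(LINT x|lebesgue_on (ball (0::'a) 1). f (norm x)) =
      sphere_area TYPE('a) * (LINT r|leb01. r powr (real DIM('a) - 1) * f r)"
proof -
  obtain f' where f': "f' \<in> borel_measurable borel" "AE r in leb01. f r = f' r" using borel_representative[OF f] by auto
  note [measurable] = f'(1)
  have AE: "AE x in lebesgue_on (ball (0::'a) 1). f' (norm x) = f (norm x)"
    using AE_radial[OF f'(2), where 'a='a] AE_ball_nonzero[where 'a='a] by eventually_elim simp
  have m': "(\<lambda>x::'a. f' (norm x)) \<in> borel_measurable (lebesgue_on (ball (0::'a) 1))"
    using f'(1) by (intro measurable_restrict_space1 measurable_completion) measurable
  show m: "(\<lambda>x. f (norm x)) \<in> borel_measurable (lebesgue_on (ball (0::'a) 1))"
    by (rule borel_measurable_lebesgue_on_AE[OF m' _ AE]) simp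
  have f'm: "f' \<in> borel_measurable leb01" using f'(1) by (intro measurable_restrict_space1 measurable_completion) measurable
  have w: "(\<lambda>r. r powr (real DIM('a) - 1) * h r) \<in> borel_measurable leb01" if "h \<in> borel_measurable leb01" for h
    using that by measurable
  have AE2: "AE r in leb01. r powr (real DIM('a) - 1) * f' r = r powr (real DIM('a) - 1) * f r"
    using f'(2) by eventually_elim simp
  show "integrable (lebesgue_on (ball (0::'a) 1)) (\<lambda>x. f (norm x)) \<longleftrightarrow> integrable leb01 (\<lambda>r. r powr (real DIM('a) - 1) * f r)"
    using polar_borel(1)[OF f'(1), where 'a='a] integrable_cong_AE[OF m' m AE] integrable_cong_AE[OF w[OF f'm] w[OF f] AE2] by simp
  show "(LINT x|lebesgue_on (ball (0::'a) 1). f (norm x)) = sphere_area TYPE('a) * (LINT r|leb01. r powr (real DIM('a) - 1) * f r)"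
    using polar_borel(2)[OF f'(1), where 'a='a] integral_cong_AE[OF m' m AE] integral_cong_AE[OF w[OF f'm] w[OF f] AE2] by simp
qed

section \<open>Integration along a ray\<close>

lemma nn_integral_scaleR:
  fixes f :: "'a::euclidean_space \<Rightarrow> ennreal"
  assumes [measurable]: "f \<in> borel_measurable borel" and c: "0 < c"
  shows "(\<integral>\<^sup>+x. f x \<partial>lborel) = ennreal (c ^ DIM('a)) * (\<integral>\<^sup>+y. f (c *\<^sub>R y) \<partial>lborel)"
proof -
  have "(\<integral>\<^sup>+x. f x \<partial>lborel) = (\<integral>\<^sup>+x. f x \<partial>density (distr lborel borel (\<lambda>x. 0 + c *\<^sub>R x)) (\<lambda>_. ennreal (\<bar>c\<bar> ^ DIM('a))))"
    using lborel_affine[of c "0::'a"] c by simp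
  also have "\<dots> = ennreal (c ^ DIM('a)) * (\<integral>\<^sup>+x. f x \<partial>distr lborel borel (\<lambda>x. 0 + c *\<^sub>R x))"
    using c by (subst nn_integral_density) (auto simp: nn_integral_cmult)
  also have "(\<integral>\<^sup>+x. f x \<partial>distr lborel borel (\<lambda>x. 0 + c *\<^sub>R x)) = (\<integral>\<^sup>+y. f (0 + c *\<^sub>R y) \<partial>lborel)"
    by (rule nn_integral_distr) auto
  finally show ?thesis by simp
qed

text \<open>Integrating \<open>F (t y)\<close> over \<open>t > 0\<close> and over the shell \<open>1/2 < |y| < 1\<close> is, by scaling, dominated by
  the integral of \<open>F\<close>, since \<open>x / t\<close> lies in the shell only for \<open>|x| < t < 2 |x|\<close>.\<close>

theorem exists_integrable_ray:
  fixes F :: "'a::euclidean_space \<Rightarrow> ennreal"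
  assumes F[measurable]: "F \<in> borel_measurable borel" and fin: "(\<integral>\<^sup>+x. F x \<partial>lborel) < \<infinity>"
  obtains e where "norm e = 1" "(\<integral>\<^sup>+s. ennreal (s ^ (DIM('a) - 1)) * indicator {0<..} s * F (s *\<^sub>R e) \<partial>lborel) < \<infinity>"
proof -
  let ?N = "DIM('a)"
  define S where "S = ball (0::'a) 1 - cball 0 (1/2)"
  have S[measurable]: "S \<in> sets borel" by (simp add: S_def)
  define J where "J y = (\<integral>\<^sup>+t. ennreal (t ^ (?N - 1)) * indicator {0<..} t * F (t *\<^sub>R y) \<partial>lborel)" for y
  have Jm[measurable]: "J \<in> borel_measurable borel" unfolding J_def by measurable
  \<comment> \<open>Substituting x = t y for fixed t: the Jacobian t^(-n), with n the dimension,
    meets t^(n-1) and leaves the kernel 1/t.\<close>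
  have inner: "(\<integral>\<^sup>+y. indicator S y * (ennreal (t ^ (?N - 1)) * indicator {0<..} t * F (t *\<^sub>R y)) \<partial>lborel) =
     (\<integral>\<^sup>+x. ennreal (1 / t) * indicator {0<..} t * (indicator S (x /\<^sub>R t) * F x) \<partial>lborel)" for t
  proof (cases "t > 0")
    case True
    have tN: "ennreal (t ^ (?N - 1)) = ennreal (1 / t) * ennreal (t ^ ?N)"
    proof -
      have "t ^ ?N = t * t ^ (?N - 1)" by (metis DIM_positive power_eq_if less_numeral_extra(3))
      then show ?thesis using True by (simp flip: ennreal_mult)
    qed
    have ind: "indicator {0<..} t = (1::ennreal)" using True by simp
    have "(\<integral>\<^sup>+y. indicator S y * (ennreal (t ^ (?N - 1)) * indicator {0<..} t * F (t *\<^sub>R y)) \<partial>lborel) =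
      (\<integral>\<^sup>+y. ennreal (t ^ (?N - 1)) * (indicator S y * F (t *\<^sub>R y)) \<partial>lborel)"
      by (rule nn_integral_cong) (use True in \<open>auto simp: mult_ac\<close>)
    also have "\<dots> = ennreal (t ^ (?N - 1)) * (\<integral>\<^sup>+y. indicator S y * F (t *\<^sub>R y) \<partial>lborel)"
      by (rule nn_integral_cmult) measurable
    also have "\<dots> = ennreal (1 / t) * ennreal (t ^ ?N) * (\<integral>\<^sup>+y. indicator S y * F (t *\<^sub>R y) \<partial>lborel)"
      by (simp only: tN)
    also have "ennreal (1 / t) * ennreal (t ^ ?N) * (\<integral>\<^sup>+y. indicator S y * F (t *\<^sub>R y) \<partial>lborel) =
       ennreal (1 / t) * (\<integral>\<^sup>+x. indicator S (x /\<^sub>R t) * F x \<partial>lborel)"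
      using nn_integral_scaleR[of "\<lambda>x. indicator S (x /\<^sub>R t) * F x", OF _ True] True by (simp add: mult.assoc)
    also have "\<dots> = (\<integral>\<^sup>+x. ennreal (1 / t) * (indicator S (x /\<^sub>R t) * F x) \<partial>lborel)"
      by (rule nn_integral_cmult[symmetric]) measurable
    finally show ?thesis by (simp only: ind mult_1_right)
  qed simp
  \<comment> \<open>x/t lies in the shell only for t in an interval of length |x|, on which 1/t is
    at most 1/|x|.\<close>
  have ker: "(\<integral>\<^sup>+t. ennreal (1 / t) * indicator {0<..} t * indicator S (x /\<^sub>R t) \<partial>lborel) \<le> 1" for x :: 'a
  proof (cases "x = 0")
    case True
    then show ?thesis by (simp add: S_def)
  next
    case False
    then have nx: "norm x > 0" by simp
    have "(\<integral>\<^sup>+t. ennreal (1 / t) * indicator {0<..} t * indicator S (x /\<^sub>R t) \<partial>lborel) \<le> (\<integral>\<^sup>+t. ennreal (1 / norm x) * indicator {norm x..2 * norm x} t \<partial>lborel)"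
    proof (rule nn_integral_mono)
      fix t :: real
      show "ennreal (1 / t) * indicator {0<..} t * indicator S (x /\<^sub>R t) \<le> ennreal (1 / norm x) * indicator {norm x..2 * norm x} t"
      proof (cases "t > 0 \<and> x /\<^sub>R t \<in> S")
        case True
        have nt: "norm (x /\<^sub>R t) = norm x / t" using True by (simp add: divide_inverse mult.commute)
        have "norm (x /\<^sub>R t) < 1" "1/2 < norm (x /\<^sub>R t)" using True by (auto simp: S_def)
        then have 1: "norm x < t" "t < 2 * norm x"
          unfolding nt using True by (simp_all add: pos_divide_less_eq pos_less_divide_eq)
        have 2: "1 / t \<le> 1 / norm x" using 1(1) nx True by (intro divide_left_mono mult_pos_pos) auto
        have 3: "indicator {norm x..2 * norm x} t = (1::ennreal)" "indicator {0<..} t = (1::ennreal)" "indicator S (x /\<^sub>R t) = (1::ennreal)"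
          using 1 True by simp_all
        show ?thesis unfolding 3 using ennreal_leI[OF 2] by simp
      qed (auto simp: indicator_def)
    qed
    also have "\<dots> = ennreal (1 / norm x) * ennreal (norm x)" using nx by (simp add: nn_integral_cmult_indicator)
    also have "\<dots> = 1" using nx by (simp flip: ennreal_mult)
    finally show ?thesis .
  qed
  have "(\<integral>\<^sup>+y. indicator S y * J y \<partial>lborel) = (\<integral>\<^sup>+y. (\<integral>\<^sup>+t. indicator S y * (ennreal (t ^ (?N - 1)) * indicator {0<..} t * F (t *\<^sub>R y)) \<partial>lborel) \<partial>lborel)"
    unfolding J_def by (rule nn_integral_cong, rule nn_integral_cmult[symmetric]) measurable
  also have "\<dots> = (\<integral>\<^sup>+t. (\<integral>\<^sup>+y. indicator S y * (ennreal (t ^ (?N - 1)) * indicator {0<..} t * F (t *\<^sub>R y)) \<partial>lborel) \<partial>lborel)"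
    by (rule lborel_pair.Fubini') measurable
  also have "\<dots> = (\<integral>\<^sup>+t. (\<integral>\<^sup>+x. ennreal (1 / t) * indicator {0<..} t * (indicator S (x /\<^sub>R t) * F x) \<partial>lborel) \<partial>lborel)"
    by (simp only: inner)
  also have "\<dots> = (\<integral>\<^sup>+x. (\<integral>\<^sup>+t. ennreal (1 / t) * indicator {0<..} t * (indicator S (x /\<^sub>R t) * F x) \<partial>lborel) \<partial>lborel)"
    by (rule lborel_pair.Fubini') measurable
  also have "\<dots> = (\<integral>\<^sup>+x. (\<integral>\<^sup>+t. ennreal (1 / t) * indicator {0<..} t * indicator S (x /\<^sub>R t) \<partial>lborel) * F x \<partial>lborel)"
    by (rule nn_integral_cong) (subst nn_integral_multc[symmetric], measurable, simp add: mult.assoc)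
  also have "\<dots> \<le> (\<integral>\<^sup>+x. 1 * F x \<partial>lborel)"
    by (intro nn_integral_mono mult_right_mono ker) auto
  also have "\<dots> < \<infinity>" using fin by simp
  finally have "(\<integral>\<^sup>+y. indicator S y * J y \<partial>lborel) \<noteq> \<infinity>" by simp
  then have AE: "AE y in lborel. indicator S y * J y \<noteq> \<infinity>" by (intro nn_integral_PInf_AE) measurable
  \<comment> \<open>J is finite almost everywhere on the shell, and the shell, being nonempty and
    open, is not null.\<close>
  have "\<exists>y\<in>S. J y < \<infinity>"
  proof (rule ccontr)
    assume "\<not> ?thesis"
    then have "\<And>y. y \<in> S \<Longrightarrow> J y = \<infinity>" by (auto simp: less_top[symmetric])
    then have "AE y in lborel. y \<notin> S" using AE by (auto elim!: eventually_mono)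
    then have "S \<in> null_sets lborel" by (simp add: AE_iff_null_sets)
    then have "negligible S" by (auto simp: negligible_iff_null_sets null_sets_completion_iff2)
    moreover have "open S" by (simp add: S_def open_Diff)
    moreover have "S \<noteq> {}"
    proof -
      obtain b :: 'a where "b \<in> Basis" using nonempty_Basis by blast
      then have "(3/4) *\<^sub>R b \<in> S" by (simp add: S_def)
      then show ?thesis by blast
    qed
    ultimately show False using open_not_negligible by blast
  qed
  then obtain y where y: "y \<in> S" "J y < \<infinity>" by blast
  have ny: "norm y > 0" using y(1) by (auto simp: S_def)
  \<comment> \<open>Passing from y to its direction rescales the parameter of the ray, which
    multiplies the integral by a power of |y|.\<close>
  define e where "e = y /\<^sub>R norm y"
  have e: "norm e = 1" "norm y *\<^sub>R e = y" using ny by (auto simp: e_def)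
  have "(\<integral>\<^sup>+s. ennreal (s ^ (?N - 1)) * indicator {0<..} s * F (s *\<^sub>R e) \<partial>lborel) =
     ennreal (norm y ^ DIM(real)) * (\<integral>\<^sup>+t. ennreal ((norm y *\<^sub>R t) ^ (?N - 1)) * indicator {0<..} (norm y *\<^sub>R t) * F ((norm y *\<^sub>R t) *\<^sub>R e) \<partial>lborel)"
    by (rule nn_integral_scaleR[OF _ ny]) measurable
  also have "(\<integral>\<^sup>+t. ennreal ((norm y *\<^sub>R t) ^ (?N - 1)) * indicator {0<..} (norm y *\<^sub>R t) * F ((norm y *\<^sub>R t) *\<^sub>R e) \<partial>lborel) =
     (\<integral>\<^sup>+t. ennreal (norm y ^ (?N - 1)) * (ennreal (t ^ (?N - 1)) * indicator {0<..} t * F (t *\<^sub>R y)) \<partial>lborel)"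
  proof (rule nn_integral_cong)
    fix t :: real
    have "(norm y *\<^sub>R t) *\<^sub>R e = t *\<^sub>R y" using e(2) by (metis mult.commute real_scaleR_def scaleR_scaleR)
    then show "ennreal ((norm y *\<^sub>R t) ^ (?N - 1)) * indicator {0<..} (norm y *\<^sub>R t) * F ((norm y *\<^sub>R t) *\<^sub>R e) =
      ennreal (norm y ^ (?N - 1)) * (ennreal (t ^ (?N - 1)) * indicator {0<..} t * F (t *\<^sub>R y))"
      using ny by (cases "t > 0") (auto simp: power_mult_distrib ennreal_mult mult.assoc zero_less_mult_iff)
  qed
  also have "\<dots> = ennreal (norm y ^ (?N - 1)) * J y" unfolding J_def by (rule nn_integral_cmult) measurable
  finally have "(\<integral>\<^sup>+s. ennreal (s ^ (?N - 1)) * indicator {0<..} s * F (s *\<^sub>R e) \<partial>lborel) < \<infinity>"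
    using y(2) by (simp add: ennreal_mult_less_top)
  then show ?thesis using that e(1) by blast
qed

section \<open>Density of test functions\<close>

abbreviation dist2 :: "(real \<Rightarrow> real) \<Rightarrow> (real \<Rightarrow> real) \<Rightarrow> real" where
  "dist2 f g \<equiv> (LINT r|leb01. (f r - g r)^2)"

abbreviation L2_01 :: "(real \<Rightarrow> real) set" where
  "L2_01 \<equiv> {f \<in> borel_measurable leb01. integrable leb01 (\<lambda>r. (f r)^2)}"

lemma LINT_const_01: "(LINT r|leb01. c) = (c::real)"
proof -
  have "measure leb01 (space leb01) = 1" by (simp add: measure_restrict_space space_restrict_space)
  then show ?thesis by (subst lebesgue_integral_const) simp
qed

lemma square_diff_le: "(a - c)^2 \<le> 2 * (a - b)^2 + 2 * (b - c)^2" for a b c :: real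
  using zero_le_power2[of "(a - b) - (b - c)"] by (simp add: power2_eq_square algebra_simps)

lemma L2_01_diff:
  assumes "f \<in> L2_01" "g \<in> L2_01" shows "integrable leb01 (\<lambda>r. (f r - g r)^2)"
  using weighted_square_expand(1)[of "\<lambda>_. 1" leb01 f g "-1"] assms by simp

lemma dist2_triangle:
  assumes "f \<in> L2_01" "g \<in> L2_01" "h \<in> L2_01"
  shows "dist2 f h \<le> 2 * dist2 f g + 2 * dist2 g h"
proof -
  have "dist2 f h \<le> (LINT r|leb01. 2 * (f r - g r)^2 + 2 * (g r - h r)^2)"
    using L2_01_diff assms square_diff_le by (intro integral_mono) auto
  then show ?thesis using L2_01_diff[OF assms(1,2)] L2_01_diff[OF assms(2,3)] by simp
qed

lemma bounded_L2_01:
  assumes "f \<in> borel_measurable leb01" "\<And>r. r \<in> {0<..<1} \<Longrightarrow> \<bar>f r\<bar> \<le> K"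
  shows "f \<in> L2_01"
proof -
  have "(f r)^2 \<le> K\<^sup>2" if "r \<in> {0<..<1}" for r using assms(2)[OF that] by (metis abs_ge_zero power2_abs power_mono)
  then have "integrable leb01 (\<lambda>r. (f r)^2)"
    using assms(1) by (intro Bochner_Integration.integrable_bound[OF integrable_const_01[of "K\<^sup>2"]]) (auto simp: space_restrict_space)
  then show ?thesis using assms(1) by simp
qed

lemma continuous_L2_01:
  assumes "continuous_on {0..1} f" shows "f \<in> L2_01"
proof -
  have "compact (f ` {0..1})" by (rule compact_continuous_image[OF assms]) simp
  then obtain K where "\<And>r. r \<in> {0..1} \<Longrightarrow> \<bar>f r\<bar> \<le> K" using compact_imp_bounded bounded_iff by (metis imageI real_norm_def)
  then have K: "\<And>r. r \<in> {0<..<1} \<Longrightarrow> \<bar>f r\<bar> \<le> K" by simp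
  have "f \<in> borel_measurable leb01"
    by (intro continuous_imp_measurable_on_sets_lebesgue continuous_on_subset[OF assms]) auto
  then show ?thesis by (rule bounded_L2_01) (rule K)
qed

lemma test_function_L2_01: "k \<in> test_functions {0<..<1} \<Longrightarrow> k \<in> L2_01"
  by (rule continuous_L2_01) (auto elim!: test_functionE intro: smooth_continuous)

lemma dist2_dominated:
  assumes f: "f \<in> borel_measurable leb01" and h: "\<And>n::nat. h n \<in> borel_measurable leb01" and w: "integrable leb01 w"
    and lim: "AE r in leb01. (\<lambda>n. h n r) \<longlonglongrightarrow> f r" and bd: "\<And>n r. r \<in> {0<..<1} \<Longrightarrow> (f r - h n r)\<^sup>2 \<le> w r" and e: "e > 0"
  shows "\<exists>n. dist2 f (h n) < e"
proof -
  have "(\<lambda>n. dist2 f (h n)) \<longlonglongrightarrow> (LINT r|leb01. 0)"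
  proof (rule integral_dominated_convergence[OF _ _ w])
    show "AE r in leb01. (\<lambda>n. (f r - h n r)^2) \<longlonglongrightarrow> 0"
      using lim
    proof eventually_elim
      case (elim r)
      then have "(\<lambda>n. (f r - h n r)^2) \<longlonglongrightarrow> (f r - f r)\<^sup>2" by (intro tendsto_intros)
      then show ?case by simp
    qed
    show "AE r in leb01. norm ((f r - h n r)^2) \<le> w r" for n
      using bd by (intro AE_I2) (simp add: space_restrict_space)
  qed (use f h in measurable)
  then have "(\<lambda>n. dist2 f (h n)) \<longlonglongrightarrow> 0" by simp
  then have "\<forall>\<^sub>F n in sequentially. dist2 f (h n) < e" using e by (rule order_tendstoD)
  then show ?thesis by (auto simp: eventually_sequentially)
qed

lemma real_polynomial_smooth: "real_polynomial_function (p :: real \<Rightarrow> real) \<Longrightarrow> smooth p"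
proof (induction rule: real_polynomial_function.induct)
  case (linear f)
  have "f = (\<lambda>x. f 1 * (1 * (x \<bullet> 1) + 0))"
    using linear linear_simps(5)[of f] by (metis (no_types, opaque_lifting) add.right_neutral inner_real_def mult.commute mult.right_neutral mult_1 real_scaleR_def)
  moreover have "smooth (\<lambda>x::real. f 1 * (1 * (x \<bullet> 1) + 0))"
  proof (intro smooth_cmult smooth_affine_inner)
    show "smooth (\<lambda>x::real. x)"
    proof (rule smooth_fun_algebra[where A="{\<lambda>x. x}"])
      fix g :: "real \<Rightarrow> real" and b :: real assume "g \<in> {\<lambda>x. x}"
      then have g: "g = (\<lambda>x. x)" by simp
      then show "g differentiable_on UNIV" by simp
      have "partial_deriv b g = (\<lambda>x. b)" unfolding g by (rule partial_deriv_eq) (rule has_derivative_ident)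
      then show "partial_deriv b g \<in> fun_algebra {\<lambda>x. x}" by (simp add: fun_algebra.const)
    qed (auto intro: fun_algebra.gen)
  qed
  ultimately show ?case by simp
qed (auto intro: smooth_add smooth_mult)

lemma flat_tendsto_1:
  assumes "filterlim s at_top sequentially" shows "(\<lambda>n. flat 0 (s n)) \<longlonglongrightarrow> 1"
proof -
  have "(\<lambda>n. exp (- inverse (s n))) \<longlonglongrightarrow> exp (- 0)"
    by (intro tendsto_intros filterlim_compose[OF tendsto_inverse_0_at_top[OF filterlim_ident] assms])
  then have "(\<lambda>n. exp (- inverse (s n))) \<longlonglongrightarrow> 1" by simp
  then show ?thesis
  proof (rule Lim_transform_eventually)
    have "\<forall>\<^sub>F n in sequentially. 0 < s n" using assms by (simp add: filterlim_at_top_dense)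
    then show "\<forall>\<^sub>F n in sequentially. exp (- inverse (s n)) = flat 0 (s n)"
      by eventually_elim (simp add: flat_def divide_inverse)
  qed
qed

text \<open>Clamping makes the function bounded, so that continuous approximants can be clamped
  alike and dominated by a constant. Polynomials then provide smoothness, and bumps filling (0,1)
  provide compact support.\<close>

lemma test_functions_dense_L2:
  assumes g: "g \<in> L2_01" and e: "e > 0"
  shows "\<exists>k\<in>test_functions {0<..<1}. dist2 g k < e"
proof -
  have gm: "g \<in> borel_measurable leb01" and gi: "integrable leb01 (\<lambda>r. (g r)^2)" using g by auto
  \<comment> \<open>Three uses of the triangle inequality for squares weigh the four errors by 2, 4,
    8 and 8, in total 22 < 32.\<close>
  define e' where "e' = e / 32"
  have e': "e' > 0" using e by (simp add: e'_def)
  define cl where "cl K y = max (- K) (min K y)" for K y :: real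
  have clb: "\<bar>cl K y\<bar> \<le> K" if "0 \<le> K" for K y using that by (auto simp: cl_def)
  have clm: "(\<lambda>r. cl K (f r)) \<in> borel_measurable leb01" if "f \<in> borel_measurable leb01" for f K
    using that unfolding cl_def by measurable
  have "\<exists>n. dist2 g (\<lambda>r. cl (real n) (g r)) < e'"
  proof (rule dist2_dominated[OF gm clm[OF gm] gi _ _ e'])
    show "AE r in leb01. (\<lambda>n. cl (real n) (g r)) \<longlonglongrightarrow> g r"
    proof (rule AE_I2, rule tendsto_eventually)
      fix r
      obtain N :: nat where "\<bar>g r\<bar> \<le> real N" using real_arch_simple by blast
      then show "\<forall>\<^sub>F n in sequentially. cl (real n) (g r) = g r"
        unfolding eventually_sequentially by (intro exI[of _ N]) (auto simp: cl_def)
    qed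
    show "(g r - cl (real n) (g r))^2 \<le> (g r)^2" for n r
      by (rule abs_le_square_iff[THEN iffD1]) (auto simp: cl_def abs_le_iff max_def min_def)
  qed
  then obtain n where n: "dist2 g (\<lambda>r. cl (real n) (g r)) < e'" by blast
  define K where "K = real n"
  define g1 where "g1 r = cl K (g r)" for r
  have g1m: "g1 \<in> borel_measurable leb01" unfolding g1_def by (rule clm[OF gm])
  have g1b: "\<bar>g1 r\<bar> \<le> K" for r unfolding g1_def by (rule clb) (simp add: K_def)
  have g1L: "g1 \<in> L2_01" by (rule bounded_L2_01[OF g1m g1b])
  have d1: "dist2 g g1 < e'" using n by (simp add: g1_def K_def)
  have "g1 measurable_on {0<..<1}" using g1m by (simp add: measurable_on_iff_borel_measurable)
  then obtain Nn F where N: "negligible Nn" and cF: "\<And>n. continuous_on UNIV (F n)"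
    and lF: "\<And>x. x \<notin> Nn \<Longrightarrow> (\<lambda>n. F n x) \<longlonglongrightarrow> (if x \<in> {0<..<1} then g1 x else 0)"
    unfolding measurable_on_def by blast
  have "\<exists>n. dist2 g1 (\<lambda>r. cl K (F n r)) < e'"
  proof (rule dist2_dominated[OF g1m _ integrable_const_01[of "(2 * K)^2"] _ _ e'])
    have Fm: "F n \<in> borel_measurable leb01" for n
      by (intro continuous_imp_measurable_on_sets_lebesgue continuous_on_subset[OF cF]) auto
    then show "(\<lambda>r. cl K (F n r)) \<in> borel_measurable leb01" for n by (rule clm)
    show "AE r in leb01. (\<lambda>n. cl K (F n r)) \<longlonglongrightarrow> g1 r"
    proof -
      have "negligible {r \<in> {0<..<1}. \<not> r \<notin> Nn}" by (rule negligible_subset[OF N]) auto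
      then have "AE r in leb01. r \<notin> Nn" by (subst AE_lebesgue_on_iff) auto
      then show ?thesis using AE_space
      proof eventually_elim
        case (elim r)
        then have "(\<lambda>n. F n r) \<longlonglongrightarrow> g1 r" using lF[of r] by (simp add: space_restrict_space)
        then have "(\<lambda>n. cl K (F n r)) \<longlonglongrightarrow> cl K (g1 r)" unfolding cl_def by (intro tendsto_intros)
        moreover have "cl K (g1 r) = g1 r" using g1b[of r] by (auto simp: cl_def abs_le_iff)
        ultimately show ?case by simp
      qed
    qed
    show "(g1 r - cl K (F n r))^2 \<le> (2 * K)^2" for n r
      using g1b[of r] clb[of K "F n r"] by (intro abs_le_square_iff[THEN iffD1]) (auto simp: K_def)
  qed
  then obtain n2 where n2: "dist2 g1 (\<lambda>r. cl K (F n2 r)) < e'" by blast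
  define h where "h r = cl K (F n2 r)" for r
  have ch: "continuous_on {0..1} h" unfolding h_def cl_def by (intro continuous_intros continuous_on_subset[OF cF]) auto
  have hL: "h \<in> L2_01" by (rule continuous_L2_01[OF ch])
  have d2: "dist2 g1 h < e'" using n2 by (simp add: h_def)
  have "sqrt (e' / 2) > 0" using e' by simp
  then obtain p where p: "real_polynomial_function p" "\<And>x. x \<in> {0..1} \<Longrightarrow> \<bar>h x - p x\<bar> < sqrt (e' / 2)"
    using Stone_Weierstrass_real_polynomial_function[OF _ ch, of "sqrt (e' / 2)"] by auto
  have sp: "smooth p" by (rule real_polynomial_smooth[OF p(1)])
  have cp: "continuous_on {0..1} p" by (rule smooth_continuous[OF sp])
  have pL: "p \<in> L2_01" by (rule continuous_L2_01[OF cp])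
  have d3: "dist2 h p < e'"
  proof -
    have "dist2 h p \<le> (LINT r|leb01. e' / 2)"
    proof (rule integral_mono[OF L2_01_diff[OF hL pL] integrable_const_01])
      fix r assume "r \<in> space leb01"
      then have "\<bar>h r - p r\<bar> < sqrt (e' / 2)" by (intro p) (simp add: space_restrict_space)
      then have "\<bar>h r - p r\<bar>\<^sup>2 \<le> (sqrt (e' / 2))^2" by (intro power_mono) auto
      then show "(h r - p r)^2 \<le> e' / 2" using e' by simp
    qed
    then show ?thesis using e' unfolding LINT_const_01 by linarith
  qed
  \<comment> \<open>The box fills (0,1) while its edges steepen: at a fixed r the steepness times
    the distance to either edge tends to infinity, so the bumps tend to 1.\<close>
  define B where "B n = box_bump (1 / (real n + 3)) (1 - 1 / (real n + 3)) n" for n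
  have BT: "B n \<in> test_functions {0<..<1}" for n
  proof -
    define t where "t = 1 / (real n + 3)"
    have "0 < t" by (simp add: t_def)
    then have "{t..1 - t} \<subseteq> {0<..<1}" by auto
    then have "{1 / (real n + 3)..1 - 1 / (real n + 3)} \<subseteq> {0<..<1}" by (simp only: t_def)
    then show ?thesis unfolding B_def by (intro box_bump_test_function) simp
  qed
  have kT: "(\<lambda>r. p r * B n r) \<in> test_functions {0<..<1}" for n
    using BT[of n] by (auto simp: test_functions_def intro!: smooth_mult sp)
  have "compact (p ` {0..1})" by (rule compact_continuous_image[OF cp]) simp
  then obtain C where C: "\<And>r. r \<in> {0..1} \<Longrightarrow> \<bar>p r\<bar> \<le> C" using compact_imp_bounded bounded_iff by (metis imageI real_norm_def)
  have "\<exists>n. dist2 p (\<lambda>r. p r * B n r) < e'"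
  proof (rule dist2_dominated[OF _ _ integrable_const_01[of "C\<^sup>2"] _ _ e'])
    show "p \<in> borel_measurable leb01" using pL by simp
    show "(\<lambda>r. p r * B n r) \<in> borel_measurable leb01" for n using test_function_L2_01[OF kT[of n]] by simp
    show "AE r in leb01. (\<lambda>n. p r * B n r) \<longlonglongrightarrow> p r"
    proof (rule AE_I2)
      fix r assume "r \<in> space leb01"
      then have r: "0 < r" "r < 1" by (auto simp: space_restrict_space)
      have lim: "filterlim (\<lambda>n. real (Suc n) * (t - 1 / (real n + 3))) at_top sequentially" if "t > 0" for t
      proof (rule filterlim_at_top_mono)
        have "filterlim (\<lambda>n. - 1 + t * real (Suc n)) at_top sequentially"
          by (intro filterlim_tendsto_add_at_top[OF tendsto_const] filterlim_tendsto_pos_mult_at_top[OF tendsto_const that]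
            filterlim_compose[OF filterlim_real_sequentially filterlim_Suc])
        then show "filterlim (\<lambda>n. - 1 + t * real (Suc n)) at_top sequentially" .
        show "\<forall>\<^sub>F n in sequentially. - 1 + t * real (Suc n) \<le> real (Suc n) * (t - 1 / (real n + 3))"
        proof (rule always_eventually, rule allI)
          fix n :: nat
          have "real (Suc n) * (1 / (real n + 3)) \<le> 1" by (simp add: divide_le_eq)
          then show "- 1 + t * real (Suc n) \<le> real (Suc n) * (t - 1 / (real n + 3))" by (simp add: right_diff_distrib mult.commute del: of_nat_Suc)
        qed
      qed
      have "B n r = flat 0 (real (Suc n) * (r - 1 / (real n + 3))) * flat 0 (real (Suc n) * ((1 - r) - 1 / (real n + 3)))" for n
        unfolding B_def box_bump_def by (simp add: algebra_simps)
      moreover have "(\<lambda>n. flat 0 (real (Suc n) * (r - 1 / (real n + 3))) * flat 0 (real (Suc n) * ((1 - r) - 1 / (real n + 3)))) \<longlonglongrightarrow> 1 * 1"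
        by (intro tendsto_mult flat_tendsto_1 lim) (use r in auto)
      ultimately have "(\<lambda>n. B n r) \<longlonglongrightarrow> 1" by simp
      then have "(\<lambda>n. p r * B n r) \<longlonglongrightarrow> p r * 1" by (intro tendsto_intros)
      then show "(\<lambda>n. p r * B n r) \<longlonglongrightarrow> p r" by simp
    qed
    show "(p r - p r * B n r)^2 \<le> C\<^sup>2" if r: "r \<in> {0<..<1}" for n r
    proof -
      have "\<bar>p r - p r * B n r\<bar> = \<bar>p r\<bar> * \<bar>1 - B n r\<bar>" by (simp add: abs_mult[symmetric] algebra_simps)
      also have "\<dots> \<le> \<bar>p r\<bar> * 1"
        using box_bump_nonneg[of "1 / (real n + 3)" "1 - 1 / (real n + 3)" n r] box_bump_le_1[of "1 / (real n + 3)" "1 - 1 / (real n + 3)" n r]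
        by (intro mult_left_mono) (auto simp: B_def)
      also have "\<dots> \<le> \<bar>C\<bar>" using C[of r] r by simp
      finally show ?thesis by (simp only: abs_le_square_iff)
    qed
  qed
  then obtain n4 where n4: "dist2 p (\<lambda>r. p r * B n4 r) < e'" by blast
  have kL: "(\<lambda>r. p r * B n4 r) \<in> L2_01" by (rule test_function_L2_01[OF kT])
  have "dist2 g (\<lambda>r. p r * B n4 r) < e"
    using dist2_triangle[OF g g1L kL] dist2_triangle[OF g1L hL kL] dist2_triangle[OF hL pL kL] d1 d2 d3 n4 e by (simp add: e'_def)
  then show ?thesis using kT[of n4] by (intro bexI[of _ "\<lambda>r. p r * B n4 r"])
qed

text \<open>A test function is the derivative of another as soon as its mean is zero, so an
  approximation of \<open>g\<close> is corrected by a multiple of a bump. The correction is small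
  because \<open>g\<close> has mean zero and means are continuous in L2.\<close>

lemma mean_zero_approximation:
  assumes g: "g \<in> L2_01" and g0: "(LINT r|leb01. g r) = 0" and e: "e > 0"
  shows "\<exists>f\<in>test_functions {0<..<1}. dist2 g (partial_deriv 1 f) < e"
proof -
  define \<eta> where "\<eta> = box_bump (1/4) (3/4::real) 0"
  have \<eta>: "\<eta> \<in> test_functions {0<..<1}" unfolding \<eta>_def by (rule box_bump_test_function) auto
  define I where "I = (LINT x|leb01. \<eta> x)"
  have I: "I > 0" unfolding I_def \<eta>_def by (rule integral_box_bump_pos)
  have L1: "integrable leb01 f" if "f \<in> L2_01" for f
  proof (rule Bochner_Integration.integrable_bound[of _ "\<lambda>r. 1 + (f r)^2"])
    show "integrable leb01 (\<lambda>r. 1 + (f r)^2)" using that integrable_const_01 by simp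
    show "AE r in leb01. norm (f r) \<le> norm (1 + (f r)^2)"
      using abs_le_1_plus_square by (intro AE_I2) (metis abs_ge_self order_trans real_norm_def)
  qed (use that in simp)
  \<comment> \<open>Chosen so that 4 \<delta> (1 + 1/I^2) = e, which covers the approximation error
    and the correction of size at most c^2/I^2.\<close>
  define \<delta> where "\<delta> = e / (4 * (1 + 1 / I\<^sup>2))"
  have \<delta>: "\<delta> > 0" using e I by (auto simp: \<delta>_def intro!: divide_pos_pos add_pos_nonneg)
  obtain k where k: "k \<in> test_functions {0<..<1}" "dist2 g k < \<delta>" using test_functions_dense_L2[OF g \<delta>] by blast
  note kL = test_function_L2_01[OF k(1)] and \<eta>L = test_function_L2_01[OF \<eta>]
  define c where "c = (LINT r|leb01. k r)"
  define m where "m = c / I"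
  have c2: "c\<^sup>2 \<le> \<delta>"
  proof -
    have "(LINT r|leb01. 1 * (g r - k r) * 1)^2 \<le> (LINT r|leb01. 1 * (g r - k r)^2) * (LINT r|leb01. 1 * 1\<^sup>2)"
      by (rule weighted_Cauchy_Schwarz) (use g kL L2_01_diff[OF g kL] integrable_const_01 in auto)
    then have "(LINT r|leb01. g r - k r)^2 \<le> dist2 g k" using LINT_const_01[of 1] by simp
    moreover have "(LINT r|leb01. g r - k r) = - c" using L1[OF g] L1[OF kL] g0 by (simp add: c_def)
    ultimately show ?thesis using k(2) by simp
  qed
  define q where "q r = k r - m * \<eta> r" for r
  have qT: "q \<in> test_functions {0<..<1}" unfolding q_def[abs_def] by (rule test_functions_diff_cmult[OF k(1) \<eta>])
  have "(LINT r|leb01. q r) = 0" unfolding q_def using L1[OF kL] L1[OF \<eta>L] I by (simp add: m_def c_def I_def[symmetric])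
  with qT obtain f where f: "f \<in> test_functions {0<..<1}" "partial_deriv 1 f = q" by (rule mean_zero_antiderivative)
  note qL = test_function_L2_01[OF qT]
  have "dist2 g q \<le> 2 * dist2 g k + 2 * dist2 k q" by (rule dist2_triangle[OF g kL qL])
  also have "dist2 k q = m\<^sup>2 * (LINT r|leb01. (\<eta> r)^2)" by (simp add: q_def power_mult_distrib)
  also have "\<dots> \<le> m\<^sup>2 * (LINT r|leb01. 1)"
  proof (intro mult_left_mono integral_mono)
    show "(\<eta> r)^2 \<le> 1" for r
      using box_bump_nonneg[of "1/4" "3/4::real" 0 r] box_bump_le_1[of "1/4" "3/4::real" 0 r] by (simp add: \<eta>_def power_le_one)
  qed (use \<eta>L integrable_const_01 in auto)
  also have "\<dots> = c\<^sup>2 / I\<^sup>2" unfolding LINT_const_01 by (simp add: m_def power_divide)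
  finally have "dist2 g q \<le> 2 * dist2 g k + 2 * (c\<^sup>2 / I\<^sup>2)" by simp
  also have "\<dots> < 2 * \<delta> + 2 * (\<delta> / I\<^sup>2) + 2 * \<delta>"
    using k(2) divide_right_mono[OF c2, of "I\<^sup>2"] \<delta> by simp
  also have "\<dots> \<le> 4 * (\<delta> * (1 + 1 / I\<^sup>2))"
  proof -
    have "0 \<le> \<delta> / I\<^sup>2" using \<delta> by simp
    then show ?thesis by (simp add: distrib_left)
  qed
  also have "\<dots> = e"
  proof -
    have "0 < 1 + 1 / I\<^sup>2" by (rule add_pos_nonneg) auto
    then have "\<delta> * (1 + 1 / I\<^sup>2) = e / 4" unfolding \<delta>_def by (metis less_irrefl nonzero_eq_divide_eq divide_divide_eq_left mult.commute)
    then show ?thesis by linarith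
  qed
  finally show ?thesis using f by auto
qed

text \<open>Below a small radius d the function is replaced by a linear ramp from v(d) down to 0 at
  d/2. The energy of the ramp is at most 2 d^(M-2) v(d)^2, small for suitable d, and the modified
  derivative is square integrable with mean zero, hence approximable by derivatives of test
  functions.\<close>

theorem test_functions_dense:
  assumes M: "2 \<le> M" and v: "v \<in> calH_0M M" and e: "e > 0"
  shows "\<exists>f\<in>test_functions {0<..<1}. (LINT r|leb01. r powr (M - 1) * (wd v r - partial_deriv 1 f r)^2) < e"
proof -
  note va = calH_0M_acd[OF v]
  \<comment> \<open>The final estimate spends 4 + 8 + 2 = 14 times this quantity.\<close>
  define \<eta> where "\<eta> = e / 15"
  have \<eta>: "\<eta> > 0" using e by (simp add: \<eta>_def)
  let ?E = "\<lambda>r. r powr (M - 1) * (wd v r)^2"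
  have Ei: "integrable leb01 ?E" by (rule L2_M_D(2)[OF va(2)])
  have Eai: "?E absolutely_integrable_on {0..1}" by (rule integrable_01_abs[OF Ei])
  have "continuous_on {0..1} (\<lambda>x. integral {0..x} ?E)"
    by (rule indefinite_integral_continuous_1[OF set_lebesgue_integral_eq_integral(1)[OF Eai]])
  then have "((\<lambda>x. integral {0..x} ?E) \<longlongrightarrow> integral {0..0} ?E) (at_right 0)"
    using continuous_on_Icc_at_rightD by fastforce
  then have "\<forall>\<^sub>F x in at_right 0. integral {0..x} ?E < \<eta>" using \<eta> by (intro order_tendstoD) auto
  then obtain D where D: "D > 0" "\<And>x. 0 < x \<Longrightarrow> x < D \<Longrightarrow> integral {0..x} ?E < \<eta>" unfolding eventually_at_right_field by blast
  \<comment> \<open>Otherwise r^(M-3) v^2 would be at least \<eta>/r near 0, against its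
    integrability.\<close>
  have "\<exists>d. 0 < d \<and> d < min D 1 \<and> d powr (M - 2) * (v d)^2 < \<eta>"
  proof (rule ccontr)
    assume n: "\<not> ?thesis"
    have i3: "integrable leb01 (\<lambda>r. r powr (M - 3) * (v r)^2)" using va(4) by (simp add: calL_M_def)
    show False
    proof (rule not_integrable_reciprocal[OF i3, of "min D 1" \<eta>])
      fix x assume x: "0 < x" "x < min D 1"
      have "\<eta> \<le> x powr (M - 2) * (v x)^2" using n x by (metis min_less_iff_conj not_less)
      moreover have "x powr (M - 2) = x powr (M - 3) * x" using powr_add[of x "M - 3" 1] x by simp
      ultimately have "\<eta> \<le> (x powr (M - 3) * (v x)^2) * x" by (simp add: algebra_simps)
      then have "\<eta> / x \<le> x powr (M - 3) * (v x)^2" using x by (simp add: pos_divide_le_eq)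
      then show "\<eta> / x \<le> \<bar>x powr (M - 3) * (v x)^2\<bar>" by simp
    qed (use D \<eta> in auto)
  qed
  then obtain d where d: "0 < d" "d < 1" "d < D" "d powr (M - 2) * (v d)^2 < \<eta>" by auto
  \<comment> \<open>The slope of the ramp from 0 at d/2 to v(d) at d; since v(1) = 0 it makes the
    mean of \<open>g\<close> vanish.\<close>
  define c where "c = 2 * v d / d"
  define g where "g r = indicator {d<..<1} r * wd v r + indicator {d/2<..<d} r * c" for r
  have wai: "wd v absolutely_integrable_on {d..1}" using acd_abs_integrable[OF va(1) d(1)] by simp
  have cai: "(\<lambda>_. c) absolutely_integrable_on {d/2..d}" by (intro absolutely_integrable_continuous_real continuous_on_const)
  have i1: "integrable leb01 (\<lambda>r. indicator {d<..<1} r * wd v r)" "(LINT r|leb01. indicator {d<..<1} r * wd v r) = integral {d..1} (wd v)"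
    using LINT_interval[OF _ _ _ wai] d by auto
  have i2: "integrable leb01 (\<lambda>r. indicator {d/2<..<d} r * c)" "(LINT r|leb01. indicator {d/2<..<d} r * c) = integral {d/2..d} (\<lambda>_. c)"
    using LINT_interval[OF _ _ _ cai] d by auto
  have g0: "(LINT r|leb01. g r) = 0"
    unfolding g_def using i1 i2 acd_integral[OF va(1) d(1), of 1] d va(3) by (simp add: c_def)
  have gm: "g \<in> borel_measurable leb01" unfolding g_def using i1(1) i2(1) by (intro borel_measurable_add) auto
  define m where "m = min (d powr (M - 1)) 1"
  have m: "m > 0" using d by (simp add: m_def)
  have "integrable leb01 (\<lambda>r. (g r)^2)"
  proof (rule Bochner_Integration.integrable_bound)
    show "integrable leb01 (\<lambda>r. (1 / m) * ?E r + c\<^sup>2)"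
      by (intro Bochner_Integration.integrable_add integrable_mult_right integrable_const_01) (rule Ei)
    show "(\<lambda>r. (g r)^2) \<in> borel_measurable leb01" using gm by measurable
    show "AE r in leb01. norm ((g r)^2) \<le> norm ((1 / m) * ?E r + c\<^sup>2)"
    proof (rule AE_I2)
      fix r
      have nn: "0 \<le> (1 / m) * ?E r" using m by simp
      show "norm ((g r)^2) \<le> norm ((1 / m) * ?E r + c\<^sup>2)"
      proof (cases "r \<in> {d<..<1}")
        case True
        then have "m \<le> r powr (M - 1)" unfolding m_def using d by (intro powr_lower) auto
        then have "m * (wd v r)^2 \<le> ?E r" by (intro mult_right_mono) auto
        then have "(wd v r)^2 \<le> (1 / m) * ?E r" using m by (simp add: pos_le_divide_eq mult.commute)
        moreover have "g r = wd v r" using True by (simp add: g_def)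
        ultimately show ?thesis using add_increasing2[OF zero_le_power2[of c], of "(g r)^2" "(1 / m) * ?E r"] nn by (simp only: real_norm_def abs_power2 abs_of_nonneg add_nonneg_nonneg zero_le_power2)
      next
        case False
        then have "g r = 0 \<or> g r = c" by (auto simp: g_def indicator_def)
        then have "(g r)^2 \<le> c\<^sup>2" by auto
        then show ?thesis using nn by simp
      qed
    qed
  qed
  then have gL: "g \<in> L2_01" using gm by simp
  obtain f where f: "f \<in> test_functions {0<..<1}" "dist2 g (partial_deriv 1 f) < \<eta>"
    using mean_zero_approximation[OF gL g0 \<eta>] by blast
  have fL: "partial_deriv 1 f \<in> L2_01"
    using f(1) by (intro continuous_L2_01 smooth_continuous smooth_partial_deriv_real) (auto elim: test_functionE)
  have i3: "integrable leb01 (\<lambda>r. indicator {0<..<d} r * ?E r)" "(LINT r|leb01. indicator {0<..<d} r * ?E r) = integral {0..d} ?E"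
    using LINT_interval[OF _ _ _ absolutely_integrable_on_subinterval[OF Eai, of 0 d]] d by auto
  define C where "C = d powr (M - 1) * c\<^sup>2"
  have i4: "integrable leb01 (\<lambda>r. indicator {d/2<..<d} r * C)" "(LINT r|leb01. indicator {d/2<..<d} r * C) = C * (d / 2)"
    using LINT_interval[of "d/2" d "\<lambda>_. C"] d absolutely_integrable_continuous_real[OF continuous_on_const[of "{d/2..d}" C]] by (auto simp: field_simps)
  have Cd: "C * (d / 2) = 2 * (d powr (M - 2) * (v d)^2)"
  proof -
    have "d powr (M - 1) = d powr (M - 2) * d" using powr_add[of d "M - 2" 1] d by simp
    then show ?thesis using d by (simp add: C_def c_def power_divide power_mult_distrib power2_eq_square)
  qed
  have i5: "integrable leb01 (\<lambda>r. (g r - partial_deriv 1 f r)^2)" by (rule L2_01_diff[OF gL fL])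
  have bound: "AE r in leb01. r powr (M - 1) * (wd v r - partial_deriv 1 f r)^2 \<le>
     4 * (indicator {0<..<d} r * ?E r) + 4 * (indicator {d/2<..<d} r * C) + 2 * (g r - partial_deriv 1 f r)^2"
  proof -
    have "negligible {r \<in> {0<..<1}. \<not> r \<noteq> d}" by (rule negligible_subset[of "{d}"]) auto
    then have "AE r in leb01. r \<noteq> d" by (subst AE_lebesgue_on_iff) auto
    then show ?thesis using AE_space
    proof eventually_elim
      case (elim r)
      then have r: "0 < r" "r < 1" "r \<noteq> d" by (auto simp: space_restrict_space)
      have p1: "r powr (M - 1) \<le> 1" using r M by (intro powr_le1) auto
      have "r powr (M - 1) * (wd v r - partial_deriv 1 f r)^2 \<le> r powr (M - 1) * (2 * (wd v r - g r)^2 + 2 * (g r - partial_deriv 1 f r)^2)"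
        by (intro mult_left_mono square_diff_le) auto
      also have "\<dots> = 2 * (r powr (M - 1) * (wd v r - g r)^2) + 2 * (r powr (M - 1) * (g r - partial_deriv 1 f r)^2)"
        by (simp add: algebra_simps)
      also have "r powr (M - 1) * (g r - partial_deriv 1 f r)^2 \<le> 1 * (g r - partial_deriv 1 f r)^2"
        by (intro mult_right_mono p1) auto
      also have "r powr (M - 1) * (wd v r - g r)^2 \<le> 2 * (indicator {0<..<d} r * ?E r) + 2 * (indicator {d/2<..<d} r * C)"
      proof (cases "r < d")
        case False
        then have "g r = wd v r" using r by (simp add: g_def)
        then show ?thesis using False r by simp
      next
        case True
        have "r powr (M - 1) * (wd v r - g r)^2 \<le> r powr (M - 1) * (2 * (wd v r)^2 + 2 * (g r)^2)"
          using square_diff_le[of "wd v r" "g r" 0] by (intro mult_left_mono) auto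
        also have "\<dots> = 2 * ?E r + 2 * (r powr (M - 1) * (g r)^2)" by (simp add: algebra_simps)
        also have "r powr (M - 1) * (g r)^2 \<le> indicator {d/2<..<d} r * C"
        proof (cases "d / 2 < r")
          case T: True
          have "g r = c" using T True by (simp add: g_def)
          moreover have "r powr (M - 1) \<le> d powr (M - 1)" using M True r by (intro powr_mono2) auto
          ultimately show ?thesis using T True by (simp add: C_def mult_right_mono)
        next
          case F: False
          have "g r = 0" using F True by (simp add: g_def)
          then show ?thesis using F by simp
        qed
        finally show ?thesis using True r by simp
      qed
      finally show ?case by simp
    qed
  qed
  have "(LINT r|leb01. r powr (M - 1) * (wd v r - partial_deriv 1 f r)^2) \<le>
    (LINT r|leb01. 4 * (indicator {0<..<d} r * ?E r) + 4 * (indicator {d/2<..<d} r * C) + 2 * (g r - partial_deriv 1 f r)^2)"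
  proof (rule integral_mono_AE[OF _ _ bound])
    show "integrable leb01 (\<lambda>r. r powr (M - 1) * (wd v r - partial_deriv 1 f r)^2)"
    proof (rule Bochner_Integration.integrable_bound)
      show "integrable leb01 (\<lambda>r. 4 * (indicator {0<..<d} r * ?E r) + 4 * (indicator {d/2<..<d} r * C) + 2 * (g r - partial_deriv 1 f r)^2)"
        using i3 i4 i5 by (intro Bochner_Integration.integrable_add integrable_mult_right) auto
      show "(\<lambda>r. r powr (M - 1) * (wd v r - partial_deriv 1 f r)^2) \<in> borel_measurable leb01"
        using calH_0M_measurable(2)[OF v] fL by (intro borel_measurable_times borel_measurable_power borel_measurable_diff borel_measurable_powr_01) auto
      show "AE r in leb01. norm (r powr (M - 1) * (wd v r - partial_deriv 1 f r)^2) \<le> norm (4 * (indicator {0<..<d} r * ?E r) + 4 * (indicator {d/2<..<d} r * C) + 2 * (g r - partial_deriv 1 f r)^2)"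
        using bound by eventually_elim (simp add: order_trans[OF _ abs_ge_self])
    qed
    show "integrable leb01 (\<lambda>r. 4 * (indicator {0<..<d} r * ?E r) + 4 * (indicator {d/2<..<d} r * C) + 2 * (g r - partial_deriv 1 f r)^2)"
      using i3 i4 i5 by (intro Bochner_Integration.integrable_add integrable_mult_right) auto
  qed
  also have "\<dots> = 4 * (LINT r|leb01. indicator {0<..<d} r * ?E r) + 4 * (LINT r|leb01. indicator {d/2<..<d} r * C) + 2 * dist2 g (partial_deriv 1 f)"
    using i3(1) i4(1) i5 by simp
  also have "\<dots> < 4 * \<eta> + 8 * \<eta> + 2 * \<eta>"
    unfolding i3(2) i4(2) Cd using D(2)[OF d(1,3)] d(4) f(2) by simp
  also have "\<dots> \<le> e" using e by (simp add: \<eta>_def)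
  finally show ?thesis using f(1) by blast
qed

section \<open>Lifting profiles to radial functions\<close>

abbreviation lebB :: "'a::euclidean_space measure" where
  "lebB \<equiv> lebesgue_on (ball 0 1)"

text \<open>Division by |x|^2 lowers the exponent of the radial weight by 2, which gives the weight
  of \<open>ip_M\<close>.\<close>

lemma polar_singular:
  fixes h :: "real \<Rightarrow> real"
  assumes h: "h \<in> borel_measurable leb01"
  shows "integrable (lebB :: 'a::euclidean_space measure) (\<lambda>x. h (norm x) / (norm x)^2) \<longleftrightarrow>
      integrable leb01 (\<lambda>r. r powr (real DIM('a) - 3) * h r)"
    and "(LINT x|(lebB :: 'a measure). h (norm x) / (norm x)^2) =
      sphere_area TYPE('a) * (LINT r|leb01. r powr (real DIM('a) - 3) * h r)"
proof -
  have m: "(\<lambda>r. h r / r\<^sup>2) \<in> borel_measurable leb01"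
    using h continuous_imp_measurable_on_sets_lebesgue[OF continuous_on_id, of "{0<..<1::real}"]
    by (intro borel_measurable_divide borel_measurable_power) auto
  have eq: "r powr (real DIM('a) - 1) * (h r / r\<^sup>2) = r powr (real DIM('a) - 3) * h r" if "r \<in> space leb01" for r
  proof -
    have r: "0 < r" using that by (simp add: space_restrict_space)
    have "r powr (real DIM('a) - 1) = r powr (real DIM('a) - 3) * r\<^sup>2" using powr_add[of r "real DIM('a) - 3" 2] r by (simp add: powr_numeral)
    then show ?thesis using r by simp
  qed
  show "integrable (lebB :: 'a measure) (\<lambda>x. h (norm x) / (norm x)^2) \<longleftrightarrow>
      integrable leb01 (\<lambda>r. r powr (real DIM('a) - 3) * h r)"
    unfolding polar(2)[OF m, where 'a='a] by (rule Bochner_Integration.integrable_cong[OF refl eq])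
  show "(LINT x|(lebB :: 'a measure). h (norm x) / (norm x)^2) =
      sphere_area TYPE('a) * (LINT r|leb01. r powr (real DIM('a) - 3) * h r)"
    unfolding polar(3)[OF m, where 'a='a]
    by (rule arg_cong[where f="\<lambda>I. sphere_area TYPE('a) * I"]) (rule Bochner_Integration.integral_cong[OF refl eq])
qed

section \<open>Radial lifts of test functions\<close>

lemma partial_deriv_test_function:
  assumes "\<psi> \<in> test_functions \<Omega>" "b \<in> Basis" shows "partial_deriv b \<psi> \<in> test_functions \<Omega>"
proof -
  obtain K where K: "smooth \<psi>" "compact K" "K \<subseteq> \<Omega>" "\<And>x. x \<notin> K \<Longrightarrow> \<psi> x = 0" using assms(1) by (rule test_functionE) blast
  show ?thesis unfolding test_functions_def
    by (intro CollectI conjI exI[of _ K] allI impI smooth_partial_deriv[OF K(1) assms(2)] partial_deriv_zero_outside[OF K(2,4)] K(2,3))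
qed

text \<open>\<open>F\<close> vanishes below \<alpha>, so the function is zero near the origin, where
  the norm is not differentiable. Powers of 1/|x| are carried along because every derivative brings
  out further ones.\<close>

lemma has_derivative_radial:
  fixes x :: "'a::euclidean_space"
  assumes F: "smooth F" and \<alpha>: "0 < \<alpha>" "\<And>r. r < \<alpha> \<Longrightarrow> F r = 0"
  shows "((\<lambda>x. F (norm x) * inverse (norm x) ^ j) has_derivative
    (\<lambda>h. (x \<bullet> h) * (partial_deriv 1 F (norm x) * inverse (norm x) ^ (j + 1) - real j * (F (norm x) * inverse (norm x) ^ (j + 2))))) (at x)"
proof (cases "norm x < \<alpha>")
  case True
  have "partial_deriv 1 F (norm x) = 0" by (rule partial_deriv_zero_on_open[of "{..<\<alpha>}"]) (use True \<alpha> in auto)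
  moreover have "((\<lambda>x. F (norm x) * inverse (norm x) ^ j) has_derivative (\<lambda>_. 0)) (at x)"
    by (rule has_derivative_transform_within_open[OF has_derivative_const[of 0], of "ball 0 \<alpha>"]) (use True \<alpha> in auto)
  ultimately show ?thesis using \<alpha>(2)[OF True] by simp
next
  case False
  then have x: "x \<noteq> 0" "norm x \<noteq> 0" using \<alpha>(1) by auto
  define D where "D = partial_deriv 1 F (norm x) * inverse (norm x) ^ j - real j * (F (norm x) * inverse (norm x) ^ (j + 1))"
  have "((\<lambda>r. F r * inverse r ^ j) has_real_derivative D) (at (norm x))"
  proof -
    have "(F has_real_derivative partial_deriv 1 F (norm x)) (at (norm x))" using smooth_real_DERIV[OF F] by simp
    moreover have "((\<lambda>r. inverse r ^ j) has_real_derivative - (real j * inverse (norm x) ^ (j + 1))) (at (norm x))"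
    proof (cases j)
      case (Suc m)
      show ?thesis unfolding Suc
        by (rule DERIV_cong[OF DERIV_power_Suc[OF DERIV_inverse[OF x(2)]]]) (simp add: algebra_simps)
    qed simp
    ultimately show ?thesis unfolding D_def by (rule DERIV_cong[OF DERIV_mult]) (simp add: algebra_simps)
  qed
  then have "((\<lambda>r. F r * inverse r ^ j) has_derivative (*) D) (at (norm x))" by (simp add: has_field_derivative_def)
  from has_derivative_compose[OF has_derivative_norm[OF x(1)] this]
  have d: "((\<lambda>x. F (norm x) * inverse (norm x) ^ j) has_derivative (\<lambda>h. D * (h \<bullet> sgn x))) (at x)" .
  have "(\<lambda>h. D * (h \<bullet> sgn x)) = (\<lambda>h. (x \<bullet> h) * (partial_deriv 1 F (norm x) * inverse (norm x) ^ (j + 1) - real j * (F (norm x) * inverse (norm x) ^ (j + 2))))"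
  proof
    fix h
    have "h \<bullet> sgn x = inverse (norm x) * (x \<bullet> h)" by (simp add: sgn_div_norm inner_commute)
    then show "D * (h \<bullet> sgn x) = (x \<bullet> h) * (partial_deriv 1 F (norm x) * inverse (norm x) ^ (j + 1) - real j * (F (norm x) * inverse (norm x) ^ (j + 2)))"
      by (simp add: D_def right_diff_distrib left_diff_distrib mult_ac)
  qed
  with d show ?thesis by (simp only:)
qed

lemma radial_test_function:
  assumes f: "f \<in> test_functions {0<..<1}"
  shows "(\<lambda>x::'a::euclidean_space. f (norm x)) \<in> test_functions (ball 0 1)"
    and "grad (\<lambda>x::'a. f (norm x)) x = (partial_deriv 1 f (norm x) / norm x) *\<^sub>R x"
proof -
  obtain \<alpha> \<beta> where sm: "smooth f" and ab: "0 < \<alpha>" "\<alpha> < \<beta>" "\<beta> < 1"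
    and z: "\<And>x. x \<notin> {\<alpha><..<\<beta>} \<Longrightarrow> f x = 0" "\<And>x. x \<notin> {\<alpha><..<\<beta>} \<Longrightarrow> partial_deriv 1 f x = 0"
    using f by (rule test_function_01E) blast
  have f0: "\<And>r. r < \<alpha> \<Longrightarrow> f r = 0" by (rule z) auto
  \<comment> \<open>Profiles vanishing below \<alpha>, times powers of 1/|x|, generate together with
    the linear functionals an algebra closed under partial derivatives.\<close>
  define R where "R = (\<lambda>(F, j) (x::'a). F (norm x) * inverse (norm x) ^ j) ` ({F. smooth F \<and> (\<forall>r<\<alpha>. F r = 0)} \<times> (UNIV::nat set))"
  define A where "A = R \<union> range (\<lambda>b x. x \<bullet> b)"
  have R: "(\<lambda>x::'a. F (norm x) * inverse (norm x) ^ j) \<in> fun_algebra A" if "smooth F" "\<And>r. r < \<alpha> \<Longrightarrow> F r = 0" for F j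
    by (rule fun_algebra.gen) (use that in \<open>force simp: A_def R_def\<close>)
  have "smooth (\<lambda>x::'a. f (norm x) * inverse (norm x) ^ 0)"
  proof (rule smooth_fun_algebra[OF R[OF sm f0]])
    fix g :: "'a \<Rightarrow> real" assume "g \<in> A"
    then consider c where "g = (\<lambda>x. x \<bullet> c)" | F j where "smooth F" "\<And>r. r < \<alpha> \<Longrightarrow> F r = 0" "g = (\<lambda>x. F (norm x) * inverse (norm x) ^ j)"
      by (force simp: A_def R_def)
    then have "g differentiable_on UNIV \<and> (\<forall>b\<in>Basis. partial_deriv b g \<in> fun_algebra A)"
    proof cases
      case 1
      have d: "(g has_derivative (\<lambda>h. h \<bullet> c)) (at x)" for x unfolding 1 by (auto intro!: derivative_eq_intros)
      have "partial_deriv b g = (\<lambda>x. b \<bullet> c)" for b by (rule partial_deriv_eq[OF d])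
      then show ?thesis using d by (auto simp: differentiable_on_def differentiable_def intro: fun_algebra.const)
    next
      case 2
      let ?D = "\<lambda>x h. (x \<bullet> h) * (partial_deriv 1 F (norm x) * inverse (norm x) ^ (j + 1) - real j * (F (norm x) * inverse (norm x) ^ (j + 2)))"
      have d: "(g has_derivative ?D x) (at x)" for x unfolding 2(3) by (rule has_derivative_radial[OF 2(1) ab(1) 2(2)])
      have F': "smooth (partial_deriv 1 F)" by (rule smooth_partial_deriv_real[OF 2(1)])
      have F'0: "partial_deriv 1 F r = 0" if "r < \<alpha>" for r
        by (rule partial_deriv_zero_on_open[of "{..<\<alpha>}"]) (use that 2(2) in auto)
      have "partial_deriv b g \<in> fun_algebra A" for b
      proof -
        have "partial_deriv b g = (\<lambda>x. (x \<bullet> b) * (partial_deriv 1 F (norm x) * inverse (norm x) ^ (j + 1) + (- real j) * (F (norm x) * inverse (norm x) ^ (j + 2))))"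
          unfolding partial_deriv_eq[OF d] by simp
        moreover have "\<dots> \<in> fun_algebra A"
          by (rule fun_algebra.mult[OF fun_algebra.gen fun_algebra.add[OF R[OF F' F'0] fun_algebra.mult[OF fun_algebra.const R[OF 2(1,2)]]]])
            (auto simp: A_def)
        ultimately show ?thesis by simp
      qed
      then show ?thesis using d by (auto simp: differentiable_on_def differentiable_def)
    qed
    then show "g differentiable_on UNIV" "\<And>b. b \<in> Basis \<Longrightarrow> partial_deriv b g \<in> fun_algebra A" by auto
  qed
  then have sf: "smooth (\<lambda>x::'a. f (norm x))" by simp
  have K: "compact (cball (0::'a) \<beta>)" "cball (0::'a) \<beta> \<subseteq> ball 0 1" "\<And>x::'a. x \<notin> cball 0 \<beta> \<Longrightarrow> f (norm x) = 0"
    using ab by (auto intro!: z)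
  show "(\<lambda>x::'a::euclidean_space. f (norm x)) \<in> test_functions (ball 0 1)"
    unfolding test_functions_def by (intro CollectI conjI exI[of _ "cball (0::'a) \<beta>"] allI impI sf K)
  have d: "((\<lambda>x::'a. f (norm x)) has_derivative (\<lambda>h. (x \<bullet> h) * (partial_deriv 1 f (norm x) / norm x))) (at x)" for x
    using has_derivative_radial[OF sm ab(1) f0, where j=0 and x=x] by (simp add: divide_inverse)
  have "grad (\<lambda>x::'a. f (norm x)) x = (\<Sum>b\<in>Basis. (partial_deriv 1 f (norm x) / norm x) *\<^sub>R ((x \<bullet> b) *\<^sub>R b))"
    unfolding grad_def partial_deriv_eq[OF d] by (intro sum.cong refl) (simp add: mult.commute)
  also have "\<dots> = (partial_deriv 1 f (norm x) / norm x) *\<^sub>R x"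
    unfolding scaleR_sum_right[symmetric] by (simp add: euclidean_representation)
  finally show "grad (\<lambda>x::'a. f (norm x)) x = (partial_deriv 1 f (norm x) / norm x) *\<^sub>R x" .
qed

section \<open>Weak gradients of limits and differences\<close>

lemma L2_locally_integrable:
  fixes f :: "'a::euclidean_space \<Rightarrow> real"
  assumes f: "f \<in> borel_measurable (lebesgue_on \<Omega>)" "integrable (lebesgue_on \<Omega>) (\<lambda>x. (f x)^2)" and \<Omega>: "open \<Omega>"
  shows "locally_integrable \<Omega> f"
  unfolding locally_integrable_def
proof (intro allI impI, elim conjE)
  fix K assume K: "compact K" "K \<subseteq> \<Omega>"
  have \<Omega>L: "\<Omega> \<in> sets lebesgue" using \<Omega> by simp
  have KL: "K \<in> sets lebesgue" using K(1) by (simp add: compact_imp_closed borel_closed)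
  have "set_integrable lebesgue \<Omega> (\<lambda>x. (f x)^2)"
    unfolding set_integrable_def using f(2) \<Omega>L by (simp add: integrable_restrict_space)
  then have "set_integrable lebesgue K (\<lambda>x. (f x)^2)" by (rule set_integrable_subset) (use K KL in auto)
  then have i: "integrable (lebesgue_on K) (\<lambda>x. (f x)^2)"
    unfolding set_integrable_def using KL by (simp add: integrable_restrict_space)
  interpret finite_measure "lebesgue_on K" by (rule finite_measure_lebesgue_on) (simp add: K(1) lmeasurable_compact)
  show "integrable (lebesgue_on K) f"
  proof (rule Bochner_Integration.integrable_bound)
    show "integrable (lebesgue_on K) (\<lambda>x. 1 + (f x)^2)" using i by simp
    show "f \<in> borel_measurable (lebesgue_on K)" by (rule measurable_restrict_mono[OF f(1) K(2)])
    show "AE x in lebesgue_on K. norm (f x) \<le> norm (1 + (f x)^2)"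
      using abs_le_1_plus_square by (intro AE_I2) (metis abs_ge_self order_trans real_norm_def)
  qed
qed

lemma tendsto_of_square: "(\<lambda>n. (f n - c)^2) \<longlonglongrightarrow> 0 \<Longrightarrow> f \<longlonglongrightarrow> (c::real)"
proof -
  assume "(\<lambda>n. (f n - c)^2) \<longlonglongrightarrow> 0"
  from tendsto_real_sqrt[OF this] have "(\<lambda>n. \<bar>f n - c\<bar>) \<longlonglongrightarrow> 0" by simp
  then show ?thesis by (simp add: tendsto_rabs_zero_iff LIM_zero_iff)
qed

lemma test_limit:
  fixes f :: "'a::euclidean_space \<Rightarrow> real"
  assumes \<Omega>: "open \<Omega>" and f: "f \<in> borel_measurable (lebesgue_on \<Omega>)" "locally_integrable \<Omega> f"
    and h: "\<And>n::nat. h n \<in> borel_measurable (lebesgue_on \<Omega>)" "\<And>n. locally_integrable \<Omega> (h n)"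
    and i: "\<And>n. integrable (lebesgue_on \<Omega>) (\<lambda>x. (f x - h n x)^2)"
    and lim: "(\<lambda>n. LINT x|lebesgue_on \<Omega>. (f x - h n x)^2) \<longlonglongrightarrow> 0" and k: "k \<in> test_functions \<Omega>"
  shows "(\<lambda>n. LINT x|lebesgue_on \<Omega>. h n x * k x) \<longlonglongrightarrow> (LINT x|lebesgue_on \<Omega>. f x * k x)"
proof (rule tendsto_of_square)
  let ?L = "lebesgue_on \<Omega>"
  have sk: "smooth k" using k by (simp add: test_functions_def)
  have km: "k \<in> borel_measurable ?L"
    by (intro continuous_imp_measurable_on_sets_lebesgue smooth_continuous sk) (use \<Omega> in simp)
  have k2: "integrable ?L (\<lambda>x. (k x)^2)"
    unfolding power2_eq_square by (intro integrable_times_test_function \<Omega> continuous_locally_integrable smooth_continuous sk k)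
  let ?K = "LINT x|?L. (k x)^2"
  have le: "((LINT x|?L. h n x * k x) - (LINT x|?L. f x * k x))^2 \<le> (LINT x|?L. (f x - h n x)^2) * ?K" for n
  proof -
    have "(LINT x|?L. 1 * (f x - h n x) * k x)^2 \<le> (LINT x|?L. 1 * (f x - h n x)^2) * (LINT x|?L. 1 * (k x)^2)"
      by (rule weighted_Cauchy_Schwarz) (use f h km k2 i in auto)
    moreover have "(LINT x|?L. 1 * (f x - h n x) * k x) = (LINT x|?L. f x * k x) - (LINT x|?L. h n x * k x)"
      using integrable_times_test_function[OF \<Omega> f(2) k] integrable_times_test_function[OF \<Omega> h(2) k, of n] by (simp add: left_diff_distrib)
    ultimately show ?thesis by (simp add: power2_commute)
  qed
  have "(\<lambda>n. (LINT x|?L. (f x - h n x)^2) * ?K) \<longlonglongrightarrow> 0 * ?K" by (intro tendsto_intros lim)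
  then have up: "(\<lambda>n. (LINT x|?L. (f x - h n x)^2) * ?K) \<longlonglongrightarrow> 0" by simp
  show "(\<lambda>n. ((LINT x|?L. h n x * k x) - (LINT x|?L. f x * k x))^2) \<longlonglongrightarrow> 0"
    by (rule tendsto_sandwich[OF _ _ tendsto_const up]) (use le in auto)
qed

text \<open>Test functions and their derivatives are square integrable, so both sides of the
  integration by parts pass to the limit. Only differences to the approximants are assumed to be in
  L2.\<close>

lemma weak_gradient_L2_limit:
  fixes u :: "'a::euclidean_space \<Rightarrow> real"
  assumes \<Omega>: "open \<Omega>" and u: "u \<in> borel_measurable (lebesgue_on \<Omega>)" and G: "G \<in> borel_measurable (lebesgue_on \<Omega>)"
    and \<phi>: "\<And>n::nat. smooth (\<phi> n)"
    and ui: "\<And>n. integrable (lebesgue_on \<Omega>) (\<lambda>x. (u x - \<phi> n x)^2)"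
    and Gi: "\<And>n. integrable (lebesgue_on \<Omega>) (\<lambda>x. (norm (G x - grad (\<phi> n) x))^2)"
    and ul: "(\<lambda>n. LINT x|lebesgue_on \<Omega>. (u x - \<phi> n x)^2) \<longlonglongrightarrow> 0"
    and Gl: "(\<lambda>n. LINT x|lebesgue_on \<Omega>. (norm (G x - grad (\<phi> n) x))^2) \<longlonglongrightarrow> 0"
  shows "weak_gradient \<Omega> u G"
  unfolding weak_gradient_def
proof (intro conjI ballI)
  let ?L = "lebesgue_on \<Omega>"
  have cm: "h \<in> borel_measurable ?L" if "continuous_on \<Omega> h" for h :: "'a \<Rightarrow> real"
    by (intro continuous_imp_measurable_on_sets_lebesgue that) (use \<Omega> in simp)
  have \<phi>m: "\<phi> n \<in> borel_measurable ?L" for n by (intro cm smooth_continuous \<phi>)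
  have \<phi>l: "locally_integrable \<Omega> (\<phi> n)" for n by (intro continuous_locally_integrable smooth_continuous \<phi>)
  have "locally_integrable \<Omega> (\<lambda>x. u x - \<phi> 0 x)" by (rule L2_locally_integrable[OF _ ui \<Omega>]) (use u \<phi>m in simp)
  moreover have "locally_integrable \<Omega> (\<lambda>x. (- 1) * \<phi> 0 x)"
    by (intro continuous_locally_integrable smooth_continuous smooth_cmult \<phi>)
  ultimately have "locally_integrable \<Omega> (\<lambda>x. (u x - \<phi> 0 x) - (- 1) * \<phi> 0 x)" by (rule locally_integrable_diff)
  then show lu: "locally_integrable \<Omega> u" by simp
  fix b :: 'a assume b: "b \<in> Basis"
  let ?g = "\<lambda>x. G x \<bullet> b" and ?p = "\<lambda>n. partial_deriv b (\<phi> n)"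
  have gm: "?g \<in> borel_measurable ?L" using G by measurable
  have pm: "?p n \<in> borel_measurable ?L" for n by (intro cm smooth_continuous smooth_partial_deriv \<phi> b)
  have pl: "locally_integrable \<Omega> (?p n)" for n by (intro continuous_locally_integrable smooth_continuous smooth_partial_deriv \<phi> b)
  have le: "(?g x - ?p n x)^2 \<le> (norm (G x - grad (\<phi> n) x))^2" for n x
  proof -
    have "\<bar>(G x - grad (\<phi> n) x) \<bullet> b\<bar> \<le> norm (G x - grad (\<phi> n) x)" by (rule Basis_le_norm[OF b])
    then show ?thesis by (simp add: inner_diff_left grad_inner[OF b] abs_le_square_iff[symmetric])
  qed
  have gi: "integrable ?L (\<lambda>x. (?g x - ?p n x)^2)" for n
    by (rule Bochner_Integration.integrable_bound[OF Gi[of n]]) (use gm pm le in \<open>auto intro!: AE_I2\<close>)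
  have gl: "(\<lambda>n. LINT x|?L. (?g x - ?p n x)^2) \<longlonglongrightarrow> 0"
    by (rule tendsto_sandwich[OF _ _ tendsto_const Gl]) (auto intro!: always_eventually integral_mono gi Gi le)
  have "locally_integrable \<Omega> (\<lambda>x. ?g x - ?p 0 x)" by (rule L2_locally_integrable[OF _ gi \<Omega>]) (use gm pm in simp)
  moreover have "locally_integrable \<Omega> (\<lambda>x. (- 1) * ?p 0 x)"
    by (intro continuous_locally_integrable smooth_continuous smooth_cmult smooth_partial_deriv \<phi> b)
  ultimately have "locally_integrable \<Omega> (\<lambda>x. (?g x - ?p 0 x) - (- 1) * ?p 0 x)" by (rule locally_integrable_diff)
  then show lg: "locally_integrable \<Omega> ?g" by simp
  fix \<psi> assume \<psi>: "\<psi> \<in> test_functions \<Omega>"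
  have "(\<lambda>n. LINT x|?L. \<phi> n x * partial_deriv b \<psi> x) \<longlonglongrightarrow> (LINT x|?L. u x * partial_deriv b \<psi> x)"
    by (rule test_limit[OF \<Omega> u lu \<phi>m \<phi>l ui ul partial_deriv_test_function[OF \<psi> b]])
  moreover have "(LINT x|?L. \<phi> n x * partial_deriv b \<psi> x) = - (LINT x|?L. ?p n x * \<psi> x)" for n
    using smooth_weak_gradient[OF \<phi> \<Omega>, of n] b \<psi> by (simp add: weak_gradient_def grad_inner[OF b])
  ultimately have "(\<lambda>n. - (LINT x|?L. ?p n x * \<psi> x)) \<longlonglongrightarrow> (LINT x|?L. u x * partial_deriv b \<psi> x)" by simp
  moreover have "(\<lambda>n. - (LINT x|?L. ?p n x * \<psi> x)) \<longlonglongrightarrow> - (LINT x|?L. ?g x * \<psi> x)"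
    by (intro tendsto_minus test_limit[OF \<Omega> gm lg pm pl gi gl \<psi>])
  ultimately show "(LINT x|?L. u x * partial_deriv b \<psi> x) = - (LINT x|?L. G x \<bullet> b * \<psi> x)"
    by (rule LIMSEQ_unique)
qed

lemma weak_gradient_diff:
  assumes \<Omega>: "open \<Omega>" and u: "weak_gradient \<Omega> u G" and w: "weak_gradient \<Omega> w H"
  shows "weak_gradient \<Omega> (\<lambda>x. u x - w x) (\<lambda>x. G x - H x)"
  unfolding weak_gradient_def
proof (intro conjI ballI)
  let ?L = "lebesgue_on \<Omega>"
  have lu: "locally_integrable \<Omega> u" and lw: "locally_integrable \<Omega> w" using u w by (auto simp: weak_gradient_def)
  show "locally_integrable \<Omega> (\<lambda>x. u x - w x)" by (rule locally_integrable_diff[OF lu lw])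
  fix b assume b: "b \<in> (Basis :: 'a set)"
  have lG: "locally_integrable \<Omega> (\<lambda>x. G x \<bullet> b)" and lH: "locally_integrable \<Omega> (\<lambda>x. H x \<bullet> b)"
    using u w b by (auto simp: weak_gradient_def)
  show "locally_integrable \<Omega> (\<lambda>x. (G x - H x) \<bullet> b)" unfolding inner_diff_left by (rule locally_integrable_diff[OF lG lH])
  fix \<phi> assume \<phi>: "\<phi> \<in> test_functions \<Omega>"
  note i = integrable_times_test_function[OF \<Omega>]
  have "(LINT x|?L. (u x - w x) * partial_deriv b \<phi> x) =
     (LINT x|?L. u x * partial_deriv b \<phi> x) - (LINT x|?L. w x * partial_deriv b \<phi> x)"
    unfolding left_diff_distrib
    by (rule Bochner_Integration.integral_diff[OF i[OF lu partial_deriv_test_function[OF \<phi> b]] i[OF lw partial_deriv_test_function[OF \<phi> b]]])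
  also have "\<dots> = - (LINT x|?L. G x \<bullet> b * \<phi> x) - - (LINT x|?L. H x \<bullet> b * \<phi> x)"
    using u w b \<phi> by (simp add: weak_gradient_def)
  also have "\<dots> = - (LINT x|?L. (G x - H x) \<bullet> b * \<phi> x)"
    unfolding inner_diff_left left_diff_distrib using i[OF lG \<phi>] i[OF lH \<phi>] by simp
  finally show "(LINT x|?L. (u x - w x) * partial_deriv b \<phi> x) = - (LINT x|?L. (G x - H x) \<bullet> b * \<phi> x)" .
qed

text \<open>The gradient v'(|x|) x/|x| of the lifted profile; its value 0 at the origin concerns a
  null set only.\<close>

definition radial_grad :: "(real \<Rightarrow> real) \<Rightarrow> 'a::euclidean_space \<Rightarrow> 'a" where
  "radial_grad v x = (wd v (norm x) / norm x) *\<^sub>R x"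

lemma borel_measurable_radial_grad:
  assumes "wd v \<in> borel_measurable leb01" shows "radial_grad v \<in> borel_measurable lebB"
proof -
  have "(\<lambda>r. wd v r / r) \<in> borel_measurable leb01"
    using assms continuous_imp_measurable_on_sets_lebesgue[OF continuous_on_id, of "{0<..<1::real}"] by (intro borel_measurable_divide) auto
  from polar(1)[OF this] have "(\<lambda>x::'a. wd v (norm x) / norm x) \<in> borel_measurable lebB" .
  moreover have "(\<lambda>x::'a. x) \<in> borel_measurable lebB" by (intro continuous_imp_measurable_on_sets_lebesgue continuous_on_id) simp
  ultimately show ?thesis unfolding radial_grad_def[abs_def] by (rule borel_measurable_scaleR)
qed

text \<open>One-dimensional density transplanted to the ball: polar coordinates turn the weighted
  integrals into integrals over the ball up to the factor \<open>sphere_area\<close>, and the lifted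
  approximants are test functions there.\<close>

theorem radial_lift:
  assumes N: "2 \<le> DIM('a::euclidean_space)" and v: "v \<in> calH_0M (real DIM('a))"
  shows "weak_gradient (ball (0::'a) 1) (\<lambda>x. v (norm x)) (radial_grad v)"
    and "(\<lambda>x::'a. v (norm x)) \<in> calH_rad"
proof -
  let ?N = "real DIM('a)" and ?\<omega> = "sphere_area TYPE('a)"
  have N2: "2 \<le> ?N" "1 \<le> ?N" using N by auto
  have "\<exists>f. f \<in> test_functions {0<..<1} \<and> (LINT r|leb01. r powr (?N - 1) * (wd v r - partial_deriv 1 f r)^2) < inverse (real (Suc n))" for n
  proof -
    have "inverse (real (Suc n)) > 0" by simp
    from test_functions_dense[OF N2(1) v this] show ?thesis unfolding Bex_def .
  qed
  from choice[OF allI[OF this]]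
  obtain f where ff: "\<forall>n. f n \<in> test_functions {0<..<1} \<and> (LINT r|leb01. r powr (?N - 1) * (wd v r - partial_deriv 1 (f n) r)^2) < inverse (real (Suc n))" ..
  have f: "f n \<in> test_functions {0<..<1}"
    and fe: "(LINT r|leb01. r powr (?N - 1) * (wd v r - partial_deriv 1 (f n) r)^2) < inverse (real (Suc n))" for n
    using spec[OF ff, of n] by (simp_all only: simp_thms)
  define e where "e n = (LINT r|leb01. r powr (?N - 1) * (wd v r - partial_deriv 1 (f n) r)^2)" for n
  have e0: "0 \<le> e n" for n unfolding e_def by (intro integral_nonneg_AE AE_I2) auto
  have elim: "(\<lambda>n. ?\<omega> * e n) \<longlonglongrightarrow> 0"
  proof -
    have "e n \<le> inverse (real (Suc n))" for n using fe[of n] unfolding e_def by (rule less_imp_le)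
    then have "e \<longlonglongrightarrow> 0"
      by (intro tendsto_sandwich[OF _ _ tendsto_const LIMSEQ_inverse_real_of_nat] always_eventually allI e0)
    from tendsto_mult_left[OF this, of ?\<omega>] show ?thesis by simp
  qed
  define \<phi> where "\<phi> n x = f n (norm x)" for n and x :: 'a
  let ?u = "\<lambda>x::'a. v (norm x)"
  have \<phi>T: "\<phi> n \<in> test_functions (ball 0 1)" for n unfolding \<phi>_def[abs_def] by (rule radial_test_function(1)[OF f])
  have \<phi>s: "smooth (\<phi> n)" for n using \<phi>T by (simp add: test_functions_def)
  have vm: "v \<in> borel_measurable leb01" "wd v \<in> borel_measurable leb01" using calH_0M_measurable[OF v] by auto
  have um: "?u \<in> borel_measurable lebB" by (rule polar(1)[OF vm(1)])
  have Gm: "radial_grad v \<in> borel_measurable (lebB :: 'a measure)" by (rule borel_measurable_radial_grad[OF vm(2)])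
  have fH: "f n \<in> calH_0M ?N" "AE r in leb01. wd (f n) r = partial_deriv 1 (f n) r" for n
    using test_function_calH[OF f] by auto
  define w where "w n r = v r - f n r" for n r
  have wH: "w n \<in> calH_0M ?N" for n unfolding w_def[abs_def] by (rule calH_0M_diff(1)[OF v fH(1)])
  have fm': "partial_deriv 1 (f n) \<in> borel_measurable leb01" for n
    by (rule borel_measurable_lebesgue_on_AE[OF calH_0M_measurable(2)[OF fH(1)] _ fH(2)]) simp
  have we: "energy ?N (w n) (w n) = e n" for n
    unfolding energy_square e_def
  proof (rule integral_cong_AE)
    show "AE r in leb01. r powr (?N - 1) * (wd (w n) r)^2 = r powr (?N - 1) * (wd v r - partial_deriv 1 (f n) r)^2"
      using calH_0M_diff(2)[OF v fH(1)[of n]] fH(2)[of n] unfolding w_def[abs_def] by eventually_elim simp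
  qed (use calH_0M_measurable(2)[OF wH] vm fm' in \<open>auto intro!: borel_measurable_times borel_measurable_power borel_measurable_diff\<close>)
  have wi: "integrable leb01 (\<lambda>r. r powr (?N - 1) * (w n r)^2)" for n by (rule L2_M_D(2)[OF calH_0M_L2(1)[OF wH]])
  \<comment> \<open>The pointwise bound by the energy, integrated over an interval of length 1,
    controls the L2 part; convergence of the derivatives alone suffices.\<close>
  have wle: "(LINT r|leb01. r powr (?N - 1) * (w n r)^2) \<le> e n" for n
  proof -
    have "(LINT r|leb01. r powr (?N - 1) * (w n r)^2) \<le> (LINT r|leb01. e n)"
      using calH_0M_pointwise[OF N2(2) wH[of n]] by (intro integral_mono wi integrable_const_01) (auto simp: space_restrict_space we)
    then show ?thesis by (simp only: LINT_const_01)
  qed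
  have w2m: "(\<lambda>r. (w n r)^2) \<in> borel_measurable leb01" for n using calH_0M_measurable(1)[OF wH] by measurable
  have ui: "integrable (lebB :: 'a measure) (\<lambda>x. (?u x - \<phi> n x)^2)" for n
    using polar(2)[OF w2m, where 'a='a, of n] wi[of n] by (simp add: w_def \<phi>_def)
  have ule: "(LINT x|(lebB :: 'a measure). (?u x - \<phi> n x)^2) \<le> ?\<omega> * e n" for n
    using polar(3)[OF w2m, where 'a='a, of n] mult_left_mono[OF wle less_imp_le[OF sphere_area_pos[where 'a='a]], of n] by (simp add: w_def \<phi>_def)
  have g2m: "(\<lambda>r. (wd v r - partial_deriv 1 (f n) r)^2) \<in> borel_measurable leb01" for n using vm(2) fm' by measurable
  have gi: "integrable leb01 (\<lambda>r. r powr (?N - 1) * (wd v r - partial_deriv 1 (f n) r)^2)" for n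
  proof (rule integrable_cong_AE_imp[OF L2_M_D(2)[OF calH_0M_acd(2)[OF wH[of n]]]])
    show "AE r in leb01. r powr (?N - 1) * (wd (w n) r)^2 = r powr (?N - 1) * (wd v r - partial_deriv 1 (f n) r)^2"
      using calH_0M_diff(2)[OF v fH(1)[of n]] fH(2)[of n] unfolding w_def[abs_def] by eventually_elim simp
  qed (use g2m in \<open>auto intro!: borel_measurable_times\<close>)
  have Geq: "(norm (radial_grad v x - grad (\<phi> n) x))^2 = (wd v (norm x) - partial_deriv 1 (f n) (norm x))^2" if "x \<noteq> 0" for n x
  proof -
    have "radial_grad v x - grad (\<phi> n) x = ((wd v (norm x) - partial_deriv 1 (f n) (norm x)) / norm x) *\<^sub>R x"
      unfolding \<phi>_def[abs_def] radial_grad_def radial_test_function(2)[OF f] by (simp add: scaleR_diff_left diff_divide_distrib)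
    then show ?thesis using that by simp
  qed
  have gradm: "grad (\<phi> n) \<in> borel_measurable lebB" for n
    unfolding grad_def[abs_def]
    by (intro continuous_imp_measurable_on_sets_lebesgue continuous_intros smooth_continuous smooth_partial_deriv \<phi>s) auto
  have Gm2: "(\<lambda>x. (norm (radial_grad v x - grad (\<phi> n) x))^2) \<in> borel_measurable lebB" for n using Gm gradm by measurable
  have Gae: "AE x in lebB. (wd v (norm x) - partial_deriv 1 (f n) (norm x))^2 = (norm (radial_grad v x - grad (\<phi> n) x))^2" for n
    using AE_ball_nonzero[where 'a='a] by eventually_elim (rule Geq[symmetric])
  have Gi: "integrable lebB (\<lambda>x. (norm (radial_grad v x - grad (\<phi> n) x))^2)" for n
    by (rule integrable_cong_AE_imp[OF _ Gm2]) (use polar(2)[OF g2m, where 'a='a, of n] gi Gae in auto)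
  have Geq2: "(LINT x|lebB. (norm (radial_grad v x - grad (\<phi> n) x))^2) = ?\<omega> * e n" for n
    unfolding e_def polar(3)[OF g2m, where 'a='a, symmetric]
    by (rule integral_cong_AE[OF polar(1)[OF g2m] Gm2 Gae, symmetric])
  have ul: "(\<lambda>n. LINT x|(lebB :: 'a measure). (?u x - \<phi> n x)^2) \<longlonglongrightarrow> 0"
    by (rule tendsto_sandwich[OF _ _ tendsto_const elim]) (use ule in \<open>auto intro!: always_eventually\<close>)
  have Gl: "(\<lambda>n. LINT x|lebB. (norm (radial_grad v x - grad (\<phi> n) x))^2) \<longlonglongrightarrow> 0" unfolding Geq2 by (rule elim)
  show wg: "weak_gradient (ball (0::'a) 1) ?u (radial_grad v)"
    by (rule weak_gradient_L2_limit[OF open_ball um Gm \<phi>s ui Gi ul Gl])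
  have v2m: "(\<lambda>r. (v r)^2) \<in> borel_measurable leb01" "(\<lambda>r. (wd v r)^2) \<in> borel_measurable leb01" using vm by measurable
  have u2: "integrable (lebB :: 'a measure) (\<lambda>x. (?u x)^2)"
    using polar(2)[OF v2m(1), where 'a='a] L2_M_D(2)[OF calH_0M_L2(1)[OF v]] by simp
  have G2: "integrable (lebB :: 'a measure) (\<lambda>x. (norm (radial_grad v x))^2)"
  proof (rule integrable_cong_AE_imp)
    show "integrable (lebB :: 'a measure) (\<lambda>x. (wd v (norm x))^2)"
      using polar(2)[OF v2m(2), where 'a='a] L2_M_D(2)[OF calH_0M_acd(2)[OF v]] by simp
    show "AE x in (lebB :: 'a measure). (wd v (norm x))^2 = (norm (radial_grad v x))^2"
      using AE_ball_nonzero[where 'a='a] by eventually_elim (simp add: radial_grad_def)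
  qed (use Gm in measurable)
  have H1: "?u \<in> H1 (ball 0 1)" unfolding H1_def using um u2 Gm wg G2 by blast
  have "(\<lambda>n. H1_norm (ball 0 1) (\<lambda>x. ?u x - \<phi> n x)) \<longlonglongrightarrow> sqrt 0"
    unfolding H1_norm_def
  proof (rule tendsto_real_sqrt)
    have eq: "(LINT x|lebB. (?u x - \<phi> n x)^2 + (norm (wgrad (ball 0 1) (\<lambda>x. ?u x - \<phi> n x) x))^2) =
       (LINT x|lebB. (?u x - \<phi> n x)^2) + (LINT x|lebB. (norm (radial_grad v x - grad (\<phi> n) x))^2)" for n
    proof -
      have ae: "AE x in lebB. wgrad (ball 0 1) (\<lambda>x. ?u x - \<phi> n x) x = radial_grad v x - grad (\<phi> n) x"
        by (rule wgrad_AE_eq[OF open_ball weak_gradient_diff[OF open_ball wg smooth_weak_gradient[OF \<phi>s open_ball]]])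
      have "(\<lambda>x. (?u x - \<phi> n x)^2 + (norm (radial_grad v x - grad (\<phi> n) x))^2) \<in> borel_measurable lebB"
        using ui Gi by (intro borel_measurable_add) auto
      moreover from this have "(\<lambda>x. (?u x - \<phi> n x)^2 + (norm (wgrad (ball 0 1) (\<lambda>x. ?u x - \<phi> n x) x))^2) \<in> borel_measurable lebB"
        by (rule borel_measurable_lebesgue_on_AE) (use ae in \<open>auto elim!: eventually_mono\<close>)
      ultimately have "(LINT x|lebB. (?u x - \<phi> n x)^2 + (norm (wgrad (ball 0 1) (\<lambda>x. ?u x - \<phi> n x) x))^2) =
        (LINT x|lebB. (?u x - \<phi> n x)^2 + (norm (radial_grad v x - grad (\<phi> n) x))^2)"
        by (intro integral_cong_AE) (use ae in \<open>auto elim!: eventually_mono\<close>)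
      then show ?thesis using ui Gi by simp
    qed
    show "(\<lambda>n. LINT x|lebB. (?u x - \<phi> n x)^2 + (norm (wgrad (ball 0 1) (\<lambda>x. ?u x - \<phi> n x) x))^2) \<longlonglongrightarrow> 0"
      unfolding eq using tendsto_add[OF ul Gl] by simp
  qed
  then have H10: "?u \<in> H1_0 (ball 0 1)" unfolding H1_0_def using H1 \<phi>T by auto
  have "integrable lebB (\<lambda>x::'a. (?u x)^2 / (norm x)^2)"
    using polar_singular(1)[OF v2m(1), where 'a='a] calH_0M_acd(4)[OF v] by (simp add: calL_M_def)
  then show "?u \<in> calH_rad" unfolding calH_rad_def radial_on_def using H10 by auto
qed

section \<open>Profiles of radial functions\<close>

lemma nn_integral_lebesgue_on:
  fixes h :: "'a::euclidean_space \<Rightarrow> ennreal"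
  assumes [measurable]: "h \<in> borel_measurable borel" "S \<in> sets borel"
  shows "(\<integral>\<^sup>+x. h x \<partial>lebesgue_on S) = (\<integral>\<^sup>+x. h x * indicator S x \<partial>lborel)"
proof -
  have "(\<integral>\<^sup>+x. h x \<partial>lebesgue_on S) = (\<integral>\<^sup>+x. h x * indicator S x \<partial>lebesgue)" by (rule nn_integral_restrict_space) simp
  also have "\<dots> = (\<integral>\<^sup>+x. h x * indicator S x \<partial>lborel)" by (rule nn_integral_completion) measurable
  finally show ?thesis .
qed

text \<open>Adding infinity on a null set containing the exceptional points leaves the integral
  finite; finiteness along a ray then forces the ray to meet that set only in a null set of
  parameters.\<close>

lemma exists_good_ray:
  fixes F :: "'a::euclidean_space \<Rightarrow> ennreal"
  assumes F[measurable]: "F \<in> borel_measurable borel" and fin: "(\<integral>\<^sup>+x. F x \<partial>lborel) < \<infinity>" and P: "AE x in lebB. P x"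
  obtains e where "norm e = 1" "(\<integral>\<^sup>+s. ennreal (s ^ (DIM('a) - 1)) * indicator {0<..} s * F (s *\<^sub>R e) \<partial>lborel) < \<infinity>"
    "AE s in leb01. P (s *\<^sub>R e)"
proof -
  have "negligible {x \<in> ball 0 1. \<not> P x}" using P by (simp add: AE_lebesgue_on_iff)
  then obtain A where A: "A \<in> null_sets lborel" "{x \<in> ball 0 1. \<not> P x} \<subseteq> A"
    by (auto simp: negligible_iff_null_sets null_sets_completion_iff2)
  have [measurable]: "A \<in> sets borel" using A by auto
  let ?F = "\<lambda>x. F x + \<infinity> * indicator A x"
  have "(\<integral>\<^sup>+x. ?F x \<partial>lborel) = (\<integral>\<^sup>+x. F x \<partial>lborel) + \<infinity> * emeasure lborel A"
    by (subst nn_integral_add) (auto simp: nn_integral_cmult_indicator)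
  then have "(\<integral>\<^sup>+x. ?F x \<partial>lborel) < \<infinity>" using A(1) fin by (simp add: null_sets_def)
  moreover have "?F \<in> borel_measurable borel" by measurable
  ultimately obtain e where e: "norm e = 1"
    "(\<integral>\<^sup>+s. ennreal (s ^ (DIM('a) - 1)) * indicator {0<..} s * ?F (s *\<^sub>R e) \<partial>lborel) < \<infinity>"
    using exists_integrable_ray[of ?F] by blast
  have "(\<integral>\<^sup>+s. ennreal (s ^ (DIM('a) - 1)) * indicator {0<..} s * F (s *\<^sub>R e) \<partial>lborel) \<le>
    (\<integral>\<^sup>+s. ennreal (s ^ (DIM('a) - 1)) * indicator {0<..} s * ?F (s *\<^sub>R e) \<partial>lborel)"
    by (intro nn_integral_mono mult_left_mono) auto
  then have f: "(\<integral>\<^sup>+s. ennreal (s ^ (DIM('a) - 1)) * indicator {0<..} s * F (s *\<^sub>R e) \<partial>lborel) < \<infinity>"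
    using e(2) by (rule le_less_trans)
  have "AE s in lborel. ennreal (s ^ (DIM('a) - 1)) * indicator {0<..} s * ?F (s *\<^sub>R e) \<noteq> \<infinity>"
    by (rule nn_integral_PInf_AE) (use e(2) in auto)
  then have "AE s in lborel. s \<in> {0<..<1} \<longrightarrow> P (s *\<^sub>R e)"
  proof eventually_elim
    case (elim s)
    show ?case
    proof (intro impI, rule ccontr)
      assume s: "s \<in> {0<..<1}" and n: "\<not> P (s *\<^sub>R e)"
      then have "s *\<^sub>R e \<in> A" using A(2) e(1) by auto
      moreover have "ennreal (s ^ (DIM('a) - 1)) \<noteq> 0" using s by (simp add: ennreal_eq_0_iff not_le)
      ultimately show False using elim s by (auto simp: ennreal_mult_eq_top_iff)
    qed
  qed
  then have "AE s in leb01. P (s *\<^sub>R e)" by (rule AE_lborel_lebesgue_on) simp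
  with e(1) f show ?thesis by (rule that)
qed

lemma borel_representative_vector:
  fixes G :: "'b::euclidean_space \<Rightarrow> 'a::euclidean_space"
  assumes G: "G \<in> borel_measurable (lebesgue_on S)" and S: "S \<in> sets lebesgue"
  obtains G' where "G' \<in> borel_measurable borel" "AE x in lebesgue_on S. G x = G' x"
proof -
  have "\<exists>g. g \<in> borel_measurable borel \<and> (AE x in lebesgue_on S. G x \<bullet> b = g x)" for b
  proof -
    have "(\<lambda>x. G x \<bullet> b) \<in> borel_measurable (lebesgue_on S)" using G by measurable
    from borel_representative[OF this S] show ?thesis by blast
  qed
  from choice[OF allI[OF this]] obtain g where
    g0: "\<forall>b. g b \<in> borel_measurable borel \<and> (AE x in lebesgue_on S. G x \<bullet> b = g b x)" ..
  have g[measurable]: "g b \<in> borel_measurable borel" for b using g0 by simp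
  have "AE x in lebesgue_on S. \<forall>b\<in>Basis. G x \<bullet> b = g b x"
    using g0 by (intro AE_finite_allI) auto
  then have "AE x in lebesgue_on S. G x = (\<Sum>b\<in>Basis. g b x *\<^sub>R b)"
  proof eventually_elim
    case (elim x)
    have "G x = (\<Sum>b\<in>Basis. (G x \<bullet> b) *\<^sub>R b)" by (simp add: euclidean_representation)
    also have "\<dots> = (\<Sum>b\<in>Basis. g b x *\<^sub>R b)" by (rule sum.cong) (use elim in auto)
    finally show ?case .
  qed
  moreover have "(\<lambda>x. \<Sum>b\<in>Basis. g b x *\<^sub>R b) \<in> borel_measurable borel" by measurable
  ultimately show ?thesis using that by blast
qed

lemma LINT_leb01_le:
  fixes h :: "real \<Rightarrow> real"
  assumes h[measurable]: "h \<in> borel_measurable borel" and nn: "\<And>s. 0 \<le> h s" and c: "0 \<le> c"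
    and le: "(\<integral>\<^sup>+s. ennreal (h s) * indicator {0<..<1} s \<partial>lborel) \<le> ennreal c"
  shows "integrable leb01 h" "(LINT s|leb01. h s) \<le> c"
proof -
  have hm: "h \<in> borel_measurable leb01" by (rule measurable_restrict_space1[OF measurable_completion]) simp
  have eq: "(\<integral>\<^sup>+s. ennreal (h s) \<partial>leb01) = (\<integral>\<^sup>+s. ennreal (h s) * indicator {0<..<1} s \<partial>lborel)"
    by (rule nn_integral_lebesgue_on) auto
  show i: "integrable leb01 h"
    by (rule integrableI_nonneg[OF hm]) (use nn le eq in \<open>auto intro: le_less_trans[OF _ ennreal_less_top]\<close>)
  have "ennreal (LINT s|leb01. h s) \<le> ennreal c"
    using nn_integral_eq_integral[OF i] nn le eq by simp
  then show "(LINT s|leb01. h s) \<le> c" using c by (simp add: ennreal_le_iff)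
qed

lemma L2_01_L2_M: "f \<in> L2_01 \<Longrightarrow> 1 \<le> M \<Longrightarrow> f \<in> L2_M M"
proof -
  assume f: "f \<in> L2_01" and M: "1 \<le> M"
  have "integrable leb01 (\<lambda>r. r powr (1 - 1) * (f r)^2) \<longleftrightarrow> integrable leb01 (\<lambda>r. (f r)^2)"
    by (rule Bochner_Integration.integrable_cong[OF refl]) (simp add: space_restrict_space)
  then have "f \<in> L2_M 1" using f by (simp add: L2_M_def)
  then show "f \<in> L2_M M" by (rule L2_M_mono[OF _ M])
qed

lemma norm_diff_square_le: "(norm (a - b))^2 \<le> 2 * (norm a)^2 + 2 * (norm b)^2" for a b :: "'a::real_normed_vector"
proof -
  have "(norm (a - b))^2 \<le> (norm a + norm b)^2" by (intro power_mono norm_triangle_ineq4 norm_ge_zero)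
  also have "\<dots> \<le> 2 * (norm a)^2 + 2 * (norm b)^2"
    using zero_le_power2[of "norm a - norm b"] by (simp add: power2_eq_square algebra_simps)
  finally show ?thesis .
qed

lemma borel_measurable_grad: "smooth \<phi> \<Longrightarrow> grad \<phi> \<in> borel_measurable borel"
  unfolding grad_def[abs_def]
  by (intro borel_measurable_continuous_onI continuous_intros smooth_continuous smooth_partial_deriv)

lemma grad_square_integrable:
  fixes \<phi> :: "'a::euclidean_space \<Rightarrow> real"
  assumes "\<phi> \<in> test_functions \<Omega>" "open \<Omega>"
  shows "integrable (lebesgue_on \<Omega>) (\<lambda>x. (\<phi> x)^2)" "integrable (lebesgue_on \<Omega>) (\<lambda>x. (norm (grad \<phi> x))^2)"
proof -
  have sq: "integrable (lebesgue_on \<Omega>) (\<lambda>x. (k x)^2)" if "k \<in> test_functions \<Omega>" for k :: "'a \<Rightarrow> real"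
    unfolding power2_eq_square
    by (intro integrable_times_test_function assms continuous_locally_integrable smooth_continuous that)
      (use that in \<open>simp add: test_functions_def\<close>)
  show "integrable (lebesgue_on \<Omega>) (\<lambda>x. (\<phi> x)^2)" by (rule sq[OF assms(1)])
  have "(norm (grad \<phi> x))^2 = (\<Sum>b\<in>Basis. (partial_deriv b \<phi> x)^2)" for x
  proof -
    have "(norm (grad \<phi> x))^2 = (\<Sum>b\<in>Basis. (grad \<phi> x \<bullet> b) * (grad \<phi> x \<bullet> b))"
      unfolding power2_norm_eq_inner by (rule euclidean_inner)
    also have "\<dots> = (\<Sum>b\<in>Basis. (partial_deriv b \<phi> x)^2)"
      by (intro sum.cong refl) (simp add: grad_inner power2_eq_square)
    finally show ?thesis .
  qed
  then show "integrable (lebesgue_on \<Omega>) (\<lambda>x. (norm (grad \<phi> x))^2)"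
    using sq[OF partial_deriv_test_function[OF assms(1)]] by simp
qed

text \<open>Borel representatives are fixed because measurability along a single ray is not
  guaranteed for Lebesgue measurable functions. The rate (1/4)^k is meant for summation with weights
  2^k.\<close>

lemma H1_0_approximation:
  fixes u :: "'a::euclidean_space \<Rightarrow> real"
  assumes "u \<in> H1_0 (ball 0 1)"
  obtains u' G' \<phi> where "u' \<in> borel_measurable borel" "G' \<in> borel_measurable borel"
    "AE x in lebB. u x = u' x" "\<And>k::nat. \<phi> k \<in> test_functions (ball 0 1)"
    "\<And>k. integrable lebB (\<lambda>x. (u' x - \<phi> k x)^2 + (norm (G' x - grad (\<phi> k) x))^2)"
    "\<And>k. (LINT x|lebB. (u' x - \<phi> k x)^2 + (norm (G' x - grad (\<phi> k) x))^2) < (1/4) ^ k"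
proof -
  let ?B = "ball (0::'a) 1"
  obtain G \<phi> where u: "u \<in> borel_measurable lebB" "integrable lebB (\<lambda>x. (u x)^2)" and G: "G \<in> borel_measurable lebB"
    "weak_gradient ?B u G" "integrable lebB (\<lambda>x. (norm (G x))^2)"
    and \<phi>: "\<forall>n::nat. \<phi> n \<in> test_functions ?B" "(\<lambda>n. H1_norm ?B (\<lambda>x. u x - \<phi> n x)) \<longlonglongrightarrow> 0"
    using assms unfolding H1_0_def H1_def by blast
  note \<phi>T = spec[OF \<phi>(1)]
  have \<phi>s: "smooth (\<phi> n)" for n using \<phi>T[of n] by (simp add: test_functions_def)
  obtain u' where u': "u' \<in> borel_measurable borel" "AE x in lebB. u x = u' x" using borel_representative[OF u(1)] by auto
  obtain G' where G': "G' \<in> borel_measurable borel" "AE x in lebB. G x = G' x" using borel_representative_vector[OF G(1)] by auto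
  define q where "q n x = (u' x - \<phi> n x)^2 + (norm (G' x - grad (\<phi> n) x))^2" for n x
  have \<phi>b: "\<phi> n \<in> borel_measurable borel" for n by (intro borel_measurable_continuous_onI smooth_continuous \<phi>s)
  note [measurable] = u'(1) G'(1) \<phi>b borel_measurable_grad[OF \<phi>s]
  have b2l: "h \<in> borel_measurable lebB" if "h \<in> borel_measurable borel" for h :: "'a \<Rightarrow> real"
    by (rule measurable_restrict_space1[OF measurable_completion]) (use that in simp)
  have qm: "q n \<in> borel_measurable lebB" for n by (rule b2l) (simp add: q_def[abs_def])
  have qi: "integrable lebB (q n)" for n
  proof (rule Bochner_Integration.integrable_bound[OF _ qm])
    show "integrable lebB (\<lambda>x. 2 * (u x)^2 + 2 * (\<phi> n x)^2 + (2 * (norm (G x))^2 + 2 * (norm (grad (\<phi> n) x))^2))"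
      using u(2) G(3) grad_square_integrable[OF \<phi>T open_ball, of n] by simp
    show "AE x in lebB. norm (q n x) \<le> norm (2 * (u x)^2 + 2 * (\<phi> n x)^2 + (2 * (norm (G x))^2 + 2 * (norm (grad (\<phi> n) x))^2))"
      using u'(2) G'(2)
    proof eventually_elim
      case (elim x)
      have "(u x - \<phi> n x)^2 \<le> 2 * (u x)^2 + 2 * (\<phi> n x)^2" using norm_diff_square_le[of "u x" "\<phi> n x"] by simp
      moreover have "(norm (G x - grad (\<phi> n) x))^2 \<le> 2 * (norm (G x))^2 + 2 * (norm (grad (\<phi> n) x))^2" by (rule norm_diff_square_le)
      ultimately show ?case unfolding q_def elim[symmetric] by simp
    qed
  qed
  have E: "(LINT x|lebB. q n x) = (H1_norm ?B (\<lambda>x. u x - \<phi> n x))^2" for n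
  proof -
    let ?h = "\<lambda>x. (u x - \<phi> n x)^2 + (norm (wgrad ?B (\<lambda>x. u x - \<phi> n x) x))^2"
    have "AE x in lebB. wgrad ?B (\<lambda>x. u x - \<phi> n x) x = G x - grad (\<phi> n) x"
      by (rule wgrad_AE_eq[OF open_ball weak_gradient_diff[OF open_ball G(2) smooth_weak_gradient[OF \<phi>s open_ball]]])
    then have ae: "AE x in lebB. q n x = ?h x" using u'(2) G'(2) by eventually_elim (simp add: q_def)
    have hm: "?h \<in> borel_measurable lebB" by (rule borel_measurable_lebesgue_on_AE[OF qm _ ae]) simp
    have "0 \<le> (LINT x|lebB. ?h x)" by (intro integral_nonneg_AE AE_I2) simp
    then have "(H1_norm ?B (\<lambda>x. u x - \<phi> n x))^2 = (LINT x|lebB. ?h x)" unfolding H1_norm_def by simp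
    also have "\<dots> = (LINT x|lebB. q n x)" by (rule integral_cong_AE[OF qm hm ae, symmetric])
    finally show ?thesis by simp
  qed
  have "(\<lambda>n. LINT x|lebB. q n x) \<longlonglongrightarrow> 0\<^sup>2" unfolding E by (intro tendsto_power \<phi>(2))
  then have lim: "(\<lambda>n. LINT x|lebB. q n x) \<longlonglongrightarrow> 0" by simp
  have "\<exists>n. (LINT x|lebB. q n x) < (1/4) ^ k" for k :: nat
  proof -
    have "\<forall>\<^sub>F n in sequentially. (LINT x|lebB. q n x) < (1/4) ^ k" by (rule order_tendstoD(2)[OF lim]) simp
    then show ?thesis by (auto simp: eventually_sequentially)
  qed
  from choice[OF allI[OF this]] obtain m where m: "\<forall>k. (LINT x|lebB. q (m k) x) < (1/4) ^ k" ..
  show ?thesis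
    by (rule that[of u' G' "\<lambda>k. \<phi> (m k)"]) (use u' G'(1) \<phi>T qi m in \<open>simp_all add: q_def[abs_def]\<close>)
qed

text \<open>Almost every ray sees the test functions converge in the weighted one-dimensional norm; the
  profile is the limit along one such ray.\<close>

theorem radial_profile:
  fixes u :: "'a::euclidean_space \<Rightarrow> real"
  assumes u: "u \<in> calH_rad"
  obtains v where "v \<in> calH_0M (real DIM('a))" "AE x in lebB. u x = v (norm x)"
proof -
  let ?N = "real DIM('a)" and ?n = "DIM('a) - 1" and ?B = "ball (0::'a) 1"
  have N: "1 \<le> ?N" by simp
  have B[measurable]: "?B \<in> sets borel" by simp
  have pw: "r powr (?N - 1) = r ^ ?n" if "0 < r" for r
    using that by (simp flip: powr_realpow add: of_nat_diff)
  have u0: "u \<in> H1_0 ?B" "radial_on ?B u" "integrable lebB (\<lambda>x. (u x)^2 / (norm x)^2)" using u by (auto simp: calH_rad_def)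
  obtain g where g: "AE x in lebB. u x = g (norm x)" using u0(2) by (auto simp: radial_on_def)
  obtain u' G' \<phi> where [measurable]: "u' \<in> borel_measurable borel" "G' \<in> borel_measurable borel"
    and u': "AE x in lebB. u x = u' x" and \<phi>T: "\<And>k::nat. \<phi> k \<in> test_functions ?B"
    and qi0: "\<And>k. integrable lebB (\<lambda>x. (u' x - \<phi> k x)^2 + (norm (G' x - grad (\<phi> k) x))^2)"
    and ql0: "\<And>k. (LINT x|lebB. (u' x - \<phi> k x)^2 + (norm (G' x - grad (\<phi> k) x))^2) < (1/4) ^ k"
    using H1_0_approximation[OF u0(1)] by blast
  define q where "q k x = (u' x - \<phi> k x)^2 + (norm (G' x - grad (\<phi> k) x))^2" for k x
  have qi: "integrable lebB (q k)" and ql: "(LINT x|lebB. q k x) < (1/4) ^ k" for k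
    using qi0[of k] ql0[of k] by (simp_all only: q_def[abs_def])
  have q0: "0 \<le> q k x" for k x by (simp add: q_def)
  have \<phi>s: "smooth (\<phi> n)" for n using \<phi>T[of n] by (simp add: test_functions_def)
  have \<phi>b: "\<phi> n \<in> borel_measurable borel" for n by (intro borel_measurable_continuous_onI smooth_continuous \<phi>s)
  note [measurable] = \<phi>b borel_measurable_grad[OF \<phi>s]
  have qb[measurable]: "q n \<in> borel_measurable borel" for n unfolding q_def[abs_def] by measurable
  \<comment> \<open>The weights 2^k keep the sum integrable against the rate (1/4)^k, and finiteness
    along one ray then bounds all terms at once by multiples of (1/2)^k.\<close>
  define F where "F x = (\<Sum>k. ennreal (2 ^ k * q k x) * indicator ?B x)" for x
  have Fb[measurable]: "F \<in> borel_measurable borel" unfolding F_def[abs_def] by measurable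
  have "(\<integral>\<^sup>+x. F x \<partial>lborel) = (\<Sum>k. \<integral>\<^sup>+x. ennreal (2 ^ k * q k x) * indicator ?B x \<partial>lborel)"
    unfolding F_def by (rule nn_integral_suminf) measurable
  also have "\<dots> \<le> (\<Sum>k. ennreal ((1/2) ^ k))"
  proof (intro suminf_le summableI)
    fix k
    have "(\<integral>\<^sup>+x. ennreal (2 ^ k * q k x) * indicator ?B x \<partial>lborel) = (\<integral>\<^sup>+x. ennreal (2 ^ k * q k x) \<partial>lebB)"
      by (rule nn_integral_lebesgue_on[symmetric]) auto
    also have "\<dots> = ennreal (LINT x|lebB. 2 ^ k * q k x)" by (rule nn_integral_eq_integral) (use qi q0 in auto)
    also have "\<dots> \<le> ennreal ((1/2) ^ k)"
    proof (rule ennreal_leI)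
      have "(LINT x|lebB. 2 ^ k * q k x) \<le> 2 ^ k * (1/4) ^ k" using ql[of k] by simp
      also have "\<dots> = (1/2) ^ k" by (simp flip: power_mult_distrib)
      finally show "(LINT x|lebB. 2 ^ k * q k x) \<le> (1/2) ^ k" .
    qed
    finally show "(\<integral>\<^sup>+x. ennreal (2 ^ k * q k x) * indicator ?B x \<partial>lborel) \<le> ennreal ((1/2) ^ k)" .
  qed
  also have "\<dots> = ennreal (\<Sum>k. (1/2) ^ k)" by (rule suminf_ennreal2) (auto intro: summable_geometric)
  also have "\<dots> < \<infinity>" by simp
  finally have Ffin: "(\<integral>\<^sup>+x. F x \<partial>lborel) < \<infinity>" .
  have "AE x in lebB. u' x = g (norm x)" using u' g by eventually_elim simp
  from exists_good_ray[OF Fb Ffin this] obtain e where e: "norm e = 1"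
    "(\<integral>\<^sup>+s. ennreal (s ^ ?n) * indicator {0<..} s * F (s *\<^sub>R e) \<partial>lborel) < \<infinity>"
    "AE s in leb01. u' (s *\<^sub>R e) = g (norm (s *\<^sub>R e))" by blast
  obtain C where C: "0 \<le> C" "(\<integral>\<^sup>+s. ennreal (s ^ ?n) * indicator {0<..} s * F (s *\<^sub>R e) \<partial>lborel) = ennreal C"
    using e(2) by (cases "\<integral>\<^sup>+s. ennreal (s ^ ?n) * indicator {0<..} s * F (s *\<^sub>R e) \<partial>lborel") auto
  have b2l: "h \<in> borel_measurable leb01" if "h \<in> borel_measurable borel" for h :: "real \<Rightarrow> real"
    by (rule measurable_restrict_space1[OF measurable_completion]) (use that in simp)
  have A: "integrable leb01 (\<lambda>s. s powr (?N - 1) * q k (s *\<^sub>R e))"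
    "(LINT s|leb01. s powr (?N - 1) * q k (s *\<^sub>R e)) \<le> C * (1/2) ^ k" for k
  proof -
    \<comment> \<open>The absolute value makes the integrand nonnegative off (0,1) as well, as
      \<open>LINT_leb01_le\<close> demands.\<close>
    let ?h = "\<lambda>s. 2 ^ k * (\<bar>s\<bar> ^ ?n * q k (s *\<^sub>R e))"
    have hb: "?h \<in> borel_measurable borel" by measurable
    have "(\<integral>\<^sup>+s. ennreal (?h s) * indicator {0<..<1} s \<partial>lborel) \<le> (\<integral>\<^sup>+s. ennreal (s ^ ?n) * indicator {0<..} s * F (s *\<^sub>R e) \<partial>lborel)"
    proof (rule nn_integral_mono)
      fix s :: real
      show "ennreal (?h s) * indicator {0<..<1} s \<le> ennreal (s ^ ?n) * indicator {0<..} s * F (s *\<^sub>R e)"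
      proof (cases "s \<in> {0<..<1}")
        case True
        have "ennreal (2 ^ k * q k (s *\<^sub>R e)) * indicator ?B (s *\<^sub>R e) \<le> F (s *\<^sub>R e)"
          using sum_le_suminf[OF summableI, of "{k}" "\<lambda>k. ennreal (2 ^ k * q k (s *\<^sub>R e)) * indicator ?B (s *\<^sub>R e)"]
          by (simp only: F_def finite.intros sum.insert sum.empty empty_iff add_0_right zero_le simp_thms)
        moreover have "s *\<^sub>R e \<in> ?B" using True e(1) by simp
        ultimately have "ennreal (2 ^ k * q k (s *\<^sub>R e)) \<le> F (s *\<^sub>R e)" by simp
        then have "ennreal (s ^ ?n) * ennreal (2 ^ k * q k (s *\<^sub>R e)) \<le> ennreal (s ^ ?n) * F (s *\<^sub>R e)" by (rule mult_left_mono) simp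
        moreover have "ennreal (?h s) = ennreal (s ^ ?n) * ennreal (2 ^ k * q k (s *\<^sub>R e))"
          using True q0[of k "s *\<^sub>R e"] by (subst ennreal_mult[symmetric]) (auto simp: mult_ac)
        ultimately show ?thesis using True by simp
      qed simp
    qed
    then have le: "(\<integral>\<^sup>+s. ennreal (?h s) * indicator {0<..<1} s \<partial>lborel) \<le> ennreal C" by (simp only: C(2))
    have h0: "0 \<le> ?h s" for s using q0 by simp
    note L = LINT_leb01_le[OF hb h0 C(1) le]
    have eq: "s powr (?N - 1) * q k (s *\<^sub>R e) = (1/2) ^ k * ?h s" if "s \<in> space leb01" for s
    proof -
      have "s > 0" using that by (simp add: space_restrict_space)
      then show ?thesis by (simp add: pw power_one_over)
    qed
    have "integrable leb01 (\<lambda>s. (1/2) ^ k * ?h s)" using L(1) by (rule integrable_mult_right)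
    moreover have "integrable leb01 (\<lambda>s. s powr (?N - 1) * q k (s *\<^sub>R e)) \<longleftrightarrow> integrable leb01 (\<lambda>s. (1/2) ^ k * ?h s)"
      by (rule Bochner_Integration.integrable_cong[OF refl eq])
    ultimately show "integrable leb01 (\<lambda>s. s powr (?N - 1) * q k (s *\<^sub>R e))" by blast
    have "(LINT s|leb01. s powr (?N - 1) * q k (s *\<^sub>R e)) = (LINT s|leb01. (1/2) ^ k * ?h s)"
      by (rule Bochner_Integration.integral_cong[OF refl eq])
    also have "\<dots> = (1/2) ^ k * (LINT s|leb01. ?h s)" by (rule integral_mult_right_zero)
    also have "\<dots> \<le> (1/2) ^ k * C" by (rule mult_left_mono[OF L(2)]) simp
    finally show "(LINT s|leb01. s powr (?N - 1) * q k (s *\<^sub>R e)) \<le> C * (1/2) ^ k" by (simp only: mult.commute)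
  qed
  define U where "U s = u' (s *\<^sub>R e)" for s
  define \<gamma> where "\<gamma> s = G' (s *\<^sub>R e) \<bullet> e" for s
  define f where "f k s = \<phi> k (s *\<^sub>R e)" for k s
  define f' where "f' k s = grad (\<phi> k) (s *\<^sub>R e) \<bullet> e" for k s
  have [measurable]: "U \<in> borel_measurable borel" "\<gamma> \<in> borel_measurable borel" "f k \<in> borel_measurable borel" "f' k \<in> borel_measurable borel" for k
    unfolding U_def[abs_def] \<gamma>_def[abs_def] f_def[abs_def] f'_def[abs_def] by measurable
  have Uq: "(U s - f k s)^2 \<le> q k (s *\<^sub>R e)" for k s by (simp add: q_def U_def f_def)
  have \<gamma>q: "(\<gamma> s - f' k s)^2 \<le> q k (s *\<^sub>R e)" for k s
  proof -
    have "\<bar>(G' (s *\<^sub>R e) - grad (\<phi> k) (s *\<^sub>R e)) \<bullet> e\<bar> \<le> norm (G' (s *\<^sub>R e) - grad (\<phi> k) (s *\<^sub>R e)) * norm e" by (rule Cauchy_Schwarz_ineq2)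
    then have "\<bar>\<gamma> s - f' k s\<bar> \<le> \<bar>norm (G' (s *\<^sub>R e) - grad (\<phi> k) (s *\<^sub>R e))\<bar>" by (simp add: \<gamma>_def f'_def inner_diff_left e(1))
    then have "(\<gamma> s - f' k s)^2 \<le> (norm (G' (s *\<^sub>R e) - grad (\<phi> k) (s *\<^sub>R e)))^2" by (simp only: abs_le_square_iff)
    then show ?thesis unfolding q_def by (rule order_trans) simp
  qed
  have sub: "integrable leb01 (\<lambda>s. s powr (?N - 1) * (h s)^2)" "(LINT s|leb01. s powr (?N - 1) * (h s)^2) \<le> C * (1/2) ^ k"
    if h: "h \<in> borel_measurable borel" "\<And>s. (h s)^2 \<le> q k (s *\<^sub>R e)" for h k
  proof -
    show i: "integrable leb01 (\<lambda>s. s powr (?N - 1) * (h s)^2)"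
    proof (rule Bochner_Integration.integrable_bound[OF A(1)[of k]])
      show "(\<lambda>s. s powr (?N - 1) * (h s)^2) \<in> borel_measurable leb01"
        by (intro borel_measurable_times borel_measurable_powr_01 borel_measurable_power b2l h)
      show "AE s in leb01. norm (s powr (?N - 1) * (h s)^2) \<le> norm (s powr (?N - 1) * q k (s *\<^sub>R e))"
        using h(2) q0 by (intro AE_I2) (simp add: abs_mult mult_left_mono)
    qed
    have "(LINT s|leb01. s powr (?N - 1) * (h s)^2) \<le> (LINT s|leb01. s powr (?N - 1) * q k (s *\<^sub>R e))"
      by (intro integral_mono i A(1) mult_left_mono h(2)) simp
    then show "(LINT s|leb01. s powr (?N - 1) * (h s)^2) \<le> C * (1/2) ^ k" using A(2)[of k] by (rule order_trans)
  qed
  have dm: "(\<lambda>s. \<gamma> s - f' k s) \<in> borel_measurable borel" "(\<lambda>s. U s - f k s) \<in> borel_measurable borel" for k by measurable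
  note G = sub[OF dm(1) \<gamma>q] and Us = sub[OF dm(2) Uq]
  have f'c: "continuous_on UNIV (f' k)" for k
    unfolding f'_def[abs_def] grad_def
    by (intro continuous_intros continuous_on_compose2[OF smooth_continuous[where S=UNIV, OF smooth_partial_deriv[OF \<phi>s]]]) auto
  have facd: "acd (f k) (f' k)" for k
  proof (rule acd_C1)
    fix x :: real
    have "(f k has_real_derivative f' k x) (at x)"
      using smooth_DERIV_line[OF \<phi>s, where x=0 and e=e and s=x] by (simp add: f_def[abs_def] f'_def)
    then show "(f k has_real_derivative f' k x) (at x within {0<..1})" by (rule has_field_derivative_at_within)
  qed (rule continuous_on_subset[OF f'c], simp)
  \<comment> \<open>The end of the ray lies on the unit sphere, outside the support. This matches
    the approximants with the primitive normalized by v(1) = 0.\<close>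
  have f1: "f k 1 = 0" for k
  proof -
    obtain K where K: "K \<subseteq> ?B" "\<And>x. x \<notin> K \<Longrightarrow> \<phi> k x = 0" using \<phi>T[of k] by (rule test_functionE) blast
    have "e \<notin> K" using K(1) e(1) by auto
    then show ?thesis using K(2) by (simp add: f_def)
  qed
  have dL: "(\<lambda>s. \<gamma> s - f' k s) \<in> L2_M ?N" for k using G(1)[of k] b2l[OF dm(1)] by (simp add: L2_M_def)
  have f'L: "f' k \<in> L2_M ?N" for k
    by (rule L2_01_L2_M[OF continuous_L2_01[OF continuous_on_subset[OF f'c]] N]) simp
  have \<gamma>L: "\<gamma> \<in> L2_M ?N" using L2_M_add[OF dL f'L, of 0 0] by simp
  define v where "v x = - integral {x..1} \<gamma>" for x
  have vacd: "acd v \<gamma>" unfolding acd_def v_def using L2_M_abs_integrable[OF \<gamma>L] by simp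
  have v1: "v 1 = 0" by (simp add: v_def)
  have lim: "(\<lambda>k. f k x) \<longlonglongrightarrow> v x" if x: "0 < x" "x \<le> 1" for x
  proof (rule tendsto_of_square)
    define c where "c = C * (x powr (1 - ?N) * (1 - x))"
    have le: "(f k x - v x)^2 \<le> c * (1/2) ^ k" for k
    proof -
      have "((v 1 - f k 1) - (v x - f k x))^2 \<le> (LINT s|leb01. s powr (?N - 1) * (\<gamma> s - f' k s)^2) * (x powr (1 - ?N) * (1 - x))"
        by (rule acd_Hoelder[OF N acd_diff[OF vacd facd] dL x(1) x(2)]) simp
      also have "\<dots> \<le> (C * (1/2) ^ k) * (x powr (1 - ?N) * (1 - x))" using x by (intro mult_right_mono G(2)) auto
      finally show ?thesis by (simp add: v1 f1 c_def mult_ac)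
    qed
    have "(\<lambda>k. c * (1/2) ^ k) \<longlonglongrightarrow> c * 0" by (intro tendsto_mult_left LIMSEQ_power_zero) simp
    then have up: "(\<lambda>k. c * (1/2) ^ k) \<longlonglongrightarrow> 0" by simp
    show "(\<lambda>k. (f k x - v x)^2) \<longlonglongrightarrow> 0"
      by (rule tendsto_sandwich[OF _ _ tendsto_const up]) (use le in \<open>auto intro!: always_eventually\<close>)
  qed
  have vm: "v \<in> borel_measurable leb01"
    by (intro continuous_imp_measurable_on_sets_lebesgue continuous_on_subset[OF acd_continuous[OF vacd]]) auto
  \<comment> \<open>Fatou along the ray identifies the restriction \<open>U\<close> with
    \<open>v\<close>: its distance to the approximants tends to 0, and these tend to
    \<open>v\<close> pointwise.\<close>
  have fat: "integrable leb01 (\<lambda>s. s powr (?N - 1) * (U s - v s)^2)" "(LINT s|leb01. s powr (?N - 1) * (U s - v s)^2) \<le> c" if c: "0 < c" for c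
  proof -
    have m1: "(\<lambda>s. s powr (?N - 1) * (U s - f k s)^2) \<in> borel_measurable leb01" for k using Us(1)[of k] by simp
    have m2: "(\<lambda>s. s powr (?N - 1) * (U s - v s)^2) \<in> borel_measurable leb01"
      using vm b2l[of U] by (intro borel_measurable_times borel_measurable_powr_01 borel_measurable_power borel_measurable_diff) auto
    have l: "AE s in leb01. (\<lambda>k. s powr (?N - 1) * (U s - f k s)^2) \<longlonglongrightarrow> s powr (?N - 1) * (U s - v s)^2"
      by (intro AE_I2 tendsto_intros lim) (auto simp: space_restrict_space)
    have "(\<lambda>k. C * (1/2) ^ k) \<longlonglongrightarrow> C * 0" by (intro tendsto_mult_left LIMSEQ_power_zero) simp
    then have "(\<lambda>k. C * (1/2) ^ k) \<longlonglongrightarrow> 0" by simp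
    from order_tendstoD(2)[OF this c] have ev: "\<forall>\<^sub>F k in sequentially. (LINT s|leb01. s powr (?N - 1) * (U s - f k s)^2) \<le> c"
    proof eventually_elim
      case (elim k)
      show ?case using Us(2)[of k] elim by linarith
    qed
    note r = integral_le_of_AE_tendsto[OF m1 m2 l _ Us(1) ev]
    show "integrable leb01 (\<lambda>s. s powr (?N - 1) * (U s - v s)^2)" by (rule r(1)) simp
    show "(LINT s|leb01. s powr (?N - 1) * (U s - v s)^2) \<le> c" by (rule r(2)) simp
  qed
  have "(LINT s|leb01. s powr (?N - 1) * (U s - v s)^2) \<le> 0" by (rule field_le_epsilon) (simp add: fat(2))
  moreover have "0 \<le> (LINT s|leb01. s powr (?N - 1) * (U s - v s)^2)" by (intro integral_nonneg_AE AE_I2) simp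
  ultimately have "(LINT s|leb01. s powr (?N - 1) * (U s - v s)^2) = 0" by linarith
  then have "AE s in leb01. s powr (?N - 1) * (U s - v s)^2 = 0"
    using integral_nonneg_eq_0_iff_AE[OF fat(1)[OF zero_less_one]] by simp
  \<comment> \<open>On the chosen ray the values of \<open>u'\<close> are those of the radial
    function \<open>g\<close>, so one ray determines \<open>u\<close> almost everywhere in the
    ball.\<close>
  then have "AE s in leb01. g s = v s" using e(3) AE_space
  proof eventually_elim
    case (elim s)
    then have "0 < s" by (simp add: space_restrict_space)
    then show ?case using elim by (simp add: U_def e(1))
  qed
  from AE_radial[OF this, where 'a='a] have uv: "AE x in lebB. u x = v (norm x)"
    using g AE_ball_nonzero[where 'a='a] by eventually_elim simp
  have v2m: "(\<lambda>r. (v r)^2) \<in> borel_measurable leb01" using vm by measurable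
  have "integrable (lebB :: 'a measure) (\<lambda>x. (v (norm x))^2 / (norm x)^2)"
  proof (rule integrable_cong_AE_imp[OF u0(3)])
    have "(\<lambda>x::'a. norm x) \<in> borel_measurable lebB" by (intro continuous_imp_measurable_on_sets_lebesgue continuous_on_norm_id) simp
    then show "(\<lambda>x::'a. (v (norm x))^2 / (norm x)^2) \<in> borel_measurable lebB"
      using polar(1)[OF vm, where 'a='a] by (intro borel_measurable_divide borel_measurable_power) auto
    show "AE x::'a in lebB. (u x)^2 / (norm x)^2 = (v (norm x))^2 / (norm x)^2" using uv by eventually_elim simp
  qed
  then have "v \<in> calL_M ?N" using polar_singular(1)[OF v2m, where 'a='a] vm by (simp add: calL_M_def)
  from calH_0M_I(1)[OF vacd v1 \<gamma>L this] uv show ?thesis by (rule that)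
qed

text \<open>The function witnessing \<open>radial_on\<close> may be nonmeasurable. A Borel
  representative of \<open>a\<close> restricted to a good ray replaces it, and the essential bound
  descends because non-null sets of radii are detected in the ball.\<close>

lemma radial_coefficient:
  fixes a :: "'a::euclidean_space \<Rightarrow> real"
  assumes a: "a \<in> Linfty (ball 0 1)" "radial_on (ball 0 1) a"
  obtains a0 where "a0 \<in> Linfty {0<..<1}" "AE x in lebB. a x = a0 (norm x)"
proof -
  obtain g where g: "AE x in lebB. a x = g (norm x)" using a(2) by (auto simp: radial_on_def)
  obtain K where am: "a \<in> borel_measurable lebB" and K: "AE x in lebB. \<bar>a x\<bar> \<le> K" using a(1) by (auto simp: Linfty_def)
  obtain a' where a'[measurable]: "a' \<in> borel_measurable borel" and aa': "AE x in lebB. a x = a' x" using borel_representative[OF am] by auto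
  have "AE x in lebB. a' x = g (norm x)" using aa' g by eventually_elim simp
  \<comment> \<open>With the zero integrand only the almost everywhere statement along the ray
    matters.\<close>
  moreover have "(\<lambda>_::'a. 0::ennreal) \<in> borel_measurable borel" "(\<integral>\<^sup>+x. 0 \<partial>(lborel :: 'a measure)) < \<infinity>" by simp_all
  ultimately obtain e where e: "norm e = 1" "AE s in leb01. a' (s *\<^sub>R e) = g (norm (s *\<^sub>R e))"
    using exists_good_ray[of "\<lambda>_. 0" "\<lambda>x. a' x = g (norm x)"] by blast
  define a0 where "a0 s = a' (s *\<^sub>R e)" for s
  have a0b[measurable]: "a0 \<in> borel_measurable borel" unfolding a0_def[abs_def] by measurable
  have "AE s in leb01. g s = a0 s" using e(2) AE_space by eventually_elim (simp add: a0_def e(1) space_restrict_space)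
  from AE_radial[OF this, where 'a='a] have eq: "AE x in lebB. a x = a0 (norm x)"
    using g AE_ball_nonzero[where 'a='a] by eventually_elim simp
  have "{s \<in> {0<..<1}. \<not> \<bar>a0 s\<bar> \<le> K} \<in> sets borel" by measurable
  moreover have "negligible {x \<in> ball (0::'a) 1. norm x \<in> {s \<in> {0<..<1}. \<not> \<bar>a0 s\<bar> \<le> K}}"
  proof (rule negligible_subset)
    have "AE x in lebB. \<bar>a0 (norm (x::'a))\<bar> \<le> K" using K eq by eventually_elim simp
    then show "negligible {x \<in> ball (0::'a) 1. \<not> \<bar>a0 (norm x)\<bar> \<le> K}" by (simp add: AE_lebesgue_on_iff)
  qed auto
  ultimately have "negligible {s \<in> {0<..<1}. \<not> \<bar>a0 s\<bar> \<le> K}" by (intro negligible_of_radial_preimage[where 'a='a]) auto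
  then have "AE s in leb01. \<bar>a0 s\<bar> \<le> K" by (simp add: AE_lebesgue_on_iff)
  moreover have "a0 \<in> borel_measurable leb01" by (rule measurable_restrict_space1[OF measurable_completion]) simp
  ultimately have "a0 \<in> Linfty {0<..<1}" by (auto simp: Linfty_def)
  with eq show ?thesis by (intro that)
qed

section \<open>Transfer from the ball to the interval\<close>

lemma weak_gradient_cong_AE:
  assumes \<Omega>: "open \<Omega>" and u: "weak_gradient \<Omega> u G" and w: "locally_integrable \<Omega> w" and AE: "AE x in lebesgue_on \<Omega>. u x = w x"
  shows "weak_gradient \<Omega> w G"
  unfolding weak_gradient_def
proof (intro conjI ballI)
  let ?L = "lebesgue_on \<Omega>"
  fix b :: 'a assume b: "b \<in> Basis"
  show "locally_integrable \<Omega> (\<lambda>x. G x \<bullet> b)" using u b by (auto simp: weak_gradient_def)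
  fix \<phi> assume \<phi>: "\<phi> \<in> test_functions \<Omega>"
  have lu: "locally_integrable \<Omega> u" using u by (simp add: weak_gradient_def)
  note t = partial_deriv_test_function[OF \<phi> b]
  have "(LINT x|?L. w x * partial_deriv b \<phi> x) = (LINT x|?L. u x * partial_deriv b \<phi> x)"
  proof (rule integral_cong_AE)
    show "(\<lambda>x. w x * partial_deriv b \<phi> x) \<in> borel_measurable ?L"
      by (rule borel_measurable_integrable[OF integrable_times_test_function[OF \<Omega> w t]])
    show "(\<lambda>x. u x * partial_deriv b \<phi> x) \<in> borel_measurable ?L"
      by (rule borel_measurable_integrable[OF integrable_times_test_function[OF \<Omega> lu t]])
    show "AE x in ?L. w x * partial_deriv b \<phi> x = u x * partial_deriv b \<phi> x" using AE by eventually_elim simp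
  qed
  also have "\<dots> = - (LINT x|?L. G x \<bullet> b * \<phi> x)" using u b \<phi> by (simp add: weak_gradient_def)
  finally show "(LINT x|?L. w x * partial_deriv b \<phi> x) = - (LINT x|?L. G x \<bullet> b * \<phi> x)" .
qed (rule w)

text \<open>A relation, because neither function determines the other pointwise: \<open>u\<close> is
  free on null sets and \<open>v\<close> is free outside (0,1].\<close>

definition profile_of :: "('a::euclidean_space \<Rightarrow> real) \<Rightarrow> (real \<Rightarrow> real) \<Rightarrow> bool" where
  "profile_of u v \<longleftrightarrow> u \<in> calH_rad \<and> v \<in> calH_0M (real DIM('a)) \<and> (AE x in lebB. u x = v (norm x))"

lemma profile_ex: "u \<in> calH_rad \<Longrightarrow> \<exists>v. profile_of u v"
  using radial_profile[of u] by (auto simp: profile_of_def)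

lemma profile_lift:
  "2 \<le> DIM('a::euclidean_space) \<Longrightarrow> v \<in> calH_0M (real DIM('a)) \<Longrightarrow> profile_of (\<lambda>x::'a. v (norm x)) v"
  using radial_lift(2)[of v] by (auto simp: profile_of_def)

lemma wgrad_radial:
  fixes u :: "'a::euclidean_space \<Rightarrow> real"
  assumes N: "2 \<le> DIM('a)" and uv: "profile_of u v"
  shows "AE x in lebB. wgrad (ball 0 1) u x = radial_grad v x"
proof -
  have v: "v \<in> calH_0M (real DIM('a))" and AE: "AE x in lebB. u x = v (norm x)" and u: "u \<in> calH_rad"
    using uv by (auto simp: profile_of_def)
  obtain G where "weak_gradient (ball 0 1) u G" using u by (auto simp: calH_rad_def H1_0_def H1_def)
  from weak_gradient_wgrad[OF this] have wu: "weak_gradient (ball 0 1) u (wgrad (ball 0 1) u)" .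
  note wv = radial_lift(1)[OF N v]
  have "weak_gradient (ball 0 1) (\<lambda>x. v (norm x)) (wgrad (ball 0 1) u)"
    by (rule weak_gradient_cong_AE[OF open_ball wu _ AE]) (use wv in \<open>simp add: weak_gradient_def\<close>)
  then show ?thesis by (rule weak_gradient_unique[OF open_ball _ wv])
qed

lemma LINT_cong_AE_lebesgue_on:
  fixes f h :: "'a::euclidean_space \<Rightarrow> real"
  assumes "f \<in> borel_measurable (lebesgue_on S)" "S \<in> sets lebesgue" "AE x in lebesgue_on S. f x = h x"
  shows "(LINT x|lebesgue_on S. f x) = (LINT x|lebesgue_on S. h x)"
  by (rule integral_cong_AE[OF assms(1) borel_measurable_lebesgue_on_AE[OF assms] assms(3)])

lemma ip_rad_profile:
  fixes u w :: "'a::euclidean_space \<Rightarrow> real"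
  assumes uv: "profile_of u v" and wz: "profile_of w z"
  shows "ip_rad u w = sphere_area TYPE('a) * ip_M (real DIM('a)) v z"
proof -
  have H: "v \<in> calH_0M (real DIM('a))" "z \<in> calH_0M (real DIM('a))" using assms by (auto simp: profile_of_def)
  have AE: "AE x in lebB. u x = v (norm x)" "AE x in lebB. w x = z (norm x)" using assms by (auto simp: profile_of_def)
  have m: "(\<lambda>r. v r * z r) \<in> borel_measurable leb01" using calH_0M_measurable(1)[OF H(1)] calH_0M_measurable(1)[OF H(2)] by measurable
  have "(\<lambda>x::'a. norm x) \<in> borel_measurable lebB" by (intro continuous_imp_measurable_on_sets_lebesgue continuous_on_norm_id) simp
  then have "(\<lambda>x::'a. v (norm x) * z (norm x) / (norm x)^2) \<in> borel_measurable lebB"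
    using polar(1)[OF m, where 'a='a] by (rule borel_measurable_divide[OF _ borel_measurable_power, rotated])
  then have "(LINT x::'a|lebB. v (norm x) * z (norm x) / (norm x)^2) = ip_rad u w"
    unfolding ip_rad_def by (rule LINT_cong_AE_lebesgue_on) (use AE in \<open>simp, eventually_elim, simp\<close>)
  then show ?thesis using polar_singular(2)[OF m, where 'a='a] by (simp add: ip_M_def mult.assoc)
qed

lemma form_rad_profile:
  fixes u w a :: "'a::euclidean_space \<Rightarrow> real"
  assumes N: "2 \<le> DIM('a)" and uv: "profile_of u v" and wz: "profile_of w z"
    and a0: "a0 \<in> Linfty {0<..<1}" and a: "AE x in lebB. a x = a0 (norm x)"
  shows "form_rad a u w = sphere_area TYPE('a) * form_M (real DIM('a)) a0 v z"
proof -
  have H: "v \<in> calH_0M (real DIM('a))" "z \<in> calH_0M (real DIM('a))" using assms by (auto simp: profile_of_def)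
  have AE: "AE x in lebB. u x = v (norm x)" "AE x in lebB. w x = z (norm x)" using assms by (auto simp: profile_of_def)
  have m: "(\<lambda>r. wd v r * wd z r - a0 r * v r * z r) \<in> borel_measurable leb01"
    using calH_0M_measurable[OF H(1)] calH_0M_measurable[OF H(2)] a0 unfolding Linfty_def
    by (intro borel_measurable_diff borel_measurable_times) auto
  have "(LINT x::'a|lebB. wd v (norm x) * wd z (norm x) - a0 (norm x) * v (norm x) * z (norm x)) = form_rad a u w"
    unfolding form_rad_def
  proof (rule LINT_cong_AE_lebesgue_on[OF polar(1)[OF m]])
    show "AE x::'a in lebB. wd v (norm x) * wd z (norm x) - a0 (norm x) * v (norm x) * z (norm x) =
       wgrad (ball 0 1) u x \<bullet> wgrad (ball 0 1) w x - a x * u x * w x"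
      using AE a wgrad_radial[OF N uv] wgrad_radial[OF N wz] AE_ball_nonzero[where 'a='a]
      by eventually_elim (simp add: radial_grad_def dot_square_norm power2_eq_square)
  qed simp
  then show ?thesis using polar(3)[OF m, where 'a='a] by (simp add: form_M_def)
qed

text \<open>The converse passes through the norm: a vanishing \<open>u\<close> has
  \<open>ip_rad u u = 0\<close>, hence \<open>ip_M\<close> of its profile with itself is
  zero.\<close>

lemma profile_zero_iff:
  fixes u :: "'a::euclidean_space \<Rightarrow> real"
  assumes uv: "profile_of u v"
  shows "(AE x in lebB. u x = 0) \<longleftrightarrow> (AE r in leb01. v r = 0)"
proof
  have v: "v \<in> calH_0M (real DIM('a))" and AE: "AE x in lebB. u x = v (norm x)" using uv by (auto simp: profile_of_def)
  show "AE x in lebB. u x = 0" if "AE r in leb01. v r = 0"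
    using AE_radial[OF that, where 'a='a] AE AE_ball_nonzero[where 'a='a] by eventually_elim simp
  assume z: "AE x in lebB. u x = 0"
  have "ip_rad u u = (LINT x::'a|lebB. 0)"
    unfolding ip_rad_def by (rule LINT_cong_AE_lebesgue_on[symmetric]) (use z in \<open>simp_all, eventually_elim, simp\<close>)
  then have "ip_M (real DIM('a)) v v = 0"
    using ip_rad_profile[OF uv uv] sphere_area_pos[where 'a='a] by simp
  then show "AE r in leb01. v r = 0" using ip_M_pos[of v "real DIM('a)"] v unfolding nonzero_on_def by force
qed

lemma nonzero_profile_iff:
  fixes u :: "'a::euclidean_space \<Rightarrow> real"
  assumes uv: "profile_of u v" and "u \<in> E \<longleftrightarrow> v \<in> E'"
  shows "u \<in> nonzero_on (ball 0 1) E \<longleftrightarrow> v \<in> nonzero_on {0<..<1} E'"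
  using profile_zero_iff[OF uv] assms(2) by (simp add: nonzero_on_def)

section \<open>Transfer of the minimization scheme\<close>

lemma competitors_transfer:
  assumes W: "u \<in> W \<longleftrightarrow> v \<in> W'" and uv: "R u v"
    and ip: "\<And>u v w z. R u v \<Longrightarrow> R w z \<Longrightarrow> ip u w = c * ip' v z" and c: "c \<noteq> (0::real)"
    and \<psi>: "\<And>j. j \<in> {1..<i} \<Longrightarrow> R (\<psi> j) (\<psi>' j)"
  shows "u \<in> competitors W ip \<psi> i \<longleftrightarrow> v \<in> competitors W' ip' \<psi>' i"
proof -
  have "ip u (\<psi> j) = 0 \<longleftrightarrow> ip' v (\<psi>' j) = 0" if "j \<in> {1..<i}" for j
    using ip[OF uv \<psi>[OF that]] c by simp
  then show ?thesis using W unfolding competitors_def by blast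
qed

text \<open>The constant c cancels in the quotients. Every element on one side has some partner on
  the other, so the sets of attained quotients coincide although the relation is not a
  bijection.\<close>

lemma min_level_transfer:
  assumes W: "\<And>u v. R u v \<Longrightarrow> u \<in> W \<longleftrightarrow> v \<in> W'"
    and total: "\<And>u. u \<in> W \<Longrightarrow> \<exists>v. R u v" "\<And>v. v \<in> W' \<Longrightarrow> \<exists>u. R u v"
    and q: "\<And>u v w z. R u v \<Longrightarrow> R w z \<Longrightarrow> q u w = c * q' v z"
    and ip: "\<And>u v w z. R u v \<Longrightarrow> R w z \<Longrightarrow> ip u w = c * ip' v z" and c: "c \<noteq> (0::real)"
    and \<psi>: "\<And>j. j \<in> {1..<i} \<Longrightarrow> R (\<psi> j) (\<psi>' j)"
  shows "min_level W q ip \<psi> i = min_level W' q' ip' \<psi>' i"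
proof -
  have quot: "q u u / ip u u = q' v v / ip' v v" if "R u v" for u v
    using q[OF that that] ip[OF that that] c by simp
  note comp = competitors_transfer[where R=R and ip=ip and c=c and ip'=ip', OF W _ ip c \<psi>]
  have "(\<lambda>w. q w w / ip w w) ` competitors W ip \<psi> i = (\<lambda>w. q' w w / ip' w w) ` competitors W' ip' \<psi>' i"
  proof (intro set_eqI iffI)
    fix t assume "t \<in> (\<lambda>w. q w w / ip w w) ` competitors W ip \<psi> i"
    then obtain u where u: "u \<in> competitors W ip \<psi> i" "t = q u u / ip u u" by blast
    then obtain v where uv: "R u v" using total(1) by (auto simp: competitors_def)
    then show "t \<in> (\<lambda>w. q' w w / ip' w w) ` competitors W' ip' \<psi>' i"
      using u comp[OF uv uv] quot[OF uv] by (intro image_eqI[of _ _ v]) auto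
  next
    fix t assume "t \<in> (\<lambda>w. q' w w / ip' w w) ` competitors W' ip' \<psi>' i"
    then obtain v where v: "v \<in> competitors W' ip' \<psi>' i" "t = q' v v / ip' v v" by blast
    then obtain u where uv: "R u v" using total(2) by (auto simp: competitors_def)
    then show "t \<in> (\<lambda>w. q w w / ip w w) ` competitors W ip \<psi> i"
      using v comp[OF uv uv] quot[OF uv] by (intro image_eqI[of _ _ u]) auto
  qed
  then show ?thesis unfolding min_level_def by (simp only:)
qed

lemma minimizers_below_transfer:
  assumes W: "\<And>u v. R u v \<Longrightarrow> u \<in> W \<longleftrightarrow> v \<in> W'"
    and total: "\<And>u. u \<in> W \<Longrightarrow> \<exists>v. R u v" "\<And>v. v \<in> W' \<Longrightarrow> \<exists>u. R u v"
    and q: "\<And>u v w z. R u v \<Longrightarrow> R w z \<Longrightarrow> q u w = c * q' v z"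
    and ip: "\<And>u v w z. R u v \<Longrightarrow> R w z \<Longrightarrow> ip u w = c * ip' v z" and c: "c \<noteq> (0::real)"
    and \<psi>: "\<And>j. j \<in> {1..<i} \<Longrightarrow> R (\<psi> j) (\<psi>' j)"
    and m: "minimizers_below W q ip d \<psi> i"
  shows "minimizers_below W' q' ip' d \<psi>' i"
  unfolding minimizers_below_def
proof
  fix j assume j: "j \<in> {1..<i}"
  have \<psi>j: "R (\<psi> k) (\<psi>' k)" if "k \<in> {1..<j}" for k using j that by (intro \<psi>) auto
  have eq: "min_level W q ip \<psi> j = min_level W' q' ip' \<psi>' j"
    by (rule min_level_transfer[where R=R and c=c, OF W total q ip c \<psi>j])
  have comp: "\<psi> j \<in> competitors W ip \<psi> j \<longleftrightarrow> \<psi>' j \<in> competitors W' ip' \<psi>' j"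
    by (rule competitors_transfer[where R=R and c=c, OF W[OF \<psi>[OF j]] \<psi>[OF j] ip c \<psi>j])
  have quot: "q (\<psi> j) (\<psi> j) / ip (\<psi> j) (\<psi> j) = q' (\<psi>' j) (\<psi>' j) / ip' (\<psi>' j) (\<psi>' j)"
    using q[OF \<psi>[OF j] \<psi>[OF j]] ip[OF \<psi>[OF j] \<psi>[OF j]] c by simp
  have "min_level W q ip \<psi> j < d \<and> \<psi> j \<in> competitors W ip \<psi> j \<and> q (\<psi> j) (\<psi> j) / ip (\<psi> j) (\<psi> j) = min_level W q ip \<psi> j"
    using m j by (simp only: minimizers_below_def)
  then show "min_level W' q' ip' \<psi>' j < d \<and> \<psi>' j \<in> competitors W' ip' \<psi>' j \<and> q' (\<psi>' j) (\<psi>' j) / ip' (\<psi>' j) (\<psi>' j) = min_level W' q' ip' \<psi>' j"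
    unfolding eq comp quot .
qed

text \<open>The set is the image of the product of \<open>C\<close> with the unit sphere under
  multiplication, and the sphere is connected from dimension 2 on.\<close>

lemma connected_norm_preimage:
  fixes C :: "real set"
  assumes N: "2 \<le> DIM('a::euclidean_space)" and C: "connected C" "C \<subseteq> {0<..}"
  shows "connected {x::'a. norm x \<in> C}"
proof -
  have "{x::'a. norm x \<in> C} = (\<lambda>(r, e). r *\<^sub>R e) ` (C \<times> sphere 0 1)"
  proof (intro set_eqI iffI)
    fix x :: 'a assume x: "x \<in> {x. norm x \<in> C}"
    then have "norm x > 0" using C(2) by auto
    then show "x \<in> (\<lambda>(r, e). r *\<^sub>R e) ` (C \<times> sphere 0 1)"
      using x by (intro image_eqI[of _ _ "(norm x, x /\<^sub>R norm x)"]) auto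
  next
    fix x :: 'a assume "x \<in> (\<lambda>(r, e). r *\<^sub>R e) ` (C \<times> sphere 0 1)"
    then obtain r e where "r \<in> C" "norm e = 1" "x = r *\<^sub>R e" by auto
    moreover have "0 < r" using \<open>r \<in> C\<close> C(2) by auto
    ultimately show "x \<in> {x. norm x \<in> C}" by simp
  qed
  moreover have "connected ((\<lambda>(r, e::'a). r *\<^sub>R e) ` (C \<times> sphere 0 1))"
    unfolding split_def by (intro connected_continuous_image connected_Times C(1) connected_sphere N continuous_intros)
  ultimately show ?thesis by simp
qed

text \<open>Norm images and norm preimages of connected sets are connected, so components of radii
  and components of shells correspond.\<close>

lemma components_norm_preimage:
  fixes S :: "real set"
  assumes N: "2 \<le> DIM('a::euclidean_space)" and S: "S \<subseteq> {0<..}"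
  shows "bij_betw (\<lambda>C. {x::'a. norm x \<in> C}) (components S) (components {x::'a. norm x \<in> S})"
proof -
  let ?P = "\<lambda>C. {x::'a. norm x \<in> C}"
  obtain b :: 'a where b: "norm b = 1" using vector_choose_size[of 1] by auto
  have sub: "C \<subseteq> S" "C \<noteq> {}" "connected C" if "C \<in> components S" for C
    using that by (auto simp: in_components_subset in_components_nonempty in_components_connected)
  have comp: "?P C \<in> components (?P S)" if C: "C \<in> components S" for C
    unfolding in_components_maximal
  proof (intro conjI allI impI)
    obtain r where r: "r \<in> C" "0 < r" using sub[OF C] S by fastforce
    then have rb: "r *\<^sub>R b \<in> ?P C" using b by simp
    then show "?P C \<noteq> {}" by blast
    show "?P C \<subseteq> ?P S" using sub[OF C] by auto
    show "connected (?P C)" by (rule connected_norm_preimage[OF N sub(3)[OF C]]) (use sub(1)[OF C] S in blast)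
    fix D assume D: "D \<noteq> {} \<and> ?P C \<subseteq> D \<and> D \<subseteq> ?P S \<and> connected D"
    have "norm ` D \<subseteq> C"
    proof (rule components_maximal[OF C])
      show "connected (norm ` D)" using D by (intro connected_continuous_image continuous_on_norm_id) auto
      show "norm ` D \<subseteq> S" using D by auto
      have "r *\<^sub>R b \<in> D" using D rb by blast
      then have "norm (r *\<^sub>R b) \<in> C \<inter> norm ` D" using rb by blast
      then show "C \<inter> norm ` D \<noteq> {}" by blast
    qed
    then show "D = ?P C" using D by auto
  qed
  show ?thesis
  proof (rule bij_betw_imageI)
    show "inj_on ?P (components S)"
    proof (rule inj_onI)
      fix C D assume CD: "C \<in> components S" "D \<in> components S" "?P C = ?P D"
      obtain r where r: "r \<in> C" "0 < r" using sub[OF CD(1)] S by fastforce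
      then have "r *\<^sub>R b \<in> ?P D" using b by (subst CD(3)[symmetric]) simp
      then have "r \<in> C \<inter> D" using r b by simp
      then show "C = D" using CD(1,2) components_eq by blast
    qed
    show "?P ` components S = components (?P S)"
    proof (intro equalityI subsetI)
      fix E assume "E \<in> ?P ` components S"
      then show "E \<in> components (?P S)" using comp by blast
    next
      fix E assume E: "E \<in> components (?P S)"
      then obtain x where x: "x \<in> E" using in_components_nonempty by blast
      then have "norm x \<in> S" using in_components_subset[OF E] by auto
      then have "norm x \<in> \<Union> (components S)" by (simp only: Union_components)
      then obtain C where C: "C \<in> components S" "norm x \<in> C" by blast
      have "E = ?P C" using components_eq[OF E comp[OF C(1)]] x C(2) by auto
      then show "E \<in> ?P ` components S" using C(1) by blast
    qed
  qed
qed

lemma card_nodal_domains_radial: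
  assumes "2 \<le> DIM('a::euclidean_space)"
  shows "card (nodal_domains (ball 0 1 - {0}) (\<lambda>x::'a. g (norm x))) = card (nodal_domains {0<..<1} g)"
proof -
  let ?S = "{r \<in> {0<..<1}. g r \<noteq> 0}"
  have eq: "{x \<in> ball 0 1 - {0::'a}. g (norm x) \<noteq> 0} = {x. norm x \<in> ?S}" by (intro set_eqI) auto
  have "?S \<subseteq> {0<..}" by auto
  from bij_betw_same_card[OF components_norm_preimage[OF assms this]] show ?thesis
    unfolding nodal_domains_def eq by (rule sym)
qed

theorem radial_singular_eigenvalues:
  fixes a :: "'a::euclidean_space \<Rightarrow> real"
  assumes N: "2 \<le> DIM('a)" and a: "a \<in> Linfty (ball 0 1)" "radial_on (ball 0 1) a" and i: "1 \<le> i"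
    and seq: "radial_sequence a \<psi> i" and below: "Lambda_rad a \<psi> i < ((real DIM('a) - 2) / 2)^2"
  shows "one_dimensional_on (ball 0 1) (eigenspace_rad a (Lambda_rad a \<psi> i))"
    and "u \<in> nonzero_on (ball 0 1) (eigenspace_rad a (Lambda_rad a \<psi> i)) \<Longrightarrow> has_radial_nodal_domains u i"
proof -
  let ?N = "real DIM('a)" and ?\<omega> = "sphere_area TYPE('a)"
  have N2: "2 \<le> ?N" using N by simp
  have \<omega>: "?\<omega> \<noteq> 0" using sphere_area_pos[where 'a='a] by simp
  obtain a0 where a0: "a0 \<in> Linfty {0<..<1}" "AE x in lebB. a x = a0 (norm x)" using radial_coefficient[OF a] by blast
  let ?R = "profile_of :: ('a \<Rightarrow> real) \<Rightarrow> (real \<Rightarrow> real) \<Rightarrow> bool"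
  let ?W = "nonzero_on (ball (0::'a) 1) calH_rad" and ?W' = "nonzero_on {0<..<1} (calH_0M ?N)"
  have W: "u \<in> ?W \<longleftrightarrow> v \<in> ?W'" if "?R u v" for u v
    by (rule nonzero_profile_iff[OF that]) (use that in \<open>simp add: profile_of_def\<close>)
  have total: "\<exists>v. ?R u v" if "u \<in> ?W" for u using that by (intro profile_ex) (simp add: nonzero_on_def)
  have total': "\<exists>u. ?R u v" if "v \<in> ?W'" for v using that profile_lift[OF N, of v] by (auto simp: nonzero_on_def)
  have q: "form_rad a u w = ?\<omega> * form_M ?N a0 v z" if "?R u v" "?R w z" for u v w z
    by (rule form_rad_profile[OF N that a0])
  have ip: "ip_rad u w = ?\<omega> * ip_M ?N v z" if "?R u v" "?R w z" for u v w z by (rule ip_rad_profile[OF that])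
  \<comment> \<open>Profiles exist for the minimizers below i. The choice at other indices is
    irrelevant, since no level up to i refers to them.\<close>
  define \<psi>' where "\<psi>' j = (SOME v. ?R (\<psi> j) v)" for j
  have \<psi>: "?R (\<psi> j) (\<psi>' j)" if "j \<in> {1..<i}" for j
  proof -
    have "\<psi> j \<in> calH_rad"
      using seq that unfolding radial_sequence_def minimizers_below_def competitors_def nonzero_on_def by blast
    from profile_ex[OF this] show ?thesis unfolding \<psi>'_def by (rule someI_ex)
  qed
  have seq': "radial_sequence_M ?N a0 \<psi>' i"
    unfolding radial_sequence_M_def
    by (rule minimizers_below_transfer[where R="?R" and c="?\<omega>" and \<psi>=\<psi>, OF W total total' q ip \<omega> \<psi> seq[unfolded radial_sequence_def]])
  have eq: "Lambda_rad a \<psi> i = nu_hat ?N a0 \<psi>' i"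
    unfolding Lambda_rad_def nu_hat_def
    by (rule min_level_transfer[where R="?R" and c="?\<omega>", OF W total total' q ip \<omega> \<psi>])
  define \<mu> where "\<mu> = nu_hat ?N a0 \<psi>' i"
  have below': "nu_hat ?N a0 \<psi>' i < ((?N - 2) / 2)^2" using below unfolding eq .
  note main = radial_eigenvalues[OF N2 a0(1) i seq' below', folded \<mu>_def]
  \<comment> \<open>The spaces of test functions match through lifts in one direction and profiles
    in the other, so the two eigenvalue equations are equivalent.\<close>
  have eig: "u \<in> eigenspace_rad a \<mu> \<longleftrightarrow> v \<in> eigenspace_M ?N a0 \<mu>" if uv: "?R u v" for u v
  proof -
    have sc: "form_rad a u w = \<mu> * ip_rad u w \<longleftrightarrow> form_M ?N a0 v z = \<mu> * ip_M ?N v z" if "?R w z" for w z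
      using q[OF uv that] ip[OF uv that] \<omega> by (simp add: mult.left_commute)
    have "(\<forall>w\<in>calH_rad. form_rad a u w = \<mu> * ip_rad u w) \<longleftrightarrow> (\<forall>z\<in>calH_0M ?N. form_M ?N a0 v z = \<mu> * ip_M ?N v z)"
    proof (intro iffI ballI)
      fix z assume l: "\<forall>w\<in>calH_rad. form_rad a u w = \<mu> * ip_rad u w" and z: "z \<in> calH_0M ?N"
      have r: "?R (\<lambda>x. z (norm x)) z" by (rule profile_lift[OF N z])
      then have h: "(\<lambda>x::'a. z (norm x)) \<in> calH_rad" by (simp add: profile_of_def)
      show "form_M ?N a0 v z = \<mu> * ip_M ?N v z" by (rule iffD1[OF sc[OF r] bspec[OF l h]])
    next
      fix w :: "'a \<Rightarrow> real" assume l: "\<forall>z\<in>calH_0M ?N. form_M ?N a0 v z = \<mu> * ip_M ?N v z" and w: "w \<in> calH_rad"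
      obtain z where r: "?R w z" using profile_ex[OF w] by blast
      then have h: "z \<in> calH_0M ?N" by (simp add: profile_of_def)
      show "form_rad a u w = \<mu> * ip_rad u w" by (rule iffD2[OF sc[OF r] bspec[OF l h]])
    qed
    then show ?thesis using uv by (simp add: eigenspace_rad_def eigenspace_M_def eigenspace_def profile_of_def)
  qed
  have nz: "u \<in> nonzero_on (ball 0 1) (eigenspace_rad a \<mu>) \<longleftrightarrow> v \<in> nonzero_on {0<..<1} (eigenspace_M ?N a0 \<mu>)" if "?R u v" for u v
    by (rule nonzero_profile_iff[OF that eig[OF that]])
  have prof: "\<exists>v. ?R u v" if "u \<in> eigenspace_rad a \<mu>" for u
    using that by (intro profile_ex) (simp add: eigenspace_rad_def eigenspace_def)
  obtain \<chi>0 where \<chi>0: "\<chi>0 \<in> nonzero_on {0<..<1} (eigenspace_M ?N a0 \<mu>)"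
    "\<forall>v\<in>eigenspace_M ?N a0 \<mu>. \<exists>c. AE r in leb01. v r = c * \<chi>0 r"
    using main(1) unfolding one_dimensional_on_def by blast
  have lift0: "?R (\<lambda>x. \<chi>0 (norm x)) \<chi>0"
    by (rule profile_lift[OF N]) (use \<chi>0(1) in \<open>simp add: nonzero_on_def eigenspace_M_def eigenspace_def\<close>)
  show "one_dimensional_on (ball 0 1) (eigenspace_rad a (Lambda_rad a \<psi> i))"
    unfolding eq \<mu>_def[symmetric] one_dimensional_on_def
  proof (intro bexI ballI)
    show "(\<lambda>x::'a. \<chi>0 (norm x)) \<in> nonzero_on (ball 0 1) (eigenspace_rad a \<mu>)" using nz[OF lift0] \<chi>0(1) by simp
    fix u assume u: "u \<in> eigenspace_rad a \<mu>"
    then obtain v where uv: "?R u v" using prof by blast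
    then have "v \<in> eigenspace_M ?N a0 \<mu>" using eig[OF uv] u by simp
    then obtain c where c: "AE r in leb01. v r = c * \<chi>0 r" using \<chi>0(2) by blast
    have "AE x in lebB. u x = v (norm x)" using uv by (simp add: profile_of_def)
    then have "AE x in lebB. u x = c * \<chi>0 (norm x)"
      using AE_radial[OF c, where 'a='a] AE_ball_nonzero[where 'a='a] by eventually_elim simp
    then show "\<exists>c. AE x in lebB. u x = c * \<chi>0 (norm x)" by blast
  qed
  show "has_radial_nodal_domains u i" if "u \<in> nonzero_on (ball 0 1) (eigenspace_rad a (Lambda_rad a \<psi> i))"
  proof -
    have u: "u \<in> nonzero_on (ball 0 1) (eigenspace_rad a \<mu>)" using that by (simp add: eq \<mu>_def)
    then obtain v where uv: "?R u v" using prof unfolding nonzero_on_def by blast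
    have card: "card (nodal_domains {0<..<1} v) = i" using main(2) nz[OF uv] u by simp
    have v: "v \<in> calH_0M ?N" "AE x in lebB. u x = v (norm x)" using uv by (simp_all add: profile_of_def)
    have "continuous_on {0<..<1} v" by (rule continuous_on_subset[OF acd_continuous[OF calH_0M_acd(1)[OF v(1)]]]) auto
    then show ?thesis
      unfolding has_radial_nodal_domains_def using v(2) card card_nodal_domains_radial[OF N, of v] by (intro exI[of _ v]) simp
  qed
qed

theorem mainTheorem10:
  shows "(\<forall>(M::real) (a::real \<Rightarrow> real) (\<psi>::nat \<Rightarrow> real \<Rightarrow> real) (i::nat).
            2 \<le> M \<longrightarrow> a \<in> Linfty {0<..<1} \<longrightarrow> 1 \<le> i \<longrightarrow>
            radial_sequence_M M a \<psi> i \<longrightarrow> nu_hat M a \<psi> i < ((M - 2) / 2)\<^sup>2 \<longrightarrow>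
              one_dimensional_on {0<..<1} (eigenspace_M M a (nu_hat M a \<psi> i)) \<and>
              (\<forall>u\<in>nonzero_on {0<..<1} (eigenspace_M M a (nu_hat M a \<psi> i)).
                 card (nodal_domains {0<..<1} u) = i)) \<and>
         (2 \<le> CARD('n::finite) \<longrightarrow>
          (\<forall>(a::real^'n \<Rightarrow> real) (\<psi>::nat \<Rightarrow> real^'n \<Rightarrow> real) (i::nat).
            a \<in> Linfty (ball 0 1) \<longrightarrow> radial_on (ball 0 1) a \<longrightarrow> 1 \<le> i \<longrightarrow>
            radial_sequence a \<psi> i \<longrightarrow> Lambda_rad a \<psi> i < ((real CARD('n) - 2) / 2)\<^sup>2 \<longrightarrow>
              one_dimensional_on (ball 0 1) (eigenspace_rad a (Lambda_rad a \<psi> i)) \<and>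
              (\<forall>u\<in>nonzero_on (ball 0 1) (eigenspace_rad a (Lambda_rad a \<psi> i)).
                 has_radial_nodal_domains u i)))"
proof (intro conjI allI impI ballI)
  fix M :: real and a \<psi> i
  assume *: "2 \<le> M" "a \<in> Linfty {0<..<1}" "1 \<le> i" "radial_sequence_M M a \<psi> i" "nu_hat M a \<psi> i < ((M - 2) / 2)\<^sup>2"
  show "one_dimensional_on {0<..<1} (eigenspace_M M a (nu_hat M a \<psi> i))" by (rule radial_eigenvalues(1)[OF *])
  show "card (nodal_domains {0<..<1} u) = i" if "u \<in> nonzero_on {0<..<1} (eigenspace_M M a (nu_hat M a \<psi> i))" for u
    by (rule radial_eigenvalues(2)[OF * that])
next
  fix a :: "real^'n \<Rightarrow> real" and \<psi> i
  assume "2 \<le> CARD('n)" and **: "a \<in> Linfty (ball 0 1)" "radial_on (ball 0 1) a" "1 \<le> i" "radial_sequence a \<psi> i"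
    and "Lambda_rad a \<psi> i < ((real CARD('n) - 2) / 2)\<^sup>2"
  then have N: "2 \<le> DIM(real^'n)" and below: "Lambda_rad a \<psi> i < ((real DIM(real^'n) - 2) / 2)\<^sup>2" by simp_all
  note * = radial_singular_eigenvalues[OF N ** below]
  show "one_dimensional_on (ball 0 1) (eigenspace_rad a (Lambda_rad a \<psi> i))" by (rule *(1))
  show "has_radial_nodal_domains u i" if "u \<in> nonzero_on (ball 0 1) (eigenspace_rad a (Lambda_rad a \<psi> i))" for u
    by (rule *(2)[OF that])
qed

end
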